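(* Let $p$ be a prime, $k$ a field of characteristic $p$, $G$ a finite group, and $B$ a block of $kG$ with a non-trivial normal defect group $P$ (that is, $P$ is normal in $G$) and inertial quotient $E$. Suppose that $k$ is large enough for $B$. Then $\mathrm{HH}^1(kP)^E$ is canonically isomorphic to a Lie subalgebra of $\mathrm{HH}^1(B)$. If in addition $E$ acts freely on $P\setminus\{1\}$, then $\mathrm{HH}^1(kP)^E\cong\mathrm{HH}^1(B)$ (as Lie algebras).
   Context: A block of $kG$ is an indecomposable direct factor $B$ of $kG$ as an algebra. A defect group of $B$ is a maximal $p$-subgroup $P$ of $G$ such that $kP$ is isomorphic to a direct summand of $B$ as a $kP$-$kP$-bimodule. The inertial quotient of $B$ is the $p'$-group $E=N_G(P,e)/PC_G(P)$, where $(P,e)$ is a maximal $B$-Brauer pair (so $e$ is a block idempotent of $kC_G(P)$ and $N_G(P,e)$ is its stabiliser in $N_G(P)$); it embeds in $\mathrm{Out}(P)$ and, being a $p'$-group, is lifted to a $p'$-subgroup of $\mathrm{Aut}(P)$ (unique up to conjugacy by inner automorphisms), via which $E$ acts on $P$. "Large enough" is the usual splitting field convention (satisfied for instance if $k$ is a splitting field for the group algebras of all subgroups of $G$). "Acts freely on $P\setminus\{1\}$" means that no non-identity element of $E$ fixes a non-identity element of $P$. For a $k$-algebra $A$, $\mathrm{HH}^1(A)=\mathrm{Der}(A)/\mathrm{IDer}(A)$ ($k$-linear derivations modulo inner derivations), with Lie bracket induced by $[f,g]=f\circ g-g\circ f$. The group $E$ acts on $kP$ by algebra automorphisms and hence,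 by conjugating derivations, on $\mathrm{HH}^1(kP)$ by Lie algebra automorphisms; $\mathrm{HH}^1(kP)^E$ is the Lie subalgebra of $E$-fixed points. *)

theory Defs
  imports "HOL-Algebra.Bij" "HOL-Algebra.Group_Action" "HOL-Algebra.Ideal" "HOL-Algebra.Module"
    "HOL-Computational_Algebra.Primes"
begin

section \<open>Group algebras and their blocks\<close>

text \<open>
  A \<open>k\<close>-algebra is a record of type \<open>('k, 'a) module\<close>: a ring together with a scalar
  multiplication by the field \<open>'k\<close>.  For a finite group \<open>G\<close>, the element \<open>\<Sum>x. a x \<cdot> x\<close> of \<open>kG\<close>
  is the function \<open>a\<close>, extended by \<open>0\<close> outside \<open>G\<close>; thus for a subgroup \<open>H\<close> the algebra \<open>kH\<close>,
  i.e. \<open>group_algebra (G\<lparr>carrier := H\<rparr>)\<close>, is literally a subset of \<open>kG\<close>.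
\<close>

definition group_algebra :: "('g, 'm) monoid_scheme \<Rightarrow> ('k::field, 'g \<Rightarrow> 'k) module" where
  "group_algebra G =
    \<lparr> carrier = {a. \<forall>x. x \<notin> carrier G \<longrightarrow> a x = 0},
      monoid.mult = (\<lambda>a b x. \<Sum>(y, z)\<in>{(y, z). y \<in> carrier G \<and> z \<in> carrier G \<and> y \<otimes>\<^bsub>G\<^esub> z = x}.
        a y * b z),
      monoid.one = (\<lambda>x. if x = \<one>\<^bsub>G\<^esub> then 1 else 0),
      ring.zero = (\<lambda>x. 0),
      ring.add = (\<lambda>a b x. a x + b x),
      smult = (\<lambda>c a x. c * a x) \<rparr>"

abbreviation subgroup_algebra :: "('g, 'm) monoid_scheme \<Rightarrow> 'g set \<Rightarrow> ('k::field, 'g \<Rightarrow> 'k) module"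
  where "subgroup_algebra G H \<equiv> group_algebra (G\<lparr>carrier := H\<rparr>)"

definition algebra_direct_sum :: "('k, 'a) module \<Rightarrow> 'a set \<Rightarrow> 'a set \<Rightarrow> bool" where
  "algebra_direct_sum A I J \<longleftrightarrow>
    ideal I A \<and> ideal J A \<and> I \<inter> J = {\<zero>\<^bsub>A\<^esub>} \<and> I <+>\<^bsub>A\<^esub> J = carrier A"

definition indecomposable_algebra :: "('k, 'a) module \<Rightarrow> bool" where
  "indecomposable_algebra A \<longleftrightarrow>
    carrier A \<noteq> {\<zero>\<^bsub>A\<^esub>} \<and>
    (\<forall>I J. algebra_direct_sum A I J \<longrightarrow> I = {\<zero>\<^bsub>A\<^esub>} \<or> J = {\<zero>\<^bsub>A\<^esub>})"

text \<open>A block is a direct factor \<open>I\<close> of \<open>A\<close>, viewed as an algebra with its own identity \<open>b\<close>.\<close>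

definition is_block :: "('k, 'a) module \<Rightarrow> ('k, 'a) module \<Rightarrow> bool" where
  "is_block A B \<longleftrightarrow>
    (\<exists>I J b. algebra_direct_sum A I J \<and>
      b \<in> I \<and> (\<forall>x\<in>I. b \<otimes>\<^bsub>A\<^esub> x = x \<and> x \<otimes>\<^bsub>A\<^esub> b = x) \<and>
      B = A\<lparr>carrier := I, one := b\<rparr> \<and> indecomposable_algebra B)"

definition is_block_idempotent :: "('k, 'a) module \<Rightarrow> 'a \<Rightarrow> bool" where
  "is_block_idempotent A e \<longleftrightarrow> (\<exists>B. is_block A B \<and> \<one>\<^bsub>B\<^esub> = e)"


section \<open>Defect groups\<close>

definition p_subgroup :: "nat \<Rightarrow> ('g, 'm) monoid_scheme \<Rightarrow> 'g set \<Rightarrow> bool" where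
  "p_subgroup p G Q \<longleftrightarrow> subgroup Q G \<and> (\<exists>n. card Q = p ^ n)"

text \<open>\<open>M\<close> is a sub-\<open>kQ\<close>-\<open>kQ\<close>-bimodule of \<open>kG\<close>.\<close>

definition subbimodule ::
  "('g, 'm) monoid_scheme \<Rightarrow> 'g set \<Rightarrow> ('g \<Rightarrow> 'k::field) set \<Rightarrow> bool" where
  "subbimodule G Q M \<longleftrightarrow>
    (let kG = group_algebra G; kQ = subgroup_algebra G Q in
      additive_subgroup M kG \<and>
      (\<forall>a\<in>carrier kQ. \<forall>m\<in>M. a \<otimes>\<^bsub>kG\<^esub> m \<in> M \<and> m \<otimes>\<^bsub>kG\<^esub> a \<in> M))"

definition bimodule_summand ::
  "('g, 'm) monoid_scheme \<Rightarrow> ('k::field, 'g \<Rightarrow> 'k) module \<Rightarrow> 'g set \<Rightarrow> bool" where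
  "bimodule_summand G B Q \<longleftrightarrow>
    (let kG = group_algebra G; kQ = subgroup_algebra G Q in
      \<exists>M N \<phi>. subbimodule G Q M \<and> subbimodule G Q N \<and>
        M \<inter> N = {\<zero>\<^bsub>kG\<^esub>} \<and> M <+>\<^bsub>kG\<^esub> N = carrier B \<and>
        bij_betw \<phi> (carrier kQ) M \<and>
        (\<forall>x\<in>carrier kQ. \<forall>y\<in>carrier kQ. \<phi> (x \<oplus>\<^bsub>kG\<^esub> y) = \<phi> x \<oplus>\<^bsub>kG\<^esub> \<phi> y) \<and>
        (\<forall>a\<in>carrier kQ. \<forall>x\<in>carrier kQ.
          \<phi> (a \<otimes>\<^bsub>kG\<^esub> x) = a \<otimes>\<^bsub>kG\<^esub> \<phi> x \<and> \<phi> (x \<otimes>\<^bsub>kG\<^esub> a) = \<phi> x \<otimes>\<^bsub>kG\<^esub> a))"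

definition defect_group ::
  "nat \<Rightarrow> ('g, 'm) monoid_scheme \<Rightarrow> ('k::field, 'g \<Rightarrow> 'k) module \<Rightarrow> 'g set \<Rightarrow> bool" where
  "defect_group p G B P \<longleftrightarrow>
    p_subgroup p G P \<and> bimodule_summand G B P \<and>
    (\<forall>Q. p_subgroup p G Q \<and> bimodule_summand G B Q \<and> P \<subseteq> Q \<longrightarrow> Q = P)"


section \<open>Brauer pairs and the inertial quotient\<close>

definition centralizer :: "('g, 'm) monoid_scheme \<Rightarrow> 'g set \<Rightarrow> 'g set" where
  "centralizer G Q = {g \<in> carrier G. \<forall>u\<in>Q. g \<otimes>\<^bsub>G\<^esub> u = u \<otimes>\<^bsub>G\<^esub> g}"

text \<open>The element \<open>g a g\<^sup>-\<^sup>1\<close> of \<open>kG\<close>.\<close>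

definition gconj :: "('g, 'm) monoid_scheme \<Rightarrow> 'g \<Rightarrow> ('g \<Rightarrow> 'k::field) \<Rightarrow> 'g \<Rightarrow> 'k" where
  "gconj G g a = (\<lambda>x. if x \<in> carrier G then a (inv\<^bsub>G\<^esub> g \<otimes>\<^bsub>G\<^esub> x \<otimes>\<^bsub>G\<^esub> g) else 0)"

definition fixed_elements :: "('g, 'm) monoid_scheme \<Rightarrow> 'g set \<Rightarrow> ('g \<Rightarrow> 'k::field) set" where
  "fixed_elements G Q = {a \<in> carrier (group_algebra G). \<forall>g\<in>Q. gconj G g a = a}"

text \<open>The Brauer homomorphism \<open>(kG)\<^sup>Q \<rightarrow> kC\<^sub>G(Q)\<close>.\<close>

definition brauer_map ::
  "('g, 'm) monoid_scheme \<Rightarrow> 'g set \<Rightarrow> ('g \<Rightarrow> 'k::field) \<Rightarrow> 'g \<Rightarrow> 'k" where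
  "brauer_map G Q a = (\<lambda>x. if x \<in> centralizer G Q then a x else 0)"

definition brauer_pair ::
  "nat \<Rightarrow> ('g, 'm) monoid_scheme \<Rightarrow> ('k::field, 'g \<Rightarrow> 'k) module \<Rightarrow> 'g set \<Rightarrow> ('g \<Rightarrow> 'k) \<Rightarrow> bool"
where
  "brauer_pair p G B Q e \<longleftrightarrow>
    p_subgroup p G Q \<and>
    is_block_idempotent (subgroup_algebra G (centralizer G Q)) e \<and>
    brauer_map G Q \<one>\<^bsub>B\<^esub> \<otimes>\<^bsub>group_algebra G\<^esub> e \<noteq> \<zero>\<^bsub>group_algebra G\<^esub>"

text \<open>\<open>i\<close> is a primitive idempotent of the subring of \<open>A\<close> with underlying set \<open>S\<close>.\<close>

definition primitive_idempotent :: "('k, 'a) module \<Rightarrow> 'a set \<Rightarrow> 'a \<Rightarrow> bool" where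
  "primitive_idempotent A S i \<longleftrightarrow>
    i \<in> S \<and> i \<noteq> \<zero>\<^bsub>A\<^esub> \<and> i \<otimes>\<^bsub>A\<^esub> i = i \<and>
    (\<forall>j\<in>S. \<forall>l\<in>S. j \<otimes>\<^bsub>A\<^esub> j = j \<and> l \<otimes>\<^bsub>A\<^esub> l = l \<and>
      j \<otimes>\<^bsub>A\<^esub> l = \<zero>\<^bsub>A\<^esub> \<and> l \<otimes>\<^bsub>A\<^esub> j = \<zero>\<^bsub>A\<^esub> \<and> i = j \<oplus>\<^bsub>A\<^esub> l \<longrightarrow>
      j = \<zero>\<^bsub>A\<^esub> \<or> l = \<zero>\<^bsub>A\<^esub>)"

text \<open>The inclusion \<open>(Q, f) \<le> (R, e)\<close> of Brauer pairs.\<close>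

definition brauer_le ::
  "('g, 'm) monoid_scheme \<Rightarrow> 'g set \<Rightarrow> ('g \<Rightarrow> 'k::field) \<Rightarrow> 'g set \<Rightarrow> ('g \<Rightarrow> 'k) \<Rightarrow> bool" where
  "brauer_le G Q f R e \<longleftrightarrow>
    (let kG = group_algebra G in
      Q \<subseteq> R \<and>
      (\<exists>i. primitive_idempotent kG (fixed_elements G R) i \<and>
        brauer_map G R i \<otimes>\<^bsub>kG\<^esub> e \<noteq> \<zero>\<^bsub>kG\<^esub> \<and> brauer_map G Q i \<otimes>\<^bsub>kG\<^esub> f \<noteq> \<zero>\<^bsub>kG\<^esub>))"

definition maximal_brauer_pair ::
  "nat \<Rightarrow> ('g, 'm) monoid_scheme \<Rightarrow> ('k::field, 'g \<Rightarrow> 'k) module \<Rightarrow> 'g set \<Rightarrow> ('g \<Rightarrow> 'k) \<Rightarrow> bool"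
where
  "maximal_brauer_pair p G B P e \<longleftrightarrow>
    brauer_pair p G B P e \<and>
    (\<forall>R f. brauer_pair p G B R f \<and> brauer_le G P e R f \<longrightarrow> R = P \<and> f = e)"

definition pair_stabilizer :: "('g, 'm) monoid_scheme \<Rightarrow> 'g set \<Rightarrow> ('g \<Rightarrow> 'k::field) \<Rightarrow> 'g set" where
  "pair_stabilizer G P e = {g \<in> normalizer G P. gconj G g e = e}"

definition inertial_quotient ::
  "('g, 'm) monoid_scheme \<Rightarrow> 'g set \<Rightarrow> ('g \<Rightarrow> 'k::field) \<Rightarrow> 'g set monoid" where
  "inertial_quotient G P e =
    G\<lparr>carrier := pair_stabilizer G P e\<rparr> Mod (P <#>\<^bsub>G\<^esub> centralizer G P)"

text \<open>
  A lift to \<open>Aut(P)\<close> of the canonical embedding of the inertial quotient into \<open>Out(P)\<close>: the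
  automorphisms of \<open>P\<close> induced by conjugation with the elements of a coset \<open>X\<close> of \<open>P C\<^sub>G(P)\<close> are
  exactly those in the class in \<open>Out(P)\<close> that \<open>X\<close> is sent to.
\<close>

definition inertial_lift ::
  "('g, 'm) monoid_scheme \<Rightarrow> 'g set \<Rightarrow> ('g \<Rightarrow> 'k::field) \<Rightarrow> ('g set \<Rightarrow> 'g \<Rightarrow> 'g) \<Rightarrow> bool" where
  "inertial_lift G P e \<sigma> \<longleftrightarrow>
    \<sigma> \<in> hom (inertial_quotient G P e) (AutoGroup (G\<lparr>carrier := P\<rparr>)) \<and>
    (\<forall>X\<in>carrier (inertial_quotient G P e).
      \<exists>g\<in>X. \<sigma> X = (\<lambda>u\<in>P. g \<otimes>\<^bsub>G\<^esub> u \<otimes>\<^bsub>G\<^esub> inv\<^bsub>G\<^esub> g))"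

definition acts_freely ::
  "('g, 'm) monoid_scheme \<Rightarrow> 'g set \<Rightarrow> ('g \<Rightarrow> 'k::field) \<Rightarrow> ('g set \<Rightarrow> 'g \<Rightarrow> 'g) \<Rightarrow> bool" where
  "acts_freely G P e \<sigma> \<longleftrightarrow>
    (\<forall>X\<in>carrier (inertial_quotient G P e). X \<noteq> \<one>\<^bsub>inertial_quotient G P e\<^esub> \<longrightarrow>
      (\<forall>u\<in>P - {\<one>\<^bsub>G\<^esub>}. \<sigma> X u \<noteq> u))"


section \<open>Splitting fields\<close>

text \<open>The library's locale \<open>module\<close> is restricted to commutative rings.\<close>

locale left_module = R?: ring R + M?: abelian_group M for R and M (structure) +
  assumes smult_closed: "\<lbrakk>a \<in> carrier R; x \<in> carrier M\<rbrakk> \<Longrightarrow> a \<odot>\<^bsub>M\<^esub> x \<in> carrier M"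
    and smult_l_distr: "\<lbrakk>a \<in> carrier R; b \<in> carrier R; x \<in> carrier M\<rbrakk> \<Longrightarrow>
      (a \<oplus>\<^bsub>R\<^esub> b) \<odot>\<^bsub>M\<^esub> x = a \<odot>\<^bsub>M\<^esub> x \<oplus>\<^bsub>M\<^esub> b \<odot>\<^bsub>M\<^esub> x"
    and smult_r_distr: "\<lbrakk>a \<in> carrier R; x \<in> carrier M; y \<in> carrier M\<rbrakk> \<Longrightarrow>
      a \<odot>\<^bsub>M\<^esub> (x \<oplus>\<^bsub>M\<^esub> y) = a \<odot>\<^bsub>M\<^esub> x \<oplus>\<^bsub>M\<^esub> a \<odot>\<^bsub>M\<^esub> y"
    and smult_assoc1: "\<lbrakk>a \<in> carrier R; b \<in> carrier R; x \<in> carrier M\<rbrakk> \<Longrightarrow>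
      (a \<otimes>\<^bsub>R\<^esub> b) \<odot>\<^bsub>M\<^esub> x = a \<odot>\<^bsub>M\<^esub> (b \<odot>\<^bsub>M\<^esub> x)"
    and smult_one: "x \<in> carrier M \<Longrightarrow> \<one>\<^bsub>R\<^esub> \<odot>\<^bsub>M\<^esub> x = x"

definition simple_module :: "('k, 'a) module \<Rightarrow> ('a, 'v) module \<Rightarrow> bool" where
  "simple_module A M \<longleftrightarrow>
    left_module A M \<and> carrier M \<noteq> {\<zero>\<^bsub>M\<^esub>} \<and>
    (\<forall>N. submodule N A M \<longrightarrow> N = {\<zero>\<^bsub>M\<^esub>} \<or> N = carrier M)"

definition module_endo :: "('k, 'a) module \<Rightarrow> ('a, 'v) module \<Rightarrow> ('v \<Rightarrow> 'v) \<Rightarrow> bool" where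
  "module_endo A M \<phi> \<longleftrightarrow>
    \<phi> \<in> carrier M \<rightarrow> carrier M \<and>
    (\<forall>x\<in>carrier M. \<forall>y\<in>carrier M. \<phi> (x \<oplus>\<^bsub>M\<^esub> y) = \<phi> x \<oplus>\<^bsub>M\<^esub> \<phi> y) \<and>
    (\<forall>a\<in>carrier A. \<forall>x\<in>carrier M. \<phi> (a \<odot>\<^bsub>M\<^esub> x) = a \<odot>\<^bsub>M\<^esub> \<phi> x)"

text \<open>
  \<open>A\<close> is split over \<open>k\<close>: the endomorphism ring of every simple \<open>A\<close>-module consists of the scalars
  from \<open>k\<close>.  Modules with carriers consisting of subsets of \<open>A\<close> suffice, since every simple module
  is isomorphic to a quotient of the module \<open>A\<close> by a left ideal.
\<close>

definition split_algebra :: "('k, 'a) module \<Rightarrow> bool" where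
  "split_algebra A \<longleftrightarrow>
    (\<forall>M :: ('a, 'a set) module. simple_module A M \<longrightarrow>
      (\<forall>\<phi>. module_endo A M \<phi> \<longrightarrow>
        (\<exists>c. \<forall>x\<in>carrier M. \<phi> x = (c \<odot>\<^bsub>A\<^esub> \<one>\<^bsub>A\<^esub>) \<odot>\<^bsub>M\<^esub> x)))"

text \<open>
  The splitting field convention: \<open>k\<close> is a splitting field for the algebra \<open>kC\<^sub>G(Q)f\<close>, for every
  \<open>B\<close>-Brauer pair \<open>(Q, f)\<close>.  The trivial subgroup \<open>Q\<close> yields \<open>B\<close> itself.  As \<open>kC\<^sub>G(Q)f\<close> is a direct
  factor of \<open>kC\<^sub>G(Q)\<close>, this holds if \<open>k\<close> is a splitting field for all subgroups of \<open>G\<close>.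
\<close>

definition large_enough ::
  "nat \<Rightarrow> ('g, 'm) monoid_scheme \<Rightarrow> ('k::field, 'g \<Rightarrow> 'k) module \<Rightarrow> bool" where
  "large_enough p G B \<longleftrightarrow>
    (\<forall>Q C. is_block (subgroup_algebra G (centralizer G Q)) C \<and> brauer_pair p G B Q \<one>\<^bsub>C\<^esub> \<longrightarrow>
      split_algebra C)"


section \<open>Lie algebras\<close>

record ('k, 'l) lie_algebra = "'l partial_object" +
  ladd :: "'l \<Rightarrow> 'l \<Rightarrow> 'l"
  lscale :: "'k \<Rightarrow> 'l \<Rightarrow> 'l"
  lbracket :: "'l \<Rightarrow> 'l \<Rightarrow> 'l"

definition lie_subalgebra :: "'l set \<Rightarrow> ('k, 'l) lie_algebra \<Rightarrow> bool" where
  "lie_subalgebra S L \<longleftrightarrow>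
    S \<subseteq> carrier L \<and> S \<noteq> {} \<and>
    (\<forall>x\<in>S. \<forall>y\<in>S. ladd L x y \<in> S \<and> lbracket L x y \<in> S) \<and>
    (\<forall>c. \<forall>x\<in>S. lscale L c x \<in> S)"

definition lie_iso ::
  "('k, 'l) lie_algebra \<Rightarrow> ('k, 'n) lie_algebra \<Rightarrow> ('l \<Rightarrow> 'n) \<Rightarrow> bool" where
  "lie_iso L M \<Phi> \<longleftrightarrow>
    bij_betw \<Phi> (carrier L) (carrier M) \<and>
    (\<forall>x\<in>carrier L. \<forall>y\<in>carrier L.
      \<Phi> (ladd L x y) = ladd M (\<Phi> x) (\<Phi> y) \<and>
      \<Phi> (lbracket L x y) = lbracket M (\<Phi> x) (\<Phi> y)) \<and>
    (\<forall>c. \<forall>x\<in>carrier L. \<Phi> (lscale L c x) = lscale M c (\<Phi> x))"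

definition lie_isomorphic :: "('k, 'l) lie_algebra \<Rightarrow> ('k, 'n) lie_algebra \<Rightarrow> bool" where
  "lie_isomorphic L M \<longleftrightarrow> (\<exists>\<Phi>. lie_iso L M \<Phi>)"


section \<open>The first Hochschild cohomology\<close>

definition Der :: "('k, 'a) module \<Rightarrow> ('a \<Rightarrow> 'a) set" where
  "Der A =
    {D \<in> carrier A \<rightarrow>\<^sub>E carrier A.
      (\<forall>x\<in>carrier A. \<forall>y\<in>carrier A. D (x \<oplus>\<^bsub>A\<^esub> y) = D x \<oplus>\<^bsub>A\<^esub> D y) \<and>
      (\<forall>c. \<forall>x\<in>carrier A. D (c \<odot>\<^bsub>A\<^esub> x) = c \<odot>\<^bsub>A\<^esub> D x) \<and>
      (\<forall>x\<in>carrier A. \<forall>y\<in>carrier A.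
        D (x \<otimes>\<^bsub>A\<^esub> y) = D x \<otimes>\<^bsub>A\<^esub> y \<oplus>\<^bsub>A\<^esub> x \<otimes>\<^bsub>A\<^esub> D y)}"

definition IDer :: "('k, 'a) module \<Rightarrow> ('a \<Rightarrow> 'a) set" where
  "IDer A = (\<lambda>a. \<lambda>x\<in>carrier A. a \<otimes>\<^bsub>A\<^esub> x \<ominus>\<^bsub>A\<^esub> x \<otimes>\<^bsub>A\<^esub> a) ` carrier A"

definition der_add :: "('k, 'a) module \<Rightarrow> ('a \<Rightarrow> 'a) \<Rightarrow> ('a \<Rightarrow> 'a) \<Rightarrow> 'a \<Rightarrow> 'a" where
  "der_add A D D' = (\<lambda>x\<in>carrier A. D x \<oplus>\<^bsub>A\<^esub> D' x)"

definition der_scale :: "('k, 'a) module \<Rightarrow> 'k \<Rightarrow> ('a \<Rightarrow> 'a) \<Rightarrow> 'a \<Rightarrow> 'a" where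
  "der_scale A c D = (\<lambda>x\<in>carrier A. c \<odot>\<^bsub>A\<^esub> D x)"

definition der_bracket :: "('k, 'a) module \<Rightarrow> ('a \<Rightarrow> 'a) \<Rightarrow> ('a \<Rightarrow> 'a) \<Rightarrow> 'a \<Rightarrow> 'a" where
  "der_bracket A D D' = (\<lambda>x\<in>carrier A. D (D' x) \<ominus>\<^bsub>A\<^esub> D' (D x))"

definition der_class :: "('k, 'a) module \<Rightarrow> ('a \<Rightarrow> 'a) \<Rightarrow> ('a \<Rightarrow> 'a) set" where
  "der_class A D = der_add A D ` IDer A"

text \<open>The operations on the quotient are formed as the multiplication in \<open>FactRing\<close>.\<close>

definition HH1 :: "('k, 'a) module \<Rightarrow> ('k, ('a \<Rightarrow> 'a) set) lie_algebra" where
  "HH1 A =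
    \<lparr> carrier = der_class A ` Der A,
      ladd = (\<lambda>X Y. \<Union>D\<in>X. \<Union>D'\<in>Y. der_class A (der_add A D D')),
      lscale = (\<lambda>c X. \<Union>D\<in>X. der_class A (der_scale A c D)),
      lbracket = (\<lambda>X Y. \<Union>D\<in>X. \<Union>D'\<in>Y. der_class A (der_bracket A D D')) \<rparr>"

definition der_conj :: "('k, 'a) module \<Rightarrow> ('a \<Rightarrow> 'a) \<Rightarrow> ('a \<Rightarrow> 'a) \<Rightarrow> 'a \<Rightarrow> 'a" where
  "der_conj A \<alpha> D = (\<lambda>x\<in>carrier A. \<alpha> (D (inv_into (carrier A) \<alpha> x)))"

text \<open>The fixed points of \<open>HH\<^sup>1(A)\<close> under a set \<open>\<Gamma>\<close> of algebra automorphisms of \<open>A\<close>.\<close>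

definition HH1_fixed ::
  "('k, 'a) module \<Rightarrow> ('a \<Rightarrow> 'a) set \<Rightarrow> ('k, ('a \<Rightarrow> 'a) set) lie_algebra" where
  "HH1_fixed A \<Gamma> =
    (HH1 A)\<lparr>carrier := {X \<in> carrier (HH1 A). \<forall>\<alpha>\<in>\<Gamma>. der_conj A \<alpha> ` X = X}\<rparr>"

text \<open>The algebra automorphism of \<open>kP\<close> extending an automorphism \<open>\<tau>\<close> of \<open>P\<close>.\<close>

definition lin_ext :: "'g set \<Rightarrow> ('g \<Rightarrow> 'g) \<Rightarrow> ('g \<Rightarrow> 'k::field) \<Rightarrow> 'g \<Rightarrow> 'k" where
  "lin_ext P \<tau> a = (\<lambda>u. if u \<in> P then a (inv_into P \<tau> u) else 0)"

definition HH1_kP_E ::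
  "('g, 'm) monoid_scheme \<Rightarrow> 'g set \<Rightarrow> ('g \<Rightarrow> 'k::field) \<Rightarrow> ('g set \<Rightarrow> 'g \<Rightarrow> 'g) \<Rightarrow>
   ('k, (('g \<Rightarrow> 'k) \<Rightarrow> 'g \<Rightarrow> 'k) set) lie_algebra" where
  "HH1_kP_E G P e \<sigma> =
    HH1_fixed (subgroup_algebra G P)
      ((\<lambda>X. lin_ext P (\<sigma> X)) ` carrier (inertial_quotient G P e))"

text \<open>
  The canonical map from \<open>HH\<^sup>1(kP)\<^sup>E\<close> to \<open>HH\<^sup>1(B)\<close> extends derivations along the embedding
  \<open>kP \<rightarrow> B\<close>, \<open>a \<mapsto> a e\<close>: it sends the class of \<open>D\<close> to the class of some derivation \<open>D'\<close> of \<open>B\<close> with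
  \<open>D'(a e) = D(a) e\<close> for all \<open>a\<close> in \<open>kP\<close>.  The class of such a \<open>D'\<close> is unique: \<open>kN\<^sub>G(P,e)e\<close> is
  relatively \<open>kP\<close>-separable, so a derivation of \<open>B\<close> that vanishes on \<open>kP e\<close> is inner.
\<close>

definition canonical_HH1_map ::
  "('g, 'm) monoid_scheme \<Rightarrow> ('k::field, 'g \<Rightarrow> 'k) module \<Rightarrow> 'g set \<Rightarrow> ('g \<Rightarrow> 'k) \<Rightarrow>
   ('g set \<Rightarrow> 'g \<Rightarrow> 'g) \<Rightarrow>
   ((('g \<Rightarrow> 'k) \<Rightarrow> 'g \<Rightarrow> 'k) set \<Rightarrow> (('g \<Rightarrow> 'k) \<Rightarrow> 'g \<Rightarrow> 'k) set) \<Rightarrow> bool" where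
  "canonical_HH1_map G B P e \<sigma> \<Phi> \<longleftrightarrow>
    (let kG = group_algebra G; kP = subgroup_algebra G P in
      \<forall>D\<in>Der kP. der_class kP D \<in> carrier (HH1_kP_E G P e \<sigma>) \<longrightarrow>
        (\<exists>D'\<in>Der B.
          (\<forall>a\<in>carrier kP. D' (a \<otimes>\<^bsub>kG\<^esub> e) = D a \<otimes>\<^bsub>kG\<^esub> e) \<and>
          \<Phi> (der_class kP D) = der_class B D'))"

end

theory Submission
  imports Defs "HOL.Vector_Spaces" "HOL-Library.Function_Algebras" "HOL-Algebra.Sylow"
    "HOL-Algebra.Multiplicative_Group" "HOL-Algebra.Zassenhaus"
begin

text \<open>
  Write \<open>C = C\<^sub>G(P)\<close> and let \<open>N\<close> be the stabiliser of \<open>e\<close> in \<open>G\<close>.  As \<open>P\<close> is a defect group, the block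
  idempotent \<open>b\<close> is a relative trace from \<open>P\<close> to \<open>G\<close>, which gives \<open>w \<in> kCe\<close> whose trace from \<open>P\<close> to \<open>N\<close> is \<open>e\<close>.
  Averaging with \<open>w\<close> shows that a derivation of \<open>B\<close> vanishing on \<open>kPe\<close> is inner, and it splits the 2-cocycle that
  obstructs the extension of an \<open>N\<close>-stable derivation of \<open>kP\<close> to \<open>kNe\<close>; since \<open>b\<close> is the trace of \<open>e\<close> from \<open>N\<close>
  to \<open>G\<close>, the derivation extends further to \<open>B\<close>.  A retraction \<open>kG \<rightarrow> kP\<close> of \<open>kP\<close>-\<open>kP\<close>-bimodules that sends
  \<open>e\<close> to \<open>1\<close> shows that only stable derivations extend, and that a derivation of \<open>kP\<close> with an inner extension is
  inner.  Hence ``\<open>D'\<close> extends \<open>D\<close>'' induces an isomorphism from \<open>HH\<^sup>1(kP)\<^sup>E\<close> onto a Lie subalgebra.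

  If \<open>E\<close> acts freely, every class of \<open>HH\<^sup>1(B)\<close> arises in this way.  A derivation of \<open>B\<close> can be made to vanish at
  \<open>e\<close>; then \<open>P\<close> permutes \<open>N - PC\<close> freely by conjugation, so the values on \<open>kPe\<close> can be moved into \<open>kPCe\<close>, and a
  trace from \<open>Z(P)\<close> to \<open>C\<close> makes them commute with \<open>C\<close>.  Because \<open>k\<close> splits \<open>kCe\<close>, the centre of \<open>kCe\<close> is
  \<open>kZ(P)e\<close>, so the elements of \<open>kPCe\<close> that commute with \<open>C\<close> are those of \<open>kPe\<close>.
\<close>

section \<open>Convolution\<close>

text \<open>The element w stands in for the missing fraction. It lies in kC and so commutes with P,
  which makes sums over N/P weighted by w well defined, and its conjugates over N/P add up to e. A
  second such element, for Z(P) in C, serves the arguments inside kCe. The other recurrent tool is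
  that p-groups act unipotently in characteristic p, so that a non-zero invariant subspace contains
  a non-zero fixed vector. It yields the inverse of a central element of non-zero augmentation, the
  retraction onto kP, the support of b in C, and Nakayama's lemma over kZ(P). All algebras are
  subspaces of one function space with one total product, so elements of kP, kCe, kNe and B can be
  multiplied with each other without embeddings. Quotients never appear; they are replaced by
  congruences modulo a subspace.\<close>

definition smul :: "'k::field \<Rightarrow> ('g \<Rightarrow> 'k) \<Rightarrow> 'g \<Rightarrow> 'k" where
  "smul c a = (\<lambda>x. c * a x)"

interpretation fv: vector_space "smul :: 'k::field \<Rightarrow> ('g \<Rightarrow> 'k) \<Rightarrow> 'g \<Rightarrow> 'k"
  by unfold_locales (auto simp: smul_def fun_eq_iff algebra_simps)

abbreviation lin :: "(('g \<Rightarrow> 'k::field) \<Rightarrow> 'h \<Rightarrow> 'k) \<Rightarrow> bool" where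
  "lin \<equiv> Vector_Spaces.linear smul smul"

text \<open>\<open>dl g\<close> is the group element g, \<open>supp_in H\<close> is the group
  algebra kH, and \<open>cut H\<close> is the projection of kG onto kH that forgets all other group
  elements.\<close>

definition dl :: "'g \<Rightarrow> 'g \<Rightarrow> 'k::field" where
  "dl g = (\<lambda>x. if x = g then 1 else 0)"

definition supp_in :: "'g set \<Rightarrow> ('g \<Rightarrow> 'k::field) set" where
  "supp_in H = {a. \<forall>x. x \<notin> H \<longrightarrow> a x = 0}"

definition cut :: "'g set \<Rightarrow> ('g \<Rightarrow> 'k::field) \<Rightarrow> 'g \<Rightarrow> 'k" where
  "cut H a = (\<lambda>x. if x \<in> H then a x else 0)"

lemma smul_apply [simp]: "smul c a x = c * a x"
  by (simp add: smul_def)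

lemma dl_apply: "dl g x = (if x = g then 1 else 0)"
  by (simp add: dl_def)

lemma cut_apply: "cut H a x = (if x \<in> H then a x else 0)"
  by (simp add: cut_def)

lemma sum_fun_apply: "(\<Sum>i\<in>I. F i) x = (\<Sum>i\<in>I. F i x)" for F :: "'i \<Rightarrow> 'a \<Rightarrow> 'b::comm_monoid_add"
  by (induction I rule: infinite_finite_induct) auto

lemma linI:
  assumes "\<And>x y. F (x + y) = F x + F y" "\<And>c x. F (smul c x) = smul c (F x)"
  shows "lin F"
  using assms by (simp add: Vector_Spaces.linear_iff fv.vector_space_axioms)

lemma lin_add: "lin F \<Longrightarrow> F (x + y) = F x + F y"
  by (simp add: Vector_Spaces.linear_iff)

lemma lin_smul: "lin F \<Longrightarrow> F (smul c x) = smul c (F x)"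
  by (simp add: Vector_Spaces.linear_iff)

lemma lin_0: "lin F \<Longrightarrow> F 0 = 0"
  using lin_smul[of F 0 0] by (simp add: fun_eq_iff)

lemma lin_minus: "lin F \<Longrightarrow> F (- x) = - F x"
  using lin_add[of F x "- x"] lin_0[of F] by (simp add: eq_neg_iff_add_eq_0 add.commute)

lemma lin_diff: "lin F \<Longrightarrow> F (x - y) = F x - F y"
  using lin_add[of F x "- y"] lin_minus[of F y] by simp

lemma lin_sum: "lin F \<Longrightarrow> F (\<Sum>i\<in>I. f i) = (\<Sum>i\<in>I. F (f i))"
  by (induction I rule: infinite_finite_induct) (auto simp: lin_0 lin_add)

lemmas lin_simps = lin_add lin_smul lin_0 lin_minus lin_diff lin_sum

lemma smul_sum: "smul c (\<Sum>i\<in>I. f i) = (\<Sum>i\<in>I. smul c (f i))"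
  by (simp add: fun_eq_iff sum_fun_apply sum_distrib_left)

lemma smul_simps [simp]: "smul 1 a = a" "smul 0 a = 0" "smul c 0 = 0" "smul c (smul d a) = smul (c * d) a"
  "smul (- 1) a = - a"
  by (auto simp: fun_eq_iff)

lemma smul_add: "smul c (a + b) = smul c a + smul c b" "smul (c + d) a = smul c a + smul d a"
  "smul c (a - b) = smul c a - smul c b" "smul c (- a) = - smul c a"
  by (auto simp: fun_eq_iff algebra_simps)

lemma lin_id: "lin (\<lambda>x. x)"
  by (rule linI) auto

lemma lin_plus: "lin F \<Longrightarrow> lin F' \<Longrightarrow> lin (\<lambda>x. F x + F' x)"
  by (rule linI) (auto simp: lin_simps[of F] lin_simps[of F'] smul_add)

lemma lin_neg: "lin F \<Longrightarrow> lin (\<lambda>x. - F x)"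
  by (rule linI) (auto simp: lin_simps[of F] smul_add)

lemma lin_minus_fun: "lin F \<Longrightarrow> lin F' \<Longrightarrow> lin (\<lambda>x. F x - F' x)"
  by (rule linI) (auto simp: lin_simps[of F] lin_simps[of F'] smul_add)

lemma lin_scale: "lin F \<Longrightarrow> lin (\<lambda>x. smul c (F x))"
  by (rule linI) (auto simp: lin_simps[of F] smul_add mult.commute)

lemma lin_comp: "lin F \<Longrightarrow> lin F' \<Longrightarrow> lin (\<lambda>x. F (F' x))"
  by (rule linI) (auto simp: lin_simps[of F] lin_simps[of F'])

lemma lin_sum_fun:
  assumes "\<And>i. i \<in> I \<Longrightarrow> lin (F i)"
  shows "lin (\<lambda>x. \<Sum>i\<in>I. F i x)"
proof (rule linI)
  show "(\<Sum>i\<in>I. F i (x + y)) = (\<Sum>i\<in>I. F i x) + (\<Sum>i\<in>I. F i y)" for x y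
    using lin_add[OF assms] by (simp add: sum.distrib)
  show "(\<Sum>i\<in>I. F i (smul c x)) = smul c (\<Sum>i\<in>I. F i x)" for c x
    using lin_smul[OF assms] by (simp add: smul_sum)
qed

lemma cut_add: "cut H (a + b) = cut H a + cut H b" and cut_smul: "cut H (smul c a) = smul c (cut H a)"
  by (auto simp: cut_def fun_eq_iff)

lemma lin_cut: "lin (cut H)"
  by (rule linI) (auto simp: cut_add cut_smul)

lemma cut_in: "cut H a \<in> supp_in H"
  by (simp add: cut_def supp_in_def)

lemma cut_id: "a \<in> supp_in H \<Longrightarrow> cut H a = a"
  by (auto simp: cut_def supp_in_def fun_eq_iff)

lemma supp_in_I: "(\<And>x. x \<notin> H \<Longrightarrow> a x = 0) \<Longrightarrow> a \<in> supp_in H"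
  by (simp add: supp_in_def)

lemma supp_in_mono: "H \<subseteq> K \<Longrightarrow> supp_in H \<subseteq> supp_in K"
  by (auto simp: supp_in_def)

lemma subspace_supp_in: "fv.subspace (supp_in H)"
  by (auto simp: fv.subspace_def supp_in_def)

lemma dl_in: "g \<in> H \<Longrightarrow> dl g \<in> supp_in H"
  by (auto simp: supp_in_def dl_def)

lemma subspace_closed:
  assumes "fv.subspace S"
  shows "0 \<in> S" "a \<in> S \<Longrightarrow> b \<in> S \<Longrightarrow> a + b \<in> S" "a \<in> S \<Longrightarrow> b \<in> S \<Longrightarrow> a - b \<in> S" "a \<in> S \<Longrightarrow> - a \<in> S"
    "a \<in> S \<Longrightarrow> smul c a \<in> S" "(\<And>i. i \<in> I \<Longrightarrow> f i \<in> S) \<Longrightarrow> (\<Sum>i\<in>I. f i) \<in> S"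
  using assms by (auto intro: fv.subspace_0 fv.subspace_add fv.subspace_diff fv.subspace_neg fv.subspace_scale fv.subspace_sum)

lemmas supp_in_closed = subspace_closed[OF subspace_supp_in]

lemma expand_dl:
  assumes "finite H" "a \<in> supp_in H"
  shows "a = (\<Sum>g\<in>H. smul (a g) (dl g))"
  using assms by (auto simp: fun_eq_iff sum_fun_apply dl_def supp_in_def if_distrib cong: if_cong)

text \<open>Linear extension of a map given on the basis H. It is linear on all functions, but only
  its values on \<open>supp_in H\<close> carry meaning.\<close>

definition lext :: "'g set \<Rightarrow> ('g \<Rightarrow> 'h \<Rightarrow> 'k::field) \<Rightarrow> ('g \<Rightarrow> 'k) \<Rightarrow> 'h \<Rightarrow> 'k" where
  "lext H E a = (\<Sum>g\<in>H. smul (a g) (E g))"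

lemma lin_lext: "lin (lext H E)"
  by (rule linI) (auto simp: lext_def smul_add sum.distrib smul_sum)

lemma lext_dl: "finite H \<Longrightarrow> g \<in> H \<Longrightarrow> lext H E (dl g) = E g"
  by (simp add: lext_def dl_def if_distrib[of "\<lambda>c. smul c _"] cong: if_cong)

lemma lin_eq_on:
  assumes "finite H" "lin F" "lin F'" "\<And>g. g \<in> H \<Longrightarrow> F (dl g) = F' (dl g)" "a \<in> supp_in H"
  shows "F a = F' a"
proof -
  have "F (\<Sum>g\<in>H. smul (a g) (dl g)) = F' (\<Sum>g\<in>H. smul (a g) (dl g))"
    using assms by (simp add: lin_sum[of F] lin_smul[of F] lin_sum[of F'] lin_smul[of F'])
  then show ?thesis using expand_dl[OF assms(1,5)] by simp
qed

lemma lin_in_on: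
  assumes "finite H" "lin F" "fv.subspace S" "\<And>g. g \<in> H \<Longrightarrow> F (dl g) \<in> S" "a \<in> supp_in H"
  shows "F a \<in> S"
proof -
  have "F (\<Sum>g\<in>H. smul (a g) (dl g)) \<in> S"
    using assms by (simp add: lin_sum[of F] lin_smul[of F] subspace_closed)
  then show ?thesis using expand_dl[OF assms(1,5)] by simp
qed

locale finite_group = group G for G :: "('g, 'm) monoid_scheme" (structure) +
  assumes finG: "finite (carrier G)"
begin

text \<open>One product serves all subgroups: on functions supported in H it is the product of kH
  (\<open>subgroup_algebra_mult\<close>). It reads only values on G and its results lie in kG, while
  \<open>dl \<one>\<close> is neutral only for functions supported in G.\<close>

abbreviation star :: "('g \<Rightarrow> 'k::field) \<Rightarrow> ('g \<Rightarrow> 'k) \<Rightarrow> 'g \<Rightarrow> 'k" (infixl "\<star>" 70) where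
  "a \<star> b \<equiv> a \<otimes>\<^bsub>group_algebra G\<^esub> b"

lemma star_apply:
  assumes "x \<in> carrier G"
  shows "(a \<star> b) x = (\<Sum>y\<in>carrier G. a y * b (inv y \<otimes> x))"
proof -
  have "(a \<star> b) x = (\<Sum>(y, z)\<in>{(y, z). y \<in> carrier G \<and> z \<in> carrier G \<and> y \<otimes> z = x}. a y * b z)"
    by (simp add: group_algebra_def)
  also have "\<dots> = (\<Sum>y\<in>carrier G. a y * b (inv y \<otimes> x))"
  proof (rule sum.reindex_bij_witness[of _ "\<lambda>y. (y, inv y \<otimes> x)" fst])
  qed (use assms in \<open>auto simp: m_assoc[symmetric] inv_solve_left\<close>)
  finally show ?thesis .
qed

lemma star_outside: "x \<notin> carrier G \<Longrightarrow> (a \<star> b) x = 0"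
proof -
  assume "x \<notin> carrier G"
  then have "{(y, z). y \<in> carrier G \<and> z \<in> carrier G \<and> y \<otimes> z = x} = {}" by auto
  then show ?thesis unfolding group_algebra_def by (simp del: Collect_empty_eq)
qed

lemma star_in: "a \<star> b \<in> supp_in (carrier G)"
  by (simp add: supp_in_def star_outside)

lemma star_eqI:
  assumes "\<And>x. x \<in> carrier G \<Longrightarrow> (a \<star> b) x = (c \<star> d) x"
  shows "a \<star> b = c \<star> d"
  using assms star_outside by (metis ext)

lemma star_add_left: "(a + b) \<star> c = a \<star> c + b \<star> c"
proof
  fix x show "((a + b) \<star> c) x = (a \<star> c + b \<star> c) x"
    by (cases "x \<in> carrier G") (auto simp: star_apply star_outside algebra_simps sum.distrib)
qed

lemma star_add_right: "c \<star> (a + b) = c \<star> a + c \<star> b"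
proof
  fix x show "(c \<star> (a + b)) x = (c \<star> a + c \<star> b) x"
    by (cases "x \<in> carrier G") (auto simp: star_apply star_outside algebra_simps sum.distrib)
qed

lemma star_smul_left: "smul r a \<star> c = smul r (a \<star> c)"
proof
  fix x show "(smul r a \<star> c) x = smul r (a \<star> c) x"
    by (cases "x \<in> carrier G") (auto simp: star_apply star_outside algebra_simps sum_distrib_left)
qed

lemma star_smul_right: "c \<star> smul r a = smul r (c \<star> a)"
proof
  fix x show "(c \<star> smul r a) x = smul r (c \<star> a) x"
    by (cases "x \<in> carrier G") (auto simp: star_apply star_outside algebra_simps sum_distrib_left)
qed

lemma lin_star_left: "lin F \<Longrightarrow> lin (\<lambda>x. a \<star> F x)"
  by (rule linI) (auto simp: lin_simps[of F] star_add_right star_smul_right)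

lemma lin_star_right: "lin F \<Longrightarrow> lin (\<lambda>x. F x \<star> a)"
  by (rule linI) (auto simp: lin_simps[of F] star_add_left star_smul_left)

lemmas lin_intros = lin_id lin_plus lin_neg lin_minus_fun lin_scale lin_sum_fun lin_star_left lin_star_right
  lin_comp[OF lin_cut] lin_comp[OF lin_lext]

lemma star_0 [simp]: "0 \<star> a = 0" "a \<star> 0 = 0"
  using lin_0[OF lin_star_right[OF lin_id]] lin_0[OF lin_star_left[OF lin_id]] by auto

lemma star_minus: "(- a) \<star> b = - (a \<star> b)" "a \<star> (- b) = - (a \<star> b)"
  using lin_minus[OF lin_star_right[OF lin_id]] lin_minus[OF lin_star_left[OF lin_id]] by auto

lemma star_diff: "(a - b) \<star> c = a \<star> c - b \<star> c" "c \<star> (a - b) = c \<star> a - c \<star> b"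
  using lin_diff[OF lin_star_right[OF lin_id]] lin_diff[OF lin_star_left[OF lin_id]] by auto

lemma star_sum: "(\<Sum>i\<in>I. f i) \<star> c = (\<Sum>i\<in>I. f i \<star> c)" "c \<star> (\<Sum>i\<in>I. f i) = (\<Sum>i\<in>I. c \<star> f i)"
  using lin_sum[OF lin_star_right[OF lin_id]] lin_sum[OF lin_star_left[OF lin_id]] by auto

lemmas star_distribs = star_add_left star_add_right star_minus star_diff star_smul_left star_smul_right

lemma star_assoc: "a \<star> b \<star> c = a \<star> (b \<star> c)"
proof (rule star_eqI)
  fix x assume x: "x \<in> carrier G"
  have "(a \<star> b \<star> c) x = (\<Sum>y\<in>carrier G. \<Sum>z\<in>carrier G. a z * b (inv z \<otimes> y) * c (inv y \<otimes> x))"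
    using x by (simp add: star_apply sum_distrib_right)
  also have "\<dots> = (\<Sum>z\<in>carrier G. \<Sum>y\<in>carrier G. a z * b (inv z \<otimes> y) * c (inv y \<otimes> x))"
    by (rule sum.swap)
  also have "\<dots> = (\<Sum>z\<in>carrier G. \<Sum>y\<in>carrier G. a z * b y * c (inv (z \<otimes> y) \<otimes> x))"
  proof (rule sum.cong[OF refl])
    fix z assume z: "z \<in> carrier G"
    show "(\<Sum>y\<in>carrier G. a z * b (inv z \<otimes> y) * c (inv y \<otimes> x)) = (\<Sum>y\<in>carrier G. a z * b y * c (inv (z \<otimes> y) \<otimes> x))"
      by (rule sum.reindex_bij_witness[of _ "\<lambda>y. z \<otimes> y" "\<lambda>y. inv z \<otimes> y"])
        (use z in \<open>auto simp: m_assoc[symmetric]\<close>)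
  qed
  also have "\<dots> = (a \<star> (b \<star> c)) x"
    using x by (simp add: star_apply sum_distrib_left inv_mult_group m_assoc mult.assoc)
  finally show "(a \<star> b \<star> c) x = (a \<star> (b \<star> c)) x" .
qed

lemma dl_star: "g \<in> carrier G \<Longrightarrow> x \<in> carrier G \<Longrightarrow> (dl g \<star> a) x = a (inv g \<otimes> x)"
  by (simp add: star_apply dl_def finG if_distrib[of "\<lambda>c. c * _"] cong: if_cong)

lemma star_dl:
  assumes "g \<in> carrier G" "x \<in> carrier G"
  shows "(a \<star> dl g) x = a (x \<otimes> inv g)"
proof -
  have "inv y \<otimes> x = g \<longleftrightarrow> y = x \<otimes> inv g" if "y \<in> carrier G" for y
    using assms that by (metis inv_closed inv_inv inv_solve_left inv_solve_right)
  then show ?thesis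
    using assms by (simp add: star_apply dl_def finG if_distrib[of "\<lambda>c. _ * c"] cong: if_cong)
qed

lemma dl_dl: "g \<in> carrier G \<Longrightarrow> h \<in> carrier G \<Longrightarrow> dl g \<star> dl h = (dl (g \<otimes> h) :: 'g \<Rightarrow> 'k::field)"
proof
  fix x assume gh: "g \<in> carrier G" "h \<in> carrier G"
  show "(dl g \<star> dl h) x = (dl (g \<otimes> h) x :: 'k)"
  proof (cases "x \<in> carrier G")
    case True
    then have "inv g \<otimes> x = h \<longleftrightarrow> x = g \<otimes> h" using gh by (metis inv_solve_left)
    then show ?thesis using gh True by (simp add: dl_star dl_apply)
  next
    case False
    then show ?thesis using gh by (auto simp: star_outside dl_apply)
  qed
qed

lemma dl_one: "a \<in> supp_in (carrier G) \<Longrightarrow> dl \<one> \<star> a = a" "a \<in> supp_in (carrier G) \<Longrightarrow> a \<star> dl \<one> = a"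
proof -
  assume a: "a \<in> supp_in (carrier G)"
  show "dl \<one> \<star> a = a" "a \<star> dl \<one> = a"
    using a by (auto simp: fun_eq_iff dl_star star_dl star_outside supp_in_def)
      (metis dl_star star_dl star_outside one_closed l_one r_one inv_one)+
qed

lemma dl_one_star [simp]: "dl \<one> \<star> (a \<star> b) = a \<star> b" "a \<star> b \<star> dl \<one> = a \<star> b"
  by (simp_all add: dl_one star_in)

lemma dl_mult_star: "g \<in> carrier G \<Longrightarrow> h \<in> carrier G \<Longrightarrow> dl g \<star> (dl h \<star> a) = dl (g \<otimes> h) \<star> a"
  by (simp add: star_assoc[symmetric] dl_dl)

lemma star_supp:
  assumes "subgroup H G" "a \<in> supp_in H" "b \<in> supp_in H"
  shows "a \<star> b \<in> supp_in H"
proof (rule supp_in_I)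
  fix x assume x: "x \<notin> H"
  show "(a \<star> b) x = 0"
  proof (cases "x \<in> carrier G")
    case True
    have "a y * b (inv y \<otimes> x) = 0" if "y \<in> carrier G" for y
    proof (rule ccontr)
      assume "a y * b (inv y \<otimes> x) \<noteq> 0"
      then have "y \<in> H" "inv y \<otimes> x \<in> H" using assms(2,3) by (auto simp: supp_in_def)
      then have "y \<otimes> (inv y \<otimes> x) \<in> H" using assms(1) by (simp add: subgroup.m_closed)
      then show False using x that True by (simp add: m_assoc[symmetric])
    qed
    then show ?thesis unfolding star_apply[OF True] by (intro sum.neutral) blast
  qed (simp add: star_outside)
qed

lemma fin_sub: "H \<subseteq> carrier G \<Longrightarrow> finite H"
  using finG finite_subset by blast

lemma fin_subgroup: "subgroup H G \<Longrightarrow> finite H"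
  using fin_sub subgroup.subset by blast

lemma gconj_eq:
  assumes "g \<in> carrier G"
  shows "gconj G g a = dl g \<star> a \<star> dl (inv g)"
proof
  fix x show "gconj G g a x = (dl g \<star> a \<star> dl (inv g)) x"
    using assms by (cases "x \<in> carrier G") (auto simp: gconj_def star_dl dl_star star_outside m_assoc)
qed

end

section \<open>Conjugation and transversals\<close>

text \<open>An orbit with more than one element has length p^i with i > 0, and f is constant on it,
  so its contribution vanishes in characteristic p. The action is a bare function, so that both
  conjugation of elements and translation of cosets can be plugged in.\<close>

lemma sum_fixed_points:
  fixes f :: "'x \<Rightarrow> 'k::field" and D :: "('g, 'm) monoid_scheme"
  assumes "group D" "prime p" "CHAR('k) = p" "card (carrier D) = p ^ n" "finite X"
    and closed: "\<And>g x. g \<in> carrier D \<Longrightarrow> x \<in> X \<Longrightarrow> act g x \<in> X"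
    and one: "\<And>x. x \<in> X \<Longrightarrow> act \<one>\<^bsub>D\<^esub> x = x"
    and mult: "\<And>g h x. g \<in> carrier D \<Longrightarrow> h \<in> carrier D \<Longrightarrow> x \<in> X \<Longrightarrow> act (g \<otimes>\<^bsub>D\<^esub> h) x = act g (act h x)"
    and inv: "\<And>g x. g \<in> carrier D \<Longrightarrow> x \<in> X \<Longrightarrow> f (act g x) = f x"
  shows "(\<Sum>x\<in>X. f x) = (\<Sum>x\<in>{x \<in> X. \<forall>g\<in>carrier D. act g x = x}. f x)"
proof -
  interpret D: group D by fact
  let ?D = "carrier D"
  have finD: "finite ?D"
    using assms(2,4) card.infinite[of ?D] prime_gt_0_nat[of p] by fastforce
  define F where "F = {x \<in> X. \<forall>g\<in>?D. act g x = x}"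
  define orb where "orb x = (\<lambda>g. act g x) ` ?D" for x
  have orb_sub: "orb x \<subseteq> X" if "x \<in> X" for x
    using that closed by (auto simp: orb_def)
  have orb_self: "x \<in> orb x" if "x \<in> X" for x
    using one[OF that] D.one_closed by (force simp: orb_def)
  have act_inv: "act (inv\<^bsub>D\<^esub> g) (act g x) = x" if "g \<in> ?D" "x \<in> X" for g x
    using that mult[of "inv\<^bsub>D\<^esub> g" g x] one by simp
  have orb_act: "orb (act g x) = orb x" if g: "g \<in> ?D" and x: "x \<in> X" for g x
  proof
    show "orb (act g x) \<subseteq> orb x"
      using g x by (auto simp: orb_def mult[symmetric])
    show "orb x \<subseteq> orb (act g x)"
    proof
      fix y assume "y \<in> orb x"
      then obtain h where h: "h \<in> ?D" "y = act h x" by (auto simp: orb_def)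
      then have "y = act (h \<otimes>\<^bsub>D\<^esub> inv\<^bsub>D\<^esub> g) (act g x)"
        using g x closed mult act_inv by simp
      then show "y \<in> orb (act g x)" using h g by (auto simp: orb_def)
    qed
  qed
  have orb_eq: "{y \<in> X - F. orb y = orb x} = orb x" if x: "x \<in> X - F" for x
  proof
    show "{y \<in> X - F. orb y = orb x} \<subseteq> orb x" using orb_self by auto
    show "orb x \<subseteq> {y \<in> X - F. orb y = orb x}"
    proof
      fix y assume y: "y \<in> orb x"
      then obtain g where g: "g \<in> ?D" "y = act g x" by (auto simp: orb_def)
      then have 1: "orb y = orb x" "y \<in> X" using orb_act closed x by auto
      have "y \<notin> F"
      proof
        assume "y \<in> F"
        then have "orb y = {y}" using D.one_closed by (auto simp: orb_def F_def intro!: image_eqI[of _ _ "\<one>\<^bsub>D\<^esub>"])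
        then have "orb x = {x}" using 1 orb_self[of x] x by auto
        then have "x \<in> F" using x by (auto simp: F_def orb_def)
        then show False using x by blast
      qed
      with 1 show "y \<in> {y \<in> X - F. orb y = orb x}" by simp
    qed
  qed
  have card_orb: "p dvd card (orb x)" if x: "x \<in> X - F" for x
  proof -
    \<comment> \<open>The fibres of the orbit map are the left cosets of the stabiliser. Their equal
      size makes the orbit length a divisor of p^n.\<close>
    have "card {g \<in> ?D. act g x = y} = card {g \<in> ?D. act g x = x}" if y: "y \<in> orb x" for y
    proof -
      obtain g where g: "g \<in> ?D" "y = act g x" using y by (auto simp: orb_def)
      have "bij_betw (\<lambda>h. g \<otimes>\<^bsub>D\<^esub> h) {g \<in> ?D. act g x = x} {g \<in> ?D. act g x = y}"
        by (rule bij_betw_byWitness[where f' = "\<lambda>h. inv\<^bsub>D\<^esub> g \<otimes>\<^bsub>D\<^esub> h"])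
          (use g x mult act_inv in \<open>auto simp: D.m_assoc[symmetric]\<close>)
      then show ?thesis by (simp add: bij_betw_same_card)
    qed
    moreover have "card ?D = (\<Sum>y\<in>orb x. card {g \<in> ?D. act g x = y})"
      using sum.group[of ?D "orb x" "\<lambda>g. act g x" "\<lambda>_. 1 :: nat"] finD by (simp add: orb_def)
    ultimately have "card ?D = card (orb x) * card {g \<in> ?D. act g x = x}" by simp
    then have "card (orb x) dvd p ^ n" using assms(4) by (metis dvd_triv_left)
    then obtain i where i: "card (orb x) = p ^ i"
      using assms(2) divides_primepow_nat by blast
    show ?thesis
    proof (cases i)
      case 0
      then have "card (orb x) = 1" using i by simp
      then have "orb x = {x}" using orb_self[of x] x by (auto simp: card_1_singleton_iff)
      then have "x \<in> F" using x by (auto simp: F_def orb_def)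
      then show ?thesis using x by blast
    qed (use i in simp)
  qed
  have "(\<Sum>x\<in>X - F. f x) = (\<Sum>Y\<in>orb ` (X - F). \<Sum>x\<in>{x \<in> X - F. orb x = Y}. f x)"
    using sum.group[of "X - F" "orb ` (X - F)" orb f] assms(5) by simp
  also have "\<dots> = 0"
  proof (rule sum.neutral, rule ballI)
    fix Y assume "Y \<in> orb ` (X - F)"
    then obtain x where x: "x \<in> X - F" "Y = orb x" by blast
    have "f y = f x" if "y \<in> orb x" for y using that x inv by (auto simp: orb_def)
    then have "(\<Sum>x\<in>{x \<in> X - F. orb x = Y}. f x) = of_nat (card (orb x)) * f x"
      using orb_eq[OF x(1)] x(2) by simp
    also have "of_nat (card (orb x)) = (0 :: 'k)"
      using card_orb[OF x(1)] assms(3) by (simp add: of_nat_eq_0_iff_char_dvd)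
    finally show "(\<Sum>x\<in>{x \<in> X - F. orb x = Y}. f x) = 0" by simp
  qed
  finally have "(\<Sum>x\<in>X - F. f x) = 0" .
  moreover have "F \<subseteq> X" by (auto simp: F_def)
  ultimately show ?thesis
    using sum.subset_diff[of F X f] assms(5) by (simp add: F_def)
qed

context finite_group
begin

text \<open>Written as a product, so that its algebraic rules come from those of
  \<open>star\<close>; for g in G it agrees with \<open>gconj\<close>.\<close>

definition cj :: "'g \<Rightarrow> ('g \<Rightarrow> 'k::field) \<Rightarrow> 'g \<Rightarrow> 'k" where
  "cj g a = dl g \<star> a \<star> dl (inv g)"

lemma cj_apply: "g \<in> carrier G \<Longrightarrow> x \<in> carrier G \<Longrightarrow> cj g a x = a (inv g \<otimes> x \<otimes> g)"
  by (simp add: cj_def star_dl dl_star m_assoc)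

lemma cj_in: "cj g a \<in> supp_in (carrier G)"
  by (simp add: cj_def star_in)

lemma gconj_cj: "g \<in> carrier G \<Longrightarrow> gconj G g a = cj g a"
  by (simp add: gconj_eq cj_def)

lemma lin_cj: "lin (cj g)"
  unfolding cj_def by (intro lin_intros)

lemmas cj_lin_simps = lin_simps[OF lin_cj]

lemma cj_mult: "g \<in> carrier G \<Longrightarrow> cj g (a \<star> b) = cj g a \<star> cj g b"
  by (simp add: cj_def star_assoc dl_mult_star)

lemma cj_cj: "g \<in> carrier G \<Longrightarrow> h \<in> carrier G \<Longrightarrow> cj g (cj h a) = cj (g \<otimes> h) a"
  by (simp add: cj_def star_assoc dl_mult_star dl_dl inv_mult_group)

lemma cj_one: "a \<in> supp_in (carrier G) \<Longrightarrow> cj \<one> a = a"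
  by (simp add: cj_def dl_one star_in)

lemma cj_dl: "g \<in> carrier G \<Longrightarrow> x \<in> carrier G \<Longrightarrow> cj g (dl x) = dl (g \<otimes> x \<otimes> inv g)"
  by (simp add: cj_def dl_dl)

lemma dl_star_cj: "g \<in> carrier G \<Longrightarrow> dl g \<star> a = cj g a \<star> dl g"
  by (simp add: cj_def star_assoc dl_dl)
    (metis dl_one_star(2) star_assoc)

lemma cj_eq_iff:
  assumes "g \<in> carrier G" "a \<in> supp_in (carrier G)"
  shows "cj g a = a \<longleftrightarrow> dl g \<star> a = a \<star> dl g"
proof
  show "cj g a = a \<Longrightarrow> dl g \<star> a = a \<star> dl g" using dl_star_cj[OF assms(1)] by metis
  show "dl g \<star> a = a \<star> dl g \<Longrightarrow> cj g a = a"
    using assms by (simp add: cj_def star_assoc dl_dl dl_one)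
qed

lemma cj_inv_eq: "g \<in> carrier G \<Longrightarrow> a \<in> supp_in (carrier G) \<Longrightarrow> cj g a = b \<Longrightarrow> cj (inv g) b = a"
  by (metis cj_cj cj_one inv_closed l_inv)

section \<open>Transversals, and sums of functions that are constant on left cosets\<close>

definition transversal :: "'g set \<Rightarrow> 'g set \<Rightarrow> 'g set \<Rightarrow> bool" where
  "transversal T K H \<longleftrightarrow> T \<subseteq> K \<and> (\<forall>g\<in>K. \<exists>!t. t \<in> T \<and> inv t \<otimes> g \<in> H)"

text \<open>The representative of H is fixed to be \<one>: several sums over a transversal have a
  distinguished term at the trivial coset, which should appear there without conjugation.\<close>

definition tv :: "'g set \<Rightarrow> 'g set \<Rightarrow> 'g set" where
  "tv K H = (SOME T. transversal T K H \<and> \<one> \<in> T)"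

lemma subgroup_in: "subgroup H G \<Longrightarrow> x \<in> H \<Longrightarrow> x \<in> carrier G"
  using subgroup.subset by blast

lemma coset_rel:
  assumes H: "subgroup H G" and "x \<in> carrier G" "y \<in> carrier G" "z \<in> carrier G"
  shows "inv x \<otimes> y \<in> H \<Longrightarrow> inv y \<otimes> x \<in> H"
    "inv x \<otimes> y \<in> H \<Longrightarrow> inv y \<otimes> z \<in> H \<Longrightarrow> inv x \<otimes> z \<in> H"
proof -
  show "inv y \<otimes> x \<in> H" if "inv x \<otimes> y \<in> H"
    using subgroup.m_inv_closed[OF H that] assms by (simp add: inv_mult_group)
  show "inv x \<otimes> z \<in> H" if "inv x \<otimes> y \<in> H" "inv y \<otimes> z \<in> H"
    using subgroup.m_closed[OF H that] assms
    by (metis (no_types) inv_closed inv_solve_left m_assoc m_closed)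
qed

lemma tv_ex:
  assumes K: "subgroup K G" and H: "subgroup H G"
  shows "\<exists>T. transversal T K H \<and> \<one> \<in> T"
proof -
  \<comment> \<open>All of H is represented by \<one>. Elsewhere the choice depends only on the
    coset, because the chosen predicate does (\<open>req\<close>).\<close>
  define r where "r g = (if g \<in> H then \<one> else SOME x. x \<in> K \<and> inv g \<otimes> x \<in> H)" for g
  have r: "r g \<in> K \<and> inv g \<otimes> r g \<in> H" if "g \<in> K" for g
  proof (cases "g \<in> H")
    case True
    then show ?thesis using K H that
      by (simp add: r_def subgroup.one_closed subgroup.m_inv_closed subgroup_in)
  next
    case False
    have "g \<in> K \<and> inv g \<otimes> g \<in> H" using that K H by (simp add: subgroup.one_closed subgroup_in)
    then show ?thesis using False by (auto simp: r_def intro: someI2)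
  qed
  have req: "r g = r g'" if "g \<in> K" "g' \<in> K" "inv g \<otimes> g' \<in> H" for g g'
  proof -
    have gG: "g \<in> carrier G" "g' \<in> carrier G" using that K subgroup_in by auto
    have "g \<in> H \<longleftrightarrow> g' \<in> H"
      using coset_rel(2)[OF H, of \<one> g g'] coset_rel(2)[OF H, of \<one> g' g] coset_rel(1)[OF H, of g g'] gG that(3)
      by fastforce
    moreover have "inv g \<otimes> x \<in> H \<longleftrightarrow> inv g' \<otimes> x \<in> H" if "x \<in> K" for x
      using coset_rel(2)[OF H, of g g' x] coset_rel(2)[OF H, of g' g x] coset_rel(1)[OF H, of g g']
        gG that \<open>inv g \<otimes> g' \<in> H\<close> subgroup_in[OF K] by blast
    ultimately have "(\<lambda>x. x \<in> K \<and> inv g \<otimes> x \<in> H) = (\<lambda>x. x \<in> K \<and> inv g' \<otimes> x \<in> H)" "g \<in> H \<longleftrightarrow> g' \<in> H"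
      by blast+
    then show ?thesis unfolding r_def by presburger
  qed
  have "transversal (r ` K) K H"
    unfolding transversal_def
  proof (intro conjI ballI)
    show "r ` K \<subseteq> K" using r by auto
    fix g assume g: "g \<in> K"
    show "\<exists>!t. t \<in> r ` K \<and> inv t \<otimes> g \<in> H"
    proof (rule ex1I[of _ "r g"])
      show "r g \<in> r ` K \<and> inv r g \<otimes> g \<in> H"
        using r[OF g] g coset_rel(1)[OF H, of g "r g"] subgroup_in[OF K] by blast
      fix t assume t: "t \<in> r ` K \<and> inv t \<otimes> g \<in> H"
      then obtain g' where g': "g' \<in> K" "t = r g'" by blast
      have "inv g' \<otimes> g \<in> H"
        using coset_rel(2)[OF H, of g' "r g'" g] r[OF g'(1)] t g' g subgroup_in[OF K] by auto
      then show "t = r g" using req g g' by blast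
    qed
  qed
  moreover have "\<one> \<in> r ` K"
    using H K by (auto simp: r_def subgroup.one_closed intro!: image_eqI[of _ _ \<one>])
  ultimately show ?thesis by blast
qed

lemma tv:
  assumes "subgroup K G" "subgroup H G"
  shows "transversal (tv K H) K H" "\<one> \<in> tv K H"
  using someI_ex[OF tv_ex[OF assms]] by (auto simp: tv_def)

lemma transversal_finite: "subgroup K G \<Longrightarrow> transversal T K H \<Longrightarrow> finite T"
  using fin_subgroup finite_subset by (auto simp: transversal_def)

text \<open>Each element of one transversal is matched with the element of the other that lies in
  the same left coset, where F has the same value.\<close>

lemma transversal_sum:
  assumes K: "subgroup K G" and H: "subgroup H G" "H \<subseteq> K" and T: "transversal T K H" and T': "transversal T' K H"
    and F: "\<And>g h. g \<in> K \<Longrightarrow> h \<in> H \<Longrightarrow> F (g \<otimes> h) = F g"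
  shows "sum F T = sum F T'"
proof (rule sum.reindex_bij_witness[of _ "\<lambda>t'. THE t. t \<in> T \<and> inv t \<otimes> t' \<in> H" "\<lambda>t. THE t'. t' \<in> T' \<and> inv t' \<otimes> t \<in> H"])
  have KG: "x \<in> carrier G" if "x \<in> K" for x using that K subgroup_in by auto
  have 1: "(THE t. t \<in> S \<and> inv t \<otimes> g \<in> H) \<in> S \<and> inv (THE t. t \<in> S \<and> inv t \<otimes> g \<in> H) \<otimes> g \<in> H"
    if "transversal S K H" "g \<in> K" for S g
    using that theI'[of "\<lambda>t. t \<in> S \<and> inv t \<otimes> g \<in> H"] by (auto simp: transversal_def)
  have 2: "(THE t. t \<in> S \<and> inv t \<otimes> g \<in> H) = s" if "transversal S K H" "g \<in> K" "s \<in> S" "inv s \<otimes> g \<in> H" for S g s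
    using that by (intro the1_equality) (auto simp: transversal_def)
  have sub: "T \<subseteq> K" "T' \<subseteq> K" using T T' by (auto simp: transversal_def)
  fix t assume t: "t \<in> T"
  have t': "(THE t'. t' \<in> T' \<and> inv t' \<otimes> t \<in> H) \<in> T'" "inv (THE t'. t' \<in> T' \<and> inv t' \<otimes> t \<in> H) \<otimes> t \<in> H"
    using 1[OF T'] t sub by auto
  then show "(THE t'. t' \<in> T' \<and> inv t' \<otimes> t \<in> H) \<in> T'" by simp
  show "(THE s. s \<in> T \<and> inv s \<otimes> (THE t'. t' \<in> T' \<and> inv t' \<otimes> t \<in> H) \<in> H) = t"
    using t t' sub KG coset_rel(1)[OF H(1), of _ t] by (intro 2[OF T]) blast+
  have "F t = F ((THE t'. t' \<in> T' \<and> inv t' \<otimes> t \<in> H) \<otimes> (inv (THE t'. t' \<in> T' \<and> inv t' \<otimes> t \<in> H) \<otimes> t))"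
    using t t' sub KG by (simp add: m_assoc[symmetric] subset_iff)
  also have "\<dots> = F (THE t'. t' \<in> T' \<and> inv t' \<otimes> t \<in> H)"
    using t' sub by (intro F) auto
  finally show "F (THE t'. t' \<in> T' \<and> inv t' \<otimes> t \<in> H) = F t" ..
next
  have KG: "x \<in> carrier G" if "x \<in> K" for x using that K subgroup_in by auto
  have 1: "(THE t. t \<in> S \<and> inv t \<otimes> g \<in> H) \<in> S \<and> inv (THE t. t \<in> S \<and> inv t \<otimes> g \<in> H) \<otimes> g \<in> H"
    if "transversal S K H" "g \<in> K" for S g
    using that theI'[of "\<lambda>t. t \<in> S \<and> inv t \<otimes> g \<in> H"] by (auto simp: transversal_def)
  have 2: "(THE t. t \<in> S \<and> inv t \<otimes> g \<in> H) = s" if "transversal S K H" "g \<in> K" "s \<in> S" "inv s \<otimes> g \<in> H" for S g s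
    using that by (intro the1_equality) (auto simp: transversal_def)
  have sub: "T \<subseteq> K" "T' \<subseteq> K" using T T' by (auto simp: transversal_def)
  fix t assume t: "t \<in> T'"
  have t': "(THE t'. t' \<in> T \<and> inv t' \<otimes> t \<in> H) \<in> T" "inv (THE t'. t' \<in> T \<and> inv t' \<otimes> t \<in> H) \<otimes> t \<in> H"
    using 1[OF T] t sub by auto
  then show "(THE t'. t' \<in> T \<and> inv t' \<otimes> t \<in> H) \<in> T" by simp
  show "(THE s. s \<in> T' \<and> inv s \<otimes> (THE t'. t' \<in> T \<and> inv t' \<otimes> t \<in> H) \<in> H) = t"
    using t t' sub KG coset_rel(1)[OF H(1), of _ t] by (intro 2[OF T']) blast+
qed

lemma transversal_shift:
  assumes K: "subgroup K G" and T: "transversal T K H" and m: "m \<in> K"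
  shows "transversal ((\<otimes>) m ` T) K H"
  unfolding transversal_def
proof (intro conjI ballI)
  have KG: "x \<in> carrier G" if "x \<in> K" for x using that K subgroup_in by auto
  have sub: "T \<subseteq> K" using T by (auto simp: transversal_def)
  show "(\<otimes>) m ` T \<subseteq> K" using sub m K by (auto intro: subgroup.m_closed)
  fix g assume g: "g \<in> K"
  have eq: "inv (m \<otimes> t) \<otimes> g = inv t \<otimes> (inv m \<otimes> g)" if "t \<in> T" for t
    using that sub m g KG by (simp add: inv_mult_group m_assoc subset_iff)
  have "inv m \<otimes> g \<in> K" using m g K by (simp add: subgroup.m_closed subgroup.m_inv_closed)
  then have "\<exists>!t. t \<in> T \<and> inv t \<otimes> (inv m \<otimes> g) \<in> H" using T by (simp add: transversal_def)
  then show "\<exists>!t. t \<in> (\<otimes>) m ` T \<and> inv t \<otimes> g \<in> H" using eq by (smt (verit) imageE image_eqI)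
qed

text \<open>Inversion turns left cosets into right cosets, and \<open>norm\<close> makes the two
  coincide.\<close>

lemma transversal_inv:
  assumes K: "subgroup K G" and T: "transversal T K H" and H: "subgroup H G"
    and norm: "\<And>k h. k \<in> K \<Longrightarrow> h \<in> H \<Longrightarrow> k \<otimes> h \<otimes> inv k \<in> H"
  shows "transversal (m_inv G ` T) K H"
  unfolding transversal_def
proof (intro conjI ballI)
  have KG: "x \<in> carrier G" if "x \<in> K" for x using that K subgroup_in by auto
  have sub: "T \<subseteq> K" using T by (auto simp: transversal_def)
  show "m_inv G ` T \<subseteq> K" using sub K by (auto intro: subgroup.m_inv_closed)
  fix g assume g: "g \<in> K"
  have eq: "inv (inv t) \<otimes> g \<in> H \<longleftrightarrow> inv t \<otimes> inv g \<in> H" if t: "t \<in> T" for t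
  proof -
    have tK: "t \<in> K" using t sub by auto
    have tg: "t \<in> carrier G" "g \<in> carrier G" using g tK KG by auto
    have "t \<otimes> g \<in> H \<Longrightarrow> inv g \<otimes> inv t \<in> H"
      using subgroup.m_inv_closed[OF H, of "t \<otimes> g"] tg by (simp add: inv_mult_group)
    moreover have "inv g \<otimes> inv t \<in> H \<Longrightarrow> t \<otimes> g \<in> H"
      using subgroup.m_inv_closed[OF H, of "inv g \<otimes> inv t"] tg by (simp add: inv_mult_group)
    moreover have "inv g \<otimes> inv t \<in> H \<Longrightarrow> inv t \<otimes> inv g \<in> H"
    proof -
      assume "inv g \<otimes> inv t \<in> H"
      then have "g \<otimes> (inv g \<otimes> inv t) \<otimes> inv g \<in> H" by (rule norm[OF g])
      moreover have "g \<otimes> (inv g \<otimes> inv t) = inv t" using tg by (simp add: m_assoc[symmetric])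
      ultimately show "inv t \<otimes> inv g \<in> H" by simp
    qed
    moreover have "inv t \<otimes> inv g \<in> H \<Longrightarrow> inv g \<otimes> inv t \<in> H"
    proof -
      assume "inv t \<otimes> inv g \<in> H"
      then have "t \<otimes> (inv t \<otimes> inv g) \<otimes> inv t \<in> H" by (rule norm[OF tK])
      moreover have "t \<otimes> (inv t \<otimes> inv g) = inv g" using tg by (simp add: m_assoc[symmetric])
      ultimately show "inv g \<otimes> inv t \<in> H" by simp
    qed
    ultimately have "t \<otimes> g \<in> H \<longleftrightarrow> inv t \<otimes> inv g \<in> H" by blast
    then show ?thesis using tg by simp
  qed
  have "inv g \<in> K" using g K by (simp add: subgroup.m_inv_closed)
  then have "\<exists>!t. t \<in> T \<and> inv t \<otimes> inv g \<in> H" using T by (simp add: transversal_def)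
  then show "\<exists>!t. t \<in> m_inv G ` T \<and> inv t \<otimes> g \<in> H" using eq by (smt (verit) imageE image_eqI)
qed

text \<open>The bijection between M/(M \<inter> H) and MH/H; the hypothesis \<open>prod\<close> says
  that K = MH.\<close>

lemma transversal_second_iso:
  assumes "transversal T M (M \<inter> H)" "M \<subseteq> K" "subgroup H G" "subgroup M G" "subgroup K G"
    and prod: "\<And>k. k \<in> K \<Longrightarrow> \<exists>m\<in>M. inv m \<otimes> k \<in> H"
  shows "transversal T K H"
  unfolding transversal_def
proof (intro conjI ballI)
  have sub: "T \<subseteq> M" using assms(1) by (auto simp: transversal_def)
  then show "T \<subseteq> K" using assms(2) by auto
  fix g assume g: "g \<in> K"
  then obtain m where m: "m \<in> M" "inv m \<otimes> g \<in> H" using prod by blast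
  have G: "g \<in> carrier G" "m \<in> carrier G" using g m assms subgroup_in by blast+
  have "inv t \<otimes> g \<in> H \<longleftrightarrow> inv t \<otimes> m \<in> M \<inter> H" if t: "t \<in> T" for t
  proof -
    have tM: "t \<in> M" using sub t by auto
    then have "t \<in> carrier G" using assms subgroup_in by blast
    then have "inv t \<otimes> g \<in> H \<longleftrightarrow> inv t \<otimes> m \<in> H"
      using coset_rel(2)[OF assms(3), of t m g] coset_rel(2)[OF assms(3), of t g m]
        coset_rel(1)[OF assms(3), of m g] G m by blast
    then show ?thesis using tM m assms(4) by (auto simp: subgroup.m_closed subgroup.m_inv_closed)
  qed
  moreover have "\<exists>!t. t \<in> T \<and> inv t \<otimes> m \<in> M \<inter> H" using assms(1) m by (auto simp: transversal_def)
  ultimately show "\<exists>!t. t \<in> T \<and> inv t \<otimes> g \<in> H" by auto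
qed

lemma transversal_tower:
  assumes K: "subgroup K G" and M: "subgroup M G" "M \<subseteq> K" and H: "subgroup H G" "H \<subseteq> M"
    and S: "transversal S K M" and T: "transversal T M H"
  shows "transversal ((\<lambda>(s, t). s \<otimes> t) ` (S \<times> T)) K H" "inj_on (\<lambda>(s, t). s \<otimes> t) (S \<times> T)"
proof -
  have KG: "x \<in> carrier G" if "x \<in> K" for x using that K subgroup_in by auto
  have SK: "s \<in> K" "s \<in> carrier G" if "s \<in> S" for s using S KG that by (auto simp: transversal_def)
  have TM: "t \<in> M" "t \<in> K" "t \<in> carrier G" if "t \<in> T" for t using T KG that M by (auto simp: transversal_def)
  have uniq: "s = s'" if "s \<in> S" "s' \<in> S" "inv s \<otimes> g \<in> M" "inv s' \<otimes> g \<in> M" "g \<in> K" for s s' g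
    using S that by (auto simp: transversal_def)
  have uniq': "t = t'" if "t \<in> T" "t' \<in> T" "inv t \<otimes> g \<in> H" "inv t' \<otimes> g \<in> H" "g \<in> M" for t t' g
    using T that by (auto simp: transversal_def)
  have *: "s = s' \<and> t = t'" if st: "s \<in> S" "s' \<in> S" "t \<in> T" "t' \<in> T" "inv (s \<otimes> t) \<otimes> g \<in> H" "inv (s' \<otimes> t') \<otimes> g \<in> H" "g \<in> K"
    for s s' t t' g
  proof -
    have g: "g \<in> carrier G" using KG that by auto
    have a: "inv t \<otimes> (inv s \<otimes> g) \<in> H" "inv t' \<otimes> (inv s' \<otimes> g) \<in> H"
      using st SK TM g by (simp_all add: inv_mult_group m_assoc)
    have M1: "inv s \<otimes> g \<in> M" if "t \<in> T" "s \<in> S" "inv t \<otimes> (inv s \<otimes> g) \<in> H" for t s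
    proof -
      have "t \<otimes> (inv t \<otimes> (inv s \<otimes> g)) \<in> M" using that TM H M by (auto intro: subgroup.m_closed)
      then show ?thesis using that TM SK g by (simp add: m_assoc[symmetric])
    qed
    have "s = s'" using uniq st M1 a by blast
    moreover have "t = t'" using uniq' st M1 a \<open>s = s'\<close> by blast
    ultimately show ?thesis by simp
  qed
  show "inj_on (\<lambda>(s, t). s \<otimes> t) (S \<times> T)"
  proof (rule inj_onI, clarify)
    fix s t s' t' assume st: "s \<in> S" "t \<in> T" "s' \<in> S" "t' \<in> T" "s \<otimes> t = s' \<otimes> t'"
    then show "s = s' \<and> t = t'"
      using *[of s s' t t' "s \<otimes> t"] SK TM K H by (simp add: subgroup.m_closed subgroup.one_closed)
  qed
  show "transversal ((\<lambda>(s, t). s \<otimes> t) ` (S \<times> T)) K H"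
    unfolding transversal_def
  proof (intro conjI ballI)
    show "(\<lambda>(s, t). s \<otimes> t) ` (S \<times> T) \<subseteq> K" using SK TM K by (auto intro: subgroup.m_closed)
    fix g assume g: "g \<in> K"
    then obtain s where s: "s \<in> S" "inv s \<otimes> g \<in> M" using S by (auto simp: transversal_def)
    then obtain t where t: "t \<in> T" "inv t \<otimes> (inv s \<otimes> g) \<in> H" using T by (auto simp: transversal_def)
    have st: "inv (s \<otimes> t) \<otimes> g \<in> H" using s t SK TM KG g by (simp add: inv_mult_group m_assoc)
    show "\<exists>!t. t \<in> (\<lambda>(s, t). s \<otimes> t) ` (S \<times> T) \<and> inv t \<otimes> g \<in> H"
    proof (rule ex1I[of _ "s \<otimes> t"])
      show "s \<otimes> t \<in> (\<lambda>(s, t). s \<otimes> t) ` (S \<times> T) \<and> inv (s \<otimes> t) \<otimes> g \<in> H" using s t st by auto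
      fix x assume x: "x \<in> (\<lambda>(s, t). s \<otimes> t) ` (S \<times> T) \<and> inv x \<otimes> g \<in> H"
      then obtain s' t' where "s' \<in> S" "t' \<in> T" "x = s' \<otimes> t'" by auto
      then show "x = s \<otimes> t" using *[of s' s t' t g] s(1) t(1) st g x by simp
    qed
  qed
qed

lemma sum_tower:
  assumes K: "subgroup K G" and M: "subgroup M G" "M \<subseteq> K" and H: "subgroup H G" "H \<subseteq> M"
    and S: "transversal S K M" and T: "transversal T M H" and R: "transversal R K H"
    and F: "\<And>g h. g \<in> K \<Longrightarrow> h \<in> H \<Longrightarrow> F (g \<otimes> h) = F g"
  shows "sum F R = (\<Sum>s\<in>S. \<Sum>t\<in>T. F (s \<otimes> t))"
proof -
  have "sum F R = sum F ((\<lambda>(s, t). s \<otimes> t) ` (S \<times> T))"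
    using transversal_sum[OF K H(1) _ R transversal_tower(1)[OF assms(1-7)] F] H M by auto
  also have "\<dots> = (\<Sum>(s, t)\<in>S \<times> T. F (s \<otimes> t))"
    using sum.reindex[OF transversal_tower(2)[OF assms(1-7)], of F] by (simp add: case_prod_unfold)
  finally show ?thesis by (simp add: sum.cartesian_product)
qed

text \<open>Multiplication by m permutes the left cosets of H in K. This is what makes averages over
  a transversal invariant under K.\<close>

lemma sum_shift:
  assumes K: "subgroup K G" and H: "subgroup H G" "H \<subseteq> K" and T: "transversal T K H" and m: "m \<in> K"
    and F: "\<And>g h. g \<in> K \<Longrightarrow> h \<in> H \<Longrightarrow> F (g \<otimes> h) = F g"
  shows "(\<Sum>t\<in>T. F (m \<otimes> t)) = sum F T"
proof -
  have "inj_on ((\<otimes>) m) T"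
    using T m subgroup_in[OF K] by (auto simp: inj_on_def transversal_def subset_iff)
  then have "(\<Sum>t\<in>T. F (m \<otimes> t)) = sum F ((\<otimes>) m ` T)" by (simp add: sum.reindex)
  also have "\<dots> = sum F T"
    using transversal_sum[OF K H transversal_shift[OF K T m] T F] .
  finally show ?thesis .
qed

lemma sum_inv:
  assumes K: "subgroup K G" and T: "transversal T K H" and H: "subgroup H G" "H \<subseteq> K"
    and norm: "\<And>k h. k \<in> K \<Longrightarrow> h \<in> H \<Longrightarrow> k \<otimes> h \<otimes> inv k \<in> H"
    and F: "\<And>g h. g \<in> K \<Longrightarrow> h \<in> H \<Longrightarrow> F (g \<otimes> h) = F g"
  shows "(\<Sum>t\<in>T. F (inv t)) = sum F T"
proof -
  have "inj_on (m_inv G) T"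
    using T subgroup_in[OF K] by (auto simp: inj_on_def transversal_def subset_iff)
  then have "(\<Sum>t\<in>T. F (inv t)) = sum F (m_inv G ` T)" by (simp add: sum.reindex)
  also have "\<dots> = sum F T"
  proof (rule transversal_sum[OF K H _ T])
    show "transversal (m_inv G ` T) K H" using transversal_inv[OF K T H(1)] norm by blast
  qed (use F in blast)
  finally show ?thesis .
qed

lemma lin_fixed_closed:
  assumes "fv.subspace S"
  shows "fv.subspace {a \<in> S. \<forall>h\<in>H. cj h a = a}"
  using assms unfolding fv.subspace_def by (auto simp: cj_lin_simps)

end

section \<open>Unipotent actions\<close>

text \<open>The space of all functions on the type may have infinite dimension, so the comparison
  takes place inside the finite span of the \<open>dl g\<close> with g in H.\<close>

lemma subspace_dim_less:
  fixes U V :: "('g \<Rightarrow> 'k::field) set"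
  assumes "finite H" "fv.subspace U" "U \<subset> V" "V \<subseteq> supp_in H"
  shows "fv.dim U < fv.dim V" "fv.dim V \<le> card H"
proof -
  have sp: "supp_in H \<subseteq> fv.span (dl ` H :: ('g \<Rightarrow> 'k) set)"
  proof
    fix a :: "'g \<Rightarrow> 'k" assume "a \<in> supp_in H"
    then have "a = (\<Sum>g\<in>H. smul (a g) (dl g))" by (rule expand_dl[OF assms(1)])
    also have "\<dots> \<in> fv.span (dl ` H)"
      by (intro fv.span_sum fv.span_scale fv.span_base) auto
    finally show "a \<in> fv.span (dl ` H)" .
  qed
  have V: "V \<subseteq> fv.span (dl ` H)" using assms sp by auto
  have "card (dl ` H :: ('g \<Rightarrow> 'k) set) \<le> card H" using assms(1) by (rule card_image_le)
  then show "fv.dim V \<le> card H"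
    using fv.dim_le_card[OF V] assms(1) by simp
  obtain B where B: "B \<subseteq> U" "fv.independent B" "U \<subseteq> fv.span B" "card B = fv.dim U"
    by (rule fv.basis_exists)
  have fin: "finite B"
    using fv.independent_span_bound[of "dl ` H" B] B V assms by auto
  obtain v where v: "v \<in> V" "v \<notin> U" using assms by auto
  have "v \<notin> fv.span B" using v B assms(2) by (metis fv.span_minimal subsetD)
  then have ind: "fv.independent (insert v B)" using B(2) by (rule fv.independent_insertI)
  obtain C where C: "C \<subseteq> V" "fv.independent C" "V \<subseteq> fv.span C" "card C = fv.dim V"
    by (rule fv.basis_exists)
  have "finite C"
    using fv.independent_span_bound[of "dl ` H" C] C V assms by auto
  then have "card (insert v B) \<le> card C"
    using fv.independent_span_bound[of C "insert v B"] ind C(3) v B(1) assms(3) by auto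
  moreover have "v \<notin> B" using v B by auto
  ultimately show "fv.dim U < fv.dim V" using B(4) C(4) fin by simp
qed

lemma minimal_subspace:
  fixes \<S> :: "('g \<Rightarrow> 'k::field) set set"
  assumes "finite H" "\<And>U. U \<in> \<S> \<Longrightarrow> fv.subspace U \<and> U \<subseteq> supp_in H" "\<S> \<noteq> {}"
  shows "\<exists>U\<in>\<S>. \<forall>V\<in>\<S>. V \<subseteq> U \<longrightarrow> V = U"
proof -
  obtain U where U: "U \<in> \<S>" "\<And>V. V \<in> \<S> \<Longrightarrow> fv.dim U \<le> fv.dim V"
    using ex_has_least_nat[of "\<lambda>U. U \<in> \<S>" _ fv.dim] assms(3) by blast
  have "V = U" if V: "V \<in> \<S>" "V \<subseteq> U" for V
  proof (rule ccontr)
    assume "V \<noteq> U"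
    then have "V \<subset> U" using V by blast
    then have "fv.dim V < fv.dim U"
      using subspace_dim_less(1)[OF assms(1), of V U] assms(2)[OF V(1)] assms(2)[OF U(1)] by blast
    then show False using U(2)[OF V(1)] by simp
  qed
  then show ?thesis using U by blast
qed

lemma maximal_subspace:
  fixes \<S> :: "('g \<Rightarrow> 'k::field) set set"
  assumes "finite H" "\<And>U. U \<in> \<S> \<Longrightarrow> fv.subspace U \<and> U \<subseteq> supp_in H" "\<S> \<noteq> {}"
  shows "\<exists>U\<in>\<S>. \<forall>V\<in>\<S>. U \<subseteq> V \<longrightarrow> V = U"
proof -
  \<comment> \<open>The bound in \<open>subspace_dim_less\<close> concerns a space with a proper
    subspace below it: a proper U lies below \<open>supp_in H\<close>, and \<open>supp_in H\<close>
    itself lies above {0} unless it equals {0}.\<close>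
  have bound: "fv.dim U \<le> card H" if "U \<in> \<S>" for U
  proof -
    have "fv.dim U \<le> card H \<or> U = supp_in H"
      using subspace_dim_less[OF assms(1), of U "supp_in H"] assms(2)[OF that] by fastforce
    moreover have "fv.dim U \<le> card H" if "U = supp_in H"
    proof (cases "U = {0}")
      case True
      then show ?thesis using fv.dim_le_card[of U "{}"] by simp
    next
      case False
      then have "{0} \<subset> U" using that supp_in_closed(1) by auto
      then show ?thesis using subspace_dim_less(2)[OF assms(1), of "{0}" U] that by (simp add: fv.subspace_single_0)
    qed
    ultimately show ?thesis by blast
  qed
  obtain U where U: "U \<in> \<S>" "\<And>V. V \<in> \<S> \<Longrightarrow> fv.dim V \<le> fv.dim U"
    using ex_has_greatest_nat[of "\<lambda>U. U \<in> \<S>" _ fv.dim "Suc (card H)"] assms(3) bound by (metis all_not_in_conv less_Suc_eq_le)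
  have "V = U" if V: "V \<in> \<S>" "U \<subseteq> V" for V
  proof (rule ccontr)
    assume "V \<noteq> U"
    then have "U \<subset> V" using V by blast
    then have "fv.dim U < fv.dim V"
      using subspace_dim_less(1)[OF assms(1), of U V] assms(2)[OF V(1)] assms(2)[OF U(1)] by blast
    then show False using U(2)[OF V(1)] by simp
  qed
  then show ?thesis using U by blast
qed

lemma subspace_projection:
  fixes V :: "('g \<Rightarrow> 'k::field) set"
  assumes "fv.subspace V"
  obtains F where "lin F" "\<And>x. F x \<in> V" "\<And>v. v \<in> V \<Longrightarrow> F v = v"
proof -
  interpret vp: vector_space_pair "smul :: 'k \<Rightarrow> ('g \<Rightarrow> 'k) \<Rightarrow> 'g \<Rightarrow> 'k" "smul :: 'k \<Rightarrow> ('g \<Rightarrow> 'k) \<Rightarrow> 'g \<Rightarrow> 'k"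
    by unfold_locales
  obtain F where "F ` UNIV \<subseteq> V" "lin F" "\<forall>v\<in>V. F v = v"
    using vp.linear_exists_left_inverse_on[OF lin_id assms] by auto
  then show thesis using that by blast
qed

lemma lin_funpow:
  fixes F :: "('g \<Rightarrow> 'k::field) \<Rightarrow> 'g \<Rightarrow> 'k"
  assumes "lin F"
  shows "lin (F ^^ i)"
proof (induction i)
  case 0
  have "F ^^ 0 = (\<lambda>x. x)" by auto
  then show ?case by (simp only: lin_id)
next
  case (Suc i)
  have "F ^^ Suc i = (\<lambda>x. F ((F ^^ i) x))" by auto
  then show ?case using lin_comp[OF assms Suc] by (simp only:)
qed

lemma binomial_operator:
  fixes T :: "('g \<Rightarrow> 'k::field) \<Rightarrow> 'g \<Rightarrow> 'k"
  assumes "lin A" and T: "\<And>x. T x = x + A x"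
  shows "(T ^^ n) v = (\<Sum>i\<le>n. smul (of_nat (n choose i)) ((A ^^ i) v))"
proof (induction n arbitrary: v)
  case 0
  then show ?case by simp
next
  case (Suc n)
  have "(T ^^ Suc n) v = (T ^^ n) (T v)" by (simp add: funpow_swap1)
  also have "\<dots> = (\<Sum>i\<le>n. smul (of_nat (n choose i)) ((A ^^ i) (v + A v)))"
    unfolding Suc T by simp
  also have "\<dots> = (\<Sum>i\<le>n. smul (of_nat (n choose i)) ((A ^^ i) v) + smul (of_nat (n choose i)) ((A ^^ Suc i) v))"
    by (simp only: lin_add[OF lin_funpow[OF assms(1)]] smul_add funpow_Suc_right comp_apply)
  also have "\<dots> = (\<Sum>i\<le>n. smul (of_nat (n choose i)) ((A ^^ i) v)) + (\<Sum>i\<le>n. smul (of_nat (n choose i)) ((A ^^ Suc i) v))"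
    by (rule sum.distrib)
  also have "(\<Sum>i\<le>n. smul (of_nat (n choose i)) ((A ^^ i) v)) = v + (\<Sum>i\<le>n. smul (of_nat (n choose Suc i)) ((A ^^ Suc i) v))"
  proof -
    have "(\<Sum>i\<le>Suc n. smul (of_nat (n choose i)) ((A ^^ i) v)) = v + (\<Sum>i\<le>n. smul (of_nat (n choose Suc i)) ((A ^^ Suc i) v))"
      by (subst sum.atMost_Suc_shift) simp
    then show ?thesis by (simp add: binomial_eq_0)
  qed
  finally have "(T ^^ Suc n) v = v + (\<Sum>i\<le>n. smul (of_nat (Suc n choose Suc i)) ((A ^^ Suc i) v))"
    by (simp only: binomial_Suc_Suc of_nat_add smul_add sum.distrib add_ac)
  also have "\<dots> = (\<Sum>i\<le>Suc n. smul (of_nat (Suc n choose i)) ((A ^^ i) v))"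
    by (subst sum.atMost_Suc_shift) simp
  finally show ?case .
qed

text \<open>The binomial coefficients strictly between 0 and p vanish in k, and the exponent p^n is
  reached by iterating the case of p.\<close>

lemma freshman_operator:
  fixes T :: "('g \<Rightarrow> 'k::field) \<Rightarrow> 'g \<Rightarrow> 'k"
  assumes "lin A" "prime p" "CHAR('k) = p" and T: "\<And>x. T x = x + A x"
  shows "(T ^^ (p ^ n)) v = v + (A ^^ (p ^ n)) v"
proof -
  have p: "(S ^^ p) v = v + (B ^^ p) v" if "lin B" "\<And>x. S x = x + B x" for S B :: "('g \<Rightarrow> 'k) \<Rightarrow> 'g \<Rightarrow> 'k" and v
  proof -
    let ?f = "\<lambda>i. smul (of_nat (p choose i)) ((B ^^ i) v)"
    have "?f i = 0" if "i \<in> {..p} - {0, p}" for i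
    proof -
      have "p dvd (p choose i)" using that assms(2) by (intro dvd_choose_prime) auto
      then show ?thesis using assms(3) by (simp add: of_nat_eq_0_iff_char_dvd)
    qed
    then have "(S ^^ p) v = (\<Sum>i\<in>{0, p}. ?f i)"
      unfolding binomial_operator[OF that] by (intro sum.mono_neutral_right) auto
    then show ?thesis using prime_gt_0_nat[OF assms(2)] by simp
  qed
  show ?thesis
  proof (induction n arbitrary: v)
    case (Suc n)
    have "((T ^^ (p ^ n)) ^^ p) v = v + ((A ^^ (p ^ n)) ^^ p) v"
      by (rule p[OF lin_funpow[OF assms(1)] Suc])
    then show ?case by (simp add: funpow_mult mult.commute)
  qed (simp add: T)
qed

section \<open>Groups of p-power order acting in characteristic p\<close>

locale modular_group = finite_group G for G :: "('g, 'm) monoid_scheme" (structure) +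
  fixes scalars :: "'k::field itself" and p :: nat
  assumes prime_p: "prime p" and char_p: "CHAR('k) = p"
begin

lemma card_p_dvd: "card A = p ^ n \<Longrightarrow> card A \<noteq> 1 \<Longrightarrow> of_nat (card A) = (0 :: 'k)"
  using char_p by (cases n) (auto simp: of_nat_eq_0_iff_char_dvd)

lemma subgroup_group: "subgroup D G \<Longrightarrow> group (G\<lparr>carrier := D\<rparr>)"
  using subgroup_imp_group by blast

lemma card_subgroup_p_power:
  assumes D: "subgroup D G" "card D = p ^ n" and Q: "subgroup Q G" "Q \<subseteq> D"
  shows "\<exists>i. card Q = p ^ i"
proof -
  interpret D: group "G\<lparr>carrier := D\<rparr>" by (rule subgroup_group[OF D(1)])
  have "subgroup Q (G\<lparr>carrier := D\<rparr>)" using D(1) Q by (simp add: subgroup_incl)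
  from D.lagrange[OF this] have "card Q dvd order (G\<lparr>carrier := D\<rparr>)" by (metis dvd_triv_right)
  then have "card Q dvd p ^ n" using D(2) by (simp add: order_def)
  then show ?thesis using prime_p divides_primepow_nat by blast
qed

text \<open>Let Q act by left multiplication on its left cosets in D. Their number is divisible by
  p, so the number of fixed cosets is as well; a coset gQ is fixed exactly when g normalises Q. The
  coset Q is fixed, hence so is another one.\<close>

lemma normalizer_grows:
  assumes D: "subgroup D G" "card D = p ^ n" and Q: "subgroup Q G" "Q \<subset> D"
  shows "\<exists>g\<in>D - Q. \<forall>q\<in>Q. inv g \<otimes> q \<otimes> g \<in> Q"
proof (rule ccontr)
  assume neg: "\<not> ?thesis"
  have DG: "x \<in> carrier G" if "x \<in> D" for x using that D subgroup_in by auto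
  have QD: "x \<in> D" if "x \<in> Q" for x using that Q by auto
  have finD: "finite D" "finite Q" using D Q fin_subgroup by auto
  define c where "c g = (\<otimes>) g ` Q" for g
  have c_iff: "h \<in> c g \<longleftrightarrow> inv g \<otimes> h \<in> Q" if "g \<in> D" "h \<in> D" for g h
  proof -
    have "h = g \<otimes> (inv g \<otimes> h)" using that DG by (simp add: m_assoc[symmetric])
    moreover have "inv g \<otimes> (g \<otimes> q) = q" if "q \<in> Q" for q
      using that QD DG \<open>g \<in> D\<close> by (simp add: m_assoc[symmetric])
    ultimately show ?thesis by (auto simp: c_def)
  qed
  have c_sub: "c g \<subseteq> D" if "g \<in> D" for g using that D QD by (auto simp: c_def subgroup.m_closed)
  have c_eq: "c g = c h \<longleftrightarrow> h \<in> c g" if "g \<in> D" "h \<in> D" for g h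
  proof
    assume "c g = c h"
    then show "h \<in> c g" using c_iff[of h h] that DG Q by (simp add: subgroup.one_closed)
  next
    assume "h \<in> c g"
    then have 1: "inv g \<otimes> h \<in> Q" using c_iff that by blast
    then have "x \<in> c g \<longleftrightarrow> x \<in> c h" if "x \<in> D" for x
      using coset_rel(2)[OF Q(1), of g h x] coset_rel(2)[OF Q(1), of h g x] coset_rel(1)[OF Q(1), of g h]
        c_iff[of g x] c_iff[of h x] \<open>g \<in> D\<close> \<open>h \<in> D\<close> that DG by blast
    then show "c g = c h" using c_sub that by blast
  qed
  have "card D = (\<Sum>Y\<in>c ` D. card {g \<in> D. c g = Y})"
    using sum.group[of D "c ` D" c "\<lambda>_. 1 :: nat"] finD by simp
  also have "\<dots> = (\<Sum>Y\<in>c ` D. card Q)"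
  proof (rule sum.cong[OF refl])
    fix Y assume "Y \<in> c ` D"
    then obtain g where g: "g \<in> D" "Y = c g" by blast
    have "{h \<in> D. c h = Y} = c g" using g c_eq[of g] c_sub[of g] by blast
    moreover have "card (c g) = card Q"
      unfolding c_def using g DG QD by (intro card_image) (auto simp: inj_on_def)
    ultimately show "card {g \<in> D. c g = Y} = card Q" by simp
  qed
  finally have card: "card D = card (c ` D) * card Q" by simp
  have "card (c ` D) dvd p ^ n" using card D(2) by (metis dvd_triv_left)
  then obtain i where i: "card (c ` D) = p ^ i" using prime_p divides_primepow_nat by blast
  have "card Q < card D" using Q(2) finD by (simp add: psubset_card_mono)
  then have "card (c ` D) \<noteq> 1" using card by auto
  then have zero: "of_nat (card (c ` D)) = (0 :: 'k)" using card_p_dvd i by blast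
  obtain j where j: "card Q = p ^ j" using card_subgroup_p_power[OF D Q(1)] Q(2) by blast
  have act_c: "(\<otimes>) q ` c g = c (q \<otimes> g)" if "q \<in> Q" "g \<in> D" for q g
    using that DG QD by (force simp: c_def image_image m_assoc)
  define F where "F = {Y \<in> c ` D. \<forall>q\<in>Q. (\<otimes>) q ` Y = Y}"
  have "(\<Sum>Y\<in>c ` D. 1 :: 'k) = (\<Sum>Y\<in>{Y \<in> c ` D. \<forall>q\<in>carrier (G\<lparr>carrier := Q\<rparr>). (\<otimes>) q ` Y = Y}. 1)"
  proof (rule sum_fixed_points[OF subgroup_group[OF Q(1)] prime_p char_p])
    show "card (carrier (G\<lparr>carrier := Q\<rparr>)) = p ^ j" using j by simp
    show "finite (c ` D)" using finD by simp
    show "(\<otimes>) g ` x \<in> c ` D" if "g \<in> carrier (G\<lparr>carrier := Q\<rparr>)" "x \<in> c ` D" for g x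
      using that act_c QD D(1) by (auto simp: subgroup.m_closed)
    show "(\<otimes>) \<one>\<^bsub>G\<lparr>carrier := Q\<rparr>\<^esub> ` x = x" if "x \<in> c ` D" for x
      using that c_sub DG by (force simp: image_iff subset_iff)
    show "(\<otimes>) (g \<otimes>\<^bsub>G\<lparr>carrier := Q\<rparr>\<^esub> h) ` x = (\<otimes>) g ` ((\<otimes>) h ` x)"
      if "g \<in> carrier (G\<lparr>carrier := Q\<rparr>)" "h \<in> carrier (G\<lparr>carrier := Q\<rparr>)" "x \<in> c ` D" for g h x
    proof -
      obtain x' where x': "x' \<in> D" "x = c x'" using \<open>x \<in> c ` D\<close> by blast
      have "g \<in> Q" "h \<in> Q" "g \<in> D" "h \<in> D" "h \<otimes> x' \<in> D" "g \<otimes> h \<in> Q"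
        using that QD x' D(1) Q(1) by (simp_all add: subgroup.m_closed)
      then show ?thesis using x' act_c DG by (simp add: m_assoc)
    qed
  qed auto
  then have F0: "of_nat (card F) = (0 :: 'k)" using zero by (simp add: F_def)
  \<comment> \<open>If no such g exists, Q is the only fixed coset, and counting gives 1 = 0 in
    k.\<close>
  have "F \<subseteq> {c \<one>}"
  proof
    fix Y assume Y: "Y \<in> F"
    then obtain g where g: "g \<in> D" "Y = c g" by (auto simp: F_def)
    have "inv g \<otimes> q \<otimes> g \<in> Q" if q: "q \<in> Q" for q
    proof -
      have "c (q \<otimes> g) = c g" using act_c[OF q g(1)] Y g q by (auto simp: F_def)
      then have "q \<otimes> g \<in> c g" using c_eq[of g "q \<otimes> g"] g q QD D(1) by (auto simp: subgroup.m_closed)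
      then show ?thesis using c_iff[of g "q \<otimes> g"] g q QD D(1) DG by (simp add: subgroup.m_closed m_assoc)
    qed
    then have "g \<in> Q" using neg g by blast
    then have "c \<one> = c g" using c_eq[of \<one> g] c_iff[of \<one> g] g D(1) DG by (simp add: subgroup.one_closed)
    then show "Y \<in> {c \<one>}" using g by simp
  qed
  moreover have "c \<one> \<in> F"
  proof -
    have "c (q \<otimes> \<one>) = c \<one>" if "q \<in> Q" for q
      using c_eq[of \<one> "q \<otimes> \<one>"] c_iff[of \<one> "q \<otimes> \<one>"] that QD DG D(1) by (auto simp: subgroup.one_closed)
    then show ?thesis using act_c[of _ \<one>] D(1) by (auto simp: F_def subgroup.one_closed)
  qed
  ultimately have "F = {c \<one>}" by blast
  then show False using F0 by simp
qed

text \<open>Take v in V - U whose stabiliser Q modulo U is largest. If Q is smaller than D, some g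
  in D - Q normalises Q, so g acts on the vectors that Q fixes modulo U, and a power of g - 1 kills
  v. The last iterate of g - 1 on v that is outside U is fixed modulo U by Q and by g, which is
  impossible. The result is a fixed vector in (V + U)/U, phrased without the quotient.\<close>

lemma unipotent_action:
  fixes U V :: "('g \<Rightarrow> 'k) set"
  assumes D: "subgroup D G" "card D = p ^ n" and U: "fv.subspace U" and V: "fv.subspace V" "V \<subseteq> supp_in (carrier G)"
    and stV: "\<And>g v. g \<in> D \<Longrightarrow> v \<in> V \<Longrightarrow> dl g \<star> v \<in> V" and stU: "\<And>g v. g \<in> D \<Longrightarrow> v \<in> U \<Longrightarrow> dl g \<star> v \<in> U"
    and VU: "\<not> V \<subseteq> U"
  shows "\<exists>v\<in>V - U. \<forall>g\<in>D. dl g \<star> v - v \<in> U"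
proof -
  have DG: "x \<in> carrier G" if "x \<in> D" for x using that D subgroup_in by auto
  have finD: "finite D" using D fin_subgroup by auto
  define st where "st v = {g \<in> D. dl g \<star> v - v \<in> U}" for v
  obtain u where u: "u \<in> V - U" using VU by blast
  have "\<exists>v. v \<in> V - U \<and> (\<forall>w. w \<in> V - U \<longrightarrow> card (st w) \<le> card (st v))"
  proof (rule ex_has_greatest_nat)
    show "u \<in> V - U" by (rule u)
    have "card (st y) \<le> card D" for y by (rule card_mono[OF finD]) (auto simp: st_def)
    then show "\<forall>y. y \<in> V - U \<longrightarrow> card (st y) < Suc (card D)" by (simp add: less_Suc_eq_le)
  qed
  then obtain v where v: "v \<in> V - U" and vmax: "\<And>w. w \<in> V - U \<Longrightarrow> card (st w) \<le> card (st v)" by blast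
  define Q where "Q = st v"
  have "subgroup Q G"
  proof (rule subgroupI)
    show "Q \<subseteq> carrier G" using DG by (auto simp: Q_def st_def)
    have "\<one> \<in> Q" using D(1) v V U by (auto simp: Q_def st_def subgroup.one_closed dl_one subspace_closed)
    then show "Q \<noteq> {}" by auto
    fix a assume "a \<in> Q"
    then have a: "a \<in> D" "dl a \<star> v - v \<in> U" by (auto simp: Q_def st_def)
    have ia: "inv a \<in> D" using a D(1) by (simp add: subgroup.m_inv_closed)
    have "dl (inv a) \<star> (dl a \<star> v - v) \<in> U" using stU a(2) ia by blast
    then have "v - dl (inv a) \<star> v \<in> U"
      using a(1) DG v V by (auto simp: star_diff dl_mult_star dl_one subset_iff)
    then have "- (v - dl (inv a) \<star> v) \<in> U" using U by (simp only: subspace_closed)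
    then show "inv a \<in> Q" using ia by (simp add: Q_def st_def)
    fix b assume "b \<in> Q"
    then have b: "b \<in> D" "dl b \<star> v - v \<in> U" by (auto simp: Q_def st_def)
    have "dl a \<star> (dl b \<star> v - v) + (dl a \<star> v - v) \<in> U"
      by (rule subspace_closed(2)[OF U stU[OF a(1) b(2)] a(2)])
    then have "dl (a \<otimes> b) \<star> v - v \<in> U"
      using a b DG by (simp add: star_diff dl_mult_star)
    then show "a \<otimes> b \<in> Q" using a b D(1) by (simp add: Q_def st_def subgroup.m_closed)
  qed
  have "Q = D"
  proof (rule ccontr)
    assume "Q \<noteq> D"
    then have "Q \<subset> D" by (auto simp: Q_def st_def)
    from normalizer_grows[OF D \<open>subgroup Q G\<close> this]
    obtain g where g: "g \<in> D" "g \<notin> Q" "\<And>q. q \<in> Q \<Longrightarrow> inv g \<otimes> q \<otimes> g \<in> Q" by blast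
    have gG: "g \<in> carrier G" using g DG by auto
    define W where "W = {w \<in> V. \<forall>q\<in>Q. dl q \<star> w - w \<in> U}"
    define T :: "('g \<Rightarrow> 'k) \<Rightarrow> 'g \<Rightarrow> 'k" where "T = (\<star>) (dl g)"
    define A :: "('g \<Rightarrow> 'k) \<Rightarrow> 'g \<Rightarrow> 'k" where "A = (\<lambda>x. T x - x)"
    have lA: "lin A" unfolding A_def T_def by (intro lin_intros)
    have TA: "T x = x + A x" for x by (simp only: A_def) simp
    have QD: "q \<in> D" if "q \<in> Q" for q using that by (simp add: Q_def st_def)
    have W_closed: "A w \<in> W" if w: "w \<in> W" for w
    proof -
      have "T w \<in> V" using w g stV by (auto simp: W_def T_def)
      moreover have "dl q \<star> T w - T w \<in> U" if q: "q \<in> Q" for q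
      proof -
        have q': "inv g \<otimes> q \<otimes> g \<in> Q" "q \<in> carrier G" using g q QD DG by auto
        have "dl (inv g \<otimes> q \<otimes> g) \<star> w - w \<in> U" using w q' by (auto simp: W_def)
        then have "dl g \<star> (dl (inv g \<otimes> q \<otimes> g) \<star> w - w) \<in> U" using stU g by blast
        moreover have "g \<otimes> (inv g \<otimes> q \<otimes> g) = q \<otimes> g" using gG q' by (simp add: m_assoc[symmetric])
        ultimately show ?thesis using gG q' by (simp add: star_diff dl_mult_star T_def)
      qed
      moreover have Aw: "A w = T w - w" by (simp only: A_def)
      moreover have "dl q \<star> (T w - w) - (T w - w) = (dl q \<star> T w - T w) - (dl q \<star> w - w)" for q
        by (simp add: star_diff)
      ultimately show ?thesis
        using w subspace_closed(3)[OF V(1), of "T w" w] subspace_closed(3)[OF U] unfolding W_def mem_Collect_eq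
        by (metis (no_types, lifting))
    qed
    have pow: "(T ^^ i) v = dl (g [^] i) \<star> v" for i
    proof (induction i)
      case (Suc i)
      have "dl g \<star> (dl (g [^] i) \<star> v) = dl (g [^] Suc i) \<star> v"
        using gG by (simp only: dl_mult_star nat_pow_closed nat_pow_Suc2)
      then show ?case using Suc by (simp add: T_def)
    qed (use v V in \<open>auto simp: dl_one subset_iff\<close>)
    interpret D: group "G\<lparr>carrier := D\<rparr>" by (rule subgroup_group[OF D(1)])
    \<comment> \<open>The order of g divides p^n, so T^(p^n) fixes v, and
      \<open>freshman_operator\<close> turns this into A^(p^n) v = 0.\<close>
    have "g [^]\<^bsub>G\<lparr>carrier := D\<rparr>\<^esub> order (G\<lparr>carrier := D\<rparr>) = \<one>"
      using D.pow_order_eq_1[of g] g by simp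
    then have "g [^] (p ^ n) = \<one>" using D(2) by (simp add: order_def nat_pow_consistent[symmetric])
    then have "(A ^^ (p ^ n)) v = 0"
      using freshman_operator[OF lA prime_p char_p TA, of n v] pow v V by (auto simp: dl_one subset_iff)
    then have ex: "\<exists>i. (A ^^ i) v \<in> U" using U by (metis subspace_closed(1))
    define i where "i = (LEAST i. (A ^^ i) v \<in> U)"
    have i: "(A ^^ i) v \<in> U" using LeastI_ex[OF ex] by (simp add: i_def)
    \<comment> \<open>The zeroth iterate is v, which lies outside U, so the least exponent is
      positive.\<close>
    then obtain j where j: "i = Suc j" using v by (cases i) auto
    define w where "w = (A ^^ j) v"
    have "w \<notin> U" using not_less_Least[of j "\<lambda>i. (A ^^ i) v \<in> U"] j by (auto simp: w_def i_def)
    moreover have "w \<in> W"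
      unfolding w_def
    proof (induction j)
      case 0
      then show ?case using v by (auto simp: W_def Q_def st_def)
    next
      case (Suc j)
      then show ?case using W_closed by simp
    qed
    moreover have "dl g \<star> w - w \<in> U" using i j A_def T_def by (simp add: w_def)
    ultimately have "w \<in> V - U" "insert g Q \<subseteq> st w" using g QD by (auto simp: W_def st_def)
    then have "card (insert g Q) \<le> card (st v)"
      using vmax[of w] card_mono[of "st w" "insert g Q"] finD by (fastforce simp: st_def)
    moreover have "finite Q" using finD by (simp add: Q_def st_def)
    ultimately show False using g(2) by (simp add: Q_def)
  qed
  then show ?thesis using v by (auto simp: Q_def st_def)
qed

lemma fixed_vector:
  fixes V :: "('g \<Rightarrow> 'k) set"
  assumes D: "subgroup D G" "card D = p ^ n" and V: "fv.subspace V" "V \<subseteq> supp_in (carrier G)"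
    and "\<And>g v. g \<in> D \<Longrightarrow> v \<in> V \<Longrightarrow> dl g \<star> v \<in> V" "w \<in> V" "w \<noteq> 0"
  shows "\<exists>v\<in>V. v \<noteq> 0 \<and> (\<forall>g\<in>D. dl g \<star> v = v)"
  using unipotent_action[OF D fv.subspace_single_0 V assms(5)] assms(6,7) by auto

end

context finite_group
begin

lemma sum_cosets:
  assumes "subgroup K G" "subgroup M G" "M \<subseteq> K"
  shows "sum F K = (\<Sum>s\<in>tv K M. \<Sum>m\<in>M. F (s \<otimes> m))"
proof -
  have triv: "subgroup {\<one>} G" by (rule triv_subgroup)
  have full: "transversal H H {\<one>}" if H: "subgroup H G" for H
    unfolding transversal_def
  proof (intro conjI ballI)
    fix g assume g: "g \<in> H"
    have "inv t \<otimes> g = \<one> \<longleftrightarrow> t = g" if "t \<in> H" for t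
      using that g subgroup_in[OF H] by (metis inv_closed inv_equality inv_inv l_inv)
    then show "\<exists>!t. t \<in> H \<and> inv t \<otimes> g \<in> {\<one>}" using g by auto
  qed auto
  show ?thesis
    using subgroup_in[OF assms(1)] assms(2)
    by (intro sum_tower[OF assms(1-3) triv _ tv(1)[OF assms(1,2)] full[OF assms(2)] full[OF assms(1)]])
      (auto simp: subgroup.one_closed)
qed

lemma fixed_commute:
  assumes "H \<subseteq> carrier G" "x \<in> supp_in (carrier G)" "\<And>h. h \<in> H \<Longrightarrow> cj h x = x" "a \<in> supp_in H"
  shows "a \<star> x = x \<star> a"
proof (rule lin_eq_on[OF fin_sub[OF assms(1)] _ _ _ assms(4)])
  show "lin (\<lambda>a. a \<star> x)" "lin ((\<star>) x)" by (intro lin_intros)+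
  show "dl g \<star> x = x \<star> dl g" if "g \<in> H" for g
    using cj_eq_iff[of g x] assms that by blast
qed

lemma commute_fixed:
  assumes "h \<in> carrier G" "x \<in> supp_in (carrier G)" "dl h \<star> x = x \<star> dl h"
  shows "cj h x = x"
  using cj_eq_iff assms by blast

lemma fixed_star:
  assumes "h \<in> carrier G" "cj h x = x" "cj h y = y"
  shows "cj h (x \<star> y) = x \<star> y"
  using assms by (simp add: cj_mult)

text \<open>kG is the sum of kQ and the span of G - Q, and both are stable under multiplication by Q
  from either side.\<close>

lemma cut_star:
  assumes Q: "subgroup Q G" and a: "a \<in> supp_in Q"
  shows "cut Q (a \<star> x) = a \<star> cut Q x" "cut Q (x \<star> a) = cut Q x \<star> a"
proof -
  have QG: "Q \<subseteq> carrier G" using Q subgroup.subset by blast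
  have *: "inv g \<otimes> y \<in> Q \<longleftrightarrow> y \<in> Q" "y \<otimes> inv g \<in> Q \<longleftrightarrow> y \<in> Q" if "g \<in> Q" "y \<in> carrier G" for g y
  proof -
    have g: "g \<in> carrier G" "inv g \<in> Q" using that Q QG by (auto simp: subgroup.m_inv_closed)
    show "inv g \<otimes> y \<in> Q \<longleftrightarrow> y \<in> Q"
    proof
      assume "inv g \<otimes> y \<in> Q"
      then have "g \<otimes> (inv g \<otimes> y) \<in> Q" using that(1) Q by (simp add: subgroup.m_closed)
      then show "y \<in> Q" using g that by (simp add: m_assoc[symmetric])
    qed (use g Q in \<open>simp add: subgroup.m_closed\<close>)
    show "y \<otimes> inv g \<in> Q \<longleftrightarrow> y \<in> Q"
    proof
      assume "y \<otimes> inv g \<in> Q"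
      then have "y \<otimes> inv g \<otimes> g \<in> Q" using that(1) Q by (simp add: subgroup.m_closed)
      then show "y \<in> Q" using g that by (simp add: m_assoc)
    qed (use g Q in \<open>simp add: subgroup.m_closed\<close>)
  qed
  show "cut Q (a \<star> x) = a \<star> cut Q x"
  proof (rule lin_eq_on[OF fin_sub[OF QG] _ _ _ a])
    show "lin (\<lambda>a. cut Q (a \<star> x))" "lin (\<lambda>a. a \<star> cut Q x)" by (intro lin_intros)+
    fix g assume g: "g \<in> Q"
    show "cut Q (dl g \<star> x) = dl g \<star> cut Q x"
    proof
      fix y show "cut Q (dl g \<star> x) y = (dl g \<star> cut Q x) y"
        using g QG * by (cases "y \<in> carrier G") (auto simp: cut_apply dl_star star_outside)
    qed
  qed
  show "cut Q (x \<star> a) = cut Q x \<star> a"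
  proof (rule lin_eq_on[OF fin_sub[OF QG] _ _ _ a])
    show "lin (\<lambda>a. cut Q (x \<star> a))" "lin (\<lambda>a. cut Q x \<star> a)" by (intro lin_intros)+
    fix g assume g: "g \<in> Q"
    show "cut Q (x \<star> dl g) = cut Q x \<star> dl g"
    proof
      fix y show "cut Q (x \<star> dl g) y = (cut Q x \<star> dl g) y"
        using g QG * by (cases "y \<in> carrier G") (auto simp: cut_apply star_dl star_outside)
    qed
  qed
qed

lemma cut_cj:
  assumes "g \<in> carrier G" "H \<subseteq> carrier G" "\<And>x. x \<in> carrier G \<Longrightarrow> inv g \<otimes> x \<otimes> g \<in> H \<longleftrightarrow> x \<in> H"
  shows "cut H (cj g a) = cj g (cut H a)"
proof
  fix x show "cut H (cj g a) x = cj g (cut H a) x"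
    using assms cj_in[of g] by (cases "x \<in> carrier G") (auto simp: cut_apply cj_apply supp_in_def)
qed

lemma cj_supp:
  assumes "g \<in> carrier G" "\<And>x. x \<in> carrier G \<Longrightarrow> inv g \<otimes> x \<otimes> g \<in> H \<Longrightarrow> x \<in> H" "a \<in> supp_in H"
  shows "cj g a \<in> supp_in H"
proof (rule supp_in_I)
  fix x assume "x \<notin> H"
  then show "cj g a x = 0"
    using assms cj_in[of g a] by (cases "x \<in> carrier G") (auto simp: cj_apply supp_in_def)
qed

lemma centralizer_subgroup:
  assumes "Q \<subseteq> carrier G"
  shows "subgroup (centralizer G Q) G"
proof (rule subgroupI)
  show "centralizer G Q \<subseteq> carrier G" by (auto simp: centralizer_def)
  have "\<one> \<in> centralizer G Q" using assms by (auto simp: centralizer_def)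
  then show "centralizer G Q \<noteq> {}" by blast
  fix a assume a: "a \<in> centralizer G Q"
  show "inv a \<in> centralizer G Q"
    unfolding centralizer_def
  proof (intro CollectI conjI ballI)
    fix u assume u: "u \<in> Q"
    have G: "a \<in> carrier G" "u \<in> carrier G" "a \<otimes> u = u \<otimes> a" using a u assms by (auto simp: centralizer_def)
    have "u \<otimes> inv a = inv a \<otimes> (a \<otimes> u) \<otimes> inv a" using G(1,2) by (simp add: m_assoc[symmetric])
    also have "\<dots> = inv a \<otimes> u" using G by (simp add: m_assoc)
    finally show "inv a \<otimes> u = u \<otimes> inv a" ..
  qed (use a in \<open>simp add: centralizer_def\<close>)
  fix b assume b: "b \<in> centralizer G Q"
  show "a \<otimes> b \<in> centralizer G Q"
    unfolding centralizer_def
  proof (intro CollectI conjI ballI)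
    fix u assume u: "u \<in> Q"
    have "a \<in> carrier G" "b \<in> carrier G" "u \<in> carrier G" "a \<otimes> u = u \<otimes> a" "b \<otimes> u = u \<otimes> b"
      using a b u assms by (auto simp: centralizer_def)
    then show "a \<otimes> b \<otimes> u = u \<otimes> (a \<otimes> b)" by (metis m_assoc)
  qed (use a b in \<open>simp add: centralizer_def\<close>)
qed

lemma inv_cancel:
  assumes "g \<in> carrier G" "x \<in> carrier G"
  shows "inv g \<otimes> (g \<otimes> x) = x" "g \<otimes> (inv g \<otimes> x) = x"
    "inv g \<otimes> (g \<otimes> x \<otimes> inv g) \<otimes> g = x" "g \<otimes> (inv g \<otimes> x \<otimes> g) \<otimes> inv g = x"
proof -
  show "inv g \<otimes> (g \<otimes> x) = x" "g \<otimes> (inv g \<otimes> x) = x"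
    using assms by (simp_all add: m_assoc[symmetric])
  then show "inv g \<otimes> (g \<otimes> x \<otimes> inv g) \<otimes> g = x" "g \<otimes> (inv g \<otimes> x \<otimes> g) \<otimes> inv g = x"
    using assms by (simp_all add: m_assoc)
qed

lemma conj_eq_iff_commute:
  assumes "g \<in> carrier G" "x \<in> carrier G"
  shows "g \<otimes> x \<otimes> inv g = x \<longleftrightarrow> g \<otimes> x = x \<otimes> g"
  using assms by (metis inv_solve_right m_closed)

lemma centralizer_commute_cj:
  assumes "Q \<subseteq> carrier G" "g \<in> centralizer G Q" "a \<in> supp_in Q"
  shows "dl g \<star> a = a \<star> dl g"
proof (rule lin_eq_on[OF fin_sub[OF assms(1)] _ _ _ assms(3)])
  show "lin ((\<star>) (dl g))" "lin (\<lambda>a. a \<star> dl g)" by (intro lin_intros)+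
  show "dl g \<star> dl u = dl u \<star> dl g" if "u \<in> Q" for u
    using assms that by (auto simp: centralizer_def dl_dl)
qed

end

section \<open>Commutative local subalgebras\<close>

text \<open>The identity f belongs to S and is in general not that of kG: S will be the centre of a
  block, or the conjugation-fixed elements of kQ with f = \<open>dl \<one>\<close>.\<close>

locale commutative_subalgebra = finite_group G for G :: "('g, 'm) monoid_scheme" (structure) +
  fixes S :: "('g \<Rightarrow> 'k::field) set" and f :: "'g \<Rightarrow> 'k"
  assumes S: "fv.subspace S" "S \<subseteq> supp_in (carrier G)"
    and S_mult: "x \<in> S \<Longrightarrow> y \<in> S \<Longrightarrow> x \<star> y \<in> S"
    and S_comm: "x \<in> S \<Longrightarrow> y \<in> S \<Longrightarrow> x \<star> y = y \<star> x"
    and f: "f \<in> S" and f_one: "x \<in> S \<Longrightarrow> f \<star> x = x"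
begin

definition unit :: "('g \<Rightarrow> 'k) \<Rightarrow> bool" where
  "unit x \<longleftrightarrow> (\<exists>y\<in>S. x \<star> y = f)"

definition pw :: "('g \<Rightarrow> 'k) \<Rightarrow> nat \<Rightarrow> 'g \<Rightarrow> 'k" where
  "pw x n = ((\<star>) x ^^ n) f"

lemma pw_simps [simp]: "pw x 0 = f" "pw x (Suc n) = x \<star> pw x n"
  by (simp_all add: pw_def)

lemma pw_in: "x \<in> S \<Longrightarrow> pw x n \<in> S"
  by (induction n) (simp_all add: f S_mult)

lemma pw_add: "x \<in> S \<Longrightarrow> pw x (m + n) = pw x m \<star> pw x n"
  by (induction m) (simp_all add: f_one pw_in star_assoc)

text \<open>The ideals x^n S descend inside a finite-dimensional space and become constant, so
  x^(m+1) lies in x^(2m+2) S. The exponent is kept positive so that a factor x can be split off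
  later.\<close>

lemma fitting:
  assumes x: "x \<in> S"
  shows "\<exists>m. \<exists>q\<in>S. pw x (Suc m) = pw x (Suc m) \<star> (pw x (Suc m) \<star> q)"
proof -
  let ?U = "\<lambda>n. (\<star>) (pw x (Suc n)) ` S"
  have sub: "fv.subspace (?U n)" for n
  proof -
    have "lin ((\<star>) (pw x (Suc n)))" by (intro lin_intros)
    then interpret m: Vector_Spaces.linear smul smul "(\<star>) (pw x (Suc n))" .
    show ?thesis by (rule m.subspace_image[OF S(1)])
  qed
  have "\<exists>U\<in>range ?U. \<forall>V\<in>range ?U. V \<subseteq> U \<longrightarrow> V = U"
  proof (rule minimal_subspace[OF finG])
    fix U assume "U \<in> range ?U"
    then obtain n where "U = ?U n" by blast
    then show "fv.subspace U \<and> U \<subseteq> supp_in (carrier G)"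
      using sub[of n] by (auto simp: star_in)
  qed simp
  then obtain m where m: "\<And>n. ?U n \<subseteq> ?U m \<Longrightarrow> ?U n = ?U m" by auto
  have "?U (m + Suc m) \<subseteq> ?U m"
  proof
    fix y assume "y \<in> ?U (m + Suc m)"
    then obtain s where s: "s \<in> S" "y = pw x (Suc m + Suc m) \<star> s" by auto
    then have "y = pw x (Suc m) \<star> (pw x (Suc m) \<star> s)"
      using pw_add[OF x, of "Suc m" "Suc m"] by (simp only: star_assoc)
    then show "y \<in> ?U m" using S_mult[OF pw_in[OF x]] s(1) by blast
  qed
  then have "?U (m + Suc m) = ?U m" by (rule m)
  moreover have "pw x (Suc m) \<in> ?U m"
    using f S_comm[OF f pw_in[OF x, of "Suc m"]] f_one[OF pw_in[OF x, of "Suc m"]] by (auto intro!: image_eqI[of _ _ f])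
  ultimately obtain q where q: "q \<in> S" "pw x (Suc m) = pw x (Suc m + Suc m) \<star> q" by auto
  then show ?thesis
    using pw_add[OF x, of "Suc m" "Suc m"] by (metis star_assoc)
qed

end

locale local_subalgebra = commutative_subalgebra +
  assumes f_nonzero: "f \<noteq> 0" and primitive: "j \<in> S \<Longrightarrow> j \<star> j = j \<Longrightarrow> j = 0 \<or> j = f"
begin

text \<open>With x^(m+1) = x^(2m+2) q from \<open>fitting\<close>, the element x^(m+1) q is
  idempotent, hence 0 or f. In the first case x^(m+1) = 0, in the second x has an inverse.\<close>

lemma unit_or_nilpotent:
  assumes x: "x \<in> S"
  shows "unit x \<or> (\<exists>n. pw x n = 0)"
proof -
  obtain m q where q: "q \<in> S" "pw x (Suc m) = pw x (Suc m) \<star> (pw x (Suc m) \<star> q)" using fitting[OF x] by blast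
  let ?j = "pw x (Suc m) \<star> q"
  have P: "pw x (Suc m) \<in> S" by (rule pw_in[OF x])
  then have j: "?j \<in> S" using S_mult q by blast
  have "?j \<star> ?j = (pw x (Suc m) \<star> ?j) \<star> q"
    using S_comm[OF q(1) j] by (simp only: star_assoc)
  then have "?j \<star> ?j = ?j" using q(2) by simp
  then consider "?j = 0" | "?j = f" using primitive j by blast
  then show ?thesis
  proof cases
    case 1
    then have "pw x (Suc m) = 0" using q(2) by simp
    then show ?thesis by blast
  next
    case 2
    then have "x \<star> (pw x m \<star> q) = f" by (simp add: star_assoc)
    then show ?thesis using S_mult pw_in[OF x] q(1) by (auto simp: unit_def)
  qed
qed

lemma unit_mult_left:
  assumes "x \<in> S" "z \<in> S" "unit (z \<star> x)"
  shows "unit x"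
proof -
  obtain y where y: "y \<in> S" "z \<star> x \<star> y = f" using assms by (auto simp: unit_def)
  have "x \<star> (z \<star> y) = f" using y assms S_comm[of z x] by (simp add: star_assoc[symmetric])
  then show ?thesis using S_mult assms y by (auto simp: unit_def)
qed

text \<open>Scale the sum to z x + z y = f. If neither x nor y is a unit, z x and z y are nilpotent.
  The last non-zero power u of z x satisfies z x u = 0, hence z y u = u, against the nilpotency of z
  y.\<close>

lemma unit_add:
  assumes "x \<in> S" "y \<in> S" "unit (x + y)"
  shows "unit x \<or> unit y"
proof (rule ccontr)
  assume neg: "\<not> ?thesis"
  obtain z where z: "z \<in> S" "(x + y) \<star> z = f" using assms by (auto simp: unit_def)
  have in_S: "z \<star> x \<in> S" "z \<star> y \<in> S" using z assms S_mult by auto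
  have sum: "z \<star> x + z \<star> y = f"
    using z assms S_comm[of z x] S_comm[of z y] by (simp add: star_add_left)
  obtain m n where mn: "pw (z \<star> x) m = 0" "pw (z \<star> y) n = 0"
    using neg unit_or_nilpotent in_S unit_mult_left z assms by meson
  define i where "i = (LEAST i. pw (z \<star> x) i = 0)"
  have i: "pw (z \<star> x) i = 0" using LeastI[of "\<lambda>i. pw (z \<star> x) i = 0"] mn by (simp add: i_def)
  then obtain l where l: "i = Suc l" using f_nonzero by (cases i) auto
  let ?u = "pw (z \<star> x) l"
  have u: "?u \<noteq> 0" using not_less_Least[of l "\<lambda>i. pw (z \<star> x) i = 0"] l by (simp add: i_def)
  have uS: "?u \<in> S" using pw_in in_S by blast
  have "z \<star> y = f - z \<star> x" using sum by (simp add: algebra_simps)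
  then have yu: "z \<star> y \<star> ?u = ?u" using i l f_one[OF uS] by (simp add: star_diff)
  have "pw (z \<star> y) r \<star> ?u = ?u" for r
    by (induction r) (simp_all add: f_one[OF uS] star_assoc, metis star_assoc yu)
  then have "?u = 0" using mn(2) by (metis star_0(1))
  then show False using u by blast
qed

lemma unit_sum:
  assumes "finite I" "\<And>i. i \<in> I \<Longrightarrow> F i \<in> S" "unit (\<Sum>i\<in>I. F i)"
  shows "\<exists>i\<in>I. unit (F i)"
  using assms
proof (induction I rule: finite_induct)
  case empty
  have "\<not> unit 0" using f_nonzero by (auto simp: unit_def)
  then show ?case using empty(2) by (simp only: sum.empty)
next
  case (insert x A)
  then have "(\<Sum>i\<in>A. F i) \<in> S" using S by (intro subspace_closed) auto
  moreover have "unit (F x + (\<Sum>i\<in>A. F i))" using insert.prems(2) unfolding sum.insert[OF insert.hyps] .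
  ultimately have "unit (F x) \<or> unit (\<Sum>i\<in>A. F i)" using insert.prems(1) by (intro unit_add) auto
  then show ?case using insert.IH insert.prems(1) by auto
qed

lemma not_unit_annihilates:
  assumes "x \<in> S" "x \<star> v = 0" "f \<star> v = v" "v \<noteq> 0"
  shows "\<not> unit x"
proof
  assume "unit x"
  then obtain y where y: "y \<in> S" "x \<star> y = f" by (auto simp: unit_def)
  then have "f \<star> v = y \<star> (x \<star> v)" using S_comm[OF assms(1) y(1)] by (simp add: star_assoc[symmetric])
  then show False using assms by simp
qed

end

section \<open>The Brauer homomorphism\<close>

context modular_group
begin

text \<open>For x in C_G(Q) the terms a(y) a'(y^-1 x) of the convolution do not change when y is
  conjugated by Q, so only the fixed points, the y in C_G(Q), contribute.\<close>

lemma brauer_mult: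
  fixes a a' :: "'g \<Rightarrow> 'k"
  assumes Q: "subgroup Q G" "card Q = p ^ n"
    and a: "\<And>q. q \<in> Q \<Longrightarrow> cj q a = a" and a': "\<And>q. q \<in> Q \<Longrightarrow> cj q a' = a'"
  shows "cut (centralizer G Q) (a \<star> a') = cut (centralizer G Q) a \<star> cut (centralizer G Q) a'"
proof
  let ?C = "centralizer G Q"
  have QG: "Q \<subseteq> carrier G" using Q subgroup.subset by blast
  have C: "subgroup ?C G" by (rule centralizer_subgroup[OF QG])
  have CG: "?C \<subseteq> carrier G" using C subgroup.subset by blast
  fix x
  show "cut ?C (a \<star> a') x = (cut ?C a \<star> cut ?C a') x"
  proof (cases "x \<in> ?C")
    case False
    then show ?thesis using star_supp[OF C cut_in[of ?C a] cut_in[of ?C a']] by (simp add: cut_apply supp_in_def)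
  next
    case True
    then have x: "x \<in> carrier G" using CG by blast
    let ?f = "\<lambda>y. a y * a' (inv y \<otimes> x)"
    have inv_conj: "b (q \<otimes> y \<otimes> inv q) = b y" if "q \<in> Q" "y \<in> carrier G" "cj q b = b" for q y and b :: "'g \<Rightarrow> 'k"
    proof -
      have q: "q \<in> carrier G" using that QG by auto
      have "cj q b (q \<otimes> y \<otimes> inv q) = b (inv q \<otimes> (q \<otimes> y \<otimes> inv q) \<otimes> q)" using that(2) q by (intro cj_apply) auto
      also have "inv q \<otimes> (q \<otimes> y \<otimes> inv q) \<otimes> q = y" using that q by (simp only: inv_cancel)
      finally show ?thesis using that by simp
    qed
    have "(a \<star> a') x = (\<Sum>y\<in>carrier G. ?f y)" using x by (simp add: star_apply)
    also have "\<dots> = (\<Sum>y\<in>{y \<in> carrier G. \<forall>q\<in>carrier (G\<lparr>carrier := Q\<rparr>). q \<otimes> y \<otimes> inv q = y}. ?f y)"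
    proof (rule sum_fixed_points[OF subgroup_group[OF Q(1)] prime_p char_p _ finG])
      show "card (carrier (G\<lparr>carrier := Q\<rparr>)) = p ^ n" using Q by simp
      fix q y assume q: "q \<in> carrier (G\<lparr>carrier := Q\<rparr>)" and y: "y \<in> carrier G"
      have qG: "q \<in> carrier G" "q \<in> Q" using q QG by auto
      show "q \<otimes> y \<otimes> inv q \<in> carrier G" using qG y by simp
      have "x \<otimes> q = q \<otimes> x" using True qG by (auto simp: centralizer_def)
      then have "inv (q \<otimes> y \<otimes> inv q) \<otimes> x = q \<otimes> (inv y \<otimes> x) \<otimes> inv q"
      proof -
        assume xq: "x \<otimes> q = q \<otimes> x"
        have "inv q \<otimes> x = x \<otimes> inv q" using xq qG x by (metis inv_closed inv_solve_left inv_solve_right m_assoc m_closed)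
        then show ?thesis using qG x y by (simp add: inv_mult_group m_assoc)
      qed
      then show "?f (q \<otimes> y \<otimes> inv q) = ?f y"
        using inv_conj[OF qG(2) y a] inv_conj[OF qG(2) _ a', of "inv y \<otimes> x"] y x qG by simp
    qed (use QG in \<open>auto simp: m_assoc inv_mult_group subset_iff\<close>)
    also have "{y \<in> carrier G. \<forall>q\<in>carrier (G\<lparr>carrier := Q\<rparr>). q \<otimes> y \<otimes> inv q = y} = ?C"
      using QG conj_eq_iff_commute by (auto simp: centralizer_def subset_iff)
    also have "(\<Sum>y\<in>?C. ?f y) = (\<Sum>y\<in>carrier G. cut ?C a y * cut ?C a' (inv y \<otimes> x))"
    proof (rule sum.mono_neutral_cong_left[OF finG CG])
      fix y assume y: "y \<in> ?C"
      then have "inv y \<otimes> x \<in> ?C" using True C by (simp add: subgroup.m_closed subgroup.m_inv_closed)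
      then show "?f y = cut ?C a y * cut ?C a' (inv y \<otimes> x)" using y by (simp add: cut_apply)
    qed (simp add: cut_apply)
    also have "\<dots> = (cut ?C a \<star> cut ?C a') x" using x by (simp add: star_apply)
    finally show ?thesis using True by (simp add: cut_apply)
  qed
qed

text \<open>If v a = 0 with a \<noteq> 0 in kQ, the annihilator of v contains a non-zero vector
  fixed by Q. On such a vector v acts as its augmentation, which is not zero. So v is cancellable,
  and \<open>fitting\<close> upgrades this to an inverse that is again central.\<close>

lemma p_group_central_inverse:
  fixes v :: "'g \<Rightarrow> 'k"
  assumes Q: "subgroup Q G" "card Q = p ^ n"
    and v: "v \<in> supp_in Q" "\<And>q. q \<in> Q \<Longrightarrow> cj q v = v" and aug: "(\<Sum>q\<in>Q. v q) \<noteq> 0"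
  shows "\<exists>v'\<in>supp_in Q. (\<forall>q\<in>Q. cj q v' = v') \<and> v \<star> v' = dl \<one>"
proof -
  have QG: "Q \<subseteq> carrier G" using Q subgroup.subset by blast
  define S :: "('g \<Rightarrow> 'k) set" where "S = {a \<in> supp_in Q. \<forall>q\<in>Q. cj q a = a}"
  have SG: "S \<subseteq> supp_in (carrier G)" using supp_in_mono[OF QG] by (auto simp: S_def)
  interpret c: commutative_subalgebra G S "dl \<one>"
  proof
    show "fv.subspace S" unfolding S_def by (rule lin_fixed_closed[OF subspace_supp_in])
    show "x \<star> y \<in> S" if "x \<in> S" "y \<in> S" for x y
      using that star_supp[OF Q(1)] QG by (auto simp: S_def cj_mult subset_iff)
    show "x \<star> y = y \<star> x" if "x \<in> S" "y \<in> S" for x y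
      using that fixed_commute[OF QG, of y x] SG by (auto simp: S_def)
    show "dl \<one> \<in> S"
      using Q(1) QG by (auto simp: S_def dl_in subgroup.one_closed cj_dl)
  qed (use SG in \<open>auto simp: dl_one\<close>)
  have inj: "a = 0" if a: "a \<in> supp_in Q" "v \<star> a = 0" for a
  proof (rule ccontr)
    assume "a \<noteq> 0"
    define V where "V = {a \<in> supp_in Q. v \<star> a = 0}"
    have comm: "v \<star> dl g = dl g \<star> v" if "g \<in> Q" for g
    proof -
      have "v \<in> supp_in (carrier G)" "g \<in> carrier G" using v(1) that QG supp_in_mono[OF QG] by auto
      then show ?thesis using cj_eq_iff[of g v] v(2)[OF that] by simp
    qed
    have "\<exists>u\<in>V. u \<noteq> 0 \<and> (\<forall>g\<in>Q. dl g \<star> u = u)"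
    proof (rule fixed_vector[OF Q])
      show "fv.subspace V"
        using subspace_supp_in[of Q] by (auto simp: V_def fv.subspace_def star_distribs)
      show "V \<subseteq> supp_in (carrier G)" using supp_in_mono[OF QG] by (auto simp: V_def)
      show "a \<in> V" "a \<noteq> 0" using a \<open>a \<noteq> 0\<close> by (auto simp: V_def)
      fix g w assume g: "g \<in> Q" and w: "w \<in> V"
      have "v \<star> (dl g \<star> w) = dl g \<star> (v \<star> w)" using comm[OF g] by (simp add: star_assoc[symmetric])
      then show "dl g \<star> w \<in> V" using w g star_supp[OF Q(1) dl_in] by (auto simp: V_def)
    qed
    then obtain u where u: "u \<in> V" "u \<noteq> 0" "\<And>g. g \<in> Q \<Longrightarrow> dl g \<star> u = u" by blast
    have "v \<star> u = (\<Sum>g\<in>Q. smul (v g) (dl g)) \<star> u" using expand_dl[OF fin_sub[OF QG] v(1)] by simp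
    also have "\<dots> = (\<Sum>g\<in>Q. smul (v g) u)" by (simp add: star_sum star_smul_left u(3))
    also have "\<dots> = smul (\<Sum>g\<in>Q. v g) u" by (simp add: fun_eq_iff sum_fun_apply sum_distrib_right)
    finally have "smul (\<Sum>g\<in>Q. v g) u = 0" using u(1) by (simp add: V_def)
    then show False using aug u(2) by (auto simp: fun_eq_iff)
  qed
  have vS: "v \<in> S" using v by (simp add: S_def)
  obtain m q where q: "q \<in> S" "c.pw v (Suc m) = c.pw v (Suc m) \<star> (c.pw v (Suc m) \<star> q)"
    using c.fitting[OF vS] by blast
  have cancel: "a = 0" if "a \<in> supp_in Q" "c.pw v i \<star> a = 0" for i a
    using that
  proof (induction i arbitrary: a)
    case 0
    then show ?case using supp_in_mono[OF QG] by (auto simp: dl_one)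
  next
    case (Suc i)
    have 1: "v \<star> (c.pw v i \<star> a) = 0" using Suc.prems(2) by (simp only: c.pw_simps star_assoc)
    have 2: "c.pw v i \<star> a \<in> supp_in Q" using c.pw_in[OF vS] star_supp[OF Q(1)] Suc by (auto simp: S_def)
    show ?case by (rule Suc.IH[OF Suc.prems(1) inj[OF 2 1]])
  qed
  let ?P = "c.pw v (Suc m)"
  \<comment> \<open>Since v^(m+1) = v^(2m+2) q, cancelling v^(m+1) leaves 1 = v^(m+1) q.\<close>
  have "?P \<star> (dl \<one> - ?P \<star> q) = 0"
    using q(2) c.pw_in[OF vS, of "Suc m"] SG by (simp add: star_diff(2) dl_one subset_iff del: c.pw_simps)
  moreover have "dl \<one> - ?P \<star> q \<in> supp_in Q"
    using c.f c.S_mult[OF c.pw_in[OF vS, of "Suc m"] q(1)]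
    by (intro supp_in_closed) (simp_all add: S_def del: c.pw_simps)
  ultimately have "dl \<one> = ?P \<star> q" using cancel by (metis eq_iff_diff_eq_0)
  then have "v \<star> (c.pw v m \<star> q) = dl \<one>" by (simp add: star_assoc)
  moreover have "c.pw v m \<star> q \<in> S" using c.S_mult[OF c.pw_in[OF vS] q(1)] .
  ultimately show ?thesis by (auto simp: S_def)
qed

text \<open>For some \<open>c\<close> in \<open>C\<^sub>G(Q)\<close> the coefficients of \<open>f\<close> on \<open>c Z(Q)\<close> have a non-zero sum.  Then the part \<open>v\<close> of
  \<open>f c\<^sup>-\<^sup>1\<close> supported in \<open>Q\<close> is a central unit of \<open>kQ\<close>, and \<open>\<tau> x\<close> is the part of \<open>x c\<^sup>-\<^sup>1\<close> supported in \<open>Q\<close>,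
  times \<open>v\<^sup>-\<^sup>1\<close>.\<close>

lemma bimodule_retraction:
  fixes f :: "'g \<Rightarrow> 'k"
  assumes Q: "subgroup Q G" "card Q = p ^ n"
    and f: "f \<in> supp_in (carrier G)" "\<And>q. q \<in> Q \<Longrightarrow> cj q f = f"
    and br: "cut (centralizer G Q) f \<star> cut (centralizer G Q) f = cut (centralizer G Q) f" "cut (centralizer G Q) f \<noteq> 0"
  obtains \<tau> where "lin \<tau>" "\<And>x. \<tau> x \<in> supp_in Q" "\<And>a x. a \<in> supp_in Q \<Longrightarrow> \<tau> (a \<star> x) = a \<star> \<tau> x"
    "\<And>a x. a \<in> supp_in Q \<Longrightarrow> \<tau> (x \<star> a) = \<tau> x \<star> a" "\<tau> f = dl \<one>"
proof -
  let ?C = "centralizer G Q"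
  have QG: "Q \<subseteq> carrier G" using Q subgroup.subset by blast
  have C: "subgroup ?C G" by (rule centralizer_subgroup[OF QG])
  have CG: "?C \<subseteq> carrier G" using C subgroup.subset by blast
  define y where "y = cut ?C f"
  have y: "y \<in> supp_in ?C" "y \<star> y = y" "y \<noteq> 0" using br cut_in by (auto simp: y_def)
  define Z where "Z = Q \<inter> ?C"
  have Z: "subgroup Z G" unfolding Z_def using Q(1) C by (rule subgroups_Inter_pair)
  obtain i where i: "card Z = p ^ i" using card_subgroup_p_power[OF Q Z] by (auto simp: Z_def)
  have Zcomm: "dl z \<star> a = a \<star> dl z" if "z \<in> Z" "a \<in> supp_in ?C" for z and a :: "'g \<Rightarrow> 'k"
  proof (rule centralizer_commute_cj[OF CG _ that(2)])
    show "z \<in> centralizer G ?C" using that(1) QG by (auto simp: Z_def centralizer_def)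
  qed
  have "\<exists>c\<in>?C. (\<Sum>z\<in>Z. y (c \<otimes> z)) \<noteq> 0"
  proof (rule ccontr)
    assume neg: "\<not> ?thesis"
    \<comment> \<open>If all coset sums of y were zero, y would kill every Z-fixed vector, since
      such a vector only sees these sums. But V is invariant under Z and non-zero, so it contains a
      non-zero Z-fixed vector, and y acts on V as the identity.\<close>
    define V where "V = {v \<in> supp_in (carrier G). y \<star> v = v}"
    have "\<exists>u\<in>V. u \<noteq> 0 \<and> (\<forall>g\<in>Z. dl g \<star> u = u)"
    proof (rule fixed_vector[OF Z i])
      show "fv.subspace V"
        using subspace_supp_in[of "carrier G"] by (auto simp: V_def fv.subspace_def star_distribs)
      show "V \<subseteq> supp_in (carrier G)" by (auto simp: V_def)
      show "y \<in> V" "y \<noteq> 0" using y supp_in_mono[OF CG] by (auto simp: V_def)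
      fix g w assume g: "g \<in> Z" and w: "w \<in> V"
      have "y \<star> (dl g \<star> w) = dl g \<star> (y \<star> w)" using Zcomm[OF g y(1)] by (simp add: star_assoc[symmetric])
      then show "dl g \<star> w \<in> V" using w by (auto simp: V_def star_in)
    qed
    then obtain u where u: "u \<in> V" "u \<noteq> 0" "\<And>g. g \<in> Z \<Longrightarrow> dl g \<star> u = u" by blast
    have "y \<star> u = (\<Sum>g\<in>?C. smul (y g) (dl g)) \<star> u" using expand_dl[OF fin_sub[OF CG] y(1)] by simp
    also have "\<dots> = (\<Sum>g\<in>?C. smul (y g) (dl g \<star> u))" by (simp add: star_sum star_smul_left)
    also have "\<dots> = (\<Sum>s\<in>tv ?C Z. \<Sum>z\<in>Z. smul (y (s \<otimes> z)) (dl (s \<otimes> z) \<star> u))"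
      by (rule sum_cosets[OF C Z]) (simp add: Z_def)
    also have "\<dots> = 0"
    proof (rule sum.neutral, rule ballI)
      fix s assume "s \<in> tv ?C Z"
      then have s: "s \<in> ?C" using tv(1)[OF C Z] by (auto simp: transversal_def)
      have "dl (s \<otimes> z) \<star> u = dl s \<star> u" if "z \<in> Z" for z
        using that s u(3)[OF that] CG subgroup_in[OF Z that] by (simp add: dl_mult_star[symmetric] subset_iff)
      then have "(\<Sum>z\<in>Z. smul (y (s \<otimes> z)) (dl (s \<otimes> z) \<star> u)) = smul (\<Sum>z\<in>Z. y (s \<otimes> z)) (dl s \<star> u)"
        by (simp add: fun_eq_iff sum_fun_apply sum_distrib_right)
      also have "\<dots> = 0" using neg s by auto
      finally show "(\<Sum>z\<in>Z. smul (y (s \<otimes> z)) (dl (s \<otimes> z) \<star> u)) = 0" .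
    qed
    finally show False using u by (simp add: V_def)
  qed
  then obtain c where c: "c \<in> ?C" "(\<Sum>z\<in>Z. y (c \<otimes> z)) \<noteq> 0" by blast
  have cG: "c \<in> carrier G" using c CG by auto
  have ic: "inv c \<in> ?C" using c C by (simp add: subgroup.m_inv_closed)
  define v where "v = cut Q (f \<star> dl (inv c))"
  have vQ: "v \<in> supp_in Q" by (simp add: v_def cut_in)
  have vq: "v q = f (q \<otimes> c)" if "q \<in> Q" for q
    using that QG cG by (auto simp: v_def cut_apply star_dl)
  have cj_fc: "cj q (f \<star> dl (inv c)) = f \<star> dl (inv c)" if "q \<in> Q" for q
  proof -
    have "cj q (dl (inv c)) = (dl (inv c) :: 'g \<Rightarrow> 'k)"
    proof (rule commute_fixed)
      show "dl q \<star> dl (inv c) = dl (inv c) \<star> (dl q :: 'g \<Rightarrow> 'k)"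
        using that QG cG ic by (auto simp: dl_dl centralizer_def)
    qed (use that QG cG in \<open>auto intro: dl_in\<close>)
    then show ?thesis using that QG f(2) by (intro fixed_star) auto
  qed
  have vfix: "cj q v = v" if q: "q \<in> Q" for q
  proof -
    have qG: "q \<in> carrier G" using q QG by auto
    have "cut Q (cj q (f \<star> dl (inv c))) = cj q v"
      unfolding v_def
    proof (rule cut_cj[OF qG QG])
      fix x assume x: "x \<in> carrier G"
      show "inv q \<otimes> x \<otimes> q \<in> Q \<longleftrightarrow> x \<in> Q"
      proof
        assume "inv q \<otimes> x \<otimes> q \<in> Q"
        then have "q \<otimes> (inv q \<otimes> x \<otimes> q) \<otimes> inv q \<in> Q" using q Q(1) by (simp add: subgroup.m_closed subgroup.m_inv_closed)
        moreover have "q \<otimes> (inv q \<otimes> x \<otimes> q) \<otimes> inv q = x"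
          using qG x by (simp only: inv_cancel)
        ultimately show "x \<in> Q" by simp
      qed (use q Q(1) in \<open>simp add: subgroup.m_closed subgroup.m_inv_closed\<close>)
    qed
    then show ?thesis using cj_fc[OF q] by (simp add: v_def)
  qed
  \<comment> \<open>v is constant on the conjugacy classes of Q, so its augmentation is the sum over
    the centre Z of Q, and there v(z) = y(c z).\<close>
  have "(\<Sum>q\<in>Q. v q) = (\<Sum>q\<in>{q \<in> Q. \<forall>u\<in>carrier (G\<lparr>carrier := Q\<rparr>). u \<otimes> q \<otimes> inv u = q}. v q)"
  proof (rule sum_fixed_points[OF subgroup_group[OF Q(1)] prime_p char_p])
    show "card (carrier (G\<lparr>carrier := Q\<rparr>)) = p ^ n" using Q by simp
    show "finite Q" using fin_sub[OF QG] .
    fix u q assume "u \<in> carrier (G\<lparr>carrier := Q\<rparr>)" "q \<in> Q"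
    then have u: "u \<in> Q" "u \<in> carrier G" and q: "q \<in> Q" "q \<in> carrier G" using QG by auto
    show "u \<otimes> q \<otimes> inv u \<in> Q" using u q Q(1) by (simp add: subgroup.m_closed subgroup.m_inv_closed)
    have "cj u v (u \<otimes> q \<otimes> inv u) = v (inv u \<otimes> (u \<otimes> q \<otimes> inv u) \<otimes> u)" using u q by (intro cj_apply) auto
    also have "inv u \<otimes> (u \<otimes> q \<otimes> inv u) \<otimes> u = q" using u q by (simp only: inv_cancel)
    finally show "v (u \<otimes> q \<otimes> inv u) = v q" using vfix[OF u(1)] by simp
  qed (use QG in \<open>auto simp: m_assoc inv_mult_group subset_iff\<close>)
  also have "{q \<in> Q. \<forall>u\<in>carrier (G\<lparr>carrier := Q\<rparr>). u \<otimes> q \<otimes> inv u = q} = Z"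
    using QG conj_eq_iff_commute by (auto simp: centralizer_def subset_iff Z_def)
  also have "(\<Sum>q\<in>Z. v q) = (\<Sum>z\<in>Z. y (c \<otimes> z))"
  proof (rule sum.cong[OF refl])
    fix z assume z: "z \<in> Z"
    then have "z \<otimes> c = c \<otimes> z" using c QG by (auto simp: Z_def centralizer_def)
    moreover have "c \<otimes> z \<in> ?C" using z c(1) C by (auto simp: Z_def subgroup.m_closed)
    ultimately have "z \<otimes> c = c \<otimes> z" "c \<otimes> z \<in> ?C" by auto
    then show "v z = y (c \<otimes> z)" using z vq[of z] by (simp add: y_def cut_apply Z_def)
  qed
  finally have aug: "(\<Sum>q\<in>Q. v q) \<noteq> 0" using c by simp
  obtain v' where v': "v' \<in> supp_in Q" "\<And>q. q \<in> Q \<Longrightarrow> cj q v' = v'" "v \<star> v' = dl \<one>"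
    using p_group_central_inverse[OF Q vQ vfix aug] by blast
  have v'G: "v' \<in> supp_in (carrier G)" using v'(1) supp_in_mono[OF QG] by auto
  show thesis
  proof
    show "lin (\<lambda>x. cut Q (x \<star> dl (inv c)) \<star> v')" by (intro lin_intros)
    show "cut Q (x \<star> dl (inv c)) \<star> v' \<in> supp_in Q" for x
      by (intro star_supp[OF Q(1)] cut_in v'(1))
    show "cut Q (f \<star> dl (inv c)) \<star> v' = dl \<one>" using v'(3) by (simp add: v_def)
    fix a x :: "'g \<Rightarrow> 'k" assume a: "a \<in> supp_in Q"
    show "cut Q (a \<star> x \<star> dl (inv c)) \<star> v' = a \<star> (cut Q (x \<star> dl (inv c)) \<star> v')"
      using cut_star(1)[OF Q(1) a] by (simp add: star_assoc)
    have "a \<star> dl (inv c) = dl (inv c) \<star> a" using centralizer_commute_cj[OF QG ic a] by simp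
    moreover have "a \<star> v' = v' \<star> a" by (rule fixed_commute[OF QG v'G v'(2) a])
    ultimately show "cut Q (x \<star> a \<star> dl (inv c)) \<star> v' = cut Q (x \<star> dl (inv c)) \<star> v' \<star> a"
      using cut_star(2)[OF Q(1) a, of "x \<star> dl (inv c)"] by (simp add: star_assoc)
  qed
qed

end

section \<open>Block idempotents\<close>

lemma (in finite_group) group_algebra_simps [simp]:
  "carrier (group_algebra G) = supp_in (carrier G)"
  "a \<oplus>\<^bsub>group_algebra G\<^esub> b = a + b" "\<zero>\<^bsub>group_algebra G\<^esub> = 0" "\<one>\<^bsub>group_algebra G\<^esub> = dl \<one>"
  "c \<odot>\<^bsub>group_algebra G\<^esub> a = smul c a"
  by (auto simp: group_algebra_def supp_in_def dl_def smul_def fun_eq_iff)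

lemma (in finite_group) subgroup_algebra_simps [simp]:
  "carrier (subgroup_algebra G H) = supp_in H"
  "a \<oplus>\<^bsub>subgroup_algebra G H\<^esub> b = a + b" "\<zero>\<^bsub>subgroup_algebra G H\<^esub> = 0" "\<one>\<^bsub>subgroup_algebra G H\<^esub> = dl \<one>"
  "c \<odot>\<^bsub>subgroup_algebra G H\<^esub> a = smul c a"
  by (auto simp: group_algebra_def supp_in_def dl_def smul_def fun_eq_iff)

lemma (in finite_group) subgroup_algebra_mult:
  assumes H: "subgroup H G" and ab: "a \<in> supp_in H" "b \<in> supp_in H"
  shows "a \<otimes>\<^bsub>subgroup_algebra G H\<^esub> b = a \<star> b"
proof
  fix x
  have HG: "H \<subseteq> carrier G" using H subgroup.subset by blast
  have "(\<Sum>(y, z)\<in>{(y, z). y \<in> H \<and> z \<in> H \<and> y \<otimes> z = x}. a y * b z)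
      = (\<Sum>(y, z)\<in>{(y, z). y \<in> carrier G \<and> z \<in> carrier G \<and> y \<otimes> z = x}. a y * b z)"
  proof (rule sum.mono_neutral_left)
    show "finite {(y, z). y \<in> carrier G \<and> z \<in> carrier G \<and> y \<otimes> z = x}"
      by (rule finite_subset[of _ "carrier G \<times> carrier G"]) (use finG in auto)
  qed (use HG ab in \<open>auto simp: supp_in_def\<close>)
  then show "(a \<otimes>\<^bsub>subgroup_algebra G H\<^esub> b) x = (a \<star> b) x"
    by (simp add: group_algebra_def)
qed

text \<open>Common interface of kH and of its blocks: on the carrier the operations of the record
  are those of the function space, and the identity may be any idempotent.\<close>

locale conv_algebra = finite_group G for G :: "('g, 'm) monoid_scheme" (structure) +
  fixes A :: "('k::field, 'g \<Rightarrow> 'k) module"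
  assumes A_subspace: "fv.subspace (carrier A)" and A_supp: "carrier A \<subseteq> supp_in (carrier G)"
    and A_mult: "x \<in> carrier A \<Longrightarrow> y \<in> carrier A \<Longrightarrow> x \<otimes>\<^bsub>A\<^esub> y = x \<star> y"
    and A_mult_closed: "x \<in> carrier A \<Longrightarrow> y \<in> carrier A \<Longrightarrow> x \<star> y \<in> carrier A"
    and A_add [simp]: "x \<oplus>\<^bsub>A\<^esub> y = x + y" and A_zero [simp]: "\<zero>\<^bsub>A\<^esub> = 0" and A_smult [simp]: "c \<odot>\<^bsub>A\<^esub> x = smul c x"
    and A_one: "\<one>\<^bsub>A\<^esub> \<in> carrier A" "x \<in> carrier A \<Longrightarrow> \<one>\<^bsub>A\<^esub> \<star> x = x" "x \<in> carrier A \<Longrightarrow> x \<star> \<one>\<^bsub>A\<^esub> = x"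
begin

lemmas A_closed = subspace_closed[OF A_subspace]

lemma A_abelian: "abelian_group A"
proof (rule abelian_groupI)
  show "\<exists>y\<in>carrier A. y \<oplus>\<^bsub>A\<^esub> x = \<zero>\<^bsub>A\<^esub>" if "x \<in> carrier A" for x
    using that by (intro bexI[of _ "- x"]) (auto simp: A_closed)
qed (auto simp: A_closed add_ac)

lemma A_ring: "ring A"
proof (rule ringI[OF A_abelian])
  show "Group.monoid A"
    by (rule monoidI) (auto simp: A_mult A_mult_closed A_one star_assoc)
qed (auto simp: A_mult A_mult_closed A_closed star_distribs)

lemma A_uminus: "x \<in> carrier A \<Longrightarrow> \<ominus>\<^bsub>A\<^esub> x = - x"
proof -
  assume x: "x \<in> carrier A"
  interpret ring A by (rule A_ring)
  show ?thesis using x by (intro minus_equality) (auto simp: A_closed)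
qed

lemma A_minus: "x \<in> carrier A \<Longrightarrow> y \<in> carrier A \<Longrightarrow> x \<ominus>\<^bsub>A\<^esub> y = x - y"
  by (simp add: a_minus_def A_uminus)

lemma A_subgroupI:
  assumes "fv.subspace I" "I \<subseteq> carrier A"
  shows "subgroup I (add_monoid A)"
proof (rule subgroup.intro)
  show "inv\<^bsub>add_monoid A\<^esub> x \<in> I" if "x \<in> I" for x
    using A_uminus[of x] that assms by (auto simp: a_inv_def subspace_closed)
qed (use assms in \<open>auto simp: subspace_closed\<close>)

lemma A_idealI:
  assumes "fv.subspace I" "I \<subseteq> carrier A"
    and "\<And>a x. a \<in> I \<Longrightarrow> x \<in> carrier A \<Longrightarrow> x \<star> a \<in> I \<and> a \<star> x \<in> I"
  shows "ideal I A"
  using assms by (intro idealI[OF A_ring A_subgroupI]) (auto simp: A_mult subset_iff)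

end

lemma (in finite_group) subgroup_conv_algebra:
  assumes H: "subgroup H G"
  shows "conv_algebra G (subgroup_algebra G H :: ('k::field, 'g \<Rightarrow> 'k) module)"
proof
  have HG: "H \<subseteq> carrier G" using H subgroup.subset by blast
  show "fv.subspace (carrier (subgroup_algebra G H))" by (simp add: subspace_supp_in)
  show "carrier (subgroup_algebra G H) \<subseteq> supp_in (carrier G)" using supp_in_mono[OF HG] by simp
  show "\<one>\<^bsub>subgroup_algebra G H\<^esub> \<in> carrier (subgroup_algebra G H)" using H by (simp add: dl_in subgroup.one_closed)
qed (use H supp_in_mono[OF subgroup.subset[OF H]] in
    \<open>auto simp: subgroup_algebra_mult star_supp dl_one\<close>)

text \<open>The primitive idempotents of the centre of kH, expressed by conjugation with H; they are
  the identities of the blocks of kH.\<close>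

definition (in finite_group) block_idem :: "'g set \<Rightarrow> ('g \<Rightarrow> 'k::field) \<Rightarrow> bool" where
  "block_idem H b \<longleftrightarrow> b \<in> supp_in H \<and> b \<noteq> 0 \<and> b \<star> b = b \<and> (\<forall>h\<in>H. cj h b = b) \<and>
    (\<forall>j\<in>supp_in H. (\<forall>h\<in>H. cj h j = j) \<and> j \<star> j = j \<and> b \<star> j = j \<longrightarrow> j = 0 \<or> j = b)"

text \<open>The identity b of the ideal I is central because b x and x b both lie in I, and I is
  recovered as the set where b acts as the identity. A central idempotent j below b splits B into
  the ideals where j acts as 1 and as 0, so indecomposability makes b primitive.\<close>

lemma (in finite_group) is_block_props:
  fixes B :: "('k::field, 'g \<Rightarrow> 'k) module"
  assumes H: "subgroup H G" and B: "is_block (subgroup_algebra G H) B"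
  shows "conv_algebra G B" "carrier B = {x \<in> supp_in H. \<one>\<^bsub>B\<^esub> \<star> x = x}" "block_idem H \<one>\<^bsub>B\<^esub>"
proof -
  let ?A = "subgroup_algebra G H :: ('k, 'g \<Rightarrow> 'k) module"
  have HG: "H \<subseteq> carrier G" using H subgroup.subset by blast
  interpret A: conv_algebra G ?A by (rule subgroup_conv_algebra[OF H])
  obtain I J b where IJ: "algebra_direct_sum ?A I J" and b: "b \<in> I" "\<forall>x\<in>I. b \<otimes>\<^bsub>?A\<^esub> x = x \<and> x \<otimes>\<^bsub>?A\<^esub> b = x"
    and Beq: "B = ?A\<lparr>carrier := I, one := b\<rparr>" and ind: "indecomposable_algebra B"
    using B unfolding is_block_def by blast
  have I: "ideal I ?A" using IJ by (simp add: algebra_direct_sum_def)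
  then interpret I: ideal I ?A .
  have IH: "I \<subseteq> supp_in H" using I.a_subset by simp
  have Imult: "x \<star> a \<in> I \<and> a \<star> x \<in> I" if "a \<in> I" "x \<in> supp_in H" for a x
  proof -
    have a: "a \<in> supp_in H" using that IH by blast
    have "x \<otimes>\<^bsub>?A\<^esub> a \<in> I" "a \<otimes>\<^bsub>?A\<^esub> x \<in> I"
      using I.I_l_closed[OF that(1), of x] I.I_r_closed[OF that(1), of x] that(2) by simp_all
    then show ?thesis
      unfolding subgroup_algebra_mult[OF H a that(2)] subgroup_algebra_mult[OF H that(2) a] by blast
  qed
  have bH: "b \<in> supp_in H" using b IH by auto
  have bx: "b \<star> x = x \<and> x \<star> b = x" if "x \<in> I" for x
  proof -
    have x: "x \<in> supp_in H" using that IH by blast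
    show ?thesis
      using b(2) that unfolding subgroup_algebra_mult[OF H bH x, symmetric] subgroup_algebra_mult[OF H x bH, symmetric]
      by blast
  qed
  have bcentral: "b \<star> x = x \<star> b" if "x \<in> supp_in H" for x
    using bx[of "b \<star> x"] bx[of "x \<star> b"] Imult[OF b(1) that] by (metis star_assoc)
  have I_eq: "I = {x \<in> supp_in H. b \<star> x = x}"
    using IH bx Imult[OF b(1)] by force
  have one: "\<one>\<^bsub>B\<^esub> = b" and carr: "carrier B = I" by (simp_all add: Beq)
  show Bcarr: "carrier B = {x \<in> supp_in H. \<one>\<^bsub>B\<^esub> \<star> x = x}" using I_eq one carr by simp
  have subI: "fv.subspace I"
    unfolding I_eq using subspace_supp_in[of H] by (auto simp: fv.subspace_def star_distribs)
  show conv: "conv_algebra G B"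
  proof
    show "fv.subspace (carrier B)" using subI carr by simp
    show "carrier B \<subseteq> supp_in (carrier G)" using carr IH supp_in_mono[OF HG] by auto
    show "x \<otimes>\<^bsub>B\<^esub> y = x \<star> y" if "x \<in> carrier B" "y \<in> carrier B" for x y
      using that carr IH subgroup_algebra_mult[OF H, of x y] by (auto simp: Beq)
    show "x \<star> y \<in> carrier B" if "x \<in> carrier B" "y \<in> carrier B" for x y
      using that carr Imult IH by auto
    show "\<one>\<^bsub>B\<^esub> \<in> carrier B" using b by (simp add: Beq)
    show "\<one>\<^bsub>B\<^esub> \<star> x = x" "x \<star> \<one>\<^bsub>B\<^esub> = x" if "x \<in> carrier B" for x
      using bx that by (auto simp: Beq)
  qed (auto simp: Beq)
  interpret B: conv_algebra G B by (rule conv)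
  have bfix: "cj h b = b" if "h \<in> H" for h
    using that HG bH supp_in_mono[OF HG] bcentral[OF dl_in[OF that]] by (intro commute_fixed) auto
  have prim: "j = 0 \<or> j = b" if j: "j \<in> supp_in H" "\<forall>h\<in>H. cj h j = j" "j \<star> j = j" "b \<star> j = j" for j
  proof -
    have jcentral: "x \<star> j = j \<star> x" if "x \<in> supp_in H" for x
      using fixed_commute[OF HG _ _ that, of j] j supp_in_mono[OF HG] by blast
    have jB: "j \<in> carrier B" using j Bcarr one by simp
    let ?I = "{x \<in> carrier B. j \<star> x = x}" and ?J = "{x \<in> carrier B. j \<star> x = 0}"
    have "algebra_direct_sum B ?I ?J"
      unfolding algebra_direct_sum_def
    proof (intro conjI)
      have jx: "x \<star> j = j \<star> x" if "x \<in> carrier B" for x using jcentral that Bcarr by auto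
      have jxa: "j \<star> (x \<star> a) = x \<star> (j \<star> a)" if "x \<in> carrier B" for x a using jx[OF that] by (simp add: star_assoc[symmetric])
      show "ideal ?I B"
      proof (intro B.A_idealI conjI)
        fix a x assume ax: "a \<in> ?I" "x \<in> carrier B"
        then show "x \<star> a \<in> ?I" using B.A_mult_closed jxa[of x a] by auto
        have "j \<star> (a \<star> x) = a \<star> x" using ax by (simp add: star_assoc[symmetric])
        then show "a \<star> x \<in> ?I" using ax B.A_mult_closed by auto
      qed (auto simp: fv.subspace_def B.A_closed star_distribs)
      show "ideal ?J B"
      proof (intro B.A_idealI conjI)
        fix a x assume ax: "a \<in> ?J" "x \<in> carrier B"
        then show "x \<star> a \<in> ?J" using B.A_mult_closed jxa[of x a] by auto
        have "j \<star> (a \<star> x) = 0" using ax by (simp add: star_assoc[symmetric])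
        then show "a \<star> x \<in> ?J" using ax B.A_mult_closed by auto
      qed (auto simp: fv.subspace_def B.A_closed star_distribs)
      show "?I \<inter> ?J = {\<zero>\<^bsub>B\<^esub>}" by (auto simp: B.A_closed)
      show "?I <+>\<^bsub>B\<^esub> ?J = carrier B"
      proof
        show "?I <+>\<^bsub>B\<^esub> ?J \<subseteq> carrier B" by (auto simp: set_add_def' B.A_closed)
        show "carrier B \<subseteq> ?I <+>\<^bsub>B\<^esub> ?J"
        proof
          fix x assume x: "x \<in> carrier B"
          have "j \<star> x \<in> ?I" using x jB B.A_mult_closed j(3) by (auto simp: star_assoc[symmetric])
          moreover have "x - j \<star> x \<in> ?J"
            using x jB B.A_mult_closed j(3) by (auto simp: star_diff B.A_closed star_assoc[symmetric])
          moreover have "x = j \<star> x \<oplus>\<^bsub>B\<^esub> (x - j \<star> x)" by simp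
          ultimately show "x \<in> ?I <+>\<^bsub>B\<^esub> ?J" unfolding set_add_def' by blast
        qed
      qed
    qed
    then have "?I = {0} \<or> ?J = {0}" using ind by (auto simp: indecomposable_algebra_def)
    moreover have "j \<in> ?I" using jB j(3) by simp
    moreover have "b - j \<in> ?J"
      using jB j(3) B.A_one(1) one bcentral[OF j(1)] j(4) by (auto simp: B.A_closed star_diff)
    ultimately have "j \<in> {0} \<or> b - j \<in> {0}" by blast
    then show ?thesis by (metis eq_iff_diff_eq_0 singletonD)
  qed
  have "b \<noteq> 0"
  proof
    assume "b = 0"
    then have "I = {0}" using I_eq I.a_subset subI subspace_closed(1) by auto
    then show False using ind carr by (simp add: indecomposable_algebra_def)
  qed
  then show "block_idem H \<one>\<^bsub>B\<^esub>"
    unfolding block_idem_def one using bH bfix prim bx[OF b(1)] by blast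
qed

context finite_group
begin

text \<open>For a block idempotent b of kH this is the centre of the block kHb, since being fixed by
  conjugation with H means commuting with kH.\<close>

definition centre :: "'g set \<Rightarrow> ('g \<Rightarrow> 'k::field) \<Rightarrow> ('g \<Rightarrow> 'k) set" where
  "centre H b = {x \<in> supp_in H. (\<forall>h\<in>H. cj h x = x) \<and> b \<star> x = x}"

lemma block_idem_local:
  assumes H: "subgroup H G" and b: "block_idem H b"
  shows "local_subalgebra G (centre H b) b"
proof
  have HG: "H \<subseteq> carrier G" using H subgroup.subset by blast
  show "centre H b \<subseteq> supp_in (carrier G)" using supp_in_mono[OF HG] by (auto simp: centre_def)
  show "fv.subspace (centre H b)"
    using subspace_supp_in[of H] by (auto simp: centre_def fv.subspace_def star_distribs cj_lin_simps)
  show "x \<star> y \<in> centre H b" if "x \<in> centre H b" "y \<in> centre H b" for x y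
    using that HG star_supp[OF H] by (auto simp: centre_def cj_mult subset_iff star_assoc[symmetric])
  show "x \<star> y = y \<star> x" if "x \<in> centre H b" "y \<in> centre H b" for x y
    using that fixed_commute[OF HG, of y x] supp_in_mono[OF HG] by (auto simp: centre_def)
qed (use b in \<open>auto simp: block_idem_def centre_def\<close>)

section \<open>Relative traces\<close>

definition rtr :: "'g set \<Rightarrow> 'g set \<Rightarrow> ('g \<Rightarrow> 'k::field) \<Rightarrow> 'g \<Rightarrow> 'k" where
  "rtr K H y = (\<Sum>t\<in>tv K H. cj t y)"

lemma lin_rtr: "lin (rtr K H)"
  unfolding rtr_def using lin_cj by (intro lin_sum_fun)

lemma cj_coset:
  assumes "g \<in> carrier G" "h \<in> carrier G" "cj h y = y"
  shows "cj (g \<otimes> h) y = cj g y"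
  using assms by (simp add: cj_cj[symmetric])

lemma rtr_fixed:
  assumes K: "subgroup K G" and H: "subgroup H G" "H \<subseteq> K" and y: "\<And>h. h \<in> H \<Longrightarrow> cj h y = y" and k: "k \<in> K"
  shows "cj k (rtr K H y) = rtr K H y"
proof -
  have KG: "g \<in> carrier G" if "g \<in> K" for g using that K subgroup_in by auto
  have T: "t \<in> K" if "t \<in> tv K H" for t using tv(1)[OF K H(1)] that by (auto simp: transversal_def)
  have "cj k (rtr K H y) = (\<Sum>t\<in>tv K H. cj (k \<otimes> t) y)"
    unfolding rtr_def cj_lin_simps using k T KG by (intro sum.cong) (auto simp: cj_cj)
  also have "\<dots> = rtr K H y"
    unfolding rtr_def
    using KG H y by (intro sum_shift[OF K H tv(1)[OF K H(1)] k] cj_coset) auto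
  finally show ?thesis .
qed

lemma rtr_mult:
  assumes K: "subgroup K G" and H: "subgroup H G" and x: "\<And>k. k \<in> K \<Longrightarrow> cj k x = x"
  shows "x \<star> rtr K H y = rtr K H (x \<star> y)" "rtr K H y \<star> x = rtr K H (y \<star> x)"
proof -
  have T: "t \<in> K" "t \<in> carrier G" if "t \<in> tv K H" for t using tv(1)[OF K H] that subgroup_in[OF K] by (auto simp: transversal_def)
  show "x \<star> rtr K H y = rtr K H (x \<star> y)" "rtr K H y \<star> x = rtr K H (y \<star> x)"
    unfolding rtr_def star_sum using T x by (auto intro!: sum.cong simp: cj_mult)
qed

lemma rtr_tower:
  assumes K: "subgroup K G" and M: "subgroup M G" "M \<subseteq> K" and H: "subgroup H G" "H \<subseteq> M"
    and y: "\<And>h. h \<in> H \<Longrightarrow> cj h y = y"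
  shows "rtr K H y = rtr K M (rtr M H y)"
proof -
  have KG: "g \<in> carrier G" if "g \<in> K" for g using that K subgroup_in by auto
  have HK: "h \<in> K" if "h \<in> H" for h using that H M by auto
  have T: "t \<in> K" if "t \<in> tv K M" for t using tv(1)[OF K M(1)] that by (auto simp: transversal_def)
  have T': "t \<in> M" if "t \<in> tv M H" for t using tv(1)[OF M(1) H(1)] that by (auto simp: transversal_def)
  have "rtr K H y = (\<Sum>s\<in>tv K M. \<Sum>t\<in>tv M H. cj (s \<otimes> t) y)"
    unfolding rtr_def
    by (rule sum_tower[OF K M H tv(1)[OF K M(1)] tv(1)[OF M(1) H(1)] tv(1)[OF K H(1)]])
      (use KG HK y in \<open>auto intro: cj_coset\<close>)
  also have "\<dots> = rtr K M (rtr M H y)"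
    unfolding rtr_def cj_lin_simps
  proof (intro sum.cong refl)
    fix s t assume "s \<in> tv K M" "t \<in> tv M H"
    then have "s \<in> carrier G" "t \<in> carrier G" using T T' KG M by blast+
    then show "cj (s \<otimes> t) y = cj s (cj t y)" by (simp add: cj_cj)
  qed
  finally show ?thesis .
qed

lemma rtr_supp:
  assumes "subgroup K G" "subgroup H G"
  shows "rtr K H y \<in> supp_in (carrier G)"
  unfolding rtr_def by (intro supp_in_closed cj_in)

end

context modular_group
begin

section \<open>From relative traces to the defect group\<close>

lemma card_transversal:
  assumes "subgroup K G" "subgroup M G" "M \<subseteq> K"
  shows "card K = card (tv K M) * card M"
  using sum_cosets[OF assms, of "\<lambda>_. 1 :: nat"] by simp

lemma set_mult_iff: "x \<in> A <#> B \<longleftrightarrow> (\<exists>a\<in>A. \<exists>b\<in>B. x = a \<otimes> b)"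
  by (auto simp: set_mult_def)

lemma normal_conj: "P \<lhd> G \<Longrightarrow> g \<in> carrier G \<Longrightarrow> u \<in> P \<Longrightarrow> g \<otimes> u \<otimes> inv g \<in> P"
  by (rule normal.inv_op_closed2)

text \<open>For x in C_G(P) the coefficient of x in the conjugate of y by g depends only on the
  double coset PgD, which is gPD as P is normal. The sum over G/D therefore collects |P : P \<inter>
  D| equal terms for each coset of PD, and this index is a power of p greater than 1.\<close>

lemma cut_rtr_eq_0:
  fixes y :: "'g \<Rightarrow> 'k"
  assumes P: "P \<lhd> G" "card P = p ^ n" and D: "subgroup D G" and nsub: "\<not> P \<subseteq> D"
    and y: "\<And>d. d \<in> D \<Longrightarrow> cj d y = y"
  shows "cut (centralizer G P) (rtr (carrier G) D y) = 0"
proof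
  fix x
  have Ps: "subgroup P G" using P normal_imp_subgroup by blast
  have PG: "u \<in> carrier G" if "u \<in> P" for u using that subgroup_in[OF Ps] by blast
  have DG: "u \<in> carrier G" if "u \<in> D" for u using that subgroup_in[OF D] by blast
  define M where "M = P <#> D"
  have M: "subgroup M G" unfolding M_def by (rule mult_norm_subgroup[OF P(1) D])
  have DM: "D \<subseteq> M" using DG subgroup.one_closed[OF Ps] unfolding M_def set_mult_iff subset_iff by (metis l_one)
  have PM: "P \<subseteq> M" using PG subgroup.one_closed[OF D] unfolding M_def set_mult_iff subset_iff by (metis r_one)
  have PD: "subgroup (P \<inter> D) G" by (rule subgroups_Inter_pair[OF Ps D])
  have carr: "subgroup (carrier G) G" by (rule subgroup_self)
  show "cut (centralizer G P) (rtr (carrier G) D y) x = 0 x"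
  proof (cases "x \<in> centralizer G P")
    case False
    then show ?thesis by (simp add: cut_apply)
  next
    case True
    then have xG: "x \<in> carrier G" and xP: "x \<otimes> u = u \<otimes> x" if "u \<in> P" for u using that by (auto simp: centralizer_def)
    have xG: "x \<in> carrier G" using True by (auto simp: centralizer_def)
    define f where "f g = cj g y x" for g
    have f_right: "f (g \<otimes> d) = f g" if "g \<in> carrier G" "d \<in> D" for g d
      using that y DG by (simp add: f_def cj_coset)
    have f_left: "f (u \<otimes> g) = f g" if g: "g \<in> carrier G" and u: "u \<in> P" for g u
    proof -
      have "f (u \<otimes> g) = cj u (cj g y) x" using g PG[OF u] by (simp add: f_def cj_cj)
      also have "\<dots> = cj g y (inv u \<otimes> x \<otimes> u)" using PG[OF u] xG by (simp add: cj_apply)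
      also have "inv u \<otimes> x \<otimes> u = x" using xP[OF u] PG[OF u] xG by (simp add: m_assoc inv_cancel)
      finally show ?thesis by (simp add: f_def)
    qed
    \<comment> \<open>P/(P \<inter> D) represents PD/D, so the inner sum can run over elements of
      P.\<close>
    have T: "transversal (tv P (P \<inter> D)) M D"
    proof (rule transversal_second_iso[OF tv(1)[OF Ps PD] PM D Ps M])
      fix k assume "k \<in> M"
      then obtain u d where "u \<in> P" "d \<in> D" "k = u \<otimes> d" by (auto simp: M_def set_mult_iff)
      then show "\<exists>m\<in>P. inv m \<otimes> k \<in> D" using PG DG by (intro bexI[of _ u]) (auto simp: inv_cancel)
    qed
    obtain i where i: "card (tv P (P \<inter> D)) = p ^ i"
      using card_transversal[OF Ps PD] P(2) prime_p divides_primepow_nat by (metis dvd_triv_left inf_le1)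
    have "card (tv P (P \<inter> D)) \<noteq> 1"
    proof
      assume "card (tv P (P \<inter> D)) = 1"
      then have "card P = card (P \<inter> D)" using card_transversal[OF Ps PD] by simp
      then show False using card_subset_eq[OF fin_subgroup[OF Ps], of "P \<inter> D"] nsub by auto
    qed
    then have zero: "of_nat (card (tv P (P \<inter> D))) = (0 :: 'k)" using card_p_dvd i by blast
    have "(\<Sum>t\<in>tv (carrier G) D. f t) = (\<Sum>s\<in>tv (carrier G) M. \<Sum>t\<in>tv P (P \<inter> D). f (s \<otimes> t))"
      using subgroup.subset[OF M] DM f_right
      by (intro sum_tower[OF carr M _ D _ tv(1)[OF carr M] T tv(1)[OF carr D]]) auto
    also have "\<dots> = (\<Sum>s\<in>tv (carrier G) M. \<Sum>t\<in>tv P (P \<inter> D). f s)"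
    proof (intro sum.cong refl)
      fix s t assume "s \<in> tv (carrier G) M" "t \<in> tv P (P \<inter> D)"
      then have s: "s \<in> carrier G" and t: "t \<in> P" "t \<in> carrier G"
        using tv(1)[OF carr M] tv(1)[OF Ps PD] PG by (auto simp: transversal_def)
      have "f (s \<otimes> t) = f (s \<otimes> t \<otimes> inv s \<otimes> s)" using s t by (simp add: m_assoc)
      also have "\<dots> = f s" using s t normal_conj[OF P(1)] by (intro f_left)
      finally show "f (s \<otimes> t) = f s" .
    qed
    also have "\<dots> = 0" using zero by simp
    finally show ?thesis using True by (simp add: cut_apply rtr_def sum_fun_apply f_def)
  qed
qed

text \<open>Q is the stabiliser of g under conjugation by D, so the trace is the sum over the
  D-orbit of g. Only the coefficient at g and the support are recorded.\<close>

lemma orbit_sum: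
  fixes g :: 'g
  assumes D: "subgroup D G" and g: "g \<in> carrier G" and Q: "Q = D \<inter> centralizer G {g}"
  shows "(rtr D Q (dl g) :: 'g \<Rightarrow> 'k) g = 1"
    "(rtr D Q (dl g) :: 'g \<Rightarrow> 'k) x \<noteq> 0 \<Longrightarrow> \<exists>d\<in>D. x = d \<otimes> g \<otimes> inv d"
proof -
  have DG: "u \<in> carrier G" if "u \<in> D" for u using that subgroup_in[OF D] by blast
  have C: "subgroup (centralizer G {g}) G" using g by (intro centralizer_subgroup) auto
  have Qs: "subgroup Q G" unfolding Q by (rule subgroups_Inter_pair[OF D C])
  have T: "transversal (tv D Q) D Q" "\<one> \<in> tv D Q" using tv[OF D Qs] by auto
  have TD: "t \<in> D" if "t \<in> tv D Q" for t using T that by (auto simp: transversal_def)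
  have val: "(rtr D Q (dl g) :: 'g \<Rightarrow> 'k) y = (\<Sum>t\<in>tv D Q. if y = t \<otimes> g \<otimes> inv t then 1 else 0)" for y
    unfolding rtr_def sum_fun_apply using g TD DG by (intro sum.cong) (auto simp: cj_dl dl_apply)
  have t1: "t = \<one>" if t: "t \<in> tv D Q" "g = t \<otimes> g \<otimes> inv t" for t
  proof -
    have "t \<in> Q" using t TD[OF t(1)] DG g conj_eq_iff_commute[of t g] by (auto simp: Q centralizer_def)
    then have "inv t \<otimes> \<one> \<in> Q" using Qs DG[OF TD[OF t(1)]] by (simp add: subgroup.m_inv_closed)
    moreover have "inv \<one> \<otimes> \<one> \<in> Q" using Qs by (simp add: subgroup.one_closed)
    moreover have "\<exists>!s. s \<in> tv D Q \<and> inv s \<otimes> \<one> \<in> Q"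
      using T(1) subgroup.one_closed[OF D] by (simp add: transversal_def)
    ultimately show ?thesis using T(2) t(1) by blast
  qed
  have "(g = t \<otimes> g \<otimes> inv t) = (t = \<one>)" if "t \<in> tv D Q" for t
  proof
    show "g = t \<otimes> g \<otimes> inv t \<Longrightarrow> t = \<one>" by (rule t1[OF that])
    show "t = \<one> \<Longrightarrow> g = t \<otimes> g \<otimes> inv t" using g by simp
  qed
  then have "(rtr D Q (dl g) :: 'g \<Rightarrow> 'k) g = (\<Sum>t\<in>tv D Q. if t = \<one> then 1 else 0)"
    unfolding val by (intro sum.cong) auto
  also have "\<dots> = 1" using T(2) transversal_finite[OF D T(1)] by simp
  finally show "(rtr D Q (dl g) :: 'g \<Rightarrow> 'k) g = 1" .
  show "\<exists>d\<in>D. x = d \<otimes> g \<otimes> inv d" if "(rtr D Q (dl g) :: 'g \<Rightarrow> 'k) x \<noteq> 0"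
  proof (rule ccontr)
    assume "\<not> ?thesis"
    then have "(rtr D Q (dl g) :: 'g \<Rightarrow> 'k) x = 0" unfolding val using TD by (intro sum.neutral) auto
    then show False using that by simp
  qed
qed

text \<open>The index of a Sylow p-subgroup is invertible in k, and b divided by this index has
  trace b.\<close>

lemma rtr_sylow:
  fixes b :: "'g \<Rightarrow> 'k"
  assumes b: "b \<in> supp_in (carrier G)" "\<And>g. g \<in> carrier G \<Longrightarrow> cj g b = b"
  shows "\<exists>D n y. subgroup D G \<and> card D = p ^ n \<and> y \<in> supp_in (carrier G) \<and> (\<forall>d\<in>D. cj d y = y) \<and> b = rtr (carrier G) D y"
proof -
  have carr: "subgroup (carrier G) G" by (rule subgroup_self)
  have o0: "order G \<noteq> 0" using finG by (simp add: order_def) (use one_closed in blast)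
  obtain m where m: "order G = p ^ multiplicity p (order G) * m" "\<not> p dvd m"
    using multiplicity_decompose'[OF o0, of p] prime_p not_prime_unit by blast
  obtain D where D: "subgroup D G" "card D = p ^ multiplicity p (order G)"
    using sylow_thm[OF prime_p is_group m(1) finG] by blast
  have "card (tv (carrier G) D) * card D = m * card D"
    using card_transversal[OF carr D(1) subgroup.subset[OF D(1)]] m(1) D(2) by (metis mult.commute order_def)
  moreover have "card D \<noteq> 0" using D(2) prime_gt_0_nat[OF prime_p] by simp
  ultimately have card: "card (tv (carrier G) D) = m" by simp
  have m0: "of_nat m \<noteq> (0 :: 'k)" using m(2) char_p by (simp add: of_nat_eq_0_iff_char_dvd)
  let ?y = "smul (inverse (of_nat m)) b"
  have fixy: "cj g ?y = ?y" if "g \<in> carrier G" for g using b(2)[OF that] by (simp add: cj_lin_simps)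
  have "rtr (carrier G) D ?y = (\<Sum>t\<in>tv (carrier G) D. ?y)"
    unfolding rtr_def using tv(1)[OF carr D(1)] fixy by (intro sum.cong) (auto simp: transversal_def)
  also have "\<dots> = b" using m0 card by (simp add: fun_eq_iff sum_fun_apply)
  finally have "b = rtr (carrier G) D ?y" ..
  moreover have "?y \<in> supp_in (carrier G)" using b(1) by (rule supp_in_closed)
  moreover have "\<forall>d\<in>D. cj d ?y = ?y" using fixy subgroup_in[OF D(1)] by blast
  ultimately show ?thesis using D by blast
qed

text \<open>Take D of least order such that b is a trace from D, say of y. If b vanished on C_G(D),
  so would b y, and b y would be a combination of D-orbit sums of elements outside C_G(D). These are
  traces from proper subgroups of D. By minimality none of them contributes a unit to the local ring
  \<open>centre (carrier G) b\<close>, so their total, which is b, would not be a unit.\<close>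

lemma minimal_vertex:
  fixes b :: "'g \<Rightarrow> 'k"
  assumes b: "block_idem (carrier G) b"
  obtains D n y where "subgroup D G" "card D = p ^ n" "y \<in> supp_in (carrier G)" "\<And>d. d \<in> D \<Longrightarrow> cj d y = y"
    "b = rtr (carrier G) D y" "cut (centralizer G D) b \<noteq> 0"
proof -
  have carr: "subgroup (carrier G) G" by (rule subgroup_self)
  have bprops: "b \<in> supp_in (carrier G)" "b \<star> b = b" "\<And>g. g \<in> carrier G \<Longrightarrow> cj g b = b"
    using b by (auto simp: block_idem_def)
  interpret l: local_subalgebra G "centre (carrier G) b" b by (rule block_idem_local[OF carr b])
  define \<D> where "\<D> D \<longleftrightarrow> subgroup D G \<and> (\<exists>n. card D = p ^ n) \<and>
    (\<exists>y\<in>supp_in (carrier G). (\<forall>d\<in>D. cj d y = y) \<and> b = rtr (carrier G) D y)" for D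
  have "\<exists>D. \<D> D" using rtr_sylow[OF bprops(1,3)] unfolding \<D>_def by blast
  then obtain D where D: "\<D> D" and Dmin: "\<And>D'. \<D> D' \<Longrightarrow> card D \<le> card D'"
    using ex_has_least_nat[of \<D> _ card] by blast
  from D obtain n y where Ds: "subgroup D G" "card D = p ^ n" and y: "y \<in> supp_in (carrier G)" "\<And>d. d \<in> D \<Longrightarrow> cj d y = y"
    and by_eq: "b = rtr (carrier G) D y" unfolding \<D>_def by blast
  have DG: "D \<subseteq> carrier G" using subgroup.subset[OF Ds(1)] .
  have in_centre: "b \<star> rtr (carrier G) Q x \<in> centre (carrier G) b" if "subgroup Q G" "\<And>d. d \<in> Q \<Longrightarrow> cj d x = x" for Q x
    using that bprops rtr_fixed[OF carr that(1) subgroup.subset[OF that(1)] that(2)]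
    by (simp add: centre_def star_in cj_mult star_assoc[symmetric])
  \<comment> \<open>Induction on the size of the support; each step removes the D-orbit of one
    element.\<close>
  have not_unit: "\<not> l.unit (b \<star> rtr (carrier G) D x)"
    if "x \<in> supp_in (carrier G)" "\<And>d. d \<in> D \<Longrightarrow> cj d x = x" "cut (centralizer G D) x = 0" for x
    using that
  proof (induction "card {g. x g \<noteq> 0}" arbitrary: x rule: less_induct)
    case less
    show ?case
    proof (cases "x = 0")
      case True
      have "b \<star> rtr (carrier G) D x = 0" unfolding True lin_0[OF lin_rtr] by simp
      then show ?thesis using l.f_nonzero unfolding l.unit_def by (metis star_0(1))
    next
      case False
      then obtain g where g: "x g \<noteq> 0" by (auto simp: fun_eq_iff)
      have gG: "g \<in> carrier G" using g less.prems(1) by (auto simp: supp_in_def)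
      have gC: "g \<notin> centralizer G D" using g less.prems(3) by (metis cut_apply zero_fun_apply)
      define Q where "Q = D \<inter> centralizer G {g}"
      have Cg: "subgroup (centralizer G {g}) G" using gG by (intro centralizer_subgroup) auto
      have Q: "subgroup Q G" unfolding Q_def by (rule subgroups_Inter_pair[OF Ds(1) Cg])
      obtain u where "u \<in> D" "g \<otimes> u \<noteq> u \<otimes> g" using gC gG by (auto simp: centralizer_def)
      then have "u \<in> D" "u \<notin> Q" by (auto simp: Q_def centralizer_def)
      then have QD: "Q \<subset> D" by (auto simp: Q_def)
      have dlQ: "cj q (dl g) = (dl g :: 'g \<Rightarrow> 'k)" if "q \<in> Q" for q
        using that gG conj_eq_iff_commute[of q g] by (auto simp: Q_def centralizer_def cj_dl)
      let ?o = "rtr D Q (dl g) :: 'g \<Rightarrow> 'k"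
      have o_fix: "cj d ?o = ?o" if "d \<in> D" for d
        using rtr_fixed[OF Ds(1) Q _ dlQ that] QD by blast
      have o_supp: "?o \<in> supp_in (carrier G)" by (rule rtr_supp[OF Ds(1) Q])
      have x_orbit: "x (d \<otimes> g \<otimes> inv d) = x g" if d: "d \<in> D" for d
      proof -
        have dG: "d \<in> carrier G" using d DG by auto
        have "cj d x (d \<otimes> g \<otimes> inv d) = x (inv d \<otimes> (d \<otimes> g \<otimes> inv d) \<otimes> d)"
          using dG gG by (intro cj_apply) auto
        then show ?thesis using less.prems(2)[OF d] dG gG by (simp only: inv_cancel)
      qed
      define x' where "x' = x - smul (x g) ?o"
      have x'_in: "x' \<in> supp_in (carrier G)"
        unfolding x'_def using less.prems(1) o_supp by (intro supp_in_closed)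
      have x'_fix: "cj d x' = x'" if "d \<in> D" for d
        using less.prems(2)[OF that] o_fix[OF that] by (simp add: x'_def cj_lin_simps)
      have o_C: "?o z = 0" if z: "z \<in> centralizer G D" for z
      proof (rule ccontr)
        assume "?o z \<noteq> 0"
        then obtain d where d: "d \<in> D" "z = d \<otimes> g \<otimes> inv d" using orbit_sum(2)[OF Ds(1) gG Q_def] by blast
        have dG: "d \<in> carrier G" "inv d \<in> D" using d DG Ds(1) by (auto simp: subgroup.m_inv_closed)
        then have "z \<otimes> d = d \<otimes> z" using z d by (auto simp: centralizer_def)
        then have "g = z" using d dG gG by (simp add: m_assoc)
        then show False using z gC by simp
      qed
      have x'_C: "cut (centralizer G D) x' = 0"
      proof
        fix z
        have "cut (centralizer G D) x z = 0" unfolding less.prems(3) by simp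
        then show "cut (centralizer G D) x' z = 0 z"
          using o_C[of z] by (auto simp: cut_apply x'_def)
      qed
      have "{h. x' h \<noteq> 0} \<subset> {h. x h \<noteq> 0}"
      proof
        show "{h. x' h \<noteq> 0} \<subseteq> {h. x h \<noteq> 0}"
        proof
          fix h assume "h \<in> {h. x' h \<noteq> 0}"
          then have "x h \<noteq> 0 \<or> ?o h \<noteq> 0" by (auto simp: x'_def)
          then show "h \<in> {h. x h \<noteq> 0}"
            using orbit_sum(2)[OF Ds(1) gG Q_def, of h] x_orbit g by fastforce
        qed
        have "x' g = 0" using orbit_sum(1)[OF Ds(1) gG Q_def] by (simp add: x'_def)
        then show "{h. x' h \<noteq> 0} \<noteq> {h. x h \<noteq> 0}" using g by auto
      qed
      moreover have "finite {h. x h \<noteq> 0}"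
        by (rule finite_subset[OF _ finG]) (use less.prems(1) in \<open>auto simp: supp_in_def\<close>)
      ultimately have IH: "\<not> l.unit (b \<star> rtr (carrier G) D x')"
        using less.hyps[of x'] x'_in x'_fix x'_C psubset_card_mono by blast
      let ?z = "b \<star> rtr (carrier G) Q (smul (x g) (dl g))"
      have xo: "rtr (carrier G) D (smul (x g) ?o) = rtr (carrier G) Q (smul (x g) (dl g))"
        using rtr_tower[OF carr Ds(1) DG Q _ dlQ] QD by (simp add: lin_simps[OF lin_rtr] psubset_imp_subset)
      have "x = x' + smul (x g) ?o" by (simp add: x'_def)
      then have "b \<star> rtr (carrier G) D x = b \<star> rtr (carrier G) D x' + ?z"
        using xo by (metis lin_add[OF lin_rtr] star_add_right)
      \<comment> \<open>An inverse z' is fixed by G and can be moved into the trace. Then b is a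
        trace from Q, against the minimality of D.\<close>
      moreover have nz: "\<not> l.unit ?z"
      proof
        assume "l.unit ?z"
        then obtain z' where z': "z' \<in> centre (carrier G) b" "?z \<star> z' = b" by (auto simp: l.unit_def)
        have z'fix: "cj h z' = z'" if "h \<in> carrier G" for h using z' that by (auto simp: centre_def)
        let ?y = "b \<star> smul (x g) (dl g) \<star> z'"
        have "rtr (carrier G) Q ?y = b"
          using z'(2) rtr_mult(1)[OF carr Q bprops(3)] rtr_mult(2)[OF carr Q z'fix] by simp
        moreover have "cj q ?y = ?y" if q: "q \<in> Q" for q
        proof -
          have "q \<in> carrier G" using subgroup_in[OF Q q] .
          then show ?thesis using z'fix bprops(3) dlQ[OF q] by (simp add: cj_mult cj_lin_simps)
        qed
        ultimately have "\<D> Q"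
          unfolding \<D>_def using Q card_subgroup_p_power[OF Ds Q] QD star_in by (metis psubset_imp_subset)
        moreover have "card Q < card D" using QD fin_subgroup[OF Ds(1)] by (simp add: psubset_card_mono)
        ultimately show False using Dmin[of Q] by simp
      qed
      moreover have "?z \<in> centre (carrier G) b"
        using in_centre[OF Q, of "smul (x g) (dl g)"] dlQ by (simp add: cj_lin_simps)
      moreover have "b \<star> rtr (carrier G) D x' \<in> centre (carrier G) b"
        using in_centre[OF Ds(1), of x'] x'_fix by blast
      ultimately show ?thesis using l.unit_add IH by metis
    qed
  qed
  have "cut (centralizer G D) b \<noteq> 0"
  proof
    assume z: "cut (centralizer G D) b = 0"
    have bD: "cj d b = b" if "d \<in> D" for d using that DG bprops(3) by auto
    have "cut (centralizer G D) (b \<star> y) = cut (centralizer G D) b \<star> cut (centralizer G D) y"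
      by (rule brauer_mult[OF Ds bD y(2)])
    also have "\<dots> = 0" using z by simp
    finally have "\<not> l.unit (b \<star> rtr (carrier G) D (b \<star> y))"
      using DG y(2) bD by (intro not_unit) (auto simp: star_in cj_mult subset_iff)
    moreover have "b \<star> rtr (carrier G) D (b \<star> y) = b"
      using rtr_mult(1)[OF carr Ds(1) bprops(3), of y] by_eq bprops(2) by simp
    ultimately show False using l.f bprops(2) by (auto simp: l.unit_def)
  qed
  then show thesis using that Ds y by_eq by blast
qed

text \<open>The retraction \<tau> with \<tau> b = 1 splits the embedding of kQ that sends a to a b:
  the complement of kQb in B is the kernel of \<tau>.\<close>

lemma bimodule_summandI:
  fixes B :: "('k, 'g \<Rightarrow> 'k) module"
  assumes Q: "subgroup Q G" "card Q = p ^ n"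
    and b: "block_idem (carrier G) b" and B: "carrier B = {x \<in> supp_in (carrier G). b \<star> x = x}"
    and br: "cut (centralizer G Q) b \<noteq> 0"
  shows "bimodule_summand G B Q"
proof -
  have QG: "Q \<subseteq> carrier G" using subgroup.subset[OF Q(1)] .
  have QsG: "a \<in> supp_in (carrier G)" if "a \<in> supp_in Q" for a :: "'g \<Rightarrow> 'k" using that supp_in_mono[OF QG] by auto
  have bprops: "b \<in> supp_in (carrier G)" "b \<star> b = b" "\<And>g. g \<in> carrier G \<Longrightarrow> cj g b = b"
    using b by (auto simp: block_idem_def)
  have bQ: "cj q b = b" if "q \<in> Q" for q using that QG bprops(3) by auto
  have bx: "x \<star> b = b \<star> x" if "x \<in> supp_in (carrier G)" for x
    using fixed_commute[OF order_refl bprops(1) bprops(3) that] .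
  have "cut (centralizer G Q) b \<star> cut (centralizer G Q) b = cut (centralizer G Q) b"
    using brauer_mult[OF Q bQ bQ] bprops(2) by simp
  then obtain \<tau> where \<tau>: "lin \<tau>" "\<And>x. \<tau> x \<in> supp_in Q" "\<And>a x. a \<in> supp_in Q \<Longrightarrow> \<tau> (a \<star> x) = a \<star> \<tau> x"
    "\<And>a x. a \<in> supp_in Q \<Longrightarrow> \<tau> (x \<star> a) = \<tau> x \<star> a" "\<tau> b = dl \<one>"
    using bimodule_retraction[OF Q bprops(1) bQ _ br] by blast
  have \<tau>b: "\<tau> (a \<star> b) = a" if "a \<in> supp_in Q" for a
    using that \<tau>(3,5) QsG by (simp add: dl_one)
  interpret A: conv_algebra G "subgroup_algebra G (carrier G) :: ('k, 'g \<Rightarrow> 'k) module"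
    by (rule subgroup_conv_algebra[OF subgroup_self])
  have kG: "subgroup_algebra G (carrier G) = (group_algebra G :: ('k, 'g \<Rightarrow> 'k) module)" by simp
  let ?M = "(\<lambda>a. a \<star> b) ` supp_in Q" and ?N = "{x \<in> carrier B. \<tau> x = 0}"
  have xaB: "x \<star> a \<in> carrier B" "a \<star> x \<in> carrier B" if "x \<in> carrier B" "a \<in> supp_in (carrier G)" for x a
  proof -
    have "b \<star> (a \<star> x) = a \<star> (b \<star> x)" using bx[OF that(2)] by (simp add: star_assoc[symmetric])
    then show "a \<star> x \<in> carrier B" using that B by (simp add: star_in)
    have "b \<star> (x \<star> a) = x \<star> a" using that B by (simp add: star_assoc[symmetric])
    then show "x \<star> a \<in> carrier B" using that B by (simp add: star_in)
  qed
  have bB: "b \<in> carrier B" using B bprops by simp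
  have subB: "fv.subspace (carrier B)"
    unfolding B using subspace_supp_in[of "carrier G"] by (auto simp: fv.subspace_def star_distribs)
  have subM: "fv.subspace ?M"
  proof -
    have "lin (\<lambda>a. a \<star> b)" by (intro lin_intros)
    then interpret m: Vector_Spaces.linear smul smul "\<lambda>a. a \<star> b" .
    show ?thesis by (rule m.subspace_image[OF subspace_supp_in])
  qed
  have subN: "fv.subspace ?N"
    using subB by (auto simp: fv.subspace_def lin_simps[OF \<tau>(1)])
  have add_sub: "additive_subgroup X (group_algebra G)" if "fv.subspace X" "X \<subseteq> supp_in (carrier G)" for X :: "('g \<Rightarrow> 'k) set"
    using A.A_subgroupI[of X] that unfolding kG by (intro additive_subgroup.intro) simp
  show ?thesis
    unfolding bimodule_summand_def Let_def
  proof (intro exI conjI ballI)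
    show "subbimodule G Q ?M"
      unfolding subbimodule_def Let_def
    proof (intro conjI ballI)
      show "additive_subgroup ?M (group_algebra G)" using subM by (intro add_sub) (auto simp: star_in)
      fix a m :: "'g \<Rightarrow> 'k" assume "a \<in> carrier (subgroup_algebra G Q)" "m \<in> ?M"
      then obtain c where a: "a \<in> supp_in Q" and c: "c \<in> supp_in Q" "m = c \<star> b" by auto
      show "a \<star> m \<in> ?M" using a c star_supp[OF Q(1)] by (auto simp: star_assoc[symmetric])
      have "m \<star> a = (c \<star> a) \<star> b" using c bx[OF QsG[OF a]] by (simp add: star_assoc)
      then show "m \<star> a \<in> ?M" using a c star_supp[OF Q(1)] by auto
    qed
    show "subbimodule G Q ?N"
      unfolding subbimodule_def Let_def
    proof (intro conjI ballI)
      show "additive_subgroup ?N (group_algebra G)" using subN B by (intro add_sub) auto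
      fix a m :: "'g \<Rightarrow> 'k" assume "a \<in> carrier (subgroup_algebra G Q)" "m \<in> ?N"
      then show "a \<star> m \<in> ?N" "m \<star> a \<in> ?N" using \<tau>(3,4) xaB QsG by auto
    qed
    have z: "0 \<in> supp_in Q" "0 \<in> carrier B" using supp_in_closed(1) subspace_closed(1)[OF subB] by auto
    show "?M \<inter> ?N = {\<zero>\<^bsub>group_algebra G\<^esub>}"
    proof -
      have "0 = 0 \<star> b" by simp
      then have "0 \<in> ?M" using z(1) by (rule image_eqI)
      moreover have "0 \<in> ?N" using z(2) lin_0[OF \<tau>(1)] by simp
      moreover have "x = 0" if "x \<in> ?M" "x \<in> ?N" for x using that \<tau>b by auto
      ultimately show ?thesis by auto
    qed
    show "?M <+>\<^bsub>group_algebra G\<^esub> ?N = carrier B"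
    proof
      show "?M <+>\<^bsub>group_algebra G\<^esub> ?N \<subseteq> carrier B"
        using xaB(2)[OF bB] QsG subspace_closed(2)[OF subB] by (auto simp: set_add_def')
      show "carrier B \<subseteq> ?M <+>\<^bsub>group_algebra G\<^esub> ?N"
      proof
        fix x assume x: "x \<in> carrier B"
        have "\<tau> x \<star> b \<in> ?M" using \<tau>(2) by blast
        moreover have "x - \<tau> x \<star> b \<in> ?N"
          using x \<tau>b[OF \<tau>(2)] xaB(2)[OF bB QsG[OF \<tau>(2)]] subspace_closed(3)[OF subB] by (simp add: lin_simps[OF \<tau>(1)])
        moreover have "x = \<tau> x \<star> b \<oplus>\<^bsub>group_algebra G\<^esub> (x - \<tau> x \<star> b)" by simp
        ultimately show "x \<in> ?M <+>\<^bsub>group_algebra G\<^esub> ?N" unfolding set_add_def' by blast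
      qed
    qed
    show "bij_betw (\<lambda>a. a \<star> b) (carrier (subgroup_algebra G Q)) ?M"
      using \<tau>b by (auto simp: bij_betw_def intro!: inj_on_inverseI[of _ \<tau>])
    fix x y :: "'g \<Rightarrow> 'k" assume x: "x \<in> carrier (subgroup_algebra G Q)" and y: "y \<in> carrier (subgroup_algebra G Q)"
    show "(x \<oplus>\<^bsub>group_algebra G\<^esub> y) \<star> b = x \<star> b \<oplus>\<^bsub>group_algebra G\<^esub> y \<star> b" by (simp add: star_add_left)
    show "x \<star> y \<star> b = x \<star> (y \<star> b)" by (rule star_assoc)
    show "y \<star> x \<star> b = y \<star> b \<star> x" using bx[OF QsG, of x] x by (simp add: star_assoc)
  qed
qed

text \<open>A minimal \<open>p\<close>-subgroup \<open>D\<close> such that \<open>b\<close> is a trace from \<open>D\<close> contains \<open>P\<close>, because the trace from a subgroup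
  not containing \<open>P\<close> has no support in \<open>C\<^sub>G(P)\<close>; and \<open>kD\<close> is a summand of \<open>B\<close>, so \<open>D\<close> equals the defect group.\<close>

theorem defect_relative_trace:
  fixes B :: "('k, 'g \<Rightarrow> 'k) module"
  assumes b: "block_idem (carrier G) b" and B: "carrier B = {x \<in> supp_in (carrier G). b \<star> x = x}"
    and P: "P \<lhd> G" "defect_group p G B P" and br: "cut (centralizer G P) b \<noteq> 0"
  obtains y where "y \<in> supp_in (carrier G)" "\<And>u. u \<in> P \<Longrightarrow> cj u y = y" "b = rtr (carrier G) P y"
proof -
  obtain D n y where D: "subgroup D G" "card D = p ^ n" "y \<in> supp_in (carrier G)" "\<And>d. d \<in> D \<Longrightarrow> cj d y = y"
    "b = rtr (carrier G) D y" "cut (centralizer G D) b \<noteq> 0"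
    using minimal_vertex[OF b] by blast
  obtain m where m: "card P = p ^ m" using P(2) by (auto simp: defect_group_def p_subgroup_def)
  have "P \<subseteq> D" using cut_rtr_eq_0[OF P(1) m D(1) _ D(4)] br D(5) by blast
  moreover have "p_subgroup p G D" using D by (auto simp: p_subgroup_def)
  moreover have "bimodule_summand G B D" by (rule bimodule_summandI[OF D(1,2) b B D(6)])
  ultimately have "D = P" using P(2) by (auto simp: defect_group_def)
  then show thesis using that D by blast
qed

end

section \<open>Blocks with a normal defect group\<close>

text \<open>That P is a defect group is recorded in the form \<open>trace_b\<close>, which
  \<open>defect_relative_trace\<close> provides.\<close>

locale normal_block = modular_group G scalars p
  for G :: "('g, 'm) monoid_scheme" (structure) and scalars :: "'k::field itself" and p +
  fixes P :: "'g set" and b e :: "'g \<Rightarrow> 'k" and n :: nat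
  assumes P_normal: "P \<lhd> G" and P_card: "card P = p ^ n"
    and b_block: "block_idem (carrier G) b" and e_block: "block_idem (centralizer G P) e"
    and brauer_be: "cut (centralizer G P) b \<star> e \<noteq> 0"
    and trace_b: "\<exists>y\<in>supp_in (carrier G). (\<forall>u\<in>P. cj u y = y) \<and> b = rtr (carrier G) P y"
begin

abbreviation C :: "'g set" where "C \<equiv> centralizer G P"

text \<open>As P is normal in G, this is the stabiliser of the pair (P, e); see
  \<open>pair_stabilizer_eq\<close>.\<close>

definition N :: "'g set" where "N = {g \<in> carrier G. cj g e = e}"

lemma P_sub: "subgroup P G" using P_normal normal_imp_subgroup by blast
lemma P_carrier: "P \<subseteq> carrier G" using subgroup.subset[OF P_sub] .
lemma C_sub: "subgroup C G" by (rule centralizer_subgroup[OF P_carrier])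
lemma C_carrier: "C \<subseteq> carrier G" using subgroup.subset[OF C_sub] .
lemma G_sub: "subgroup (carrier G) G" by (rule subgroup_self)

lemma PG: "u \<in> P \<Longrightarrow> u \<in> carrier G" using P_carrier by blast
lemma CG: "u \<in> C \<Longrightarrow> u \<in> carrier G" using C_carrier by blast

lemma C_commute: "c \<in> C \<Longrightarrow> u \<in> P \<Longrightarrow> c \<otimes> u = u \<otimes> c"
  by (auto simp: centralizer_def)

lemma P_conj: "g \<in> carrier G \<Longrightarrow> u \<in> P \<Longrightarrow> g \<otimes> u \<otimes> inv g \<in> P"
  by (rule normal_conj[OF P_normal])

lemma P_conj': "g \<in> carrier G \<Longrightarrow> u \<in> P \<Longrightarrow> inv g \<otimes> u \<otimes> g \<in> P"
  using P_conj[of "inv g" u] by simp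

lemma C_conj:
  assumes g: "g \<in> carrier G" and c: "c \<in> C"
  shows "g \<otimes> c \<otimes> inv g \<in> C"
  unfolding centralizer_def
proof (intro CollectI conjI ballI)
  show "g \<otimes> c \<otimes> inv g \<in> carrier G" using g CG[OF c] by simp
  fix u assume u: "u \<in> P"
  have "inv g \<otimes> u \<otimes> g \<in> P" using P_conj' g u by blast
  then have "c \<otimes> (inv g \<otimes> u \<otimes> g) = inv g \<otimes> u \<otimes> g \<otimes> c" using C_commute c by blast
  then have "g \<otimes> (c \<otimes> (inv g \<otimes> u \<otimes> g)) \<otimes> inv g = g \<otimes> (inv g \<otimes> u \<otimes> g \<otimes> c) \<otimes> inv g" by simp
  then show "g \<otimes> c \<otimes> inv g \<otimes> u = u \<otimes> (g \<otimes> c \<otimes> inv g)"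
    using g PG[OF u] CG[OF c] by (simp add: m_assoc inv_cancel)
qed

lemma C_conj_iff: "g \<in> carrier G \<Longrightarrow> x \<in> carrier G \<Longrightarrow> inv g \<otimes> x \<otimes> g \<in> C \<longleftrightarrow> x \<in> C"
  using C_conj[of g "inv g \<otimes> x \<otimes> g"] C_conj[of "inv g" x] by (auto simp: inv_cancel)

lemma cj_C: "g \<in> carrier G \<Longrightarrow> a \<in> supp_in C \<Longrightarrow> cj g a \<in> supp_in C"
  using C_conj_iff by (intro cj_supp) auto

lemma supp_C: "a \<in> supp_in C \<Longrightarrow> a \<in> supp_in (carrier G)"
  using supp_in_mono[OF C_carrier] by blast

lemma supp_P: "a \<in> supp_in P \<Longrightarrow> a \<in> supp_in (carrier G)"
  using supp_in_mono[OF P_carrier] by blast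

lemma PC_commute:
  assumes "a \<in> supp_in P" "x \<in> supp_in C"
  shows "x \<star> a = a \<star> x"
proof (rule lin_eq_on[OF fin_sub[OF C_carrier] _ _ _ assms(2)])
  show "lin (\<lambda>x. x \<star> a)" "lin ((\<star>) a)" by (intro lin_intros)+
  show "dl g \<star> a = a \<star> dl g" if "g \<in> C" for g by (rule centralizer_commute_cj[OF P_carrier that assms(1)])
qed

lemma cj_PC: "u \<in> P \<Longrightarrow> x \<in> supp_in C \<Longrightarrow> cj u x = x"
  using PC_commute[OF dl_in[of u P]] PG supp_C by (intro commute_fixed) auto

lemma b_in: "b \<in> supp_in (carrier G)" and b_idem: "b \<star> b = b" and b_fixed: "g \<in> carrier G \<Longrightarrow> cj g b = b"
  using b_block by (auto simp: block_idem_def)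

lemma e_in: "e \<in> supp_in C" and e_idem: "e \<star> e = e" and e_fixed: "c \<in> C \<Longrightarrow> cj c e = e" and e_nonzero: "e \<noteq> 0"
  using e_block by (auto simp: block_idem_def)

lemma e_supp: "e \<in> supp_in (carrier G)" using e_in supp_C by blast

lemma e_commute_C: "x \<in> supp_in C \<Longrightarrow> x \<star> e = e \<star> x"
  by (rule fixed_commute[OF C_carrier e_supp e_fixed])

lemma b_commute: "x \<in> supp_in (carrier G) \<Longrightarrow> x \<star> b = b \<star> x"
  by (rule fixed_commute[OF order_refl b_in b_fixed])

text \<open>The difference \<open>x\<close> of the two sides satisfies \<open>x\<^sup>3 = x\<close> and kills all \<open>P\<close>-fixed vectors, so it vanishes.\<close>

lemma b_supp_C: "cut C b = b"
proof -
  define b' where "b' = cut C b"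
  have b'_fixed: "cj g b' = b'" if "g \<in> carrier G" for g
    using cut_cj[OF that C_carrier C_conj_iff[OF that], of b] b_fixed[OF that] by (simp add: b'_def)
  have b'_idem: "b' \<star> b' = b'"
    using brauer_mult[OF P_sub P_card, of b b] b_fixed PG b_idem by (simp add: b'_def)
  have b'_in: "b' \<in> supp_in (carrier G)" unfolding b'_def by (rule supp_C[OF cut_in])
  define x where "x = b - b'"
  have x_in: "x \<in> supp_in (carrier G)" unfolding x_def using b_in b'_in by (rule supp_in_closed)
  have x_fixed: "cj g x = x" if "g \<in> carrier G" for g
    using that b_fixed b'_fixed by (simp add: x_def cj_lin_simps)
  have x_C: "x g = 0" if "g \<in> C" for g using that by (simp add: x_def b'_def cut_apply)
  \<comment> \<open>For commuting idempotents b and b', the square of b - b' is b + b' - 2bb', and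
    multiplying once more by b - b' gives b - b' back.\<close>
  have xxx: "x \<star> (x \<star> (x \<star> a)) = x \<star> a" for a
  proof -
    have bb': "b' \<star> b = b \<star> b'" by (rule b_commute[OF b'_in])
    have 1: "b \<star> (b \<star> a) = b \<star> a" "b' \<star> (b' \<star> a) = b' \<star> a" "b' \<star> (b \<star> a) = b \<star> (b' \<star> a)" for a
      using b_idem b'_idem bb' by (simp_all add: star_assoc[symmetric])
    have xA: "x \<star> (b \<star> a) = b \<star> a - b \<star> (b' \<star> a)" and xE: "x \<star> (b' \<star> a) = b \<star> (b' \<star> a) - b' \<star> a"
      and xD: "x \<star> (b \<star> (b' \<star> a)) = 0" and xa: "x \<star> a = b \<star> a - b' \<star> a"
      by (simp_all add: x_def star_diff 1)
    have "x \<star> (x \<star> (x \<star> a)) = b \<star> a - b \<star> (b' \<star> a) - 0 - (0 - (b \<star> (b' \<star> a) - b' \<star> a))"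
      by (simp only: xa star_diff(2) xA xE xD)
    then show ?thesis by (simp add: xa)
  qed
  \<comment> \<open>x v is the sum of the x(g) g v. Replacing g by u g u^-1 with u in P changes
    neither factor, because u g u^-1 = g (g^-1 u g u^-1) and the bracket lies in P, which fixes v.
    So only g in C_G(P) remain, and x is zero there.\<close>
  have kill: "x \<star> v = 0" if v: "\<And>u. u \<in> P \<Longrightarrow> dl u \<star> v = v" for v
  proof
    fix z
    have "x \<star> v = (\<Sum>g\<in>carrier G. smul (x g) (dl g)) \<star> v" using expand_dl[OF finG x_in] by simp
    also have "\<dots> = (\<Sum>g\<in>carrier G. smul (x g) (dl g \<star> v))" by (simp add: star_sum star_smul_left)
    finally have "(x \<star> v) z = (\<Sum>g\<in>carrier G. x g * (dl g \<star> v) z)" by (simp add: sum_fun_apply)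
    also have "\<dots> = (\<Sum>g\<in>{g \<in> carrier G. \<forall>u\<in>carrier (G\<lparr>carrier := P\<rparr>). u \<otimes> g \<otimes> inv u = g}. x g * (dl g \<star> v) z)"
    proof (rule sum_fixed_points[OF subgroup_group[OF P_sub] prime_p char_p _ finG])
      show "card (carrier (G\<lparr>carrier := P\<rparr>)) = p ^ n" using P_card by simp
      fix u g assume "u \<in> carrier (G\<lparr>carrier := P\<rparr>)" and g: "g \<in> carrier G"
      then have u: "u \<in> P" "u \<in> carrier G" using PG by auto
      show "u \<otimes> g \<otimes> inv u \<in> carrier G" using u g by simp
      have "cj u x (u \<otimes> g \<otimes> inv u) = x (inv u \<otimes> (u \<otimes> g \<otimes> inv u) \<otimes> u)"
        using u g by (intro cj_apply) auto
      then have 1: "x (u \<otimes> g \<otimes> inv u) = x g" using x_fixed[OF u(2)] u g by (simp only: inv_cancel)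
      have "u \<otimes> g \<otimes> inv u = g \<otimes> (inv g \<otimes> u \<otimes> g \<otimes> inv u)" using u g by (simp add: m_assoc inv_cancel)
      moreover have "inv g \<otimes> u \<otimes> g \<otimes> inv u \<in> P"
        using P_conj'[OF g u(1)] u P_sub by (simp add: subgroup.m_closed subgroup.m_inv_closed)
      ultimately have "dl (u \<otimes> g \<otimes> inv u) \<star> v = dl g \<star> v"
        using v[of "inv g \<otimes> u \<otimes> g \<otimes> inv u"] g PG dl_mult_star[of g "inv g \<otimes> u \<otimes> g \<otimes> inv u" v] by simp
      then show "x (u \<otimes> g \<otimes> inv u) * (dl (u \<otimes> g \<otimes> inv u) \<star> v) z = x g * (dl g \<star> v) z" using 1 by simp
    qed (use PG in \<open>auto simp: m_assoc inv_mult_group\<close>)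
    also have "\<dots> = 0"
    proof (rule sum.neutral, rule ballI)
      fix g assume "g \<in> {g \<in> carrier G. \<forall>u\<in>carrier (G\<lparr>carrier := P\<rparr>). u \<otimes> g \<otimes> inv u = g}"
      then have "g \<in> C" using PG conj_eq_iff_commute by (auto simp: centralizer_def)
      then show "x g * (dl g \<star> v) z = 0" using x_C by simp
    qed
    finally show "(x \<star> v) z = 0 z" by simp
  qed
  have "x = 0"
  proof (rule ccontr)
    assume x0: "x \<noteq> 0"
    let ?V = "range ((\<star>) x)"
    have "lin ((\<star>) x)" by (intro lin_intros)
    then interpret m: Vector_Spaces.linear smul smul "(\<star>) x" .
    have "\<exists>v\<in>?V. v \<noteq> 0 \<and> (\<forall>g\<in>P. dl g \<star> v = v)"
    proof (rule fixed_vector[OF P_sub P_card])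
      show "fv.subspace ?V" by (rule m.subspace_image[OF fv.subspace_UNIV])
      show "?V \<subseteq> supp_in (carrier G)" by (auto simp: star_in)
      have "x = x \<star> dl \<one>" using x_in by (simp add: dl_one)
      then show "x \<in> ?V" by (rule range_eqI[of _ _ "dl \<one>"])
      show "x \<noteq> 0" by (rule x0)
      fix u v assume u: "u \<in> P" and "v \<in> ?V"
      then obtain a where a: "v = x \<star> a" by blast
      have "dl u \<star> x = x \<star> dl u" using cj_eq_iff[OF PG[OF u] x_in] x_fixed PG[OF u] by blast
      then have "dl u \<star> v = x \<star> (dl u \<star> a)" using a by (simp add: star_assoc[symmetric])
      then show "dl u \<star> v \<in> ?V" by (rule range_eqI[of _ _ "dl u \<star> a"])
    qed
    then obtain a where a: "x \<star> a \<noteq> 0" "\<And>u. u \<in> P \<Longrightarrow> dl u \<star> (x \<star> a) = x \<star> a" by blast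
    have "x \<star> (x \<star> a) = 0" by (rule kill[OF a(2)])
    then show False using xxx[of a] a(1) by (metis star_0(2))
  qed
  then show ?thesis by (simp add: x_def b'_def)
qed

lemma b_in_C: "b \<in> supp_in C" using cut_in[of C b] b_supp_C by simp

lemma e_primitive: "j \<in> supp_in C \<Longrightarrow> (\<And>c. c \<in> C \<Longrightarrow> cj c j = j) \<Longrightarrow> j \<star> j = j \<Longrightarrow> e \<star> j = j \<Longrightarrow> j = 0 \<or> j = e"
  using e_block unfolding block_idem_def by blast

text \<open>b has support in C, so b e is an idempotent of the centre of kCe. Hence it is 0 or e,
  and \<open>brauer_be\<close> excludes 0.\<close>

lemma be: "b \<star> e = e" "e \<star> b = e"
proof -
  have comm: "e \<star> b = b \<star> e" by (rule b_commute[OF e_supp])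
  have "b \<star> e = 0 \<or> b \<star> e = e"
  proof (rule e_primitive)
    show "b \<star> e \<in> supp_in C" by (rule star_supp[OF C_sub b_in_C e_in])
    show "cj c (b \<star> e) = b \<star> e" if "c \<in> C" for c using that CG b_fixed e_fixed by (simp add: cj_mult)
    have "b \<star> e \<star> (b \<star> e) = b \<star> (e \<star> b) \<star> e" by (simp add: star_assoc)
    also have "\<dots> = b \<star> b \<star> (e \<star> e)" using comm by (simp add: star_assoc)
    finally show "b \<star> e \<star> (b \<star> e) = b \<star> e" by (simp add: b_idem e_idem)
    show "e \<star> (b \<star> e) = b \<star> e" using comm e_idem by (simp add: star_assoc[symmetric]) (simp add: star_assoc)
  qed
  then show "b \<star> e = e" using brauer_be b_supp_C by simp
  then show "e \<star> b = e" using comm by simp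
qed

section \<open>The conjugates of e, and b as their sum\<close>

lemma cj_e_fixed:
  assumes g: "g \<in> carrier G" and c: "c \<in> C"
  shows "cj c (cj g e) = cj g e"
proof -
  have "c \<otimes> g = g \<otimes> (inv g \<otimes> c \<otimes> g)" using g CG[OF c] by (simp add: m_assoc inv_cancel)
  moreover have "inv g \<otimes> c \<otimes> g \<in> C" using C_conj[of "inv g" c] g c by simp
  ultimately show ?thesis using g CG c e_fixed by (simp add: cj_cj cj_coset)
qed

lemma e_cj_e:
  assumes g: "g \<in> carrier G"
  shows "e \<star> cj g e = 0 \<or> e \<star> cj g e = e"
proof (rule e_primitive)
  have g_in: "cj g e \<in> supp_in C" by (rule cj_C[OF g e_in])
  show "e \<star> cj g e \<in> supp_in C" by (rule star_supp[OF C_sub e_in g_in])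
  show "cj c (e \<star> cj g e) = e \<star> cj g e" if "c \<in> C" for c
    using that CG e_fixed cj_e_fixed[OF g] by (simp add: cj_mult)
  have "e \<star> cj g e \<star> (e \<star> cj g e) = e \<star> (cj g e \<star> e) \<star> cj g e" by (simp add: star_assoc)
  also have "\<dots> = (e \<star> e) \<star> (cj g e \<star> cj g e)" using e_commute_C[OF g_in] by (simp add: star_assoc)
  also have "\<dots> = e \<star> cj g e" using g e_idem by (simp add: cj_mult[symmetric])
  finally show "e \<star> cj g e \<star> (e \<star> cj g e) = e \<star> cj g e" .
  show "e \<star> (e \<star> cj g e) = e \<star> cj g e" using e_idem by (simp add: star_assoc[symmetric])
qed

text \<open>By primitivity the product is 0 or e. If it is e, conjugating back shows e f = f for f =
  \<open>cj (inv g) e\<close>. As f is not 0, the same dichotomy gives f = e f = e, so g lies in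
  N.\<close>

lemma e_orthogonal:
  assumes g: "g \<in> carrier G" "g \<notin> N"
  shows "e \<star> cj g e = 0"
proof (rule ccontr)
  assume "e \<star> cj g e \<noteq> 0"
  then have 1: "e \<star> cj g e = e" using e_cj_e[OF g(1)] by blast
  have ig: "inv g \<in> carrier G" using g by simp
  have "cj (inv g) e = cj (inv g) (e \<star> cj g e)" using 1 by simp
  also have "\<dots> = cj (inv g) e \<star> e" using g by (simp add: cj_mult cj_cj cj_one e_supp)
  also have "\<dots> = e \<star> cj (inv g) e" by (rule e_commute_C[OF cj_C[OF ig e_in]])
  finally have 2: "cj (inv g) e = e \<star> cj (inv g) e" .
  have "cj (inv g) e \<noteq> 0"
  proof
    assume "cj (inv g) e = 0"
    then have "cj g (cj (inv g) e) = 0" using cj_lin_simps(3) by metis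
    then show False using g e_nonzero by (simp add: cj_cj cj_one e_supp)
  qed
  then have "cj (inv g) e = e" using 2 e_cj_e[OF ig] by metis
  then have "cj g e = e" using g by (metis cj_cj cj_one e_supp ig r_inv)
  then show False using g by (simp add: N_def)
qed

lemma N_sub: "subgroup N G"
proof (rule subgroupI)
  show "N \<subseteq> carrier G" by (auto simp: N_def)
  have "\<one> \<in> N" by (simp add: N_def cj_one e_supp)
  then show "N \<noteq> {}" by blast
  show "inv a \<in> N" if "a \<in> N" for a
    using that cj_inv_eq[of a e e] e_supp by (auto simp: N_def)
  show "a \<otimes> c \<in> N" if "a \<in> N" "c \<in> N" for a c
    using that by (auto simp: N_def cj_cj[symmetric])
qed

lemma NG: "g \<in> N \<Longrightarrow> g \<in> carrier G" by (simp add: N_def)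
lemma N_carrier: "N \<subseteq> carrier G" using NG by blast
lemma e_N: "g \<in> N \<Longrightarrow> cj g e = e" by (simp add: N_def)
lemma C_N: "C \<subseteq> N" using CG e_fixed by (auto simp: N_def)
lemma P_N: "P \<subseteq> N" using PG cj_PC[OF _ e_in] by (auto simp: N_def)

lemma e_commute_N: "x \<in> supp_in N \<Longrightarrow> x \<star> e = e \<star> x"
  by (rule fixed_commute[OF N_carrier e_supp e_N])

lemma e_commute_P: "x \<in> supp_in P \<Longrightarrow> x \<star> e = e \<star> x"
  using PC_commute e_in by metis

lemma e_rtr_e: "e \<star> rtr (carrier G) N e = e"
proof -
  have T: "transversal (tv (carrier G) N) (carrier G) N" "\<one> \<in> tv (carrier G) N" using tv[OF G_sub N_sub] by auto
  have "e \<star> cj t e = (if t = \<one> then e else 0)" if t: "t \<in> tv (carrier G) N" for t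
  proof (cases "t = \<one>")
    case True
    then show ?thesis using e_idem by (simp add: cj_one e_supp)
  next
    case False
    have tG: "t \<in> carrier G" using t T by (auto simp: transversal_def)
    have "t \<notin> N"
    proof
      assume "t \<in> N"
      then have "inv t \<otimes> \<one> \<in> N" "inv \<one> \<otimes> \<one> \<in> N" using N_sub tG by (simp_all add: subgroup.m_inv_closed subgroup.one_closed)
      moreover have "\<exists>!s. s \<in> tv (carrier G) N \<and> inv s \<otimes> \<one> \<in> N" using T(1) by (simp add: transversal_def)
      ultimately show False using T(2) t False by blast
    qed
    then show ?thesis using e_orthogonal[OF tG] False by simp
  qed
  then have "e \<star> rtr (carrier G) N e = (\<Sum>t\<in>tv (carrier G) N. if t = \<one> then e else 0)"
    unfolding rtr_def star_sum by (intro sum.cong) auto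
  then show ?thesis using T(2) transversal_finite[OF G_sub T(1)] by simp
qed

text \<open>The trace of e is a central idempotent of kG below b, and it is not 0 because its
  product with e is e. Now b is primitive.\<close>

lemma b_eq: "b = rtr (carrier G) N e"
proof -
  let ?b = "rtr (carrier G) N e"
  have fixed: "cj g ?b = ?b" if "g \<in> carrier G" for g
    using rtr_fixed[OF G_sub N_sub N_carrier e_N that] .
  have "?b \<star> ?b = rtr (carrier G) N (e \<star> ?b)" by (rule rtr_mult(2)[OF G_sub N_sub fixed])
  then have "?b \<star> ?b = ?b" by (simp add: e_rtr_e)
  moreover have "b \<star> ?b = ?b" using rtr_mult(1)[OF G_sub N_sub b_fixed, of e] be by simp
  moreover have "?b \<in> supp_in (carrier G)" by (rule rtr_supp[OF G_sub N_sub])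
  ultimately have "?b = 0 \<or> ?b = b" using b_block fixed unfolding block_idem_def by blast
  moreover have "?b \<noteq> 0" using e_rtr_e e_nonzero by (metis star_0(2))
  ultimately show ?thesis by simp
qed

text \<open>Cutting y down to C shows that b is the trace of some z in kC; multiplying by e gives e
  as the sum over G/P of e (g z g^-1). The summands are constant on the cosets of the normal
  subgroup P. Take as representatives the inverses of s m with s in G/N and m in N/P: since m fixes
  e, the part belonging to m is the conjugate by m^-1 of one element w, the sum over s. A second
  inversion, in N/P, turns this into a trace.\<close>

lemma relative_trace_e:
  obtains w where "w \<in> supp_in C" "e \<star> w = w" "rtr N P w = e"
proof -
  obtain y where y: "y \<in> supp_in (carrier G)" "\<And>u. u \<in> P \<Longrightarrow> cj u y = y" "b = rtr (carrier G) P y"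
    using trace_b by blast
  define z where "z = cut C y"
  have z_in: "z \<in> supp_in C" by (simp add: z_def cut_in)
  have z_P: "cj u z = z" if "u \<in> P" for u by (rule cj_PC[OF that z_in])
  have TP: "t \<in> carrier G" if "t \<in> tv (carrier G) P" for t using tv(1)[OF G_sub P_sub] that by (auto simp: transversal_def)
  have bz: "b = rtr (carrier G) P z"
  proof -
    have "b = cut C (rtr (carrier G) P y)" using y(3) b_supp_C by simp
    also have "\<dots> = (\<Sum>t\<in>tv (carrier G) P. cut C (cj t y))" unfolding rtr_def by (rule lin_sum[OF lin_cut])
    also have "\<dots> = rtr (carrier G) P z"
      unfolding rtr_def z_def using TP cut_cj[OF _ C_carrier C_conj_iff] by (intro sum.cong) auto
    finally show ?thesis .
  qed
  define F where "F g = e \<star> cj g z" for g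
  have F_right: "F (g \<otimes> u) = F g" if "g \<in> carrier G" "u \<in> P" for g u
    using that z_P PG by (simp add: F_def cj_coset)
  have F_left: "F (u \<otimes> g) = F g" if "g \<in> carrier G" "u \<in> P" for g u
  proof -
    have "u \<otimes> g = g \<otimes> (inv g \<otimes> u \<otimes> g)" using that PG by (simp add: m_assoc inv_cancel)
    then show ?thesis using F_right[of g "inv g \<otimes> u \<otimes> g"] that P_conj' by simp
  qed
  define w where "w = (\<Sum>s\<in>tv (carrier G) N. F (inv s))"
  have TN: "t \<in> carrier G" if "t \<in> tv (carrier G) N" for t using tv(1)[OF G_sub N_sub] that by (auto simp: transversal_def)
  have TNP: "t \<in> N" if "t \<in> tv N P" for t using tv(1)[OF N_sub P_sub] that by (auto simp: transversal_def)
  have F_C: "F g \<in> supp_in C" if "g \<in> carrier G" for g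
    unfolding F_def by (intro star_supp[OF C_sub e_in] cj_C that z_in)
  have w_in: "w \<in> supp_in C" unfolding w_def using TN F_C by (intro supp_in_closed) auto
  have ew: "e \<star> w = w" unfolding w_def star_sum F_def star_assoc[symmetric] e_idem ..
  have "e = (\<Sum>t\<in>tv (carrier G) P. F t)"
    using be(2) bz by (simp add: F_def rtr_def star_sum)
  also have "\<dots> = (\<Sum>t\<in>tv (carrier G) P. F (inv t))"
    by (rule sum_inv[OF G_sub tv(1)[OF G_sub P_sub] P_sub P_carrier P_conj F_right, symmetric])
  also have "\<dots> = (\<Sum>s\<in>tv (carrier G) N. \<Sum>m\<in>tv N P. F (inv (s \<otimes> m)))"
  proof (rule sum_tower[OF G_sub N_sub N_carrier P_sub P_N tv(1)[OF G_sub N_sub] tv(1)[OF N_sub P_sub] tv(1)[OF G_sub P_sub]])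
    fix g u assume "g \<in> carrier G" "u \<in> P"
    then show "F (inv (g \<otimes> u)) = F (inv g)"
      using F_left[of "inv g" "inv u"] PG P_sub by (simp add: inv_mult_group subgroup.m_inv_closed)
  qed
  also have "\<dots> = (\<Sum>m\<in>tv N P. \<Sum>s\<in>tv (carrier G) N. F (inv (s \<otimes> m)))" by (rule sum.swap)
  also have "\<dots> = (\<Sum>m\<in>tv N P. cj (inv m) w)"
  proof (rule sum.cong[OF refl])
    fix m assume "m \<in> tv N P"
    then have m: "m \<in> carrier G" "inv m \<in> carrier G" "cj (inv m) e = e"
      using TNP NG e_N N_sub by (auto simp: subgroup.m_inv_closed)
    have "F (inv (s \<otimes> m)) = cj (inv m) (F (inv s))" if "s \<in> tv (carrier G) N" for s
      using m TN[OF that] by (simp add: F_def cj_mult cj_cj inv_mult_group)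
    then show "(\<Sum>s\<in>tv (carrier G) N. F (inv (s \<otimes> m))) = cj (inv m) w"
      unfolding w_def cj_lin_simps by (intro sum.cong) auto
  qed
  also have "\<dots> = (\<Sum>m\<in>tv N P. cj m w)"
  proof (rule sum_inv[OF N_sub tv(1)[OF N_sub P_sub] P_sub P_N])
    show "k \<otimes> h \<otimes> inv k \<in> P" if "k \<in> N" "h \<in> P" for k h using that P_conj NG by blast
    show "cj (g \<otimes> h) w = cj g w" if "g \<in> N" "h \<in> P" for g h
      using that NG PG cj_PC[OF _ w_in] by (intro cj_coset) auto
  qed
  finally have "rtr N P w = e" by (simp add: rtr_def)
  then show thesis using that w_in ew by blast
qed

end

section \<open>Extending derivations\<close>

context finite_group
begin

text \<open>Linear on all functions and a derivation on S. Totality allows linear maps to be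
  compared on group elements; \<open>DerE\<close> obtains such a map from an element of
  \<open>Der\<close>.\<close>

definition derivation_on :: "('g \<Rightarrow> 'k::field) set \<Rightarrow> (('g \<Rightarrow> 'k) \<Rightarrow> 'g \<Rightarrow> 'k) \<Rightarrow> bool" where
  "derivation_on S d \<longleftrightarrow> lin d \<and> (\<forall>x\<in>S. d x \<in> S) \<and> (\<forall>x\<in>S. \<forall>y\<in>S. d (x \<star> y) = d x \<star> y + x \<star> d y)"

lemma leibniz_on_basis:
  fixes d :: "('g \<Rightarrow> 'k::field) \<Rightarrow> 'g \<Rightarrow> 'k"
  assumes H: "H \<subseteq> carrier G" and d: "lin d"
    and basis: "\<And>g h. g \<in> H \<Longrightarrow> h \<in> H \<Longrightarrow> d (dl (g \<otimes> h)) = d (dl g) \<star> dl h + dl g \<star> d (dl h)"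
    and xy: "x \<in> supp_in H" "y \<in> supp_in H"
  shows "d (x \<star> y) = d x \<star> y + x \<star> d y"
proof (rule lin_eq_on[OF fin_sub[OF H] _ _ _ xy(1)])
  show "lin (\<lambda>x. d (x \<star> y))" "lin (\<lambda>x. d x \<star> y + x \<star> d y)" using d by (intro lin_intros lin_comp[OF d])+
  fix g assume g: "g \<in> H"
  show "d (dl g \<star> y) = d (dl g) \<star> y + dl g \<star> d y"
  proof (rule lin_eq_on[OF fin_sub[OF H] _ _ _ xy(2)])
    show "lin (\<lambda>y. d (dl g \<star> y))" "lin (\<lambda>y. d (dl g) \<star> y + dl g \<star> d y)" using d by (intro lin_intros lin_comp[OF d])+
    show "d (dl g \<star> dl h) = d (dl g) \<star> dl h + dl g \<star> d (dl h)" if "h \<in> H" for h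
      using basis[OF g that] g that H by (simp add: dl_dl subset_iff)
  qed
qed

end

context normal_block
begin

definition Bs :: "('g \<Rightarrow> 'k) set" where "Bs = {x \<in> supp_in (carrier G). b \<star> x = x}"

definition extends :: "(('g \<Rightarrow> 'k) \<Rightarrow> 'g \<Rightarrow> 'k) \<Rightarrow> (('g \<Rightarrow> 'k) \<Rightarrow> 'g \<Rightarrow> 'k) \<Rightarrow> bool" where
  "extends d d' \<longleftrightarrow> (\<forall>a\<in>supp_in P. d' (a \<star> e) = d a \<star> e)"

text \<open>The conjugate of d by g differs from d by the inner derivation of c. The equation is
  stated at \<open>cj g a\<close>, so that the inverse of g does not occur.\<close>

definition stable_at :: "'g \<Rightarrow> (('g \<Rightarrow> 'k) \<Rightarrow> 'g \<Rightarrow> 'k) \<Rightarrow> ('g \<Rightarrow> 'k) \<Rightarrow> bool" where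
  "stable_at g d c \<longleftrightarrow> (\<forall>a\<in>supp_in P. d (cj g a) = cj g (d a) + (c \<star> cj g a - cj g a \<star> c))"

lemma BsI: "x \<in> supp_in (carrier G) \<Longrightarrow> b \<star> x = x \<Longrightarrow> x \<in> Bs" by (simp add: Bs_def)
lemma Bs_supp: "x \<in> Bs \<Longrightarrow> x \<in> supp_in (carrier G)" by (simp add: Bs_def)
lemma Bs_b: "x \<in> Bs \<Longrightarrow> b \<star> x = x" "x \<in> Bs \<Longrightarrow> x \<star> b = x"
  using b_commute by (auto simp: Bs_def)

lemma Bs_subspace: "fv.subspace Bs"
  unfolding Bs_def using subspace_supp_in[of "carrier G"] by (auto simp: fv.subspace_def star_distribs)

lemmas Bs_closed = subspace_closed[OF Bs_subspace]

lemma Bs_star: "x \<in> Bs \<Longrightarrow> x \<star> y \<in> Bs" "y \<in> Bs \<Longrightarrow> x \<in> supp_in (carrier G) \<Longrightarrow> x \<star> y \<in> Bs"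
proof -
  show "x \<star> y \<in> Bs" if "x \<in> Bs"
    using that by (intro BsI star_in) (simp add: Bs_b star_assoc[symmetric])
  show "x \<star> y \<in> Bs" if "y \<in> Bs" "x \<in> supp_in (carrier G)"
  proof (intro BsI star_in)
    have "b \<star> (x \<star> y) = x \<star> (b \<star> y)" using b_commute[OF that(2)] by (simp add: star_assoc[symmetric])
    then show "b \<star> (x \<star> y) = x \<star> y" using that(1) by (simp add: Bs_b)
  qed
qed

lemma e_Bs: "e \<in> Bs" by (intro BsI e_supp be)

lemma ee_star: "e \<star> (e \<star> x) = e \<star> x" by (simp add: star_assoc[symmetric] e_idem)

lemma supp_N: "a \<in> supp_in N \<Longrightarrow> a \<in> supp_in (carrier G)"
  using supp_in_mono[OF N_carrier] by blast
lemma P_supp_N: "a \<in> supp_in P \<Longrightarrow> a \<in> supp_in N"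
  using supp_in_mono[OF P_N] by blast
lemma C_supp_N: "a \<in> supp_in C \<Longrightarrow> a \<in> supp_in N"
  using supp_in_mono[OF C_N] by blast
lemma e_in_N: "e \<in> supp_in N" using C_supp_N e_in .

lemma e_dl: "g \<in> N \<Longrightarrow> dl g \<star> e = e \<star> dl g"
  by (rule e_commute_N[OF dl_in])

lemma cj_P: "g \<in> carrier G \<Longrightarrow> a \<in> supp_in P \<Longrightarrow> cj g a \<in> supp_in P"
proof (rule cj_supp)
  fix x assume g: "g \<in> carrier G" and x: "x \<in> carrier G" "inv g \<otimes> x \<otimes> g \<in> P"
  have "g \<otimes> (inv g \<otimes> x \<otimes> g) \<otimes> inv g \<in> P" by (rule P_conj[OF g x(2)])
  then show "x \<in> P" using g x(1) by (simp only: inv_cancel)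
qed

lemma retraction:
  obtains \<tau> :: "('g \<Rightarrow> 'k) \<Rightarrow> 'g \<Rightarrow> 'k" where "lin \<tau>" "\<And>x. \<tau> x \<in> supp_in P" "\<And>a x. a \<in> supp_in P \<Longrightarrow> \<tau> (a \<star> x) = a \<star> \<tau> x"
    "\<And>a x. a \<in> supp_in P \<Longrightarrow> \<tau> (x \<star> a) = \<tau> x \<star> a" "\<And>a. a \<in> supp_in P \<Longrightarrow> \<tau> (a \<star> e) = a"
proof -
  have "cut C e = e" using cut_id[OF e_in] .
  then obtain \<tau> where \<tau>: "lin \<tau>" "\<And>x. \<tau> x \<in> supp_in P" "\<And>a x. a \<in> supp_in P \<Longrightarrow> \<tau> (a \<star> x) = a \<star> \<tau> x"
    "\<And>a x. a \<in> supp_in P \<Longrightarrow> \<tau> (x \<star> a) = \<tau> x \<star> a" "\<tau> e = dl \<one>"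
    using bimodule_retraction[OF P_sub P_card e_supp cj_PC[OF _ e_in]] e_idem e_nonzero by metis
  have "\<tau> (a \<star> e) = a" if "a \<in> supp_in P" for a
    using that \<tau>(3,5) dl_one(2)[OF supp_P[OF that]] by simp
  then show thesis using \<tau> that by blast
qed

lemma sum_b: "(\<Sum>t\<in>tv (carrier G) N. dl t \<star> (e \<star> dl (inv t))) = b"
  by (subst b_eq) (simp add: rtr_def cj_def star_assoc)

lemma tvG: "t \<in> tv (carrier G) N \<Longrightarrow> t \<in> carrier G"
  using tv(1)[OF G_sub N_sub] by (auto simp: transversal_def)

text \<open>e g e = e (g e g^-1) g, which vanishes for g outside N by orthogonality of the
  conjugates of e.\<close>

lemma eGe:
  assumes "x \<in> supp_in (carrier G)"
  shows "e \<star> (x \<star> e) \<in> supp_in N"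
proof (rule lin_in_on[OF finG _ subspace_supp_in _ assms])
  show "lin (\<lambda>x. e \<star> (x \<star> e))" by (intro lin_intros)
  fix g assume g: "g \<in> carrier G"
  show "e \<star> (dl g \<star> e) \<in> supp_in N"
  proof (cases "g \<in> N")
    case True
    then show ?thesis by (intro star_supp[OF N_sub] e_in_N dl_in)
  next
    case False
    have "e \<star> (dl g \<star> e) = e \<star> cj g e \<star> dl g" using dl_star_cj[OF g, of e] by (simp add: star_assoc)
    then show ?thesis using e_orthogonal[OF g False] supp_in_closed(1) by simp
  qed
qed

text \<open>z is the sum over t in G/P of d(t e) w t^-1. A summand depends only on the coset of t,
  because d kills kPe and w commutes with P. Multiplying by m, applying the Leibniz rule and
  shifting the sum leaves d(m b) times the trace of w from P to G, and that trace is b.\<close>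

lemma inner_if_zero_on_kPe:
  assumes d: "derivation_on Bs d" and zero: "\<And>a. a \<in> supp_in P \<Longrightarrow> d (a \<star> e) = 0"
  shows "\<exists>z\<in>Bs. \<forall>x\<in>Bs. d x = z \<star> x - x \<star> z"
proof -
  obtain w where w: "w \<in> supp_in C" "e \<star> w = w" "rtr N P w = e" by (rule relative_trace_e)
  have lind: "lin d" and d_Bs: "\<And>x. x \<in> Bs \<Longrightarrow> d x \<in> Bs"
    and leib: "\<And>x y. x \<in> Bs \<Longrightarrow> y \<in> Bs \<Longrightarrow> d (x \<star> y) = d x \<star> y + x \<star> d y"
    using d by (auto simp: derivation_on_def)
  define T where "T = tv (carrier G) P"
  have T: "transversal T (carrier G) P" unfolding T_def by (rule tv(1)[OF G_sub P_sub])
  have TG: "t \<in> carrier G" if "t \<in> T" for t using T that by (auto simp: transversal_def)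
  have w_P: "dl u \<star> w = w \<star> dl u" if "u \<in> P" for u using PC_commute[OF dl_in[OF that] w(1)] by simp
  define F where "F g = d (dl g \<star> e) \<star> w \<star> dl (inv g)" for g
  have ge_Bs: "dl g \<star> e \<in> Bs" if "g \<in> carrier G" for g
    using Bs_star(2)[OF e_Bs dl_in[OF that]] .
  have F_right: "F (g \<otimes> u) = F g" if g: "g \<in> carrier G" and u: "u \<in> P" for g u
  proof -
    have uG: "u \<in> carrier G" "u \<in> N" using u PG P_N by auto
    have "dl (g \<otimes> u) \<star> e = dl (g \<otimes> u) \<star> (e \<star> e)" by (simp add: e_idem)
    also have "\<dots> = dl g \<star> (dl u \<star> e) \<star> e" using g uG by (simp add: star_assoc dl_mult_star)
    also have "\<dots> = (dl g \<star> e) \<star> (dl u \<star> e)" using e_dl[OF uG(2)] by (simp add: star_assoc)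
    finally have "d (dl (g \<otimes> u) \<star> e) = d (dl g \<star> e) \<star> (dl u \<star> e)"
      using leib[OF ge_Bs ge_Bs, OF g uG(1)] zero[OF dl_in[OF u]] by simp
    then have "F (g \<otimes> u) = d (dl g \<star> e) \<star> (dl u \<star> (e \<star> w) \<star> dl (inv (g \<otimes> u)))"
      by (simp add: F_def star_assoc)
    also have "\<dots> = d (dl g \<star> e) \<star> (w \<star> (dl u \<star> dl (inv (g \<otimes> u))))"
      using w(2) w_P[OF u] by (simp add: star_assoc)
    also have "\<dots> = F g"
      using g uG by (simp add: dl_dl F_def star_assoc inv_mult_group m_assoc[symmetric])
    finally show ?thesis .
  qed
  define z where "z = (\<Sum>t\<in>T. F t)"
  have F_Bs: "F g \<in> Bs" if "g \<in> carrier G" for g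
    unfolding F_def by (intro Bs_star(1) d_Bs ge_Bs that)
  have z_Bs: "z \<in> Bs" unfolding z_def by (rule Bs_closed(6)) (use F_Bs TG in blast)
  have sum_w: "(\<Sum>t\<in>T. dl t \<star> (e \<star> w) \<star> dl (inv t)) = b"
  proof -
    have "rtr (carrier G) P w = b"
      using rtr_tower[OF G_sub N_sub N_carrier P_sub P_N cj_PC[OF _ w(1)]] w(3) b_eq by simp
    then show ?thesis by (simp add: rtr_def T_def cj_def w(2))
  qed
  have on_G: "d (dl m \<star> b) = z \<star> dl m - dl m \<star> z" if m: "m \<in> carrier G" for m
  proof -
    have mb: "dl m \<star> b \<in> Bs" using Bs_star(2)[OF BsI[OF b_in b_idem] dl_in[OF m]] .
    have 1: "dl m \<star> F t = F (m \<otimes> t) \<star> dl m - d (dl m \<star> b) \<star> (dl t \<star> (e \<star> w) \<star> dl (inv t))" if t: "t \<in> T" for t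
    proof -
      have tG: "t \<in> carrier G" using TG[OF t] .
      have "dl (m \<otimes> t) \<star> e = (dl m \<star> b) \<star> (dl t \<star> e)"
        using m tG Bs_b(1)[OF ge_Bs[OF tG]] by (simp add: star_assoc dl_mult_star)
      then have "d (dl (m \<otimes> t) \<star> e) = d (dl m \<star> b) \<star> (dl t \<star> e) + dl m \<star> (b \<star> d (dl t \<star> e))"
        using leib[OF mb ge_Bs[OF tG]] by (simp add: star_assoc)
      also have "b \<star> d (dl t \<star> e) = d (dl t \<star> e)" by (rule Bs_b(1)[OF d_Bs[OF ge_Bs[OF tG]]])
      finally have 2: "dl m \<star> d (dl t \<star> e) = d (dl (m \<otimes> t) \<star> e) - d (dl m \<star> b) \<star> (dl t \<star> e)"
        by (metis add_diff_cancel_left')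
      have "dl m \<star> F t = (dl m \<star> d (dl t \<star> e)) \<star> (w \<star> dl (inv t))" by (simp add: F_def star_assoc)
      also have "\<dots> = d (dl (m \<otimes> t) \<star> e) \<star> (w \<star> dl (inv t)) - d (dl m \<star> b) \<star> (dl t \<star> (e \<star> w) \<star> dl (inv t))"
        unfolding 2 by (simp add: star_diff star_assoc)
      also have "d (dl (m \<otimes> t) \<star> e) \<star> (w \<star> dl (inv t)) = F (m \<otimes> t) \<star> dl m"
        using m tG by (simp add: F_def star_assoc dl_dl inv_mult_group m_assoc)
      finally show ?thesis .
    qed
    have "dl m \<star> z = (\<Sum>t\<in>T. F (m \<otimes> t) \<star> dl m - d (dl m \<star> b) \<star> (dl t \<star> (e \<star> w) \<star> dl (inv t)))"
      unfolding z_def star_sum using 1 by (intro sum.cong) auto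
    also have "\<dots> = (\<Sum>t\<in>T. F (m \<otimes> t)) \<star> dl m - d (dl m \<star> b) \<star> b"
      by (simp only: sum_subtractf star_sum[symmetric] sum_w)
    also have "(\<Sum>t\<in>T. F (m \<otimes> t)) = z"
      unfolding z_def by (rule sum_shift[OF G_sub P_sub P_carrier T m F_right])
    also have "d (dl m \<star> b) \<star> b = d (dl m \<star> b)" by (rule Bs_b(2)[OF d_Bs[OF mb]])
    finally have eq: "dl m \<star> z = z \<star> dl m - d (dl m \<star> b)" .
    show ?thesis unfolding eq by simp
  qed
  have "d x = z \<star> x - x \<star> z" if x: "x \<in> Bs" for x
  proof -
    have "d (x \<star> b) = z \<star> x - x \<star> z"
    proof (rule lin_eq_on[OF finG _ _ _ Bs_supp[OF x]])
      show "lin (\<lambda>x. d (x \<star> b))" "lin (\<lambda>x. z \<star> x - x \<star> z)" by (intro lin_intros lin_comp[OF lind])+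
    qed (rule on_G)
    then show ?thesis by (simp add: Bs_b[OF x])
  qed
  then show ?thesis using z_Bs by blast
qed

text \<open>Multiply by e on both sides and apply the bimodule retraction onto kP: d(a) e becomes
  d(a), and the image of e z e serves as c.\<close>

lemma inner_restriction:
  assumes d: "\<And>a. a \<in> supp_in P \<Longrightarrow> d a \<in> supp_in P"
    and inner: "\<And>a. a \<in> supp_in P \<Longrightarrow> z \<star> (a \<star> e) - a \<star> e \<star> z = d a \<star> e"
  shows "\<exists>c\<in>supp_in P. \<forall>a\<in>supp_in P. d a = c \<star> a - a \<star> c"
proof -
  obtain \<tau> :: "('g \<Rightarrow> 'k) \<Rightarrow> 'g \<Rightarrow> 'k" where \<tau>: "lin \<tau>" "\<And>x. \<tau> x \<in> supp_in P" "\<And>a x. a \<in> supp_in P \<Longrightarrow> \<tau> (a \<star> x) = a \<star> \<tau> x"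
    "\<And>a x. a \<in> supp_in P \<Longrightarrow> \<tau> (x \<star> a) = \<tau> x \<star> a" "\<And>a. a \<in> supp_in P \<Longrightarrow> \<tau> (a \<star> e) = a"
    by (rule retraction) blast
  have "d a = \<tau> (e \<star> z \<star> e) \<star> a - a \<star> \<tau> (e \<star> z \<star> e)" if a: "a \<in> supp_in P" for a
  proof -
    have ae: "a \<star> e = e \<star> a" by (rule e_commute_P[OF a])
    have dae: "d a \<star> e = e \<star> d a" by (rule e_commute_P[OF d[OF a]])
    have "d a \<star> e = e \<star> (d a \<star> e) \<star> e" by (simp add: dae star_assoc[symmetric] e_idem)
      (simp add: star_assoc dae[symmetric] e_idem)
    also have "\<dots> = e \<star> (z \<star> (a \<star> e)) \<star> e - e \<star> (a \<star> e \<star> z) \<star> e"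
      unfolding inner[OF a, symmetric] by (simp add: star_diff)
    also have "e \<star> (z \<star> (a \<star> e)) \<star> e = e \<star> z \<star> e \<star> a" using ae by (simp add: star_assoc e_idem ee_star)
    also have "e \<star> (a \<star> e \<star> z) \<star> e = a \<star> (e \<star> z \<star> e)"
      unfolding ae by (simp add: star_assoc[symmetric] e_idem) (simp add: ae[symmetric] star_assoc)
    finally have eq: "d a \<star> e = e \<star> z \<star> e \<star> a - a \<star> (e \<star> z \<star> e)" .
    have "\<tau> (d a \<star> e) = \<tau> (e \<star> z \<star> e \<star> a) - \<tau> (a \<star> (e \<star> z \<star> e))" unfolding eq by (rule lin_diff[OF \<tau>(1)])
    then show ?thesis using \<tau>(5)[OF d[OF a]] \<tau>(3,4)[OF a] by simp
  qed
  then show ?thesis using \<tau>(2) by blast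
qed

text \<open>For g in N the element g e is invertible in kNe and conjugates a e to (g a g^-1) e.
  Differentiating this product gives stability inside B, with d'(g e) g^-1 e in the place of c; the
  retraction carries it down to kP.\<close>

lemma stable_if_extends:
  assumes d: "derivation_on (supp_in P) d" and d': "derivation_on Bs d'" and ext: "extends d d'" and g: "g \<in> N"
  shows "\<exists>c\<in>supp_in P. stable_at g d c"
proof -
  obtain \<tau> :: "('g \<Rightarrow> 'k) \<Rightarrow> 'g \<Rightarrow> 'k" where \<tau>: "lin \<tau>" "\<And>x. \<tau> x \<in> supp_in P" "\<And>a x. a \<in> supp_in P \<Longrightarrow> \<tau> (a \<star> x) = a \<star> \<tau> x"
    "\<And>a x. a \<in> supp_in P \<Longrightarrow> \<tau> (x \<star> a) = \<tau> x \<star> a" "\<And>a. a \<in> supp_in P \<Longrightarrow> \<tau> (a \<star> e) = a"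
    by (rule retraction) blast
  have dP: "\<And>a. a \<in> supp_in P \<Longrightarrow> d a \<in> supp_in P" using d by (auto simp: derivation_on_def)
  have leib: "\<And>x y. x \<in> Bs \<Longrightarrow> y \<in> Bs \<Longrightarrow> d' (x \<star> y) = d' x \<star> y + x \<star> d' y"
    and d'_Bs: "\<And>x. x \<in> Bs \<Longrightarrow> d' x \<in> Bs" using d' by (auto simp: derivation_on_def)
  have ext': "d' (a \<star> e) = d a \<star> e" if "a \<in> supp_in P" for a using ext that by (simp add: extends_def)
  have gG: "g \<in> carrier G" "inv g \<in> carrier G" "inv g \<in> N" using g NG N_sub by (auto simp: subgroup.m_inv_closed)
  have one_P: "dl \<one> \<in> supp_in P" by (rule dl_in[OF subgroup.one_closed[OF P_sub]])
  have "d (dl \<one>) = 0"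
  proof -
    have "d (dl \<one> \<star> dl \<one>) = d (dl \<one>) \<star> dl \<one> + dl \<one> \<star> d (dl \<one>)"
      using d one_P by (auto simp: derivation_on_def)
    then have "d (dl \<one>) = d (dl \<one>) + d (dl \<one>)"
      unfolding dl_one(1)[OF supp_P[OF one_P]] dl_one(2)[OF supp_P[OF dP[OF one_P]]] dl_one(1)[OF supp_P[OF dP[OF one_P]]] .
    then show ?thesis by (metis add_cancel_right_right)
  qed
  then have d'e: "d' e = 0" using ext'[OF one_P] e_supp by (simp add: dl_one)
  have Bs_ge: "dl h \<star> e \<in> Bs" if "h \<in> carrier G" for h using Bs_star(2)[OF e_Bs dl_in[OF that]] .
  define c where "c = \<tau> (d' (dl g \<star> e) \<star> (dl (inv g) \<star> e))"
  \<comment> \<open>As d' e = 0, differentiating (g e)(g^-1 e) = e gives the derivative of the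
    inverse.\<close>
  have z1: "d' (dl g \<star> e) \<star> (dl (inv g) \<star> e) = - (dl g \<star> e \<star> d' (dl (inv g) \<star> e))"
  proof -
    have "dl g \<star> e \<star> (dl (inv g) \<star> e) = dl g \<star> (e \<star> dl (inv g)) \<star> e" by (simp only: star_assoc)
    also have "\<dots> = e"
      unfolding e_dl[OF gG(3), symmetric] using gG(1) by (simp add: star_assoc dl_mult_star e_idem dl_one e_supp)
    finally have "dl g \<star> e \<star> (dl (inv g) \<star> e) = e" .
    then have "d' (dl g \<star> e) \<star> (dl (inv g) \<star> e) + dl g \<star> e \<star> d' (dl (inv g) \<star> e) = 0"
      using leib[OF Bs_ge Bs_ge, of g "inv g"] d'e gG by simp
    then show ?thesis by (simp add: eq_neg_iff_add_eq_0)
  qed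
  have "d (cj g a) = cj g (d a) + (c \<star> cj g a - cj g a \<star> c)" if a: "a \<in> supp_in P" for a
  proof -
    have ga: "cj g a \<in> supp_in P" "cj g (d a) \<in> supp_in P" using cj_P gG a dP by auto
    have ae: "a \<star> e = e \<star> a" "cj g a \<star> e = e \<star> cj g a" "a \<star> e \<in> Bs"
      using e_commute_P a ga Bs_star(2)[OF e_Bs supp_P[OF a]] by auto
    have cjae: "cj g a \<star> e = dl g \<star> e \<star> (a \<star> e \<star> (dl (inv g) \<star> e))"
    proof -
      have "dl g \<star> e \<star> (a \<star> e \<star> (dl (inv g) \<star> e)) = dl g \<star> (e \<star> a) \<star> e \<star> (dl (inv g) \<star> e)" by (simp add: star_assoc)
      also have "\<dots> = dl g \<star> a \<star> (e \<star> e \<star> (dl (inv g) \<star> e))" by (simp only: ae(1)[symmetric] star_assoc)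
      also have "\<dots> = dl g \<star> a \<star> dl (inv g) \<star> e" using e_dl[OF gG(3)] by (simp add: e_idem star_assoc ee_star)
      finally show ?thesis by (simp add: cj_def)
    qed
    let ?X = "d' (dl g \<star> e) \<star> (a \<star> e \<star> (dl (inv g) \<star> e))" and ?Y = "dl g \<star> e \<star> (d a \<star> e \<star> (dl (inv g) \<star> e))"
      and ?Z = "dl g \<star> e \<star> (a \<star> e \<star> d' (dl (inv g) \<star> e))" and ?W = "d' (dl g \<star> e) \<star> (dl (inv g) \<star> e)"
    have "d (cj g a) \<star> e = ?X + (?Y + ?Z)"
      unfolding ext'[OF ga(1), symmetric] cjae
      using leib[OF Bs_ge[OF gG(1)] Bs_star(1)[OF ae(3)], of "dl (inv g) \<star> e"] leib[OF ae(3) Bs_ge[OF gG(2)]] ext'[OF a]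
      by (simp add: star_add_right)
    also have "?X = ?W \<star> cj g a"
    proof -
      have "?W \<star> cj g a = d' (dl g \<star> e) \<star> (dl (inv g) \<star> (e \<star> cj g a))" by (simp add: star_assoc)
      also have "\<dots> = d' (dl g \<star> e) \<star> (dl (inv g) \<star> cj g a \<star> e)" using ae by (simp add: star_assoc)
      also have "dl (inv g) \<star> cj g a = a \<star> dl (inv g)"
        using gG supp_P[OF a] by (simp add: cj_def star_assoc dl_mult_star)
      also have "d' (dl g \<star> e) \<star> (a \<star> dl (inv g) \<star> e) = ?X"
        using e_dl[OF gG(3)] by (simp add: star_assoc ee_star e_idem)
      finally show ?thesis ..
    qed
    also have "?Y = cj g (d a) \<star> e"
    proof -
      have dae: "d a \<star> e = e \<star> d a" by (rule e_commute_P[OF dP[OF a]])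
      have "?Y = dl g \<star> (e \<star> (d a \<star> e)) \<star> (dl (inv g) \<star> e)" by (simp add: star_assoc)
      also have "e \<star> (d a \<star> e) = d a \<star> e" unfolding dae by (simp add: ee_star)
      finally show ?thesis using e_dl[OF gG(3)] by (simp add: cj_def star_assoc ee_star e_idem)
    qed
    also have "?Z = - (cj g a \<star> ?W)"
    proof -
      have "cj g a \<star> ?W = - (cj g a \<star> (dl g \<star> e \<star> d' (dl (inv g) \<star> e)))" unfolding z1 by (simp add: star_minus)
      also have "cj g a \<star> (dl g \<star> e \<star> d' (dl (inv g) \<star> e)) = dl g \<star> a \<star> (e \<star> d' (dl (inv g) \<star> e))"
        using dl_star_cj[OF gG(1), of a] by (simp add: star_assoc)
      also have "\<dots> = ?Z" using ae by (simp add: star_assoc ee_star) (simp add: star_assoc[symmetric] e_idem)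
      finally have eq: "cj g a \<star> ?W = - ?Z" .
      show ?thesis unfolding eq by simp
    qed
    finally have "d (cj g a) \<star> e = ?W \<star> cj g a + (cj g (d a) \<star> e + - (cj g a \<star> ?W))" .
    then have "\<tau> (d (cj g a) \<star> e) = \<tau> (?W \<star> cj g a + (cj g (d a) \<star> e + - (cj g a \<star> ?W)))" by simp
    also have "\<dots> = c \<star> cj g a + (cj g (d a) - cj g a \<star> c)"
      unfolding lin_add[OF \<tau>(1)] lin_minus[OF \<tau>(1)] c_def using \<tau>(3-5) ga by simp
    finally show ?thesis using \<tau>(5)[OF dP[OF ga(1)]] by (simp add: algebra_simps)
  qed
  then show ?thesis using \<tau>(2) unfolding stable_at_def c_def by blast
qed

text \<open>Conjugation by u is inner already in kP: apply d to both sides of (u a u^-1) u = u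
  a.\<close>

lemma stable_at_P:
  assumes d: "derivation_on (supp_in P) d" and u: "u \<in> P"
  shows "stable_at u d (d (dl u) \<star> dl (inv u))" "d (dl u) \<star> dl (inv u) \<in> supp_in P"
proof -
  have dP: "\<And>a. a \<in> supp_in P \<Longrightarrow> d a \<in> supp_in P"
    and leib: "\<And>x y. x \<in> supp_in P \<Longrightarrow> y \<in> supp_in P \<Longrightarrow> d (x \<star> y) = d x \<star> y + x \<star> d y"
    using d by (auto simp: derivation_on_def)
  have uG: "u \<in> carrier G" "inv u \<in> P" using u PG P_sub by (auto simp: subgroup.m_inv_closed)
  have star_P: "x \<star> y \<in> supp_in P" if "x \<in> supp_in P" "y \<in> supp_in P" for x y :: "'g \<Rightarrow> 'k"
    using star_supp[OF P_sub that] .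
  have dlu: "dl u \<in> supp_in P" "dl (inv u) \<in> supp_in P" using u uG by (auto intro: dl_in)
  show "d (dl u) \<star> dl (inv u) \<in> supp_in P" by (intro star_P dP dlu)
  show "stable_at u d (d (dl u) \<star> dl (inv u))"
    unfolding stable_at_def
  proof
    fix a :: "'g \<Rightarrow> 'k" assume a: "a \<in> supp_in P"
    let ?c = "d (dl u) \<star> dl (inv u)"
    have conj: "cj u a \<star> dl u = dl u \<star> a" by (rule dl_star_cj[OF uG(1), symmetric])
    have "d (cj u a \<star> dl u) = d (cj u a) \<star> dl u + cj u a \<star> d (dl u)"
      by (rule leib[OF cj_P[OF uG(1) a] dlu(1)])
    moreover have "d (dl u \<star> a) = d (dl u) \<star> a + dl u \<star> d a" by (rule leib[OF dlu(1) a])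
    ultimately have "d (cj u a) \<star> dl u + cj u a \<star> d (dl u) = d (dl u) \<star> a + dl u \<star> d a" using conj by metis
    then have "d (cj u a) \<star> dl u = d (dl u) \<star> a + dl u \<star> d a - cj u a \<star> d (dl u)" by (metis add_diff_cancel_right')
    then have "d (cj u a) \<star> dl u \<star> dl (inv u) = (d (dl u) \<star> a + dl u \<star> d a - cj u a \<star> d (dl u)) \<star> dl (inv u)" by simp
    then have "d (cj u a) = d (dl u) \<star> (a \<star> dl (inv u)) + cj u (d a) - cj u a \<star> ?c"
      using uG supp_P[OF dP[OF cj_P[OF uG(1) a]]]
      by (simp add: star_assoc dl_dl dl_one star_distribs) (simp add: cj_def star_assoc)
    also have "a \<star> dl (inv u) = dl (inv u) \<star> cj u a"
      using uG supp_P[OF a] by (simp add: cj_def star_assoc dl_mult_star)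
    finally have eq: "d (cj u a) = d (dl u) \<star> (dl (inv u) \<star> cj u a) + cj u (d a) - cj u a \<star> ?c" .
    show "d (cj u a) = cj u (d a) + (?c \<star> cj u a - cj u a \<star> ?c)"
      unfolding eq by (simp add: star_assoc)
  qed
qed

text \<open>A derivation of \<open>kP\<close> that is stable under \<open>N\<close> extends linearly to \<open>kN\<close>; the failure of the Leibniz
  rule is a 2-cocycle which is balanced over \<open>kP\<close>, and the relative trace \<open>e = Tr(w)\<close> from \<open>P\<close> to \<open>N\<close> turns it
  into a coboundary after multiplication by \<open>e\<close>.\<close>

lemma extend_to_N:
  assumes d: "derivation_on (supp_in P) d" and stable: "\<And>g. g \<in> N \<Longrightarrow> \<exists>c\<in>supp_in P. stable_at g d c"
  obtains D where "lin D" "\<And>x. x \<in> supp_in N \<Longrightarrow> D x \<in> supp_in N" "\<And>x. x \<in> supp_in N \<Longrightarrow> D x \<star> e = D x"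
    "\<And>x y. x \<in> supp_in N \<Longrightarrow> y \<in> supp_in N \<Longrightarrow> D (x \<star> y) = D x \<star> y + x \<star> D y"
    "\<And>a. a \<in> supp_in P \<Longrightarrow> D (a \<star> e) = d a \<star> e"
proof -
  obtain w where w: "w \<in> supp_in C" "e \<star> w = w" "rtr N P w = e" by (rule relative_trace_e)
  have lind: "lin d" and dP: "\<And>a. a \<in> supp_in P \<Longrightarrow> d a \<in> supp_in P"
    and leib: "\<And>x y. x \<in> supp_in P \<Longrightarrow> y \<in> supp_in P \<Longrightarrow> d (x \<star> y) = d x \<star> y + x \<star> d y"
    using d by (auto simp: derivation_on_def)
  define T where "T = tv N P"
  have T: "transversal T N P" and one_T: "\<one> \<in> T" unfolding T_def using tv[OF N_sub P_sub] by auto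
  have TN: "t \<in> N" "t \<in> carrier G" if "t \<in> T" for t using T that NG by (auto simp: transversal_def)
  have dl_P: "dl u \<in> supp_in P" if "u \<in> P" for u by (rule dl_in[OF that])
  \<comment> \<open>The canonical choice on P forces c \<one> = d(1) = 0, so that \<Delta> below
    agrees with d on P.\<close>
  define c where "c g = (if g \<in> P then d (dl g) \<star> dl (inv g) else SOME c. c \<in> supp_in P \<and> stable_at g d c)" for g
  have c: "c g \<in> supp_in P \<and> stable_at g d (c g)" if "g \<in> N" for g
  proof (cases "g \<in> P")
    case True
    then show ?thesis using stable_at_P[OF d True] by (simp add: c_def)
  next
    case False
    then have "c g = (SOME c. c \<in> supp_in P \<and> stable_at g d c)" by (simp add: c_def)
    then show ?thesis using someI_ex[of "\<lambda>c. c \<in> supp_in P \<and> stable_at g d c"] stable[OF that] by auto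
  qed
  define r where "r g = (THE t. t \<in> T \<and> inv t \<otimes> g \<in> P)" for g
  have r: "r g \<in> T" "inv (r g) \<otimes> g \<in> P" if "g \<in> N" for g
    using theI'[of "\<lambda>t. t \<in> T \<and> inv t \<otimes> g \<in> P"] T that unfolding r_def transversal_def by auto
  have r_eq: "r g = t" if "g \<in> N" "t \<in> T" "inv t \<otimes> g \<in> P" for g t
  proof -
    have "\<exists>!t. t \<in> T \<and> inv t \<otimes> g \<in> P" using T that(1) by (simp add: transversal_def)
    then show ?thesis unfolding r_def using that by (intro the1_equality) auto
  qed
  define u where "u g = g \<otimes> inv (r g)" for g
  have ru: "r (v \<otimes> t) = t" "u (v \<otimes> t) = v" if v: "v \<in> P" and t: "t \<in> T" for v t
  proof -
    have vt: "v \<otimes> t \<in> N" using v t P_N TN N_sub by (auto intro: subgroup.m_closed)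
    have "inv t \<otimes> (v \<otimes> t) = inv t \<otimes> v \<otimes> t" using PG[OF v] TN[OF t] by (simp add: m_assoc)
    then have "inv t \<otimes> (v \<otimes> t) \<in> P" using P_conj'[OF TN(2)[OF t] v] by simp
    then show "r (v \<otimes> t) = t" using r_eq[OF vt t] by blast
    then show "u (v \<otimes> t) = v" using PG[OF v] TN[OF t] by (simp add: u_def m_assoc)
  qed
  have split: "\<exists>v\<in>P. \<exists>t\<in>T. g = v \<otimes> t" if g: "g \<in> N" for g
  proof -
    have rg: "r g \<in> carrier G" "g \<in> carrier G" using r(1)[OF g] TN NG g by auto
    have "g = r g \<otimes> (inv (r g) \<otimes> g) \<otimes> inv (r g) \<otimes> r g" using rg by (simp add: m_assoc inv_cancel)
    then show ?thesis using P_conj[OF rg(1) r(2)[OF g]] r(1)[OF g] by blast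
  qed
  \<comment> \<open>Each g in N is v t with v in P and t in T. The value is the one that the Leibniz
    rule would force if the derivative of t were c(t) t. It is compatible with multiplication by P
    on the left by construction, and on the right by stability of d at t.\<close>
  define \<Delta> where "\<Delta> g = d (dl (u g)) \<star> dl (r g) + dl (u g) \<star> (c (r g) \<star> dl (r g))" for g
  have \<Delta>_vt: "\<Delta> (v \<otimes> t) = d (dl v) \<star> dl t + dl v \<star> (c t \<star> dl t)" if "v \<in> P" "t \<in> T" for v t
    using ru[OF that] by (simp add: \<Delta>_def)
  have \<Delta>_left: "\<Delta> (v \<otimes> g) = d (dl v) \<star> dl g + dl v \<star> \<Delta> g" if v: "v \<in> P" and g: "g \<in> N" for v g
  proof -
    obtain v' t where g_eq: "v' \<in> P" "t \<in> T" "g = v' \<otimes> t" using split[OF g] by blast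
    have G: "v \<in> carrier G" "v' \<in> carrier G" "t \<in> carrier G" using v g_eq PG TN by auto
    have "v \<otimes> v' \<in> P" using v g_eq P_sub by (simp add: subgroup.m_closed)
    moreover have "v \<otimes> g = v \<otimes> v' \<otimes> t" using g_eq G by (simp add: m_assoc)
    ultimately have "\<Delta> (v \<otimes> g) = d (dl (v \<otimes> v')) \<star> dl t + dl (v \<otimes> v') \<star> (c t \<star> dl t)"
      using \<Delta>_vt g_eq by simp
    also have "d (dl (v \<otimes> v')) = d (dl v) \<star> dl v' + dl v \<star> d (dl v')"
      using leib[OF dl_P[OF v] dl_P[OF g_eq(1)]] G by (simp add: dl_dl)
    also have "dl (v \<otimes> v') = dl v \<star> dl v'" using G by (simp add: dl_dl)
    finally have eq: "\<Delta> (v \<otimes> g) = (d (dl v) \<star> dl v' + dl v \<star> d (dl v')) \<star> dl t + dl v \<star> dl v' \<star> (c t \<star> dl t)" .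
    have dlg: "dl (v' \<otimes> t) = dl v' \<star> (dl t :: 'g \<Rightarrow> 'k)" using G by (simp add: dl_dl)
    show ?thesis
      unfolding eq unfolding g_eq(3) \<Delta>_vt[OF g_eq(1,2)] dlg by (simp only: star_distribs star_assoc add.assoc)
  qed
  have \<Delta>_right: "\<Delta> (g \<otimes> v) = \<Delta> g \<star> dl v + dl g \<star> d (dl v)" if v: "v \<in> P" and g: "g \<in> N" for v g
  proof -
    obtain v' t where g_eq: "v' \<in> P" "t \<in> T" "g = v' \<otimes> t" using split[OF g] by blast
    have G: "v \<in> carrier G" "v' \<in> carrier G" "t \<in> carrier G" "t \<in> N" using v g_eq PG TN by auto
    let ?v = "t \<otimes> v \<otimes> inv t"
    have v'': "?v \<in> P" by (rule P_conj[OF G(3) v])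
    have v''G: "?v \<in> carrier G" using PG[OF v''] .
    have cj_v: "cj t (dl v) = (dl ?v :: 'g \<Rightarrow> 'k)" using G by (simp add: cj_dl)
    have "?v \<otimes> t = t \<otimes> v" using G by (simp add: m_assoc)
    then have tv_eq: "dl ?v \<star> dl t = dl t \<star> (dl v :: 'g \<Rightarrow> 'k)" using G v''G by (simp add: dl_dl)
    have "g \<otimes> v = v' \<otimes> (?v \<otimes> t)" using g_eq G by (simp add: m_assoc)
    then have "\<Delta> (g \<otimes> v) = d (dl v') \<star> dl (?v \<otimes> t) + dl v' \<star> (d (dl ?v) \<star> dl t + dl ?v \<star> (c t \<star> dl t))"
      using \<Delta>_left[of v' "?v \<otimes> t"] \<Delta>_vt[OF v'' g_eq(2)] g_eq(1) v'' P_N G(4) N_sub by (auto simp: subgroup.m_closed)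
    also have "dl (?v \<otimes> t) = dl t \<star> (dl v :: 'g \<Rightarrow> 'k)" using tv_eq v''G G by (simp add: dl_dl)
    also have "d (dl ?v) = cj t (d (dl v)) + (c t \<star> dl ?v - dl ?v \<star> c t)"
      using c[OF G(4)] dl_P[OF v] unfolding stable_at_def cj_v[symmetric] by blast
    also have "(cj t (d (dl v)) + (c t \<star> dl ?v - dl ?v \<star> c t)) \<star> dl t + dl ?v \<star> (c t \<star> dl t)
        = cj t (d (dl v)) \<star> dl t + c t \<star> (dl ?v \<star> dl t)"
      by (simp add: star_distribs star_assoc)
    also have "\<dots> = dl t \<star> d (dl v) + c t \<star> (dl t \<star> dl v)"
      using dl_star_cj[OF G(3), of "d (dl v)"] tv_eq by simp
    finally have "\<Delta> (g \<otimes> v) = d (dl v') \<star> (dl t \<star> dl v) + dl v' \<star> (dl t \<star> d (dl v) + c t \<star> (dl t \<star> dl v))" .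
    also have "\<dots> = (d (dl v') \<star> dl t + dl v' \<star> (c t \<star> dl t)) \<star> dl v + dl v' \<star> dl t \<star> d (dl v)"
      by (simp add: star_distribs star_assoc add_ac)
    also have "\<dots> = \<Delta> g \<star> dl v + dl g \<star> d (dl v)"
      using \<Delta>_vt[OF g_eq(1,2)] g_eq(3) G by (simp add: dl_dl)
    finally show ?thesis .
  qed
  have d_one: "d (dl \<one>) = 0"
  proof -
    have one_P: "dl \<one> \<in> supp_in P" by (rule dl_P[OF subgroup.one_closed[OF P_sub]])
    have "d (dl \<one>) = d (dl \<one>) + d (dl \<one>)"
      using leib[OF one_P one_P]
      unfolding dl_one(1)[OF supp_P[OF one_P]] dl_one(2)[OF supp_P[OF dP[OF one_P]]] dl_one(1)[OF supp_P[OF dP[OF one_P]]] .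
    then show ?thesis by (metis add_cancel_right_right)
  qed
  have \<Delta>_P: "\<Delta> v = d (dl v)" if v: "v \<in> P" for v
  proof -
    have "c \<one> = 0" using subgroup.one_closed[OF P_sub] d_one by (simp add: c_def)
    then have "\<Delta> (v \<otimes> \<one>) = d (dl v)"
      using \<Delta>_vt[OF v one_T] supp_P[OF dP[OF dl_P[OF v]]] by (simp add: dl_one)
    then show ?thesis using PG[OF v] by simp
  qed
  have \<Delta>_N: "\<Delta> g \<in> supp_in N" if g: "g \<in> N" for g
  proof -
    obtain v t where g_eq: "v \<in> P" "t \<in> T" "g = v \<otimes> t" using split[OF g] by blast
    show ?thesis
      unfolding g_eq(3) \<Delta>_vt[OF g_eq(1,2)]
      by (intro supp_in_closed star_supp[OF N_sub] P_supp_N[OF dP[OF dl_P[OF g_eq(1)]]]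
          P_supp_N[OF dl_P[OF g_eq(1)]] dl_in TN(1)[OF g_eq(2)] P_supp_N[OF conjunct1[OF c[OF TN(1)[OF g_eq(2)]]]])
  qed
  have N_mult: "g \<otimes> h \<in> N" if "g \<in> N" "h \<in> N" for g h using that N_sub by (simp add: subgroup.m_closed)
  \<comment> \<open>The defect of the Leibniz rule. It is kP-linear in the second argument
    (\<open>f_right\<close>) and zero when the first lies in P (\<open>f_P\<close>), so that the
    correction will not disturb the values on kP.\<close>
  define f where "f g h = \<Delta> (g \<otimes> h) - \<Delta> g \<star> dl h - dl g \<star> \<Delta> h" for g h
  have f_right: "f g (h \<otimes> v) = f g h \<star> dl v" if g: "g \<in> N" and h: "h \<in> N" and v: "v \<in> P" for g h v
  proof -
    have G: "g \<in> carrier G" "h \<in> carrier G" "v \<in> carrier G" using g h v NG PG by auto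
    have "\<Delta> (g \<otimes> (h \<otimes> v)) = \<Delta> (g \<otimes> h) \<star> dl v + dl g \<star> (dl h \<star> d (dl v))"
      using \<Delta>_right[OF v N_mult[OF g h]] G by (simp add: m_assoc dl_mult_star)
    moreover have "\<Delta> (h \<otimes> v) = \<Delta> h \<star> dl v + dl h \<star> d (dl v)" by (rule \<Delta>_right[OF v h])
    moreover have "dl (h \<otimes> v) = dl h \<star> (dl v :: 'g \<Rightarrow> 'k)" using G by (simp add: dl_dl)
    ultimately show ?thesis unfolding f_def by (simp only: star_distribs star_assoc) simp
  qed
  have cocycle: "dl g \<star> f h l - f (g \<otimes> h) l + f g (h \<otimes> l) - f g h \<star> dl l = 0" if "g \<in> N" "h \<in> N" "l \<in> N" for g h l
  proof -
    have G: "g \<in> carrier G" "h \<in> carrier G" "l \<in> carrier G" using that NG by auto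
    have "dl (h \<otimes> l) = dl h \<star> (dl l :: 'g \<Rightarrow> 'k)" "dl (g \<otimes> h) = dl g \<star> (dl h :: 'g \<Rightarrow> 'k)" "g \<otimes> h \<otimes> l = g \<otimes> (h \<otimes> l)"
      using G by (simp_all add: dl_dl m_assoc)
    then show ?thesis unfolding f_def by (simp only: star_distribs star_assoc) simp
  qed
  have f_P: "f v h = 0" if "v \<in> P" "h \<in> N" for v h
    using \<Delta>_left[OF that] \<Delta>_P[OF that(1)] by (simp add: f_def)
  have w_P: "dl v \<star> w = w \<star> dl v" if "v \<in> P" for v using PC_commute[OF dl_in[OF that] w(1)] by simp
  define \<eta> where "\<eta> g = (\<Sum>l\<in>T. f g l \<star> w \<star> dl (inv l))" for g
  have sum_w: "(\<Sum>t\<in>T. dl t \<star> w \<star> dl (inv t)) = e"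
    using w(3) by (simp add: rtr_def T_def cj_def)
  \<comment> \<open>Multiply the cocycle identity for g, h, l by w l^-1 from the right and sum over
    l in T. The term with f g h l becomes f g h e because the weights add up to e, and in the term
    with h l the shift of the sum produces \<eta> g times h.\<close>
  have coboundary: "dl g \<star> \<eta> h - \<eta> (g \<otimes> h) + \<eta> g \<star> dl h - f g h \<star> e = 0" if g: "g \<in> N" and h: "h \<in> N" for g h
  proof -
    define F where "F l = f g l \<star> w \<star> dl (inv l)" for l
    have F_right: "F (l \<otimes> v) = F l" if l: "l \<in> N" and v: "v \<in> P" for l v
    proof -
      have G: "l \<in> carrier G" "v \<in> carrier G" using l v NG PG by auto
      have "F (l \<otimes> v) = f g l \<star> (dl v \<star> w) \<star> dl (inv (l \<otimes> v))" using f_right[OF g l v] by (simp add: F_def star_assoc)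
      also have "\<dots> = F l"
        unfolding w_P[OF v] using G by (simp add: F_def star_assoc dl_dl inv_mult_group m_assoc[symmetric])
      finally show ?thesis .
    qed
    have "(\<Sum>l\<in>T. f g (h \<otimes> l) \<star> w \<star> dl (inv l)) = (\<Sum>l\<in>T. F (h \<otimes> l) \<star> dl h)"
    proof (rule sum.cong[OF refl])
      fix l assume "l \<in> T"
      then have "l \<in> carrier G" "h \<in> carrier G" using TN h NG by auto
      then show "f g (h \<otimes> l) \<star> w \<star> dl (inv l) = F (h \<otimes> l) \<star> dl h"
        by (simp add: F_def star_assoc dl_dl inv_mult_group m_assoc)
    qed
    also have "\<dots> = (\<Sum>l\<in>T. F (h \<otimes> l)) \<star> dl h" by (simp only: star_sum)
    also have "(\<Sum>l\<in>T. F (h \<otimes> l)) = \<eta> g"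
      unfolding \<eta>_def F_def[symmetric] by (rule sum_shift[OF N_sub P_sub P_N T h F_right])
    finally have shift: "(\<Sum>l\<in>T. f g (h \<otimes> l) \<star> w \<star> dl (inv l)) = \<eta> g \<star> dl h" .
    have fe: "f g h \<star> e = (\<Sum>l\<in>T. f g h \<star> dl l \<star> w \<star> dl (inv l))"
      unfolding sum_w[symmetric] star_sum by (simp add: star_assoc)
    have "(\<Sum>l\<in>T. (dl g \<star> f h l - f (g \<otimes> h) l + f g (h \<otimes> l) - f g h \<star> dl l) \<star> w \<star> dl (inv l)) = 0"
      using cocycle[OF g h] TN by (intro sum.neutral) simp
    then have "(\<Sum>l\<in>T. dl g \<star> (f h l \<star> w \<star> dl (inv l)) - f (g \<otimes> h) l \<star> w \<star> dl (inv l)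
        + f g (h \<otimes> l) \<star> w \<star> dl (inv l) - f g h \<star> dl l \<star> w \<star> dl (inv l)) = 0"
      by (simp only: star_distribs star_assoc)
    then show ?thesis
      unfolding shift[symmetric] fe by (simp only: sum_subtractf sum.distrib star_sum[symmetric] \<eta>_def)
  qed
  \<comment> \<open>The Leibniz defect of \<Delta> g e is f g h e, and that of \<eta> is its
    negative.\<close>
  define E where "E g = \<Delta> g \<star> e + \<eta> g" for g
  have \<eta>_N: "\<eta> g \<in> supp_in N" if g: "g \<in> N" for g
    unfolding \<eta>_def
  proof (rule supp_in_closed(6))
    fix l assume l: "l \<in> T"
    have "f g l \<in> supp_in N"
      unfolding f_def using g TN(1)[OF l] \<Delta>_N N_mult by (intro supp_in_closed star_supp[OF N_sub] dl_in) auto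
    then show "f g l \<star> w \<star> dl (inv l) \<in> supp_in N"
      using TN(1)[OF l] N_sub by (intro star_supp[OF N_sub] C_supp_N[OF w(1)] dl_in) (auto simp: subgroup.m_inv_closed)
  qed
  have \<eta>_e: "\<eta> g \<star> e = \<eta> g" if g: "g \<in> N" for g
    unfolding \<eta>_def star_sum
  proof (rule sum.cong[OF refl])
    fix l assume l: "l \<in> T"
    have "inv l \<in> N" using TN(1)[OF l] N_sub by (simp add: subgroup.m_inv_closed)
    then have "w \<star> (dl (inv l) \<star> e) = w \<star> dl (inv l)"
      using e_dl e_commute_C[OF w(1)] w(2) by (simp add: star_assoc[symmetric])
    then show "f g l \<star> w \<star> dl (inv l) \<star> e = f g l \<star> w \<star> dl (inv l)" by (simp add: star_assoc)
  qed
  have E_mult: "E (g \<otimes> h) = E g \<star> dl h + dl g \<star> E h" if g: "g \<in> N" and h: "h \<in> N" for g h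
  proof -
    have 1: "\<eta> (g \<otimes> h) = dl g \<star> \<eta> h + \<eta> g \<star> dl h - f g h \<star> e"
    proof -
      have "dl g \<star> \<eta> h + \<eta> g \<star> dl h - f g h \<star> e - \<eta> (g \<otimes> h) = 0"
        unfolding coboundary[OF g h, symmetric] by (simp only: diff_conv_add_uminus ac_simps)
      then show ?thesis by (metis eq_iff_diff_eq_0)
    qed
    have "\<Delta> (g \<otimes> h) \<star> e = f g h \<star> e + \<Delta> g \<star> (dl h \<star> e) + dl g \<star> (\<Delta> h \<star> e)"
      unfolding f_def by (simp only: star_distribs star_assoc) simp
    also have "dl h \<star> e = e \<star> dl h" by (rule e_dl[OF h])
    finally have 2: "\<Delta> (g \<otimes> h) \<star> e = f g h \<star> e + \<Delta> g \<star> (e \<star> dl h) + dl g \<star> (\<Delta> h \<star> e)" .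
    show ?thesis unfolding E_def 1 2 by (simp only: star_distribs star_assoc) simp
  qed
  define D where "D = lext N E"
  have D: "lin D" unfolding D_def by (rule lin_lext)
  have D_dl: "D (dl g) = E g" if "g \<in> N" for g unfolding D_def by (rule lext_dl[OF fin_sub[OF N_carrier] that])
  have D_N: "D x \<in> supp_in N" if "x \<in> supp_in N" for x
  proof (rule lin_in_on[OF fin_sub[OF N_carrier] D subspace_supp_in _ that])
    show "D (dl g) \<in> supp_in N" if "g \<in> N" for g
      unfolding D_dl[OF that] E_def
      by (rule supp_in_closed(2)[OF star_supp[OF N_sub \<Delta>_N[OF that] e_in_N] \<eta>_N[OF that]])
  qed
  have D_e: "D x \<star> e = D x" if "x \<in> supp_in N" for x
  proof (rule lin_eq_on[OF fin_sub[OF N_carrier] _ D _ that])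
    show "lin (\<lambda>x. D x \<star> e)" using D by (intro lin_intros)
    show "D (dl g) \<star> e = D (dl g)" if "g \<in> N" for g
      by (simp add: D_dl[OF that] E_def star_add_left \<eta>_e[OF that] star_assoc e_idem)
  qed
  have D_leib: "D (x \<star> y) = D x \<star> y + x \<star> D y" if "x \<in> supp_in N" "y \<in> supp_in N" for x y
    using that N_mult E_mult by (intro leibniz_on_basis[OF N_carrier D]) (auto simp: D_dl)
  have De: "D e = 0"
  proof -
    have "D (e \<star> e) = D e \<star> e + e \<star> D e" by (rule D_leib[OF e_in_N e_in_N])
    moreover have "e \<star> D e = D e" using D_e[OF e_in_N] e_commute_N[OF D_N[OF e_in_N]] by simp
    ultimately have "D e = D e + D e" unfolding e_idem D_e[OF e_in_N] by simp
    then show ?thesis by (metis add_cancel_right_right)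
  qed
  have D_P: "D a = d a \<star> e" if "a \<in> supp_in P" for a
  proof (rule lin_eq_on[OF fin_sub[OF P_carrier] D _ _ that])
    show "lin (\<lambda>a. d a \<star> e)" using lind by (intro lin_intros)
    fix v assume v: "v \<in> P"
    then have "\<eta> v = 0" unfolding \<eta>_def using f_P TN(1) by (intro sum.neutral) auto
    then show "D (dl v) = d (dl v) \<star> e" using v P_N D_dl \<Delta>_P[OF v] by (auto simp: E_def)
  qed
  have "D (a \<star> e) = d a \<star> e" if a: "a \<in> supp_in P" for a
    using D_leib[OF P_supp_N[OF a] e_in_N] D_P[OF a] by (simp add: De star_assoc e_idem)
  then show thesis using that D D_N D_e D_leib by blast
qed

text \<open>b is the sum of the orthogonal idempotents t e t^-1 with t in G/N, so B is a matrix
  algebra over kNe, with entry e s^-1 x t e at (s, t). Applying D to all entries gives a derivation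
  of B. As \<one> is in T, the element a e sits at the entry (\<one>, \<one>) alone, which explains
  the values on kPe.\<close>

lemma extend_to_B:
  assumes D: "lin D" "\<And>x. x \<in> supp_in N \<Longrightarrow> D x \<in> supp_in N" "\<And>x. x \<in> supp_in N \<Longrightarrow> D x \<star> e = D x"
    "\<And>x y. x \<in> supp_in N \<Longrightarrow> y \<in> supp_in N \<Longrightarrow> D (x \<star> y) = D x \<star> y + x \<star> D y"
  shows "\<exists>d'. derivation_on Bs d' \<and> (\<forall>a\<in>supp_in P. d' (a \<star> e) = D (a \<star> e))"
proof -
  define T where "T = tv (carrier G) N"
  have T: "transversal T (carrier G) N" and one_T: "\<one> \<in> T" unfolding T_def using tv[OF G_sub N_sub] by auto
  have TG: "t \<in> carrier G" if "t \<in> T" for t using tvG that by (simp add: T_def)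
  have sumb: "(\<Sum>t\<in>T. dl t \<star> (e \<star> dl (inv t))) = b" using sum_b by (simp add: T_def)
  have eD: "e \<star> D x = D x" if "x \<in> supp_in N" for x using D(2,3) e_commute_N that by metis
  define m where "m s t x = e \<star> (dl (inv s) \<star> (x \<star> (dl t \<star> e)))" for s t x
  have m_N: "m s t x \<in> supp_in N" for s t x
    using eGe[of "dl (inv s) \<star> (x \<star> dl t)"] by (simp add: m_def star_assoc star_in)
  define d' where "d' x = (\<Sum>s\<in>T. \<Sum>t\<in>T. dl s \<star> (D (m s t x) \<star> dl (inv t)))" for x
  have lin': "lin d'"
    unfolding d'_def m_def by (intro lin_intros lin_comp[OF D(1)])
  have d'_Bs: "d' x \<in> Bs" for x
    unfolding d'_def
  proof (intro Bs_closed(6))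
    fix s t assume st: "s \<in> T" "t \<in> T"
    have "D (m s t x) = e \<star> D (m s t x)" using eD[OF m_N] by simp
    then have "D (m s t x) \<in> Bs" using Bs_star(1)[OF e_Bs] by metis
    then show "dl s \<star> (D (m s t x) \<star> dl (inv t)) \<in> Bs" by (intro Bs_star(2)[OF Bs_star(1)] dl_in TG st)
  qed
  \<comment> \<open>Inserting b, as a sum over T, between x and y gives the matrix product of the
    entries.\<close>
  have m_mult: "m s t (x \<star> y) = (\<Sum>r\<in>T. m s r x \<star> m r t y)" if x: "x \<in> Bs" for s t x y
  proof -
    have "x \<star> y = x \<star> (b \<star> y)" using Bs_b(2)[OF x] by (simp add: star_assoc[symmetric])
    also have "\<dots> = (\<Sum>r\<in>T. x \<star> (dl r \<star> (e \<star> (e \<star> (dl (inv r) \<star> y)))))"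
      unfolding sumb[symmetric] star_sum by (simp add: star_assoc ee_star)
    finally show ?thesis unfolding m_def by (simp only: star_sum star_assoc)
  qed
  have leib: "d' (x \<star> y) = d' x \<star> y + x \<star> d' y" if x: "x \<in> Bs" and y: "y \<in> Bs" for x y
  proof -
    have right: "(\<Sum>t\<in>T. m r t y \<star> dl (inv t)) = e \<star> (dl (inv r) \<star> y)" for r
    proof -
      have "(\<Sum>t\<in>T. m r t y \<star> dl (inv t)) = e \<star> (dl (inv r) \<star> (y \<star> b))"
        unfolding sumb[symmetric] star_sum m_def by (simp only: star_assoc)
      then show ?thesis using Bs_b(2)[OF y] by simp
    qed
    have left: "(\<Sum>s\<in>T. dl s \<star> m s r x) = x \<star> (dl r \<star> e)" for r
    proof -
      have "(\<Sum>s\<in>T. dl s \<star> m s r x) = b \<star> (x \<star> (dl r \<star> e))"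
        unfolding sumb[symmetric] star_sum m_def by (simp only: star_assoc)
      then show ?thesis using Bs_b(1)[OF x] by (simp add: star_assoc[symmetric])
    qed
    have term1: "(\<Sum>s\<in>T. \<Sum>t\<in>T. \<Sum>r\<in>T. dl s \<star> (D (m s r x) \<star> (m r t y \<star> dl (inv t)))) = d' x \<star> y"
    proof -
      have "(\<Sum>s\<in>T. \<Sum>t\<in>T. \<Sum>r\<in>T. dl s \<star> (D (m s r x) \<star> (m r t y \<star> dl (inv t))))
          = (\<Sum>s\<in>T. \<Sum>r\<in>T. \<Sum>t\<in>T. dl s \<star> (D (m s r x) \<star> (m r t y \<star> dl (inv t))))"
        by (intro sum.cong refl sum.swap)
      also have "\<dots> = (\<Sum>s\<in>T. \<Sum>r\<in>T. dl s \<star> (D (m s r x) \<star> (e \<star> (dl (inv r) \<star> y))))"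
        by (simp only: star_sum[symmetric] right)
      also have "\<dots> = d' x \<star> y"
        unfolding d'_def star_sum
        by (intro sum.cong refl) (metis D(3) m_N star_assoc)
      finally show ?thesis .
    qed
    have term2: "(\<Sum>s\<in>T. \<Sum>t\<in>T. \<Sum>r\<in>T. dl s \<star> (m s r x \<star> (D (m r t y) \<star> dl (inv t)))) = x \<star> d' y"
    proof -
      have "(\<Sum>s\<in>T. \<Sum>t\<in>T. \<Sum>r\<in>T. dl s \<star> (m s r x \<star> (D (m r t y) \<star> dl (inv t))))
          = (\<Sum>t\<in>T. \<Sum>s\<in>T. \<Sum>r\<in>T. dl s \<star> (m s r x \<star> (D (m r t y) \<star> dl (inv t))))"
        by (rule sum.swap)
      also have "\<dots> = (\<Sum>t\<in>T. \<Sum>r\<in>T. \<Sum>s\<in>T. dl s \<star> (m s r x \<star> (D (m r t y) \<star> dl (inv t))))"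
        by (intro sum.cong refl sum.swap)
      also have "\<dots> = (\<Sum>t\<in>T. \<Sum>r\<in>T. x \<star> (dl r \<star> e) \<star> (D (m r t y) \<star> dl (inv t)))"
        by (simp only: star_assoc[symmetric] star_sum[symmetric] left[unfolded star_assoc[symmetric]])
      also have "\<dots> = (\<Sum>t\<in>T. \<Sum>r\<in>T. x \<star> (dl r \<star> (D (m r t y) \<star> dl (inv t))))"
        by (intro sum.cong refl) (metis eD m_N star_assoc)
      also have "\<dots> = (\<Sum>r\<in>T. \<Sum>t\<in>T. x \<star> (dl r \<star> (D (m r t y) \<star> dl (inv t))))" by (rule sum.swap)
      also have "\<dots> = x \<star> d' y" by (simp only: d'_def star_sum)
      finally show ?thesis .
    qed
    have "d' (x \<star> y) = (\<Sum>s\<in>T. \<Sum>t\<in>T. \<Sum>r\<in>T. dl s \<star> (D (m s r x) \<star> (m r t y \<star> dl (inv t)))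
        + dl s \<star> (m s r x \<star> (D (m r t y) \<star> dl (inv t))))"
      unfolding d'_def m_mult[OF x] lin_sum[OF D(1)] D(4)[OF m_N m_N] by (simp only: star_sum star_distribs star_assoc)
    then show ?thesis unfolding sum.distrib term1 term2 .
  qed
  have "d' (a \<star> e) = D (a \<star> e)" if a: "a \<in> supp_in P" for a
  proof -
    have ae: "a \<star> e = e \<star> a" by (rule e_commute_P[OF a])
    have not_N: "t \<notin> N" if t: "t \<in> T" "t \<noteq> \<one>" for t
    proof
      assume "t \<in> N"
      then have "inv t \<otimes> \<one> \<in> N" "inv \<one> \<otimes> \<one> \<in> N" using N_sub TG[OF t(1)] by (simp_all add: subgroup.m_inv_closed subgroup.one_closed)
      moreover have "\<exists>!s. s \<in> T \<and> inv s \<otimes> \<one> \<in> N" using T by (simp add: transversal_def)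
      ultimately show False using one_T t by blast
    qed
    have kill: "e \<star> (dl g \<star> e) = 0" if "g \<in> carrier G" "g \<notin> N" for g
      using e_orthogonal[OF that] dl_star_cj[OF that(1), of e] by (simp add: star_assoc[symmetric])
    have m0: "m s t (a \<star> e) = 0" if st: "s \<in> T" "t \<in> T" "s \<noteq> \<one> \<or> t \<noteq> \<one>" for s t
    proof (cases "t = \<one>")
      case True
      then have "inv s \<notin> N" using not_N[OF st(1)] st(3) N_sub TG[OF st(1)] by (metis inv_inv subgroup.m_inv_closed)
      then have 0: "e \<star> (dl (inv s) \<star> e) = 0" using kill TG[OF st(1)] by simp
      have "m s t (a \<star> e) = (e \<star> (dl (inv s) \<star> e)) \<star> (a \<star> (dl t \<star> e))" unfolding m_def ae by (simp only: star_assoc)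
      then show ?thesis unfolding 0 by simp
    next
      case False
      then have 0: "e \<star> (dl t \<star> e) = 0" using kill not_N TG st(2) by blast
      have "m s t (a \<star> e) = e \<star> (dl (inv s) \<star> (a \<star> (e \<star> (dl t \<star> e))))" unfolding m_def by (simp only: star_assoc)
      then show ?thesis unfolding 0 by simp
    qed
    have m1: "m \<one> \<one> (a \<star> e) = a \<star> e"
      using supp_P[OF a] ae by (simp add: m_def dl_one e_supp star_assoc e_idem star_in) (simp add: star_assoc[symmetric] e_idem)
    have inner: "(\<Sum>t\<in>T. dl s \<star> (D (m s t (a \<star> e)) \<star> dl (inv t))) = (if s = \<one> then D (a \<star> e) else 0)" if s: "s \<in> T" for s
    proof -
      have "(\<Sum>t\<in>T. dl s \<star> (D (m s t (a \<star> e)) \<star> dl (inv t))) = (\<Sum>t\<in>T. if t = \<one> then (if s = \<one> then D (a \<star> e) else 0) else 0)"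
      proof (rule sum.cong[OF refl])
        fix t assume t: "t \<in> T"
        have ae_N: "a \<star> e \<in> supp_in N" by (intro star_supp[OF N_sub] P_supp_N a e_in_N)
        show "dl s \<star> (D (m s t (a \<star> e)) \<star> dl (inv t)) = (if t = \<one> then (if s = \<one> then D (a \<star> e) else 0) else 0)"
        proof (cases "s = \<one> \<and> t = \<one>")
          case True
          then show ?thesis using m1 supp_N[OF D(2)[OF ae_N]] by (simp add: dl_one)
        next
          case False
          then have "m s t (a \<star> e) = 0" using m0[OF s t] by blast
          then have "dl s \<star> (D (m s t (a \<star> e)) \<star> dl (inv t)) = 0" using lin_0[OF D(1)] by (metis star_0)
          then show ?thesis using False by auto
        qed
      qed
      then show ?thesis using one_T transversal_finite[OF G_sub T] by simp
    qed
    have "d' (a \<star> e) = (\<Sum>s\<in>T. if s = \<one> then D (a \<star> e) else 0)" unfolding d'_def using inner by (intro sum.cong) auto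
    then show ?thesis using one_T transversal_finite[OF G_sub T] by simp
  qed
  moreover have "derivation_on Bs d'" using lin' d'_Bs leib by (simp add: derivation_on_def)
  ultimately show ?thesis by blast
qed

lemma stable_derivation_extends:
  assumes "derivation_on (supp_in P) d" "\<And>g. g \<in> N \<Longrightarrow> \<exists>c\<in>supp_in P. stable_at g d c"
  shows "\<exists>d'. derivation_on Bs d' \<and> extends d d'"
proof -
  obtain D :: "('g \<Rightarrow> 'k) \<Rightarrow> 'g \<Rightarrow> 'k" where D: "lin D" "\<And>x. x \<in> supp_in N \<Longrightarrow> D x \<in> supp_in N" "\<And>x. x \<in> supp_in N \<Longrightarrow> D x \<star> e = D x"
    "\<And>x y. x \<in> supp_in N \<Longrightarrow> y \<in> supp_in N \<Longrightarrow> D (x \<star> y) = D x \<star> y + x \<star> D y"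
    "\<And>a. a \<in> supp_in P \<Longrightarrow> D (a \<star> e) = d a \<star> e"
    by (rule extend_to_N[OF assms]) blast+
  obtain d' where d': "derivation_on Bs d'" "\<forall>a\<in>supp_in P. d' (a \<star> e) = D (a \<star> e)"
    using extend_to_B[OF D(1-4)] by blast
  then have "extends d d'" unfolding extends_def using D(5) by metis
  then show ?thesis using d'(1) by blast
qed

end

section \<open>The centre of the block of the centralizer\<close>

context normal_block
begin

text \<open>PC_G(P) consists of the elements that act on P by inner automorphisms, so the inertial
  quotient is N/M. The group \<open>Z\<close> below is the centre of P.\<close>

definition M :: "'g set" where "M = P <#> C"
definition Z :: "'g set" where "Z = P \<inter> C"

lemma M_sub: "subgroup M G"
  unfolding M_def by (rule mult_norm_subgroup[OF P_normal C_sub])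

lemma M_iff: "x \<in> M \<longleftrightarrow> (\<exists>u\<in>P. \<exists>c\<in>C. x = u \<otimes> c)"
  by (auto simp: M_def set_mult_iff)

lemma P_M: "P \<subseteq> M"
  unfolding M_iff subset_iff using PG subgroup.one_closed[OF C_sub] by (metis r_one)

lemma C_M: "C \<subseteq> M"
  unfolding M_iff subset_iff using CG subgroup.one_closed[OF P_sub] by (metis l_one)

lemma M_N: "M \<subseteq> N"
  unfolding M_iff subset_iff using P_N C_N N_sub by (metis subgroup.m_closed subsetD)

lemma M_carrier: "M \<subseteq> carrier G" using subgroup.subset[OF M_sub] .

lemma Z_sub: "subgroup Z G" unfolding Z_def by (rule subgroups_Inter_pair[OF P_sub C_sub])
lemma Z_C: "Z \<subseteq> C" and Z_P: "Z \<subseteq> P" by (auto simp: Z_def)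
lemma ZG: "z \<in> Z \<Longrightarrow> z \<in> carrier G" using Z_P PG by blast

lemma Z_commute:
  fixes x :: "'g \<Rightarrow> 'k"
  assumes "z \<in> Z" "x \<in> supp_in C"
  shows "dl z \<star> x = x \<star> dl z"
  using PC_commute[OF dl_in assms(2), of z] assms(1) Z_P by auto

lemma Z_fixed: "z \<in> Z \<Longrightarrow> x \<in> supp_in C \<Longrightarrow> cj z x = x"
  using cj_PC Z_P by blast

lemma cj_Z: "z \<in> Z \<Longrightarrow> c \<in> C \<Longrightarrow> cj c (dl z) = (dl z :: 'g \<Rightarrow> 'k)"
  using C_commute[of c z] Z_P PG CG conj_eq_iff_commute[of c z] by (auto simp: cj_dl)

sublocale centre: local_subalgebra G "centre C e" e
  by (rule block_idem_local[OF C_sub e_block])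

lemma centre_C: "x \<in> centre C e \<Longrightarrow> x \<in> supp_in C" by (simp add: centre_def)
lemma centre_e: "x \<in> centre C e \<Longrightarrow> e \<star> x = x" by (simp add: centre_def)
lemma centre_fixed: "x \<in> centre C e \<Longrightarrow> c \<in> C \<Longrightarrow> cj c x = x" by (simp add: centre_def)

lemma centre_commute: "x \<in> centre C e \<Longrightarrow> y \<in> supp_in C \<Longrightarrow> y \<star> x = x \<star> y"
  by (rule fixed_commute[OF C_carrier]) (auto simp: centre_def intro: supp_C)

lemma cj_centre:
  assumes g: "g \<in> N" and x: "x \<in> centre C e"
  shows "cj g x \<in> centre C e"
proof -
  have gG: "g \<in> carrier G" using NG g .
  have "cj c (cj g x) = cj g x" if c: "c \<in> C" for c
  proof -
    have 1: "inv g \<otimes> c \<otimes> g \<in> C" using C_conj[of "inv g" c] gG c by simp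
    have "c \<otimes> g = g \<otimes> (inv g \<otimes> c \<otimes> g)" using gG CG[OF c] by (simp add: m_assoc inv_cancel)
    then show ?thesis using gG CG c 1 centre_fixed[OF x 1] by (simp add: cj_cj cj_coset)
  qed
  moreover have "e \<star> cj g x = cj g (e \<star> x)" using gG e_N[OF g] by (simp add: cj_mult)
  ultimately show ?thesis
    using cj_C[OF gG centre_C[OF x]] centre_e[OF x] by (simp add: centre_def)
qed

lemma tvCZ: "t \<in> tv C Z \<Longrightarrow> t \<in> C"
  using tv(1)[OF C_sub Z_sub] by (auto simp: transversal_def)

text \<open>Split the trace of w from P to N at M. The partial trace q to M is central in kCe, and e
  is the sum of the conjugates of q over N/M. The centre is local, so one conjugate is a unit and
  hence q is a unit. Then w times the inverse of q has trace e from P to M, and M/P has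
  representatives C/Z.\<close>

lemma relative_trace_Z:
  obtains w where "w \<in> supp_in C" "e \<star> w = w" "rtr C Z w = e"
proof -
  obtain w where w: "w \<in> supp_in C" "e \<star> w = w" "rtr N P w = e" by (rule relative_trace_e)
  define q where "q = rtr M P w"
  have tvM: "t \<in> M" "t \<in> N" "t \<in> carrier G" if "t \<in> tv M P" for t
    using tv(1)[OF M_sub P_sub] that M_N N_carrier by (auto simp: transversal_def)
  have q: "q \<in> centre C e"
    unfolding centre_def
  proof (intro CollectI conjI ballI)
    show "q \<in> supp_in C" unfolding q_def rtr_def by (intro supp_in_closed(6) cj_C tvM(3) w(1))
    show "cj c q = q" if "c \<in> C" for c
      unfolding q_def by (rule rtr_fixed[OF M_sub P_sub P_M cj_PC[OF _ w(1)]]) (use that C_M in auto)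
    have "e \<star> q = rtr M P (e \<star> w)" unfolding q_def using e_N M_N by (intro rtr_mult(1)[OF M_sub P_sub]) auto
    then show "e \<star> q = q" by (simp add: w(2) q_def)
  qed
  have tvN: "t \<in> N" if "t \<in> tv N M" for t using tv(1)[OF N_sub M_sub] that by (auto simp: transversal_def)
  have "(\<Sum>t\<in>tv N M. cj t q) = e"
    using rtr_tower[OF N_sub M_sub M_N P_sub P_M cj_PC[OF _ w(1)]] w(3) by (simp add: rtr_def q_def)
  then have "centre.unit (\<Sum>t\<in>tv N M. cj t q)" using centre.f e_idem by (auto simp: centre.unit_def)
  then obtain t where t: "t \<in> tv N M" "centre.unit (cj t q)"
    using centre.unit_sum[of "tv N M" "\<lambda>t. cj t q"] cj_centre[OF tvN q] transversal_finite[OF N_sub tv(1)[OF N_sub M_sub]] by blast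
  then obtain y where y: "y \<in> centre C e" "cj t q \<star> y = e" by (auto simp: centre.unit_def)
  have tG: "t \<in> N" "inv t \<in> N" "t \<in> carrier G" using tvN[OF t(1)] N_sub NG by (auto simp: subgroup.m_inv_closed)
  define z where "z = cj (inv t) y"
  have z: "z \<in> centre C e" unfolding z_def by (rule cj_centre[OF tG(2) y(1)])
  have "cj (inv t) (cj t q \<star> y) = q \<star> z"
    using tG supp_C[OF centre_C[OF q]] by (simp add: cj_mult cj_cj cj_one z_def)
  then have qz: "q \<star> z = e" using y(2) e_N[OF tG(2)] by simp
  have z_M: "cj m z = z" if m: "m \<in> M" for m
  proof -
    obtain u c where uc: "u \<in> P" "c \<in> C" "m = u \<otimes> c" using m M_iff by blast
    then show ?thesis
      using cj_coset[of u c z] centre_fixed[OF z uc(2)] cj_PC[OF uc(1) centre_C[OF z]] PG CG by simp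
  qed
  have wz: "w \<star> z \<in> supp_in C" by (rule star_supp[OF C_sub w(1) centre_C[OF z]])
  have T: "transversal (tv C (C \<inter> P)) M P"
  proof (rule transversal_second_iso[OF tv(1)[OF C_sub subgroups_Inter_pair[OF C_sub P_sub]] C_M P_sub C_sub M_sub])
    fix k assume "k \<in> M"
    then obtain u c where uc: "u \<in> P" "c \<in> C" "k = u \<otimes> c" using M_iff by blast
    have "inv c \<otimes> k = inv c \<otimes> (c \<otimes> u)" using C_commute[OF uc(2,1)] uc(3) by simp
    then have "inv c \<otimes> k = u" using PG[OF uc(1)] CG[OF uc(2)] by (simp add: inv_cancel)
    then show "\<exists>m\<in>C. inv m \<otimes> k \<in> P" using uc by (intro bexI[of _ c]) auto
  qed
  have "rtr C Z (w \<star> z) = rtr M P (w \<star> z)"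
    unfolding rtr_def
  proof (rule transversal_sum[OF M_sub P_sub P_M _ tv(1)[OF M_sub P_sub]])
    show "transversal (tv C Z) M P" using T by (simp add: Z_def Int_commute)
    show "cj (g \<otimes> h) (w \<star> z) = cj g (w \<star> z)" if "g \<in> M" "h \<in> P" for g h
      using that M_carrier PG cj_PC[OF _ wz] by (intro cj_coset) auto
  qed
  also have "\<dots> = q \<star> z" unfolding q_def by (rule rtr_mult(2)[OF M_sub P_sub z_M, symmetric])
  finally have "rtr C Z (w \<star> z) = e" by (simp add: qz)
  moreover have "e \<star> (w \<star> z) = w \<star> z" using w(2) by (simp add: star_assoc[symmetric])
  ultimately show thesis using that wz by blast
qed

text \<open>This element spans the socle of kZ. In kC its annihilator is the ideal generated by the
  z - 1 with z in Z; see \<open>zeta_annihilator\<close>.\<close>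

definition \<zeta> :: "'g \<Rightarrow> 'k" where "\<zeta> = (\<Sum>z\<in>Z. dl z)"

lemma Z_\<zeta>: assumes z: "z \<in> Z" shows "dl z \<star> \<zeta> = \<zeta>"
proof -
  have "dl z \<star> \<zeta> = (\<Sum>y\<in>Z. dl (z \<otimes> y))"
    unfolding \<zeta>_def star_sum using z ZG by (intro sum.cong) (auto simp: dl_dl)
  also have "\<dots> = \<zeta>"
    unfolding \<zeta>_def
    by (rule sum.reindex_bij_witness[of _ "\<lambda>y. inv z \<otimes> y" "\<lambda>y. z \<otimes> y"])
      (use z ZG Z_sub in \<open>auto simp: inv_cancel subgroup.m_closed subgroup.m_inv_closed\<close>)
  finally show ?thesis .
qed

lemma \<zeta>_C: "\<zeta> \<in> supp_in C"
  unfolding \<zeta>_def using Z_C by (intro supp_in_closed dl_in) auto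

lemma \<zeta>_commute: "x \<in> supp_in C \<Longrightarrow> x \<star> \<zeta> = \<zeta> \<star> x"
  unfolding \<zeta>_def star_sum using Z_commute by (intro sum.cong) auto

text \<open>A Maschke-type argument: averaging a linear projection onto \<open>r kC \<zeta>\<close> with the relative trace of \<open>w\<close>
  makes it \<open>kC\<close>-linear, so that \<open>r kC \<zeta>\<close> is generated by an element \<open>f\<close> which acts on it as the identity.\<close>

lemma nilpotent_times_zeta:
  assumes r: "r \<in> centre C e" and nil: "centre.pw r m = 0"
  shows "r \<star> \<zeta> = 0"
proof -
  obtain w where w: "w \<in> supp_in C" "e \<star> w = w" "rtr C Z w = e" by (rule relative_trace_Z)
  define V where "V = (\<lambda>x. r \<star> (x \<star> \<zeta>)) ` supp_in C"
  have subV: "fv.subspace V"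
  proof -
    have "lin (\<lambda>x. r \<star> (x \<star> \<zeta>))" by (intro lin_intros)
    then interpret m: Vector_Spaces.linear smul smul "\<lambda>x. r \<star> (x \<star> \<zeta>)" .
    show ?thesis unfolding V_def by (rule m.subspace_image[OF subspace_supp_in])
  qed
  have V_star: "x \<star> v \<in> V" if x: "x \<in> supp_in C" and "v \<in> V" for x v
  proof -
    obtain y where y: "y \<in> supp_in C" "v = r \<star> (y \<star> \<zeta>)" using \<open>v \<in> V\<close> by (auto simp: V_def)
    have "x \<star> v = r \<star> (x \<star> y \<star> \<zeta>)" using centre_commute[OF r x] y by (simp add: star_assoc[symmetric])
    then show ?thesis using star_supp[OF C_sub x y(1)] by (auto simp: V_def)
  qed
  have V_Z: "dl z \<star> v = v" if z: "z \<in> Z" and "v \<in> V" for z v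
  proof -
    obtain y where y: "y \<in> supp_in C" "v = r \<star> (y \<star> \<zeta>)" using \<open>v \<in> V\<close> by (auto simp: V_def)
    have "dl z \<star> v = r \<star> y \<star> (dl z \<star> \<zeta>)"
      using Z_commute[OF z star_supp[OF C_sub centre_C[OF r] y(1)]] y(2) by (simp add: star_assoc[symmetric])
    then show ?thesis using Z_\<zeta>[OF z] y(2) by (simp add: star_assoc)
  qed
  have V_e: "e \<star> v = v" if "v \<in> V" for v
    using that centre_e[OF r] by (auto simp: V_def star_assoc[symmetric])
  obtain F :: "('g \<Rightarrow> 'k) \<Rightarrow> 'g \<Rightarrow> 'k" where F: "lin F" "\<And>x. F x \<in> V" "\<And>v. v \<in> V \<Longrightarrow> F v = v"
    using subspace_projection[OF subV] by blast
  have dl_C: "dl c \<in> supp_in C" if "c \<in> C" for c by (rule dl_in[OF that])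
  \<comment> \<open>The conjugates of w over C/Z add up to e, so q is still the identity on V. On kC
    \<zeta> the sum does not depend on the transversal, because Z acts trivially there and on the
    values of F.\<close>
  define q where "q m = (\<Sum>c\<in>tv C Z. dl c \<star> (w \<star> F (dl (inv c) \<star> m)))" for m
  have linq: "lin q" unfolding q_def by (intro lin_intros lin_comp[OF F(1)])
  have q_V: "q m \<in> V" for m
    unfolding q_def by (intro subspace_closed(6)[OF subV] V_star dl_C tvCZ w(1) F(2))
  have q_id: "q v = v" if v: "v \<in> V" for v
  proof -
    have "q v = (\<Sum>c\<in>tv C Z. (dl c \<star> w \<star> dl (inv c)) \<star> v)"
      unfolding q_def
    proof (rule sum.cong[OF refl])
      fix c assume "c \<in> tv C Z"
      then have "inv c \<in> C" using tvCZ C_sub by (auto simp: subgroup.m_inv_closed)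
      then show "dl c \<star> (w \<star> F (dl (inv c) \<star> v)) = (dl c \<star> w \<star> dl (inv c)) \<star> v"
        using F(3)[OF V_star[OF dl_C v]] by (simp add: star_assoc)
    qed
    also have "\<dots> = e \<star> v" unfolding star_sum(1)[symmetric] w(3)[symmetric] rtr_def cj_def ..
    finally show ?thesis using V_e[OF v] by simp
  qed
  have q_lin: "q (x \<star> \<zeta>) = x \<star> q \<zeta>" if x: "x \<in> supp_in C" for x
  proof (rule lin_eq_on[OF fin_sub[OF C_carrier] _ _ _ x])
    show "lin (\<lambda>x. q (x \<star> \<zeta>))" "lin (\<lambda>x. x \<star> q \<zeta>)" by (intro lin_intros lin_comp[OF linq])+
    fix h assume h: "h \<in> C"
    define \<Psi> where "\<Psi> g = dl g \<star> (w \<star> F (dl (inv g) \<star> (dl h \<star> \<zeta>)))" for g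
    have \<Psi>_right: "\<Psi> (g \<otimes> z) = \<Psi> g" if g: "g \<in> C" and z: "z \<in> Z" for g z
    proof -
      have G: "g \<in> carrier G" "z \<in> carrier G" "inv z \<in> Z" "inv g \<in> C"
        using g z CG ZG Z_sub C_sub by (auto simp: subgroup.m_inv_closed)
      have "dl (inv (g \<otimes> z)) \<star> (dl h \<star> \<zeta>) = dl (inv z) \<star> (dl (inv g) \<star> dl h) \<star> \<zeta>"
        using G by (simp add: inv_mult_group dl_dl[symmetric] star_assoc)
      also have "\<dots> = dl (inv g) \<star> dl h \<star> (dl (inv z) \<star> \<zeta>)"
        using Z_commute[OF G(3) star_supp[OF C_sub dl_C[OF G(4)] dl_C[OF h]]] by (simp add: star_assoc)
      also have "\<dots> = dl (inv g) \<star> (dl h \<star> \<zeta>)" using Z_\<zeta>[OF G(3)] by (simp add: star_assoc)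
      finally have 1: "dl (inv (g \<otimes> z)) \<star> (dl h \<star> \<zeta>) = dl (inv g) \<star> (dl h \<star> \<zeta>)" .
      have "dl (g \<otimes> z) \<star> (w \<star> v) = dl g \<star> (w \<star> (dl z \<star> v))" for v
        using Z_commute[OF z w(1)] G by (simp add: dl_dl[symmetric] star_assoc) (simp add: star_assoc[symmetric])
      then show ?thesis unfolding \<Psi>_def 1 using V_Z[OF z F(2)] by simp
    qed
    have "dl h \<star> q \<zeta> = (\<Sum>c\<in>tv C Z. \<Psi> (h \<otimes> c))"
      unfolding q_def star_sum
    proof (rule sum.cong[OF refl])
      fix c assume "c \<in> tv C Z"
      then have G: "c \<in> carrier G" "h \<in> carrier G" using tvCZ CG h by auto
      have "dl (inv (h \<otimes> c)) \<star> (dl h \<star> \<zeta>) = dl (inv c) \<star> \<zeta>"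
        using G by (simp add: dl_mult_star inv_mult_group m_assoc)
      then show "dl h \<star> (dl c \<star> (w \<star> F (dl (inv c) \<star> \<zeta>))) = \<Psi> (h \<otimes> c)"
        using G by (simp add: \<Psi>_def dl_mult_star)
    qed
    also have "\<dots> = (\<Sum>c\<in>tv C Z. \<Psi> c)" by (rule sum_shift[OF C_sub Z_sub Z_C tv(1)[OF C_sub Z_sub] h \<Psi>_right])
    also have "\<dots> = q (dl h \<star> \<zeta>)" by (simp add: q_def \<Psi>_def)
    finally show "q (dl h \<star> \<zeta>) = dl h \<star> q \<zeta>" ..
  qed
  obtain y where y: "y \<in> supp_in C" "q \<zeta> = r \<star> (y \<star> \<zeta>)" using q_V[of \<zeta>] by (auto simp: V_def)
  have rC: "r \<in> supp_in C" by (rule centre_C[OF r])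
  define v where "v = r \<star> \<zeta>"
  have "v = r \<star> (e \<star> \<zeta>)" using centre_e[OF r] e_commute_C[OF rC] by (simp add: v_def star_assoc[symmetric])
  then have vV: "v \<in> V" using e_in by (auto simp: V_def)
  \<comment> \<open>q fixes v and is kC-linear on kC \<zeta>, so v = r (q \<zeta>), and q \<zeta> =
    r y \<zeta> makes this r (y v). Iterating brings any power of the nilpotent r in front.\<close>
  have step: "v = r \<star> (y \<star> v)"
  proof -
    have "v = r \<star> q \<zeta>" using q_id[OF vV] q_lin[OF rC] by (simp add: v_def)
    also have "\<dots> = r \<star> (r \<star> y \<star> \<zeta>)" unfolding y(2) by (simp only: star_assoc)
    also have "r \<star> y \<star> \<zeta> = y \<star> v" using centre_commute[OF r y(1)] by (simp add: v_def star_assoc[symmetric])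
    finally show ?thesis .
  qed
  have "\<exists>Y\<in>supp_in C. v = centre.pw r i \<star> (Y \<star> v)" for i
  proof (induction i)
    case 0
    have "v = centre.pw r 0 \<star> (e \<star> v)" using V_e[OF vV] by simp
    then show ?case using e_in by blast
  next
    case (Suc i)
    then obtain Y where Y: "Y \<in> supp_in C" "v = centre.pw r i \<star> (Y \<star> v)" by blast
    let ?R = "centre.pw r i"
    have R: "?R \<in> supp_in C" using centre.pw_in[OF r] centre_C by blast
    have "v = ?R \<star> (Y \<star> v)" by (rule Y(2))
    also have "Y \<star> v = Y \<star> (r \<star> (y \<star> v))" by (rule arg_cong[OF step])
    also have "?R \<star> \<dots> = (?R \<star> Y \<star> r) \<star> (y \<star> v)" by (simp only: star_assoc)
    also have "?R \<star> Y \<star> r = r \<star> (?R \<star> Y)" by (rule centre_commute[OF r star_supp[OF C_sub R Y(1)]])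
    also have "r \<star> (?R \<star> Y) \<star> (y \<star> v) = centre.pw r (Suc i) \<star> (Y \<star> y \<star> v)" by (simp add: star_assoc)
    finally have "v = centre.pw r (Suc i) \<star> (Y \<star> y \<star> v)" .
    then show ?case using star_supp[OF C_sub Y(1) y(1)] by blast
  qed
  then obtain Y where "v = centre.pw r m \<star> (Y \<star> v)" by blast
  then have "v = 0" unfolding nil by simp
  then show ?thesis by (simp add: v_def)
qed

text \<open>The coefficient of a \<zeta> at s is the sum of a over the coset sZ. As all these sums
  are zero, each s z in the expansion of a may be replaced by s z - s = (z - 1) s.\<close>

lemma zeta_annihilator:
  assumes a: "a \<in> supp_in C" "a \<star> \<zeta> = 0"
  obtains A where "\<And>z. A z \<in> supp_in C" "a = (\<Sum>z\<in>Z. (dl z - dl \<one>) \<star> A z)"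
proof -
  define A where "A z = (\<Sum>s\<in>tv C Z. smul (a (s \<otimes> z)) (dl s))" for z
  have zero: "(\<Sum>z\<in>Z. a (s \<otimes> z)) = 0" if s: "s \<in> C" for s
  proof -
    have "(a \<star> \<zeta>) s = (\<Sum>z\<in>Z. a (s \<otimes> inv z))"
      unfolding \<zeta>_def star_sum sum_fun_apply using s CG ZG by (intro sum.cong) (auto simp: star_dl)
    also have "\<dots> = (\<Sum>z\<in>Z. a (s \<otimes> z))"
      by (rule sum.reindex_bij_witness[of _ "m_inv G" "m_inv G"])
        (use ZG Z_sub in \<open>auto simp: subgroup.m_inv_closed\<close>)
    finally show ?thesis using a(2) by simp
  qed
  have "a = (\<Sum>g\<in>C. smul (a g) (dl g))" by (rule expand_dl[OF fin_sub[OF C_carrier] a(1)])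
  also have "\<dots> = (\<Sum>s\<in>tv C Z. \<Sum>z\<in>Z. smul (a (s \<otimes> z)) (dl (s \<otimes> z)))" by (rule sum_cosets[OF C_sub Z_sub Z_C])
  also have "\<dots> = (\<Sum>s\<in>tv C Z. \<Sum>z\<in>Z. smul (a (s \<otimes> z)) ((dl z - dl \<one>) \<star> dl s))"
  proof (rule sum.cong[OF refl])
    fix s assume "s \<in> tv C Z"
    then have s: "s \<in> C" "s \<in> carrier G" using tvCZ CG by auto
    have "smul (a (s \<otimes> z)) ((dl z - dl \<one>) \<star> dl s) = smul (a (s \<otimes> z)) (dl (s \<otimes> z)) - smul (a (s \<otimes> z)) (dl s)" if z: "z \<in> Z" for z
      using Z_commute[OF z dl_in[OF s(1)]] s ZG[OF z] by (simp add: star_diff dl_dl smul_add)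
    then have "(\<Sum>z\<in>Z. smul (a (s \<otimes> z)) ((dl z - dl \<one>) \<star> dl s))
        = (\<Sum>z\<in>Z. smul (a (s \<otimes> z)) (dl (s \<otimes> z))) - (\<Sum>z\<in>Z. smul (a (s \<otimes> z)) (dl s))"
      by (simp add: sum_subtractf)
    also have "(\<Sum>z\<in>Z. smul (a (s \<otimes> z)) (dl s)) = smul (\<Sum>z\<in>Z. a (s \<otimes> z)) (dl s)"
      by (simp add: fun_eq_iff sum_fun_apply sum_distrib_right)
    also have "\<dots> = 0" using zero[OF s(1)] by simp
    finally have eq: "(\<Sum>z\<in>Z. smul (a (s \<otimes> z)) ((dl z - dl \<one>) \<star> dl s)) = (\<Sum>z\<in>Z. smul (a (s \<otimes> z)) (dl (s \<otimes> z))) - 0" .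
    show "(\<Sum>z\<in>Z. smul (a (s \<otimes> z)) (dl (s \<otimes> z))) = (\<Sum>z\<in>Z. smul (a (s \<otimes> z)) ((dl z - dl \<one>) \<star> dl s))"
      unfolding eq by simp
  qed
  also have "\<dots> = (\<Sum>z\<in>Z. \<Sum>s\<in>tv C Z. smul (a (s \<otimes> z)) ((dl z - dl \<one>) \<star> dl s))" by (rule sum.swap)
  also have "\<dots> = (\<Sum>z\<in>Z. (dl z - dl \<one>) \<star> A z)"
    unfolding A_def star_sum by (simp add: star_smul_right)
  finally have eq: "a = (\<Sum>z\<in>Z. (dl z - dl \<one>) \<star> A z)" .
  have "A z \<in> supp_in C" for z
    unfolding A_def by (intro supp_in_closed(6) supp_in_closed(5) dl_in tvCZ)
  then show thesis using that eq by blast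
qed

end

text \<open>\<open>split\<close> says that the centre of kCe, a local algebra, has residue field
  k.\<close>

locale split_block = normal_block G scalars p P b e n
  for G :: "('g, 'm) monoid_scheme" (structure) and scalars :: "'k::field itself" and p P b e n +
  assumes split: "x \<in> centre C e \<Longrightarrow> \<exists>c. \<not> centre.unit (x - smul c e)"
begin

text \<open>For a suitable c the difference r = x - c e is nilpotent, so r \<zeta> = 0 and r lies in
  the ideal of kC generated by the z - 1. Multiplying by w and taking the trace from Z to C returns
  r, and turns the coefficients into central ones.\<close>

lemma centre_decomposition:
  assumes x: "x \<in> centre C e"
  obtains c Y where "\<And>z. Y z \<in> centre C e" "x = smul c e + (\<Sum>z\<in>Z. (dl z - dl \<one>) \<star> Y z)"
proof -
  obtain w where w: "w \<in> supp_in C" "e \<star> w = w" "rtr C Z w = e" by (rule relative_trace_Z)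
  obtain c where c: "\<not> centre.unit (x - smul c e)" using split[OF x] by blast
  define r where "r = x - smul c e"
  have r: "r \<in> centre C e"
    unfolding r_def using x centre.f by (intro subspace_closed[OF centre.S(1)])
  then obtain m where "centre.pw r m = 0" using c centre.unit_or_nilpotent[OF r] by (auto simp: r_def)
  then have "r \<star> \<zeta> = 0" using nilpotent_times_zeta[OF r] by blast
  from zeta_annihilator[OF centre_C[OF r] this]
  obtain A where A: "\<And>z. A z \<in> supp_in C" "r = (\<Sum>z\<in>Z. (dl z - dl \<one>) \<star> A z)" by blast
  define Y where "Y z = rtr C Z (A z \<star> w)" for z
  have Aw: "A z \<star> w \<in> supp_in C" for z by (rule star_supp[OF C_sub A(1) w(1)])
  have Y: "Y z \<in> centre C e" for z
    unfolding centre_def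
  proof (intro CollectI conjI ballI)
    show "Y z \<in> supp_in C" unfolding Y_def rtr_def by (intro supp_in_closed(6) cj_C CG tvCZ Aw)
    show "cj h (Y z) = Y z" if "h \<in> C" for h
      unfolding Y_def by (rule rtr_fixed[OF C_sub Z_sub Z_C Z_fixed[OF _ Aw] that])
    have "e \<star> Y z = rtr C Z (e \<star> (A z \<star> w))" unfolding Y_def by (rule rtr_mult(1)[OF C_sub Z_sub e_fixed])
    also have "e \<star> (A z \<star> w) = A z \<star> w"
      using e_commute_C[OF A(1)] w(2) by (metis star_assoc)
    finally show "e \<star> Y z = Y z" by (simp add: Y_def)
  qed
  have fixed: "cj h (dl z - dl \<one>) = dl z - (dl \<one> :: 'g \<Rightarrow> 'k)" if "h \<in> C" "z \<in> Z" for h z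
    using cj_Z[OF that(2,1)] cj_Z[OF subgroup.one_closed[OF Z_sub] that(1)] by (simp add: cj_lin_simps)
  have "r = e \<star> r" using centre_e[OF r] by simp
  also have "\<dots> = rtr C Z (w \<star> r)" unfolding w(3)[symmetric] by (rule rtr_mult(2)[OF C_sub Z_sub centre_fixed[OF r]])
  also have "w \<star> r = (\<Sum>z\<in>Z. (dl z - dl \<one>) \<star> (A z \<star> w))"
    unfolding centre_commute[OF r w(1)] by (subst A(2)) (simp add: star_sum star_assoc)
  also have "rtr C Z \<dots> = (\<Sum>z\<in>Z. (dl z - dl \<one>) \<star> Y z)"
    unfolding lin_sum[OF lin_rtr] Y_def
    using rtr_mult(1)[OF C_sub Z_sub fixed] by (intro sum.cong) auto
  finally have "x = smul c e + (\<Sum>z\<in>Z. (dl z - dl \<one>) \<star> Y z)" unfolding r_def by (metis add.commute diff_add_cancel)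
  then show thesis using that Y by blast
qed

text \<open>Nakayama's lemma over the \<open>p\<close>-group algebra \<open>kZ\<close>, in the form of a fixed vector modulo a maximal
  proper submodule containing \<open>kZe\<close>.\<close>

lemma centre_eq_kZe:
  assumes x: "x \<in> centre C e"
  shows "\<exists>a\<in>supp_in Z. x = a \<star> e"
proof (rule ccontr)
  assume neg: "\<not> ?thesis"
  let ?S = "centre C e" and ?kZe = "(\<lambda>a. a \<star> e) ` supp_in Z"
  have Z_e: "dl z \<star> e \<in> ?S" if "z \<in> Z" for z
  proof -
    have "dl z \<star> e \<in> supp_in C" by (rule star_supp[OF C_sub dl_in e_in]) (use that Z_C in auto)
    moreover have "cj c (dl z \<star> e) = dl z \<star> e" if "c \<in> C" for c
      using cj_Z[OF \<open>z \<in> Z\<close> that] e_fixed[OF that] CG[OF that] by (simp add: cj_mult)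
    moreover have "e \<star> (dl z \<star> e) = dl z \<star> e" using Z_commute[OF that e_in] ee_star e_idem by (simp add: star_assoc)
    ultimately show ?thesis by (simp add: centre_def)
  qed
  have S_Z: "dl z \<star> v \<in> ?S" if "z \<in> Z" "v \<in> ?S" for z v
    using centre.S_mult[OF Z_e[OF that(1)] that(2)] centre_e[OF that(2)] by (simp add: star_assoc)
  have subkZe: "fv.subspace ?kZe"
  proof -
    have "lin (\<lambda>a. a \<star> e)" by (intro lin_intros)
    then interpret m: Vector_Spaces.linear smul smul "\<lambda>a. a \<star> e" .
    show ?thesis by (rule m.subspace_image[OF subspace_supp_in])
  qed
  have kZe_S: "?kZe \<subseteq> ?S"
  proof
    fix v assume "v \<in> ?kZe"
    then obtain a where a: "a \<in> supp_in Z" "v = a \<star> e" by blast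
    have "a \<star> e \<in> ?S"
    proof (rule lin_in_on[OF fin_subgroup[OF Z_sub] _ centre.S(1) _ a(1)])
      show "lin (\<lambda>a. a \<star> e)" by (intro lin_intros)
    qed (rule Z_e)
    then show "v \<in> ?S" using a by simp
  qed
  have kZe_Z: "dl z \<star> v \<in> ?kZe" if zv: "z \<in> Z" "v \<in> ?kZe" for z v
  proof -
    obtain a where a: "a \<in> supp_in Z" "v = a \<star> e" using zv(2) by blast
    have "dl z \<star> v = (dl z \<star> a) \<star> e" using a(2) by (simp add: star_assoc)
    then show ?thesis using star_supp[OF Z_sub dl_in[OF zv(1)] a(1)] by blast
  qed
  define \<U> where "\<U> = {U. fv.subspace U \<and> ?kZe \<subseteq> U \<and> U \<subset> ?S \<and> (\<forall>z\<in>Z. \<forall>v\<in>U. dl z \<star> v \<in> U)}"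
  have kZe: "?kZe \<in> \<U>" using subkZe kZe_S kZe_Z neg x unfolding \<U>_def by blast
  have "\<exists>U\<in>\<U>. \<forall>V\<in>\<U>. U \<subseteq> V \<longrightarrow> V = U"
  proof (rule maximal_subspace[OF finG])
    show "fv.subspace U \<and> U \<subseteq> supp_in (carrier G)" if "U \<in> \<U>" for U
      using that centre.S(2) unfolding \<U>_def by blast
    show "\<U> \<noteq> {}" using kZe by blast
  qed
  then obtain U where U: "U \<in> \<U>" and Umax: "\<And>V. V \<in> \<U> \<Longrightarrow> U \<subseteq> V \<Longrightarrow> V = U" by blast
  have subU: "fv.subspace U" and kZe_U: "?kZe \<subseteq> U" and US: "U \<subset> ?S" and U_Z: "\<And>z v. z \<in> Z \<Longrightarrow> v \<in> U \<Longrightarrow> dl z \<star> v \<in> U"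
    using U by (auto simp: \<U>_def)
  obtain i where i: "card Z = p ^ i" using card_subgroup_p_power[OF P_sub P_card Z_sub Z_P] by blast
  obtain s where s: "s \<in> ?S" "s \<notin> U" and s_Z: "\<And>z. z \<in> Z \<Longrightarrow> dl z \<star> s - s \<in> U"
    using unipotent_action[OF Z_sub i subU centre.S S_Z U_Z] US by blast
  \<comment> \<open>U + ks is stable under Z because s is fixed modulo U. It is strictly larger than
    U, hence the whole centre by maximality, and so z - 1 maps the centre into U.\<close>
  define U' where "U' = {v \<in> ?S. \<exists>c. v - smul c s \<in> U}"
  have "fv.subspace U'"
    unfolding fv.subspace_def
  proof (intro conjI ballI allI)
    have "0 - smul 0 s \<in> U" using subspace_closed(1)[OF subU] by simp
    then show "0 \<in> U'" using subspace_closed(1)[OF centre.S(1)] unfolding U'_def by blast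
    fix v v' assume "v \<in> U'" "v' \<in> U'"
    then obtain c c' where c: "v \<in> ?S" "v' \<in> ?S" "v - smul c s \<in> U" "v' - smul c' s \<in> U" by (auto simp: U'_def)
    have "(v + v') - smul (c + c') s = (v - smul c s) + (v' - smul c' s)" by (simp add: smul_add)
    then have "(v + v') - smul (c + c') s \<in> U" using subspace_closed(2)[OF subU c(3,4)] by metis
    then show "v + v' \<in> U'" using subspace_closed(2)[OF centre.S(1) c(1,2)] unfolding U'_def by blast
  next
    fix k v assume "v \<in> U'"
    then obtain c where c: "v \<in> ?S" "v - smul c s \<in> U" by (auto simp: U'_def)
    have "smul k v - smul (k * c) s = smul k (v - smul c s)" by (simp add: smul_add)
    then have "smul k v - smul (k * c) s \<in> U" using subspace_closed(5)[OF subU c(2)] by metis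
    then show "smul k v \<in> U'" using subspace_closed(5)[OF centre.S(1) c(1)] unfolding U'_def by blast
  qed
  moreover have UU': "U \<subseteq> U'"
  proof
    fix v assume v: "v \<in> U"
    then have "v - smul 0 s \<in> U" by simp
    then show "v \<in> U'" using v US unfolding U'_def by blast
  qed
  moreover have "s \<in> U'"
  proof -
    have "s - smul 1 s \<in> U" using subspace_closed(1)[OF subU] by simp
    then show ?thesis using s(1) unfolding U'_def by blast
  qed
  moreover have "dl z \<star> v \<in> U'" if z: "z \<in> Z" and v: "v \<in> U'" for z v
  proof -
    obtain c where c: "v \<in> ?S" "v - smul c s \<in> U" using v by (auto simp: U'_def)
    have "dl z \<star> v - smul c s = dl z \<star> (v - smul c s) + smul c (dl z \<star> s - s)"
      by (simp add: star_distribs smul_add)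
    moreover have "dl z \<star> (v - smul c s) + smul c (dl z \<star> s - s) \<in> U"
      by (intro subspace_closed(2)[OF subU] subspace_closed(5)[OF subU] U_Z z c s_Z)
    ultimately have "dl z \<star> v - smul c s \<in> U" by metis
    then show ?thesis using S_Z[OF z c(1)] unfolding U'_def by blast
  qed
  ultimately have "U' \<in> \<U> \<or> U' = ?S" using kZe_U unfolding \<U>_def U'_def by blast
  then have U'S: "U' = ?S" using Umax UU' \<open>s \<in> U'\<close> s(2) by blast
  have IS: "(dl z - dl \<one>) \<star> y \<in> U" if z: "z \<in> Z" and y: "y \<in> ?S" for z y
  proof -
    obtain c where c: "y - smul c s \<in> U" using y U'S by (auto simp: U'_def)
    have "(dl z - dl \<one>) \<star> y = dl z \<star> (y - smul c s) - (y - smul c s) + smul c (dl z \<star> s - s)"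
      using supp_C[OF centre_C[OF y]] by (simp add: star_distribs smul_add dl_one)
    also have "\<dots> \<in> U"
      by (intro subspace_closed(2)[OF subU] subspace_closed(3)[OF subU] subspace_closed(5)[OF subU] U_Z z c s_Z)
    finally show ?thesis .
  qed
  have e_U: "e \<in> U"
  proof -
    have "e = dl \<one> \<star> e" using e_supp by (simp add: dl_one)
    then have "e \<in> ?kZe" using dl_in[OF subgroup.one_closed[OF Z_sub]] by blast
    then show ?thesis using kZe_U by blast
  qed
  \<comment> \<open>By \<open>centre_decomposition\<close> the centre is spanned by e and the images
    of the z - 1, all of which lie in U.\<close>
  have "?S \<subseteq> U"
  proof
    fix y assume y: "y \<in> ?S"
    obtain c Y where Y: "\<And>z. Y z \<in> ?S" "y = smul c e + (\<Sum>z\<in>Z. (dl z - dl \<one>) \<star> Y z)"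
      using centre_decomposition[OF y] by blast
    show "y \<in> U"
      unfolding Y(2) by (intro subspace_closed(2)[OF subU] subspace_closed(5)[OF subU e_U] subspace_closed(6)[OF subU] IS Y(1))
  qed
  then show False using US by blast
qed

text \<open>Sort x by the cosets uC with u in P/Z. As u commutes with C, the part of x on uC times
  u^-1 is central in kCe, hence lies in kZe.\<close>

lemma centralizer_of_C_in_kPCe:
  fixes x :: "'g \<Rightarrow> 'k"
  assumes x: "x \<in> supp_in M" "x \<star> e = x" "\<And>c. c \<in> C \<Longrightarrow> cj c x = x"
  shows "\<exists>a\<in>supp_in P. x = a \<star> e"
proof -
  define T where "T = tv P Z"
  have TP: "t \<in> P" "t \<in> carrier G" if "t \<in> T" for t
    using tv(1)[OF P_sub Z_sub] that PG by (auto simp: T_def transversal_def)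
  have T: "transversal T M C"
  proof (rule transversal_second_iso[OF _ P_M C_sub P_sub M_sub])
    show "transversal T P (P \<inter> C)" using tv(1)[OF P_sub Z_sub] by (simp add: T_def Z_def)
    fix k assume "k \<in> M"
    then obtain u c where "u \<in> P" "c \<in> C" "k = u \<otimes> c" using M_iff by blast
    then show "\<exists>m\<in>P. inv m \<otimes> k \<in> C" using PG CG by (intro bexI[of _ u]) (auto simp: inv_cancel)
  qed
  define X where "X u = cut C (dl (inv u) \<star> x)" for u
  have X: "X u \<in> centre C e" if u: "u \<in> T" for u
    unfolding centre_def
  proof (intro CollectI conjI ballI)
    show "X u \<in> supp_in C" by (simp add: X_def cut_in)
    have uG: "u \<in> P" "u \<in> carrier G" "inv u \<in> P" using TP[OF u] P_sub by (auto simp: subgroup.m_inv_closed)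
    show "cj c (X u) = X u" if c: "c \<in> C" for c
    proof -
      have "cj c (dl (inv u)) = (dl (inv u) :: 'g \<Rightarrow> 'k)"
        using C_commute[OF c uG(3)] CG[OF c] uG conj_eq_iff_commute[of c "inv u"] by (simp add: cj_dl)
      then have "cj c (dl (inv u) \<star> x) = dl (inv u) \<star> x" using x(3)[OF c] CG[OF c] by (simp add: cj_mult)
      then show ?thesis
        unfolding X_def using cut_cj[OF CG[OF c] C_carrier C_conj_iff[OF CG[OF c]], of "dl (inv u) \<star> x"] by simp
    qed
    have "X u \<star> e = cut C (dl (inv u) \<star> x \<star> e)" unfolding X_def by (rule cut_star(2)[OF C_sub e_in, symmetric])
    then have "X u \<star> e = X u" by (simp add: X_def star_assoc x(2))
    moreover have "X u \<star> e = e \<star> X u" by (rule e_commute_C) (simp add: X_def cut_in)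
    ultimately show "e \<star> X u = X u" by simp
  qed
  have "\<exists>a. \<forall>u\<in>T. a u \<in> supp_in Z \<and> X u = a u \<star> e" using centre_eq_kZe[OF X] by metis
  then obtain a where a: "\<And>u. u \<in> T \<Longrightarrow> a u \<in> supp_in Z \<and> X u = a u \<star> e" by blast
  have finT: "finite T" by (rule transversal_finite[OF M_sub T])
  have "x = (\<Sum>u\<in>T. dl u \<star> X u)"
  proof
    fix y
    show "x y = (\<Sum>u\<in>T. dl u \<star> X u) y"
    proof (cases "y \<in> M")
      case True
      then have yG: "y \<in> carrier G" using M_carrier by blast
      obtain t where t: "t \<in> T" "inv t \<otimes> y \<in> C" and uniq: "\<And>s. s \<in> T \<Longrightarrow> inv s \<otimes> y \<in> C \<Longrightarrow> s = t"
        using T True unfolding transversal_def by blast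
      have "(dl u \<star> X u) y = (if u = t then x y else 0)" if u: "u \<in> T" for u
      proof -
        have uG: "u \<in> carrier G" by (rule TP(2)[OF u])
        have "(dl (inv u) \<star> x) (inv u \<otimes> y) = x y" using uG yG by (simp add: dl_star inv_cancel)
        then have "(dl u \<star> X u) y = (if inv u \<otimes> y \<in> C then x y else 0)"
          unfolding X_def dl_star[OF uG yG] cut_apply by simp
        moreover have "inv u \<otimes> y \<in> C \<longleftrightarrow> u = t" using uniq[OF u] t by blast
        ultimately show ?thesis by simp
      qed
      then have "(\<Sum>u\<in>T. dl u \<star> X u) y = (\<Sum>u\<in>T. if u = t then x y else 0)"
        unfolding sum_fun_apply by (intro sum.cong) auto
      then show ?thesis using t finT by simp
    next
      case False
      have "dl u \<star> X u \<in> supp_in M" if u: "u \<in> T" for u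
        using TP(1)[OF u] P_M C_M cut_in[of C] supp_in_mono[OF C_M] unfolding X_def
        by (intro star_supp[OF M_sub dl_in]) auto
      then have "(\<Sum>u\<in>T. dl u \<star> X u) y = 0"
        unfolding sum_fun_apply using False by (intro sum.neutral) (auto simp: supp_in_def)
      then show ?thesis using x(1) False by (simp add: supp_in_def)
    qed
  qed
  also have "\<dots> = (\<Sum>u\<in>T. dl u \<star> a u) \<star> e"
    unfolding star_sum using a by (intro sum.cong) (auto simp: star_assoc)
  finally have "x = (\<Sum>u\<in>T. dl u \<star> a u) \<star> e" .
  moreover have "(\<Sum>u\<in>T. dl u \<star> a u) \<in> supp_in P"
    using a TP(1) supp_in_mono[OF Z_P] by (intro supp_in_closed(6) star_supp[OF P_sub] dl_in) auto
  ultimately show ?thesis by blast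
qed

end

section \<open>Free action of the inertial quotient\<close>

context normal_block
begin

lemma derivation_inner: "z \<in> Bs \<Longrightarrow> derivation_on Bs (\<lambda>x. z \<star> x - x \<star> z)"
  unfolding derivation_on_def
proof (intro conjI ballI)
  show "lin (\<lambda>x. z \<star> x - x \<star> z)" by (intro lin_intros)
  show "z \<star> x - x \<star> z \<in> Bs" if "z \<in> Bs" "x \<in> Bs" for x by (intro Bs_closed Bs_star(1) that)
  show "z \<star> (x \<star> y) - x \<star> y \<star> z = (z \<star> x - x \<star> z) \<star> y + x \<star> (z \<star> y - y \<star> z)" for x y
    by (simp add: star_distribs star_assoc)
qed

lemma derivation_diff:
  assumes "derivation_on Bs d" "derivation_on Bs d'"
  shows "derivation_on Bs (\<lambda>x. d x - d' x)"
proof -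
  have d: "lin d" "\<And>x. x \<in> Bs \<Longrightarrow> d x \<in> Bs" "\<And>x y. x \<in> Bs \<Longrightarrow> y \<in> Bs \<Longrightarrow> d (x \<star> y) = d x \<star> y + x \<star> d y"
    and d': "lin d'" "\<And>x. x \<in> Bs \<Longrightarrow> d' x \<in> Bs" "\<And>x y. x \<in> Bs \<Longrightarrow> y \<in> Bs \<Longrightarrow> d' (x \<star> y) = d' x \<star> y + x \<star> d' y"
    using assms by (auto simp: derivation_on_def)
  show ?thesis
    unfolding derivation_on_def
  proof (intro conjI ballI)
    show "lin (\<lambda>x. d x - d' x)" by (intro lin_minus_fun d(1) d'(1))
    show "d x - d' x \<in> Bs" if "x \<in> Bs" for x by (intro Bs_closed(3) d(2) d'(2) that)
    show "d (x \<star> y) - d' (x \<star> y) = (d x - d' x) \<star> y + x \<star> (d y - d' y)" if "x \<in> Bs" "y \<in> Bs" for x y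
      unfolding d(3)[OF that] d'(3)[OF that] by (simp add: star_distribs)
  qed
qed

text \<open>R contains one element of each P-orbit on Y. Because the action is free, the conjugates
  of R by the elements of P partition Y, and the summand for u is the part of x on u R u^-1.\<close>

lemma orbit_decomposition:
  fixes x :: "'g \<Rightarrow> 'k"
  assumes free: "\<forall>y\<in>Y. \<forall>u\<in>P. u \<otimes> y = y \<otimes> u \<longrightarrow> u = \<one>"
    and Y: "Y \<subseteq> carrier G" "\<forall>y\<in>Y. \<forall>u\<in>P. u \<otimes> y \<otimes> inv u \<in> Y"
  obtains R where "\<And>x :: 'g \<Rightarrow> 'k. x \<in> supp_in Y \<Longrightarrow> (\<Sum>u\<in>P. cj u (cut R (cj (inv u) x))) = x"
proof -
  define orb where "orb y = {u \<otimes> y \<otimes> inv u | u. u \<in> P}" for y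
  define R where "R = (\<lambda>A. SOME r. r \<in> A) ` orb ` Y"
  have orb_eq: "orb (inv u \<otimes> y \<otimes> u) = orb y" if y: "y \<in> Y" and u: "u \<in> P" for y u
  proof -
    have G: "y \<in> carrier G" "u \<in> carrier G" using y u Y PG by auto
    have "\<exists>v'\<in>P. v \<otimes> (inv u \<otimes> y \<otimes> u) \<otimes> inv v = v' \<otimes> y \<otimes> inv v'" if v: "v \<in> P" for v
      using v u P_sub PG[OF v] G
      by (intro bexI[of _ "v \<otimes> inv u"]) (auto simp: m_assoc inv_mult_group subgroup.m_closed subgroup.m_inv_closed)
    moreover have "\<exists>v'\<in>P. v \<otimes> y \<otimes> inv v = v' \<otimes> (inv u \<otimes> y \<otimes> u) \<otimes> inv v'" if v: "v \<in> P" for v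
      using v u P_sub PG[OF v] G
      by (intro bexI[of _ "v \<otimes> u"]) (auto simp: m_assoc inv_mult_group subgroup.m_closed inv_cancel)
    ultimately show ?thesis unfolding orb_def by blast
  qed
  have conj_Y: "inv u \<otimes> y \<otimes> u \<in> Y" if "y \<in> Y" "u \<in> P" for y u
    using bspec[OF bspec[OF Y(2) that(1)], of "inv u"] that PG P_sub by (simp add: subgroup.m_inv_closed)
  have mem_R: "inv u \<otimes> y \<otimes> u \<in> R \<longleftrightarrow> inv u \<otimes> y \<otimes> u = (SOME r. r \<in> orb y)" if y: "y \<in> Y" and u: "u \<in> P" for y u
  proof
    assume "inv u \<otimes> y \<otimes> u \<in> R"
    then obtain y' where y': "y' \<in> Y" "inv u \<otimes> y \<otimes> u = (SOME r. r \<in> orb y')" by (auto simp: R_def)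
    have "y' = \<one> \<otimes> y' \<otimes> inv \<one>" using y' Y by auto
    then have "y' \<in> orb y'" using subgroup.one_closed[OF P_sub] unfolding orb_def by blast
    then have "inv u \<otimes> y \<otimes> u \<in> orb y'" unfolding y'(2) by (rule someI)
    then obtain v where v: "v \<in> P" "inv u \<otimes> y \<otimes> u = v \<otimes> y' \<otimes> inv v" by (auto simp: orb_def)
    have "orb (v \<otimes> y' \<otimes> inv v) = orb y'"
      using orb_eq[OF y'(1), of "inv v"] v(1) PG P_sub by (simp add: subgroup.m_inv_closed)
    then have "orb y = orb y'" using orb_eq[OF y u] v(2) by simp
    then show "inv u \<otimes> y \<otimes> u = (SOME r. r \<in> orb y)" using y'(2) by simp
  next
    assume "inv u \<otimes> y \<otimes> u = (SOME r. r \<in> orb y)"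
    then show "inv u \<otimes> y \<otimes> u \<in> R" using y by (simp add: R_def)
  qed
  have "(\<Sum>u\<in>P. cj u (cut R (cj (inv u) x))) = x" if x: "x \<in> supp_in Y" for x :: "'g \<Rightarrow> 'k"
  proof
    fix y
    have val: "cj u (cut R (cj (inv u) x)) y = (if inv u \<otimes> y \<otimes> u \<in> R then x y else 0)" if u: "u \<in> P" and y: "y \<in> carrier G" for u
    proof -
      have "cj (inv u) x (inv u \<otimes> y \<otimes> u) = x y"
        using PG[OF u] y cj_apply[of "inv u" "inv u \<otimes> y \<otimes> u" x] by (simp add: inv_cancel)
      then show ?thesis using PG[OF u] y by (simp add: cj_apply cut_apply)
    qed
    show "(\<Sum>u\<in>P. cj u (cut R (cj (inv u) x))) y = x y"
    proof (cases "y \<in> Y")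
      case False
      then have "x y = 0" using x by (simp add: supp_in_def)
      moreover have "cj u (cut R (cj (inv u) x)) y = 0" if "u \<in> P" for u
        using val[OF that] \<open>x y = 0\<close> cj_in[of u "cut R (cj (inv u) x)"] by (cases "y \<in> carrier G") (auto simp: supp_in_def)
      ultimately show ?thesis unfolding sum_fun_apply by simp
    next
      case True
      then have yG: "y \<in> carrier G" using Y by auto
      have "y = \<one> \<otimes> y \<otimes> inv \<one>" using yG by simp
      then have "y \<in> orb y" using subgroup.one_closed[OF P_sub] unfolding orb_def by blast
      then have "(SOME r. r \<in> orb y) \<in> orb y" by (rule someI)
      then obtain v where v: "v \<in> P" "(SOME r. r \<in> orb y) = v \<otimes> y \<otimes> inv v" by (auto simp: orb_def)
      have iv: "inv v \<in> P" using v P_sub by (simp add: subgroup.m_inv_closed)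
      have "inv u \<otimes> y \<otimes> u \<in> R \<longleftrightarrow> u = inv v" if u: "u \<in> P" for u
      proof
        assume "inv u \<otimes> y \<otimes> u \<in> R"
        then have eq: "inv u \<otimes> y \<otimes> u = v \<otimes> y \<otimes> inv v" using mem_R[OF True u] v(2) by simp
        have G: "u \<in> carrier G" "v \<in> carrier G" using u v PG by auto
        have "u \<otimes> v \<otimes> y = u \<otimes> (v \<otimes> y \<otimes> inv v) \<otimes> v" using G yG by (simp add: m_assoc)
        also have "\<dots> = y \<otimes> (u \<otimes> v)" unfolding eq[symmetric] using G yG by (simp add: m_assoc inv_cancel)
        finally have "u \<otimes> v = \<one>" using bspec[OF bspec[OF free True], of "u \<otimes> v"] u v P_sub by (simp add: subgroup.m_closed)
        then show "u = inv v" using G by (simp add: inv_equality)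
      next
        assume "u = inv v"
        then show "inv u \<otimes> y \<otimes> u \<in> R" using mem_R[OF True iv] v PG[OF v(1)] by simp
      qed
      then have "(\<Sum>u\<in>P. cj u (cut R (cj (inv u) x))) y = (\<Sum>u\<in>P. if u = inv v then x y else 0)"
        unfolding sum_fun_apply using val[OF _ yG] by (intro sum.cong) auto
      then show ?thesis using iv fin_sub[OF P_carrier] by simp
    qed
  qed
  then show thesis using that by blast
qed

text \<open>Conjugation by \<open>P\<close> permutes \<open>N - M\<close> freely, so the cohomology of \<open>P\<close> in the functions on
  \<open>N - M\<close> vanishes.\<close>

lemma push_into_kPCe:
  assumes free: "\<forall>y\<in>N - M. \<forall>u\<in>P. u \<otimes> y = y \<otimes> u \<longrightarrow> u = \<one>"
    and d: "derivation_on Bs d" and de: "d e = 0"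
  obtains z where "z \<in> Bs" "z \<star> e - e \<star> z = 0" "\<And>a. a \<in> supp_in P \<Longrightarrow> d (a \<star> e) - (z \<star> (a \<star> e) - a \<star> e \<star> z) \<in> supp_in M"
proof -
  have lind: "lin d" and leib: "\<And>x y. x \<in> Bs \<Longrightarrow> y \<in> Bs \<Longrightarrow> d (x \<star> y) = d x \<star> y + x \<star> d y"
    and d_Bs: "\<And>x. x \<in> Bs \<Longrightarrow> d x \<in> Bs" using d by (auto simp: derivation_on_def)
  have Y_conj: "u \<otimes> y \<otimes> inv u \<in> N - M" if y: "y \<in> N - M" and u: "u \<in> P" for y u
  proof
    have G: "u \<in> carrier G" "y \<in> carrier G" "u \<in> N" "u \<in> M" "inv u \<in> M" using y u PG NG P_N P_M M_sub by (auto simp: subgroup.m_inv_closed)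
    show "u \<otimes> y \<otimes> inv u \<in> N" using y G N_sub by (simp add: subgroup.m_closed subgroup.m_inv_closed)
    show "u \<otimes> y \<otimes> inv u \<notin> M"
    proof
      assume "u \<otimes> y \<otimes> inv u \<in> M"
      then have "inv u \<otimes> (u \<otimes> y \<otimes> inv u) \<otimes> u \<in> M" using G M_sub by (simp add: subgroup.m_closed)
      then show False using y G inv_cancel(3)[of u y] by simp
    qed
  qed
  obtain R where R: "\<And>x :: 'g \<Rightarrow> 'k. x \<in> supp_in (N - M) \<Longrightarrow> (\<Sum>u\<in>P. cj u (cut R (cj (inv u) x))) = x"
    using orbit_decomposition[OF free] Y_conj N_carrier by blast
  \<comment> \<open>The part outside M; like \<open>cut M\<close> it is linear over kM on both
    sides.\<close>
  define \<rho> :: "('g \<Rightarrow> 'k) \<Rightarrow> 'g \<Rightarrow> 'k" where "\<rho> x = x - cut M x" for x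
  have lin\<rho>: "lin \<rho>" unfolding \<rho>_def by (intro lin_intros lin_cut)
  have \<rho>_star: "\<rho> (a \<star> x) = a \<star> \<rho> x" "\<rho> (x \<star> a) = \<rho> x \<star> a" if "a \<in> supp_in M" for a x
    using cut_star[OF M_sub that] by (simp_all add: \<rho>_def star_diff)
  have dl_M: "dl u \<in> supp_in M" if "u \<in> P" for u by (rule dl_in) (use that P_M in blast)
  have e_M: "e \<in> supp_in M" using e_in supp_in_mono[OF C_M] by blast
  have Bs_ue: "dl u \<star> e \<in> Bs" if "u \<in> P" for u using Bs_star(2)[OF e_Bs dl_in[OF PG[OF that]]] .
  have e_d_e: "e \<star> d (dl u \<star> e) = d (dl u \<star> e)" "d (dl u \<star> e) \<star> e = d (dl u \<star> e)" if u: "u \<in> P" for u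
  proof -
    have "e \<star> (dl u \<star> e) = dl u \<star> e" "dl u \<star> e \<star> e = dl u \<star> e"
      using e_commute_P[OF dl_in[OF u]] by (simp_all add: star_assoc e_idem ee_star)
    then show "e \<star> d (dl u \<star> e) = d (dl u \<star> e)" "d (dl u \<star> e) \<star> e = d (dl u \<star> e)"
      using leib[OF e_Bs Bs_ue[OF u]] leib[OF Bs_ue[OF u] e_Bs] de by simp_all
  qed
  have d_N: "d (dl u \<star> e) \<in> supp_in N" if u: "u \<in> P" for u
    using eGe[OF Bs_supp[OF d_Bs[OF Bs_ue[OF u]]]] e_d_e[OF u] by simp
  have d_mult: "d (dl (u \<otimes> v) \<star> e) = d (dl u \<star> e) \<star> dl v + dl u \<star> d (dl v \<star> e)" if u: "u \<in> P" and v: "v \<in> P" for u v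
  proof -
    have "dl (u \<otimes> v) \<star> e = dl u \<star> (dl v \<star> e) \<star> e" using PG u v by (simp add: star_assoc dl_mult_star e_idem)
    also have "\<dots> = (dl u \<star> e) \<star> (dl v \<star> e)" using e_commute_P[OF dl_in[OF v]] by (simp add: star_assoc)
    finally have "d (dl (u \<otimes> v) \<star> e) = d (dl u \<star> e) \<star> (dl v \<star> e) + (dl u \<star> e) \<star> d (dl v \<star> e)"
      using leib[OF Bs_ue[OF u] Bs_ue[OF v]] by simp
    moreover have "d (dl u \<star> e) \<star> (dl v \<star> e) = d (dl u \<star> e) \<star> dl v"
      using e_commute_P[OF dl_in[OF v]] e_d_e(2)[OF u] by (simp add: star_assoc[symmetric])
    moreover have "(dl u \<star> e) \<star> d (dl v \<star> e) = dl u \<star> d (dl v \<star> e)" using e_d_e(1)[OF v] by (simp add: star_assoc)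
    ultimately show ?thesis by simp
  qed
  \<comment> \<open>The part of d(u e) u^-1 outside M: a 1-cocycle of P (\<open>c_mult\<close>) with
    values in the functions on N - M.\<close>
  define c where "c u = \<rho> (d (dl u \<star> e)) \<star> dl (inv u)" for u
  have c_Y: "c u \<in> supp_in (N - M)" if u: "u \<in> P" for u
  proof (rule supp_in_I)
    have "inv u \<in> P" using u P_sub by (simp add: subgroup.m_inv_closed)
    then have c_eq: "c u = \<rho> (d (dl u \<star> e) \<star> dl (inv u))" unfolding c_def by (rule \<rho>_star(2)[OF dl_M, symmetric])
    have "d (dl u \<star> e) \<star> dl (inv u) \<in> supp_in N"
      by (intro star_supp[OF N_sub d_N[OF u]] dl_in) (use \<open>inv u \<in> P\<close> P_N in blast)
    moreover fix y assume "y \<notin> N - M"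
    ultimately show "c u y = 0" unfolding c_eq by (auto simp: \<rho>_def cut_apply supp_in_def)
  qed
  have c_mult: "c (u \<otimes> v) = c u + cj u (c v)" if u: "u \<in> P" and v: "v \<in> P" for u v
  proof -
    have "\<rho> (d (dl (u \<otimes> v) \<star> e)) = \<rho> (d (dl u \<star> e)) \<star> dl v + dl u \<star> \<rho> (d (dl v \<star> e))"
      unfolding d_mult[OF u v] lin_add[OF lin\<rho>] \<rho>_star[OF dl_M[OF u]] \<rho>_star[OF dl_M[OF v]] ..
    then show ?thesis
      using PG[OF u] PG[OF v]
      by (simp add: c_def cj_def star_add_left star_assoc dl_dl inv_mult_group m_assoc[symmetric])
  qed
  \<comment> \<open>The contraction for an induced module: from c v keep only the part on v R v^-1.
    By \<open>c_mult\<close>, conjugating by u yields the same sum with c v - c u for c v, and the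
    parts of the constant c u add up to c u itself.\<close>
  define h where "h = (\<Sum>v\<in>P. cj v (cut R (cj (inv v) (c v))))"
  have coboundary: "cj u h = h - c u" if u: "u \<in> P" for u
  proof -
    have uG: "u \<in> carrier G" "inv u \<in> P" using PG u P_sub by (auto simp: subgroup.m_inv_closed)
    have "cj u h = (\<Sum>v\<in>P. cj (u \<otimes> v) (cut R (cj (inv (u \<otimes> v)) (c (u \<otimes> v) - c u))))"
      unfolding h_def lin_sum[OF lin_cj]
    proof (rule sum.cong[OF refl])
      fix v assume v: "v \<in> P"
      have vG: "v \<in> carrier G" using PG[OF v] .
      have "c (u \<otimes> v) - c u = cj u (c v)" unfolding c_mult[OF u v] by simp
      then have "cj (inv (u \<otimes> v)) (c (u \<otimes> v) - c u) = cj (inv v) (c v)"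
        using uG vG by (simp add: cj_cj inv_mult_group m_assoc)
      then show "cj u (cj v (cut R (cj (inv v) (c v)))) = cj (u \<otimes> v) (cut R (cj (inv (u \<otimes> v)) (c (u \<otimes> v) - c u)))"
        using uG vG by (simp add: cj_cj)
    qed
    also have "\<dots> = (\<Sum>v\<in>P. cj v (cut R (cj (inv v) (c v - c u))))"
      by (rule sum.reindex_bij_witness[of _ "\<lambda>v. inv u \<otimes> v" "\<lambda>v. u \<otimes> v"])
        (use u uG PG P_sub in \<open>auto simp: subgroup.m_closed inv_cancel\<close>)
    also have "\<dots> = h - (\<Sum>v\<in>P. cj v (cut R (cj (inv v) (c u))))"
      unfolding h_def cj_lin_simps lin_diff[OF lin_cut] by (rule sum_subtractf)
    also have "(\<Sum>v\<in>P. cj v (cut R (cj (inv v) (c u)))) = c u" by (rule R[OF c_Y[OF u]])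
    finally show ?thesis .
  qed
  have h_N: "h \<in> supp_in N"
    unfolding h_def
  proof (rule supp_in_closed(6))
    fix v assume v: "v \<in> P"
    have vG: "v \<in> carrier G" "inv v \<in> N" "v \<in> N" using PG[OF v] v P_N N_sub by (auto simp: subgroup.m_inv_closed)
    have conj_N: "cj g x \<in> supp_in N" if "g \<in> N" "x \<in> supp_in N" for g and x :: "'g \<Rightarrow> 'k"
      unfolding cj_def using that N_sub by (intro star_supp[OF N_sub] dl_in) (auto simp: subgroup.m_inv_closed)
    have "c v \<in> supp_in N" using c_Y[OF v] supp_in_mono[of "N - M" N] by blast
    then have "cj (inv v) (c v) \<in> supp_in N" using conj_N vG by blast
    then have "cut R (cj (inv v) (c v)) \<in> supp_in N" by (auto simp: supp_in_def cut_apply)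
    then show "cj v (cut R (cj (inv v) (c v))) \<in> supp_in N" using conj_N vG by blast
  qed
  define z where "z = h \<star> e"
  have he: "h \<star> e = e \<star> h" by (rule e_commute_N[OF h_N])
  have z_Bs: "z \<in> Bs" unfolding z_def by (rule Bs_star(2)[OF e_Bs supp_N[OF h_N]])
  have ze: "z \<star> e = z" "e \<star> z = z" by (simp_all add: z_def star_assoc e_idem) (simp add: he ee_star)
  have in_M: "d (dl u \<star> e) - (z \<star> (dl u \<star> e) - dl u \<star> e \<star> z) = cut M (d (dl u \<star> e))" if u: "u \<in> P" for u
  proof -
    have uG: "u \<in> carrier G" using PG[OF u] .
    have "\<rho> (d (dl u \<star> e)) \<in> supp_in (carrier G)"
      unfolding \<rho>_def
      by (rule supp_in_closed(3)[OF supp_N[OF d_N[OF u]] subsetD[OF supp_in_mono[OF M_carrier] cut_in]])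
    then have "\<rho> (d (dl u \<star> e)) = c u \<star> dl u"
      using uG by (simp add: c_def star_assoc dl_dl dl_one)
    also have "c u = h - cj u h" unfolding coboundary[OF u] by simp
    also have "(h - cj u h) \<star> dl u = h \<star> dl u - dl u \<star> h" using dl_star_cj[OF uG, of h] by (simp add: star_diff)
    finally have 1: "\<rho> (d (dl u \<star> e)) = h \<star> dl u - dl u \<star> h" .
    have "\<rho> (d (dl u \<star> e)) = \<rho> (d (dl u \<star> e)) \<star> e"
      using \<rho>_star(2)[OF e_M, of "d (dl u \<star> e)"] e_d_e(2)[OF u] by simp
    also have "\<dots> = h \<star> dl u \<star> e - dl u \<star> h \<star> e" unfolding 1 by (simp add: star_diff)
    also have "h \<star> dl u \<star> e = z \<star> (dl u \<star> e)"
      using e_commute_P[OF dl_in[OF u]] by (simp add: z_def star_assoc e_idem ee_star)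
    also have "dl u \<star> h \<star> e = dl u \<star> e \<star> z" using ze(2) by (simp add: star_assoc z_def)
    finally have eq: "\<rho> (d (dl u \<star> e)) = z \<star> (dl u \<star> e) - dl u \<star> e \<star> z" .
    show ?thesis unfolding eq[symmetric] \<rho>_def by simp
  qed
  have "d (a \<star> e) - (z \<star> (a \<star> e) - a \<star> e \<star> z) \<in> supp_in M" if a: "a \<in> supp_in P" for a
  proof (rule lin_in_on[OF fin_sub[OF P_carrier] _ subspace_supp_in _ a])
    show "lin (\<lambda>a. d (a \<star> e) - (z \<star> (a \<star> e) - a \<star> e \<star> z))" by (intro lin_intros lin_comp[OF lind])
    show "d (dl u \<star> e) - (z \<star> (dl u \<star> e) - dl u \<star> e \<star> z) \<in> supp_in M" if "u \<in> P" for u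
      unfolding in_M[OF that] by (rule cut_in)
  qed
  then show thesis using that z_Bs ze by simp
qed

end

context split_block
begin

lemma derivation_from_kP:
  assumes free: "\<forall>y\<in>N - M. \<forall>u\<in>P. u \<otimes> y = y \<otimes> u \<longrightarrow> u = \<one>"
    and d: "derivation_on Bs d"
  shows "\<exists>d1 d2 z. derivation_on (supp_in P) d1 \<and> derivation_on Bs d2 \<and> extends d1 d2 \<and> z \<in> Bs \<and>
    (\<forall>x\<in>Bs. d x = d2 x + (z \<star> x - x \<star> z))"
proof -
  have lind: "lin d" and leib: "\<And>x y. x \<in> Bs \<Longrightarrow> y \<in> Bs \<Longrightarrow> d (x \<star> y) = d x \<star> y + x \<star> d y"
    and d_Bs: "\<And>x. x \<in> Bs \<Longrightarrow> d x \<in> Bs" using d by (auto simp: derivation_on_def)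
  \<comment> \<open>For an idempotent e every derivation satisfies e d(e) e = 0, so the commutator
    with z1 = [d e, e] takes e to d e.\<close>
  define z1 where "z1 = d e \<star> e - e \<star> d e"
  have z1: "z1 \<in> Bs" unfolding z1_def by (intro Bs_closed(3) Bs_star(1) d_Bs e_Bs)
  define D where "D x = d x - (z1 \<star> x - x \<star> z1)" for x
  have D: "derivation_on Bs D" unfolding D_def by (intro derivation_diff d derivation_inner z1)
  have De: "D e = 0"
  proof -
    have 1: "d e = d e \<star> e + e \<star> d e" using leib[OF e_Bs e_Bs] by (simp add: e_idem)
    have "e \<star> d e \<star> e = e \<star> (d e \<star> e + e \<star> d e) \<star> e" using 1 by simp
    also have "\<dots> = e \<star> d e \<star> e + e \<star> d e \<star> e" by (simp add: star_distribs star_assoc e_idem ee_star)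
    finally have 2: "e \<star> (d e \<star> e) = 0" by (metis add_cancel_right_right star_assoc)
    have "z1 \<star> e - e \<star> z1 = (d e \<star> e - 0) - (0 - e \<star> d e)"
      by (simp add: z1_def star_diff star_assoc e_idem ee_star 2)
    also have "\<dots> = d e" using 1 by simp
    finally show ?thesis by (simp add: D_def)
  qed
  obtain z2 where z2: "z2 \<in> Bs" "z2 \<star> e - e \<star> z2 = 0"
    "\<And>a. a \<in> supp_in P \<Longrightarrow> D (a \<star> e) - (z2 \<star> (a \<star> e) - a \<star> e \<star> z2) \<in> supp_in M"
    using push_into_kPCe[OF free D De] by blast
  define D' where "D' x = D x - (z2 \<star> x - x \<star> z2)" for x
  have D': "derivation_on Bs D'" unfolding D'_def by (intro derivation_diff D derivation_inner z2)
  have D'e: "D' e = 0" unfolding D'_def De z2(2) by simp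
  have linD': "lin D'" and leib': "\<And>x y. x \<in> Bs \<Longrightarrow> y \<in> Bs \<Longrightarrow> D' (x \<star> y) = D' x \<star> y + x \<star> D' y"
    and D'_Bs: "\<And>x. x \<in> Bs \<Longrightarrow> D' x \<in> Bs" using D' by (auto simp: derivation_on_def)
  have D'_M: "D' (a \<star> e) \<in> supp_in M" if "a \<in> supp_in P" for a using z2(3)[OF that] by (simp add: D'_def)
  obtain w where w: "w \<in> supp_in C" "e \<star> w = w" "rtr C Z w = e" by (rule relative_trace_Z)
  have we: "w \<star> e = w" using e_commute_C[OF w(1)] w(2) by simp
  have Bs_ce: "x \<star> e \<in> Bs" if "x \<in> supp_in (carrier G)" for x using Bs_star(2)[OF e_Bs that] .
  have e_left: "e \<star> D' x = D' x" if "e \<star> x = x" "x \<in> Bs" for x using leib'[OF e_Bs that(2)] that(1) D'e by simp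
  have e_right: "D' x \<star> e = D' x" if "x \<star> e = x" "x \<in> Bs" for x using leib'[OF that(2) e_Bs] that(1) D'e by simp
  \<comment> \<open>For X = D'(a e) the relation c a = a c, differentiated, expresses the commutator
    of X with c through D'(c e). Weighting with w and summing over C/Z turns X into the trace of X w
    from Z to C, which commutes with C, up to the inner derivation of \<xi>.\<close>
  define \<xi> where "\<xi> = (\<Sum>c\<in>tv C Z. D' (dl c \<star> e) \<star> (w \<star> dl (inv c)))"
  have \<xi>: "\<xi> \<in> Bs"
    unfolding \<xi>_def
  proof (rule Bs_closed(6))
    fix c assume "c \<in> tv C Z"
    then have "dl c \<in> supp_in (carrier G)" by (intro dl_in CG tvCZ)
    then show "D' (dl c \<star> e) \<star> (w \<star> dl (inv c)) \<in> Bs" by (intro Bs_star(1) D'_Bs Bs_ce)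
  qed
  have \<xi>e: "\<xi> \<star> e = \<xi>" "e \<star> \<xi> = \<xi>"
  proof -
    have c_e: "dl (inv c) \<star> e = e \<star> dl (inv c)" "dl c \<star> e = e \<star> dl c" "dl c \<in> supp_in (carrier G)" if "c \<in> tv C Z" for c
      using e_commute_C[OF dl_in] tvCZ[OF that] C_sub CG dl_in[of c "carrier G"] by (auto simp: subgroup.m_inv_closed)
    show "\<xi> \<star> e = \<xi>"
      unfolding \<xi>_def star_sum
    proof (rule sum.cong[OF refl])
      fix c assume c: "c \<in> tv C Z"
      have "w \<star> dl (inv c) \<star> e = w \<star> dl (inv c)" using c_e(1)[OF c] we by (simp add: star_assoc) (simp add: star_assoc[symmetric])
      then show "D' (dl c \<star> e) \<star> (w \<star> dl (inv c)) \<star> e = D' (dl c \<star> e) \<star> (w \<star> dl (inv c))" by (simp add: star_assoc)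
    qed
    show "e \<star> \<xi> = \<xi>"
      unfolding \<xi>_def star_sum
    proof (rule sum.cong[OF refl])
      fix c assume c: "c \<in> tv C Z"
      have "e \<star> D' (dl c \<star> e) = D' (dl c \<star> e)"
        by (rule e_left[OF _ Bs_ce[OF c_e(3)[OF c]]]) (simp add: c_e(2)[OF c] ee_star)
      then show "e \<star> (D' (dl c \<star> e) \<star> (w \<star> dl (inv c))) = D' (dl c \<star> e) \<star> (w \<star> dl (inv c))"
        by (simp add: star_assoc[symmetric])
    qed
  qed
  have key: "\<exists>a'\<in>supp_in P. D' (a \<star> e) - (\<xi> \<star> (a \<star> e) - a \<star> e \<star> \<xi>) = a' \<star> e" if a: "a \<in> supp_in P" for a
  proof -
    have ae: "a \<star> e = e \<star> a" by (rule e_commute_P[OF a])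
    have ae_Bs: "a \<star> e \<in> Bs" by (rule Bs_ce[OF supp_P[OF a]])
    define X where "X = D' (a \<star> e)"
    have X_M: "X \<in> supp_in M" unfolding X_def by (rule D'_M[OF a])
    have Xe: "X \<star> e = X" "e \<star> X = X"
      unfolding X_def by (rule e_right[OF _ ae_Bs], simp add: star_assoc e_idem, rule e_left[OF _ ae_Bs], simp add: ae ee_star)
    define X' where "X' = rtr C Z (X \<star> w)"
    have comm: "X \<star> dl c = dl c \<star> X - (a \<star> D' (dl c \<star> e) - D' (dl c \<star> e) \<star> a)" if c: "c \<in> C" for c
    proof -
      have cG: "dl c \<in> supp_in (carrier G)" by (rule dl_in[OF CG[OF c]])
      have ce: "dl c \<star> e = e \<star> dl c" by (rule e_commute_C[OF dl_in[OF c]])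
      have ca: "dl c \<star> a = a \<star> dl c" by (rule PC_commute[OF a dl_in[OF c]])
      let ?\<delta> = "D' (dl c \<star> e)"
      have \<delta>e: "?\<delta> \<star> e = ?\<delta>" "e \<star> ?\<delta> = ?\<delta>"
        by (rule e_right[OF _ Bs_ce[OF cG]], simp add: star_assoc e_idem, rule e_left[OF _ Bs_ce[OF cG]], simp add: ce ee_star)
      have "(dl c \<star> e) \<star> (a \<star> e) = (a \<star> e) \<star> (dl c \<star> e)"
      proof -
        have "(dl c \<star> e) \<star> (a \<star> e) = dl c \<star> a \<star> e" using ae by (simp add: star_assoc e_idem ee_star)
        also have "\<dots> = a \<star> (dl c \<star> e)" by (simp only: ca star_assoc)
        also have "\<dots> = (a \<star> e) \<star> (dl c \<star> e)" using ce by (simp add: star_assoc e_idem ee_star)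
        finally show ?thesis .
      qed
      then have "?\<delta> \<star> (a \<star> e) + dl c \<star> e \<star> X = X \<star> (dl c \<star> e) + a \<star> e \<star> ?\<delta>"
        using leib'[OF Bs_ce[OF cG] ae_Bs] leib'[OF ae_Bs Bs_ce[OF cG]] unfolding X_def by metis
      moreover have "?\<delta> \<star> (a \<star> e) = ?\<delta> \<star> a" unfolding ae using \<delta>e by (simp add: star_assoc[symmetric])
      moreover have "dl c \<star> e \<star> X = dl c \<star> X" using Xe by (simp add: star_assoc)
      moreover have "X \<star> (dl c \<star> e) = X \<star> dl c" unfolding ce using Xe by (simp add: star_assoc[symmetric])
      moreover have "a \<star> e \<star> ?\<delta> = a \<star> ?\<delta>" using \<delta>e by (simp add: star_assoc)
      ultimately have "?\<delta> \<star> a + dl c \<star> X = X \<star> dl c + a \<star> ?\<delta>" by metis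
      then show ?thesis by (metis (no_types, lifting) add.commute add_diff_cancel_right' diff_diff_eq2)
    qed
    have "X = X \<star> e" using Xe by simp
    also have "\<dots> = (\<Sum>c\<in>tv C Z. X \<star> dl c \<star> (w \<star> dl (inv c)))"
      unfolding w(3)[symmetric] rtr_def cj_def star_sum by (simp add: star_assoc)
    also have "\<dots> = (\<Sum>c\<in>tv C Z. dl c \<star> (X \<star> w) \<star> dl (inv c) - (a \<star> (D' (dl c \<star> e) \<star> (w \<star> dl (inv c))) - D' (dl c \<star> e) \<star> (w \<star> dl (inv c)) \<star> a))"
    proof (rule sum.cong[OF refl])
      fix c assume "c \<in> tv C Z"
      then have c: "c \<in> C" "inv c \<in> C" using tvCZ C_sub by (auto simp: subgroup.m_inv_closed)
      have "w \<star> dl (inv c) \<star> a = a \<star> (w \<star> dl (inv c))"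
        by (rule PC_commute[OF a star_supp[OF C_sub w(1) dl_in[OF c(2)]]])
      then have wa: "a \<star> (w \<star> dl (inv c)) = w \<star> dl (inv c) \<star> a" ..
      show "X \<star> dl c \<star> (w \<star> dl (inv c)) = dl c \<star> (X \<star> w) \<star> dl (inv c) - (a \<star> (D' (dl c \<star> e) \<star> (w \<star> dl (inv c))) - D' (dl c \<star> e) \<star> (w \<star> dl (inv c)) \<star> a)"
        unfolding comm[OF c(1)] by (simp only: star_diff star_assoc wa[unfolded star_assoc])
    qed
    also have "\<dots> = X' - (a \<star> \<xi> - \<xi> \<star> a)"
      unfolding X'_def rtr_def cj_def \<xi>_def star_sum by (simp only: sum_subtractf)
    also have "a \<star> \<xi> = a \<star> e \<star> \<xi>" using \<xi>e by (simp add: star_assoc)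
    also have "\<xi> \<star> a = \<xi> \<star> (a \<star> e)" unfolding ae using \<xi>e by (simp add: star_assoc[symmetric])
    finally have X_eq: "X = X' - (a \<star> e \<star> \<xi> - \<xi> \<star> (a \<star> e))" .
    have Xw_M: "X \<star> w \<in> supp_in M"
      by (rule star_supp[OF M_sub X_M]) (use w(1) supp_in_mono[OF C_M] in blast)
    have Z_fix: "cj z x = x" if z: "z \<in> Z" and x: "x \<in> supp_in M" for z and x :: "'g \<Rightarrow> 'k"
    proof (rule lin_eq_on[OF fin_sub[OF M_carrier] lin_cj lin_id _ x])
      fix m assume "m \<in> M"
      then obtain u c where uc: "u \<in> P" "c \<in> C" "m = u \<otimes> c" using M_iff by blast
      have zP: "z \<in> P" "z \<in> C" "z \<in> carrier G" using z Z_P Z_C ZG by auto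
      have "z \<otimes> m = m \<otimes> z"
        using C_commute[OF zP(2) uc(1)] C_commute[OF uc(2) zP(1)] PG[OF uc(1)] CG[OF uc(2)] zP(3) uc(3)
        by (metis m_assoc)
      then show "cj z (dl m) = dl m"
        using conj_eq_iff_commute[OF zP(3), of m] zP(3) \<open>m \<in> M\<close> M_carrier by (auto simp: cj_dl)
    qed
    have "\<exists>a'\<in>supp_in P. X' = a' \<star> e"
    proof (rule centralizer_of_C_in_kPCe)
      show "X' \<in> supp_in M"
        unfolding X'_def rtr_def
      proof (rule supp_in_closed(6))
        fix t assume "t \<in> tv C Z"
        then have t: "t \<in> M" using tvCZ C_M by blast
        then have "inv t \<in> M" using M_sub by (simp add: subgroup.m_inv_closed)
        with t show "cj t (X \<star> w) \<in> supp_in M" unfolding cj_def by (intro star_supp[OF M_sub] Xw_M dl_in)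
      qed
      have "X' \<star> e = rtr C Z (X \<star> w \<star> e)" unfolding X'_def by (rule rtr_mult(2)[OF C_sub Z_sub e_fixed])
      then show "X' \<star> e = X'" unfolding star_assoc we X'_def .
      show "cj c X' = X'" if "c \<in> C" for c
        unfolding X'_def by (rule rtr_fixed[OF C_sub Z_sub Z_C Z_fix[OF _ Xw_M] that])
    qed
    moreover have "X - (\<xi> \<star> (a \<star> e) - a \<star> e \<star> \<xi>) = X'" by (subst X_eq) simp
    ultimately show ?thesis unfolding X_def by simp
  qed
  define d2 where "d2 x = D' x - (\<xi> \<star> x - x \<star> \<xi>)" for x
  have d2: "derivation_on Bs d2" unfolding d2_def by (intro derivation_diff D' derivation_inner \<xi>)
  then have lind2: "lin d2" and leib2: "\<And>x y. x \<in> Bs \<Longrightarrow> y \<in> Bs \<Longrightarrow> d2 (x \<star> y) = d2 x \<star> y + x \<star> d2 y"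
    by (auto simp: derivation_on_def)
  obtain \<tau> :: "('g \<Rightarrow> 'k) \<Rightarrow> 'g \<Rightarrow> 'k" where \<tau>: "lin \<tau>" "\<And>x. \<tau> x \<in> supp_in P" "\<And>a x. a \<in> supp_in P \<Longrightarrow> \<tau> (a \<star> x) = a \<star> \<tau> x"
    "\<And>a x. a \<in> supp_in P \<Longrightarrow> \<tau> (x \<star> a) = \<tau> x \<star> a" "\<And>a. a \<in> supp_in P \<Longrightarrow> \<tau> (a \<star> e) = a"
    by (rule retraction) blast
  \<comment> \<open>By \<open>key\<close>, d2 maps kPe into itself, and there \<tau> inverts the
    embedding that sends a to a e.\<close>
  define d1 where "d1 a = \<tau> (d2 (a \<star> e))" for a
  have ext: "d2 (a \<star> e) = d1 a \<star> e" if a: "a \<in> supp_in P" for a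
  proof -
    obtain a' where "a' \<in> supp_in P" "d2 (a \<star> e) = a' \<star> e" using key[OF a] unfolding d2_def by blast
    then show ?thesis using \<tau>(5) by (simp add: d1_def)
  qed
  have d1: "derivation_on (supp_in P) d1"
    unfolding derivation_on_def
  proof (intro conjI ballI)
    show "lin d1" unfolding d1_def by (intro lin_comp[OF \<tau>(1)] lin_comp[OF lind2] lin_intros)
    show "d1 x \<in> supp_in P" for x by (simp add: d1_def \<tau>(2))
    fix x y :: "'g \<Rightarrow> 'k" assume x: "x \<in> supp_in P" and y: "y \<in> supp_in P"
    have ye: "y \<star> e = e \<star> y" by (rule e_commute_P[OF y])
    have d1y: "d1 y \<star> e = e \<star> d1 y" by (rule e_commute_P) (simp add: d1_def \<tau>(2))
    have "x \<star> y \<star> e = (x \<star> e) \<star> (y \<star> e)" using ye by (simp add: star_assoc e_idem ee_star)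
    then have "d2 (x \<star> y \<star> e) = d1 x \<star> e \<star> (y \<star> e) + x \<star> e \<star> (d1 y \<star> e)"
      using leib2[OF Bs_ce[OF supp_P[OF x]] Bs_ce[OF supp_P[OF y]]] ext[OF x] ext[OF y] by simp
    also have "d1 x \<star> e \<star> (y \<star> e) = d1 x \<star> y \<star> e" using ye by (simp add: star_assoc e_idem ee_star)
    also have "x \<star> e \<star> (d1 y \<star> e) = x \<star> d1 y \<star> e" using d1y by (simp add: star_assoc e_idem ee_star)
    finally have eq: "d2 (x \<star> y \<star> e) = (d1 x \<star> y + x \<star> d1 y) \<star> e" by (simp only: star_add_left)
    have "d1 x \<star> y + x \<star> d1 y \<in> supp_in P"
      by (intro supp_in_closed(2) star_supp[OF P_sub] x y) (simp_all add: d1_def \<tau>(2))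
    then show "d1 (x \<star> y) = d1 x \<star> y + x \<star> d1 y" unfolding d1_def[of "x \<star> y"] eq by (rule \<tau>(5))
  qed
  have "d x = d2 x + ((z1 + z2 + \<xi>) \<star> x - x \<star> (z1 + z2 + \<xi>))" for x
    unfolding d2_def D'_def D_def by (simp only: star_distribs) simp
  moreover have "z1 + z2 + \<xi> \<in> Bs" by (intro Bs_closed(2) z1 z2(1) \<xi>)
  moreover have "extends d1 d2" using ext by (simp add: extends_def)
  ultimately show ?thesis using d1 d2 by blast
qed

end

section \<open>Outer derivations\<close>

context conv_algebra
begin

lemma Der_iff:
  "D \<in> Der A \<longleftrightarrow> D \<in> extensional (carrier A) \<and> (\<forall>x\<in>carrier A. D x \<in> carrier A) \<and>
    (\<forall>x\<in>carrier A. \<forall>y\<in>carrier A. D (x + y) = D x + D y) \<and>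
    (\<forall>c. \<forall>x\<in>carrier A. D (smul c x) = smul c (D x)) \<and>
    (\<forall>x\<in>carrier A. \<forall>y\<in>carrier A. D (x \<star> y) = D x \<star> y + x \<star> D y)"
proof -
  have "D (x \<otimes>\<^bsub>A\<^esub> y) = D x \<otimes>\<^bsub>A\<^esub> y + x \<otimes>\<^bsub>A\<^esub> D y \<longleftrightarrow> D (x \<star> y) = D x \<star> y + x \<star> D y"
    if "\<forall>x\<in>carrier A. D x \<in> carrier A" "x \<in> carrier A" "y \<in> carrier A" for x y
    using that by (simp add: A_mult)
  then show ?thesis unfolding Der_def PiE_def Pi_def mem_Collect_eq A_add A_smult Int_iff by blast
qed

lemma DerI:
  assumes "derivation_on (carrier A) d"
  shows "restrict d (carrier A) \<in> Der A"
  using assms A_closed A_mult_closed unfolding Der_iff derivation_on_def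
  by (auto simp: lin_add[of d] lin_smul[of d])

text \<open>Elements of \<open>Der\<close> are undefined outside the carrier; composing with a
  linear projection onto the carrier gives a map that is linear on all functions.\<close>

lemma DerE:
  assumes "D \<in> Der A"
  obtains d where "derivation_on (carrier A) d" "\<And>x. x \<in> carrier A \<Longrightarrow> d x = D x"
proof -
  obtain F :: "('g \<Rightarrow> 'k) \<Rightarrow> 'g \<Rightarrow> 'k" where F: "lin F" "\<And>x. F x \<in> carrier A" "\<And>v. v \<in> carrier A \<Longrightarrow> F v = v"
    using subspace_projection[OF A_subspace] by blast
  have D: "\<And>x. x \<in> carrier A \<Longrightarrow> D x \<in> carrier A" "\<And>x y. x \<in> carrier A \<Longrightarrow> y \<in> carrier A \<Longrightarrow> D (x + y) = D x + D y"
    "\<And>c x. x \<in> carrier A \<Longrightarrow> D (smul c x) = smul c (D x)"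
    "\<And>x y. x \<in> carrier A \<Longrightarrow> y \<in> carrier A \<Longrightarrow> D (x \<star> y) = D x \<star> y + x \<star> D y"
    using assms unfolding Der_iff by blast+
  have "lin (\<lambda>x. D (F x))"
  proof (rule linI)
    show "D (F (x + y)) = D (F x) + D (F y)" for x y unfolding lin_add[OF F(1)] by (rule D(2)[OF F(2) F(2)])
    show "D (F (smul c x)) = smul c (D (F x))" for c x unfolding lin_smul[OF F(1)] by (rule D(3)[OF F(2)])
  qed
  then have "derivation_on (carrier A) (\<lambda>x. D (F x))"
    unfolding derivation_on_def using D(1,4) F(3) A_mult_closed by simp
  then show thesis using that F(3) by simp
qed

definition ad :: "('g \<Rightarrow> 'k) \<Rightarrow> ('g \<Rightarrow> 'k) \<Rightarrow> 'g \<Rightarrow> 'k" where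
  "ad z x = z \<star> x - x \<star> z"

lemma ad_in: "z \<in> carrier A \<Longrightarrow> x \<in> carrier A \<Longrightarrow> ad z x \<in> carrier A"
  by (simp add: ad_def A_closed A_mult_closed)

lemma ad_simps: "ad z (x + y) = ad z x + ad z y" "ad z (smul c x) = smul c (ad z x)" "ad (z + z') x = ad z x + ad z' x"
  "ad (- z) x = - ad z x" "ad (z - z') x = ad z x - ad z' x" "ad (smul c z) x = smul c (ad z x)" "ad 0 x = 0" "ad z (x \<star> y) = ad z x \<star> y + x \<star> ad z y"
  by (simp_all add: ad_def star_distribs smul_add star_assoc)

lemma IDer_eq: "IDer A = (\<lambda>z. restrict (ad z) (carrier A)) ` carrier A"
  unfolding IDer_def ad_def
  by (intro image_cong refl restrict_ext) (simp add: A_mult A_minus A_mult_closed)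

lemma mem_class:
  "E \<in> der_class A D \<longleftrightarrow> E \<in> extensional (carrier A) \<and> (\<exists>z\<in>carrier A. \<forall>x\<in>carrier A. E x = D x + ad z x)"
proof
  assume "E \<in> der_class A D"
  then show "E \<in> extensional (carrier A) \<and> (\<exists>z\<in>carrier A. \<forall>x\<in>carrier A. E x = D x + ad z x)"
    by (auto simp: der_class_def IDer_eq der_add_def)
next
  assume E: "E \<in> extensional (carrier A) \<and> (\<exists>z\<in>carrier A. \<forall>x\<in>carrier A. E x = D x + ad z x)"
  then obtain z where z: "z \<in> carrier A" "\<forall>x\<in>carrier A. E x = D x + ad z x" by blast
  have "E = der_add A D (restrict (ad z) (carrier A))"
    by (rule extensionalityI[of _ "carrier A"]) (use E z in \<open>auto simp: der_add_def\<close>)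
  then show "E \<in> der_class A D" using z(1) by (auto simp: der_class_def IDer_eq)
qed

lemma class_self: "D \<in> Der A \<Longrightarrow> D \<in> der_class A D"
  unfolding mem_class Der_iff using A_closed(1) by (auto intro!: bexI[of _ 0] simp: ad_simps)

lemma class_eqI:
  assumes z: "z \<in> carrier A" and eq: "\<And>x. x \<in> carrier A \<Longrightarrow> D x = D' x + ad z x"
  shows "der_class A D = der_class A D'"
proof (rule Set.set_eqI)
  fix E
  have "(\<exists>y\<in>carrier A. \<forall>x\<in>carrier A. E x = D x + ad y x) \<longleftrightarrow> (\<exists>y\<in>carrier A. \<forall>x\<in>carrier A. E x = D' x + ad y x)"
  proof
    assume "\<exists>y\<in>carrier A. \<forall>x\<in>carrier A. E x = D x + ad y x"
    then obtain y where "y \<in> carrier A" "\<forall>x\<in>carrier A. E x = D x + ad y x" by blast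
    then show "\<exists>y\<in>carrier A. \<forall>x\<in>carrier A. E x = D' x + ad y x"
      using z eq by (intro bexI[of _ "z + y"]) (auto simp: ad_simps A_closed add.assoc)
  next
    assume "\<exists>y\<in>carrier A. \<forall>x\<in>carrier A. E x = D' x + ad y x"
    then obtain y where "y \<in> carrier A" "\<forall>x\<in>carrier A. E x = D' x + ad y x" by blast
    then show "\<exists>y\<in>carrier A. \<forall>x\<in>carrier A. E x = D x + ad y x"
      using z eq by (intro bexI[of _ "y - z"]) (auto simp: ad_simps A_closed add.assoc)
  qed
  then show "E \<in> der_class A D \<longleftrightarrow> E \<in> der_class A D'" unfolding mem_class by blast
qed

lemma class_eqD:
  assumes "D \<in> Der A" "der_class A D = der_class A D'"
  shows "\<exists>z\<in>carrier A. \<forall>x\<in>carrier A. D x = D' x + ad z x"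
  using class_self[OF assms(1)] unfolding assms(2) mem_class by blast

lemma class_Der:
  assumes "D \<in> Der A" "E \<in> der_class A D"
  shows "E \<in> Der A"
proof -
  obtain z where z: "z \<in> carrier A" "\<And>x. x \<in> carrier A \<Longrightarrow> E x = D x + ad z x" and ext: "E \<in> extensional (carrier A)"
    using assms(2) unfolding mem_class by blast
  have D: "\<And>x. x \<in> carrier A \<Longrightarrow> D x \<in> carrier A" "\<And>x y. x \<in> carrier A \<Longrightarrow> y \<in> carrier A \<Longrightarrow> D (x + y) = D x + D y"
    "\<And>c x. x \<in> carrier A \<Longrightarrow> D (smul c x) = smul c (D x)"
    "\<And>x y. x \<in> carrier A \<Longrightarrow> y \<in> carrier A \<Longrightarrow> D (x \<star> y) = D x \<star> y + x \<star> D y"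
    using assms(1) unfolding Der_iff by blast+
  show ?thesis
    unfolding Der_iff
  proof (intro conjI ballI allI ext)
    fix x y assume x: "x \<in> carrier A" and y: "y \<in> carrier A"
    show "E (x + y) = E x + E y" using x y z D(2) by (simp add: A_closed ad_simps)
    show "E (x \<star> y) = E x \<star> y + x \<star> E y" using x y z D(4) by (simp add: A_mult_closed ad_simps star_distribs)
  next
    fix x c assume x: "x \<in> carrier A"
    show "E x \<in> carrier A" using x z D(1) by (simp add: A_closed ad_in)
    show "E (smul c x) = smul c (E x)" using x z D(3) by (simp add: A_closed ad_simps smul_add)
  qed
qed

lemma der_ops:
  assumes D: "D \<in> Der A" and E: "E \<in> Der A"
  shows "der_add A D E \<in> Der A" "der_scale A c D \<in> Der A" "der_bracket A D E \<in> Der A"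
    "x \<in> carrier A \<Longrightarrow> der_add A D E x = D x + E x" "x \<in> carrier A \<Longrightarrow> der_scale A c D x = smul c (D x)"
    "x \<in> carrier A \<Longrightarrow> der_bracket A D E x = D (E x) - E (D x)"
proof -
  have D': "\<And>x. x \<in> carrier A \<Longrightarrow> D x \<in> carrier A" "\<And>x y. x \<in> carrier A \<Longrightarrow> y \<in> carrier A \<Longrightarrow> D (x + y) = D x + D y"
    "\<And>c x. x \<in> carrier A \<Longrightarrow> D (smul c x) = smul c (D x)"
    "\<And>x y. x \<in> carrier A \<Longrightarrow> y \<in> carrier A \<Longrightarrow> D (x \<star> y) = D x \<star> y + x \<star> D y"
    using D unfolding Der_iff by blast+
  have E': "\<And>x. x \<in> carrier A \<Longrightarrow> E x \<in> carrier A" "\<And>x y. x \<in> carrier A \<Longrightarrow> y \<in> carrier A \<Longrightarrow> E (x + y) = E x + E y"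
    "\<And>c x. x \<in> carrier A \<Longrightarrow> E (smul c x) = smul c (E x)"
    "\<And>x y. x \<in> carrier A \<Longrightarrow> y \<in> carrier A \<Longrightarrow> E (x \<star> y) = E x \<star> y + x \<star> E y"
    using E unfolding Der_iff by blast+
  show add: "der_add A D E x = D x + E x" if "x \<in> carrier A" for x using that by (simp add: der_add_def)
  show scale: "der_scale A c D x = smul c (D x)" if "x \<in> carrier A" for x using that by (simp add: der_scale_def)
  show bracket: "der_bracket A D E x = D (E x) - E (D x)" if "x \<in> carrier A" for x
    using that D'(1) E'(1) by (simp add: der_bracket_def A_minus)
  show "der_add A D E \<in> Der A"
    unfolding Der_iff using D' E' add
    by (auto simp: der_add_def A_closed A_mult_closed star_distribs smul_add)
  show "der_scale A c D \<in> Der A"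
    unfolding Der_iff using D' scale
    by (auto simp: der_scale_def A_closed A_mult_closed star_distribs smul_add mult.commute)
  show "der_bracket A D E \<in> Der A"
    unfolding Der_iff
  proof (intro conjI ballI allI)
    show "der_bracket A D E \<in> extensional (carrier A)" by (simp add: der_bracket_def)
    fix x y assume x: "x \<in> carrier A" and y: "y \<in> carrier A"
    show "der_bracket A D E (x + y) = der_bracket A D E x + der_bracket A D E y"
      using x y D' E' by (simp add: bracket A_closed)
    have "D (E (x \<star> y)) = D (E x) \<star> y + E x \<star> D y + (D x \<star> E y + x \<star> D (E y))"
      using x y D' E' by (simp add: A_mult_closed A_closed)
    moreover have "E (D (x \<star> y)) = E (D x) \<star> y + D x \<star> E y + (E x \<star> D y + x \<star> E (D y))"
      using x y D' E' by (simp add: A_mult_closed A_closed)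
    ultimately have "D (E (x \<star> y)) - E (D (x \<star> y)) = (D (E x) - E (D x)) \<star> y + x \<star> (D (E y) - E (D y))"
      by (simp only: star_diff) simp
    then show "der_bracket A D E (x \<star> y) = der_bracket A D E x \<star> y + x \<star> der_bracket A D E y"
      using x y by (simp only: bracket A_mult_closed)
  next
    fix x c assume x: "x \<in> carrier A"
    show "der_bracket A D E x \<in> carrier A" using x D' E' by (simp add: bracket A_closed)
    show "der_bracket A D E (smul c x) = smul c (der_bracket A D E x)"
      using x D' E' by (simp add: bracket A_closed smul_add)
  qed
qed

lemma HH1_carrier: "carrier (HH1 A) = der_class A ` Der A"
  by (simp add: HH1_def)

text \<open>The operations are unions over all representatives, so the point is that changing a
  representative by an inner derivation changes the result by one.\<close>

lemma HH1_ops: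
  assumes D: "D \<in> Der A" and E: "E \<in> Der A"
  shows "ladd (HH1 A) (der_class A D) (der_class A E) = der_class A (der_add A D E)"
    "lscale (HH1 A) c (der_class A D) = der_class A (der_scale A c D)"
    "lbracket (HH1 A) (der_class A D) (der_class A E) = der_class A (der_bracket A D E)"
proof -
  have const: "(\<Union>x\<in>X. \<Union>y\<in>Y. f x y) = S" if "X \<noteq> {}" "Y \<noteq> {}" "\<And>x y. x \<in> X \<Longrightarrow> y \<in> Y \<Longrightarrow> f x y = S"
    for X Y :: "(('g \<Rightarrow> 'k) \<Rightarrow> 'g \<Rightarrow> 'k) set" and f and S :: "(('g \<Rightarrow> 'k) \<Rightarrow> 'g \<Rightarrow> 'k) set"
    using that by auto
  have const1: "(\<Union>x\<in>X. f x) = S" if "X \<noteq> {}" "\<And>x. x \<in> X \<Longrightarrow> f x = S"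
    for X :: "(('g \<Rightarrow> 'k) \<Rightarrow> 'g \<Rightarrow> 'k) set" and f and S :: "(('g \<Rightarrow> 'k) \<Rightarrow> 'g \<Rightarrow> 'k) set"
    using that by auto
  have ne: "der_class A D \<noteq> {}" "der_class A E \<noteq> {}" using class_self D E by auto
  have rep: "\<exists>z\<in>carrier A. \<forall>x\<in>carrier A. F x = D x + ad z x" if "F \<in> der_class A D" for F D using that by (simp add: mem_class)
  have Din: "D x \<in> carrier A" "D (ad z x) = ad (D z) x + ad z (D x)"
    if "D \<in> Der A" "x \<in> carrier A" "z \<in> carrier A" for D x z
  proof -
    have D: "\<And>x. x \<in> carrier A \<Longrightarrow> D x \<in> carrier A" "\<And>x y. x \<in> carrier A \<Longrightarrow> y \<in> carrier A \<Longrightarrow> D (x + y) = D x + D y"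
      "\<And>c x. x \<in> carrier A \<Longrightarrow> D (smul c x) = smul c (D x)"
      "\<And>x y. x \<in> carrier A \<Longrightarrow> y \<in> carrier A \<Longrightarrow> D (x \<star> y) = D x \<star> y + x \<star> D y"
      using that(1) unfolding Der_iff by blast+
    show "D x \<in> carrier A" using D(1) that by blast
    have zx: "z \<star> x \<in> carrier A" "x \<star> z \<in> carrier A" using that A_mult_closed by auto
    have "D (ad z x) = D (z \<star> x + smul (- 1) (x \<star> z))" by (simp add: ad_def)
    also have "\<dots> = D (z \<star> x) + smul (- 1) (D (x \<star> z))"
      unfolding D(2)[OF zx(1) A_closed(5)[OF zx(2)]] D(3)[OF zx(2)] ..
    also have "\<dots> = ad (D z) x + ad z (D x)" unfolding D(4)[OF that(3,2)] D(4)[OF that(2,3)] by (simp add: ad_def)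
    finally show "D (ad z x) = ad (D z) x + ad z (D x)" .
  qed
  show "ladd (HH1 A) (der_class A D) (der_class A E) = der_class A (der_add A D E)"
    unfolding HH1_def lie_algebra.simps
  proof (rule const[OF ne])
    fix D' E' assume D': "D' \<in> der_class A D" and E': "E' \<in> der_class A E"
    obtain z y where "z \<in> carrier A" "\<forall>x\<in>carrier A. D' x = D x + ad z x" "y \<in> carrier A" "\<forall>x\<in>carrier A. E' x = E x + ad y x"
      using rep[OF D'] rep[OF E'] by blast
    then show "der_class A (der_add A D' E') = der_class A (der_add A D E)"
      using der_ops(4)[OF class_Der[OF D D'] class_Der[OF E E']] der_ops(4)[OF D E]
      by (intro class_eqI[of "z + y"]) (auto simp: A_closed ad_simps add_ac)
  qed
  show "lscale (HH1 A) c (der_class A D) = der_class A (der_scale A c D)"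
    unfolding HH1_def lie_algebra.simps
  proof (rule const1[OF ne(1)])
    fix D' assume D': "D' \<in> der_class A D"
    obtain z where "z \<in> carrier A" "\<forall>x\<in>carrier A. D' x = D x + ad z x" using rep[OF D'] by blast
    then show "der_class A (der_scale A c D') = der_class A (der_scale A c D)"
      using der_ops(5)[OF class_Der[OF D D'] D] der_ops(5)[OF D E]
      by (intro class_eqI[of "smul c z"]) (auto simp: A_closed ad_simps smul_add)
  qed
  show "lbracket (HH1 A) (der_class A D) (der_class A E) = der_class A (der_bracket A D E)"
    unfolding HH1_def lie_algebra.simps
  proof (rule const[OF ne])
    fix D' E' assume D': "D' \<in> der_class A D" and E': "E' \<in> der_class A E"
    obtain z y where z: "z \<in> carrier A" "\<And>x. x \<in> carrier A \<Longrightarrow> D' x = D x + ad z x"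
      and y: "y \<in> carrier A" "\<And>x. x \<in> carrier A \<Longrightarrow> E' x = E x + ad y x"
      using rep[OF D'] rep[OF E'] by blast
    have D'D: "D' \<in> Der A" and E'D: "E' \<in> Der A" using class_Der D E D' E' by auto
    show "der_class A (der_bracket A D' E') = der_class A (der_bracket A D E)"
    \<comment> \<open>[D + ad z, E + ad y] = [D, E] + ad (D y) - ad (E z) + ad [z, y], because the
      commutator of a derivation D with ad y is ad (D y).\<close>
    proof (rule class_eqI[of "D y - E z + ad z y"])
      show "D y - E z + ad z y \<in> carrier A" using Din[OF D y(1) y(1)] Din[OF E z(1) z(1)] z y by (simp add: A_closed ad_in)
      fix x assume x: "x \<in> carrier A"
      have Dadd: "F (u + v) = F u + F v" if "F \<in> Der A" "u \<in> carrier A" "v \<in> carrier A" for F u v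
        using that unfolding Der_iff by blast
      have in1: "E x \<in> carrier A" "D x \<in> carrier A" "ad y x \<in> carrier A" "ad z x \<in> carrier A" "E' x \<in> carrier A" "D' x \<in> carrier A"
        using Din(1)[OF E x x] Din(1)[OF D x x] Din(1)[OF E'D x x] Din(1)[OF D'D x x] ad_in x y z by auto
      have "D' (E' x) = D (E x) + (ad (D y) x + ad y (D x)) + (ad z (E x) + ad z (ad y x))"
        using z(2)[OF in1(5)] unfolding y(2)[OF x] Dadd[OF D in1(1,3)] Din(2)[OF D x y(1)] ad_simps(1) .
      moreover have "E' (D' x) = E (D x) + (ad (E z) x + ad z (E x)) + (ad y (D x) + ad y (ad z x))"
        using y(2)[OF in1(6)] unfolding z(2)[OF x] Dadd[OF E in1(2,4)] Din(2)[OF E x z(1)] ad_simps(1) .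
      moreover have jacobi: "ad z (ad y x) - ad y (ad z x) = ad (ad z y) x"
        by (simp add: ad_def star_diff star_assoc)
      moreover have "ad (D y - E z + ad z y) x = ad (D y) x - ad (E z) x + (ad z (ad y x) - ad y (ad z x))"
        unfolding jacobi by (simp add: ad_def star_distribs)
      ultimately show "der_bracket A D' E' x = der_bracket A D E x + ad (D y - E z + ad z y) x"
        unfolding der_ops(6)[OF D'D E'D x] der_ops(6)[OF D E x] by (simp only:) simp
    qed
  qed
qed

end

text \<open>An extension D' of D is not unique, and no linear or multiplicative choice is made: it
  is enough that R respects the operations, while \<open>classes\<close> makes the induced map on
  classes both well defined and injective.\<close>

lemma lie_iso_from_relation:
  fixes A B :: "('k::field, 'g \<Rightarrow> 'k) module"
  assumes A: "conv_algebra G A" and B: "conv_algebra G B"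
    and R_Der: "\<And>D D'. R D D' \<Longrightarrow> D \<in> Der A \<and> D' \<in> Der B" and ex: "\<exists>D D'. R D D'"
    and add: "\<And>D D' E E'. R D D' \<Longrightarrow> R E E' \<Longrightarrow> R (der_add A D E) (der_add B D' E')"
    and bracket: "\<And>D D' E E'. R D D' \<Longrightarrow> R E E' \<Longrightarrow> R (der_bracket A D E) (der_bracket B D' E')"
    and scale: "\<And>D D' c. R D D' \<Longrightarrow> R (der_scale A c D) (der_scale B c D')"
    and classes: "\<And>D D' E E'. R D D' \<Longrightarrow> R E E' \<Longrightarrow> der_class A D = der_class A E \<longleftrightarrow> der_class B D' = der_class B E'"
  defines "T \<equiv> {der_class A D | D D'. R D D'}" and "U \<equiv> {der_class B D' | D D'. R D D'}"
  shows "lie_subalgebra U (HH1 B)"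
    "\<exists>\<Phi>. lie_iso ((HH1 A)\<lparr>carrier := T\<rparr>) ((HH1 B)\<lparr>carrier := U\<rparr>) \<Phi> \<and> (\<forall>D D'. R D D' \<longrightarrow> \<Phi> (der_class A D) = der_class B D')"
proof -
  interpret A: conv_algebra G A by (rule A)
  interpret B: conv_algebra G B by (rule B)
  have UI: "R D D' \<Longrightarrow> der_class B D' \<in> U" and TI: "R D D' \<Longrightarrow> der_class A D \<in> T" for D D'
    by (auto simp: T_def U_def)
  show "lie_subalgebra U (HH1 B)"
    unfolding lie_subalgebra_def
  proof (intro conjI ballI allI)
    show "U \<subseteq> carrier (HH1 B)" using R_Der by (auto simp: U_def B.HH1_carrier)
    show "U \<noteq> {}" using ex by (auto simp: U_def)
    fix x c assume "x \<in> U"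
    then obtain D D' where D: "R D D'" "x = der_class B D'" by (auto simp: U_def)
    have DB: "D' \<in> Der B" using R_Der[OF D(1)] by blast
    show "lscale (HH1 B) c x \<in> U"
      unfolding D(2) B.HH1_ops(2)[OF DB DB] by (rule UI[OF scale[OF D(1)]])
    fix y assume "y \<in> U"
    then obtain E E' where E: "R E E'" "y = der_class B E'" by (auto simp: U_def)
    have EB: "E' \<in> Der B" using R_Der[OF E(1)] by blast
    show "ladd (HH1 B) x y \<in> U" unfolding D(2) E(2) B.HH1_ops(1)[OF DB EB] by (rule UI[OF add[OF D(1) E(1)]])
    show "lbracket (HH1 B) x y \<in> U" unfolding D(2) E(2) B.HH1_ops(3)[OF DB EB] by (rule UI[OF bracket[OF D(1) E(1)]])
  qed
  define \<Phi> where "\<Phi> X = (SOME Y. \<exists>D D'. R D D' \<and> X = der_class A D \<and> Y = der_class B D')" for X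
  have \<Phi>: "\<Phi> (der_class A D) = der_class B D'" if "R D D'" for D D'
  proof -
    have "\<exists>E E'. R E E' \<and> der_class A D = der_class A E \<and> \<Phi> (der_class A D) = der_class B E'"
      unfolding \<Phi>_def by (rule someI[of "\<lambda>Y. \<exists>E E'. R E E' \<and> der_class A D = der_class A E \<and> Y = der_class B E'"]) (use that in blast)
    then show ?thesis using classes[OF that] by metis
  qed
  have "lie_iso ((HH1 A)\<lparr>carrier := T\<rparr>) ((HH1 B)\<lparr>carrier := U\<rparr>) \<Phi>"
    unfolding lie_iso_def lie_algebra.simps partial_object.simps
  proof (intro conjI ballI allI)
    show "bij_betw \<Phi> (carrier (HH1 A\<lparr>carrier := T\<rparr>)) (carrier (HH1 B\<lparr>carrier := U\<rparr>))"
      unfolding bij_betw_def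
    proof
      show "inj_on \<Phi> (carrier (HH1 A\<lparr>carrier := T\<rparr>))"
      proof (rule inj_onI)
        fix X Y assume "X \<in> carrier (HH1 A\<lparr>carrier := T\<rparr>)" "Y \<in> carrier (HH1 A\<lparr>carrier := T\<rparr>)" and eq: "\<Phi> X = \<Phi> Y"
        then obtain D D' E E' where "R D D'" "X = der_class A D" "R E E'" "Y = der_class A E" by (auto simp: T_def)
        then show "X = Y" using eq \<Phi> classes by metis
      qed
      show "\<Phi> ` carrier (HH1 A\<lparr>carrier := T\<rparr>) = carrier (HH1 B\<lparr>carrier := U\<rparr>)"
        using \<Phi> by (force simp: T_def U_def)
    qed
    fix x c assume "x \<in> carrier (HH1 A\<lparr>carrier := T\<rparr>)"
    then obtain D D' where D: "R D D'" "x = der_class A D" by (auto simp: T_def)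
    have D': "D \<in> Der A" "D' \<in> Der B" using R_Der[OF D(1)] by auto
    show "\<Phi> (lscale (HH1 A\<lparr>carrier := T\<rparr>) c x) = lscale (HH1 B\<lparr>carrier := U\<rparr>) c (\<Phi> x)"
      using \<Phi>[OF scale[OF D(1)]] \<Phi>[OF D(1)] A.HH1_ops(2)[OF D'(1) D'(1)] B.HH1_ops(2)[OF D'(2) D'(2)] D(2) by simp
    fix y assume "y \<in> carrier (HH1 A\<lparr>carrier := T\<rparr>)"
    then obtain E E' where E: "R E E'" "y = der_class A E" by (auto simp: T_def)
    have E': "E \<in> Der A" "E' \<in> Der B" using R_Der[OF E(1)] by auto
    show "\<Phi> (ladd (HH1 A\<lparr>carrier := T\<rparr>) x y) = ladd (HH1 B\<lparr>carrier := U\<rparr>) (\<Phi> x) (\<Phi> y)"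
      using \<Phi>[OF add[OF D(1) E(1)]] \<Phi>[OF D(1)] \<Phi>[OF E(1)] A.HH1_ops(1)[OF D'(1) E'(1)] B.HH1_ops(1)[OF D'(2) E'(2)] D(2) E(2) by simp
    show "\<Phi> (lbracket (HH1 A\<lparr>carrier := T\<rparr>) x y) = lbracket (HH1 B\<lparr>carrier := U\<rparr>) (\<Phi> x) (\<Phi> y)"
      using \<Phi>[OF bracket[OF D(1) E(1)]] \<Phi>[OF D(1)] \<Phi>[OF E(1)] A.HH1_ops(3)[OF D'(1) E'(1)] B.HH1_ops(3)[OF D'(2) E'(2)] D(2) E(2) by simp
  qed
  then show "\<exists>\<Phi>. lie_iso ((HH1 A)\<lparr>carrier := T\<rparr>) ((HH1 B)\<lparr>carrier := U\<rparr>) \<Phi> \<and> (\<forall>D D'. R D D' \<longrightarrow> \<Phi> (der_class A D) = der_class B D')"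
    using \<Phi> by blast
qed

section \<open>The canonical map\<close>

context normal_block
begin

text \<open>It suffices to test the splitting condition on a minimal left ideal; its elements \<open>x\<close> are represented by
  the singletons \<open>{x}\<close>, because the modules in the definition of \<open>split_algebra\<close> consist of sets.\<close>

lemma split_centre:
  fixes A :: "('k, 'g \<Rightarrow> 'k) module"
  assumes A: "conv_algebra G A" and carr: "carrier A = {x \<in> supp_in C. e \<star> x = x}" and one: "\<one>\<^bsub>A\<^esub> = e"
    and split: "split_algebra A" and x: "x \<in> centre C e"
  shows "\<exists>c. \<not> centre.unit (x - smul c e)"
proof -
  interpret A: conv_algebra G A by (rule A)
  have eA: "e \<in> carrier A" using A.A_one(1) one by simp
  define \<S> where "\<S> = {L. fv.subspace L \<and> L \<subseteq> carrier A \<and> L \<noteq> {0} \<and> (\<forall>a\<in>carrier A. \<forall>v\<in>L. a \<star> v \<in> L)}"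
  have "carrier A \<in> \<S>" using A.A_subspace A.A_mult_closed eA e_nonzero unfolding \<S>_def by blast
  then have "\<S> \<noteq> {}" by blast
  then have "\<exists>L\<in>\<S>. \<forall>L'\<in>\<S>. L' \<subseteq> L \<longrightarrow> L' = L"
    using A.A_supp by (intro minimal_subspace[OF finG]) (auto simp: \<S>_def)
  then obtain L where L: "L \<in> \<S>" and Lmin: "\<And>L'. L' \<in> \<S> \<Longrightarrow> L' \<subseteq> L \<Longrightarrow> L' = L" by blast
  have subL: "fv.subspace L" and LA: "\<And>v. v \<in> L \<Longrightarrow> v \<in> carrier A" and L0: "L \<noteq> {0}"
    and L_mult: "\<And>a v. a \<in> carrier A \<Longrightarrow> v \<in> L \<Longrightarrow> a \<star> v \<in> L" using L unfolding \<S>_def by auto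
  note L_closed = subspace_closed[OF subL]
  define Mo :: "('g \<Rightarrow> 'k, ('g \<Rightarrow> 'k) set) module" where
    "Mo = \<lparr>carrier = (\<lambda>v. {v}) ` L, monoid.mult = (\<lambda>X Y. X), one = {0}, ring.zero = {0},
      ring.add = (\<lambda>X Y. {the_elem X + the_elem Y}), smult = (\<lambda>a X. {a \<star> the_elem X})\<rparr>"
  have Mo [simp]: "carrier Mo = (\<lambda>v. {v}) ` L" "\<zero>\<^bsub>Mo\<^esub> = {0}" "{u} \<oplus>\<^bsub>Mo\<^esub> {v} = {u + v}" "a \<odot>\<^bsub>Mo\<^esub> {v} = {a \<star> v}" for u v a
    by (simp_all add: Mo_def)
  have group: "abelian_group Mo"
  proof (rule abelian_groupI)
    fix X assume "X \<in> carrier Mo"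
    then obtain v where v: "v \<in> L" "X = {v}" by auto
    then show "\<exists>Y\<in>carrier Mo. Y \<oplus>\<^bsub>Mo\<^esub> X = \<zero>\<^bsub>Mo\<^esub>" using L_closed by (intro bexI[of _ "{- v}"]) auto
  qed (use L_closed in \<open>auto simp: add_ac\<close>)
  have left_mod: "left_module A Mo"
    using A.A_ring group
  proof (intro left_module.intro left_module_axioms.intro)
    fix a b' X assume "a \<in> carrier A" "b' \<in> carrier A" "X \<in> carrier Mo"
    then show "(a \<otimes>\<^bsub>A\<^esub> b') \<odot>\<^bsub>Mo\<^esub> X = a \<odot>\<^bsub>Mo\<^esub> (b' \<odot>\<^bsub>Mo\<^esub> X)" by (auto simp: A.A_mult star_assoc)
  next
    fix X assume "X \<in> carrier Mo"
    then show "\<one>\<^bsub>A\<^esub> \<odot>\<^bsub>Mo\<^esub> X = X" using A.A_one(2) LA by auto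
  qed (auto simp: L_mult star_distribs)
  have scalar: "smul c v = smul c e \<star> v" "smul c e \<in> carrier A" if "v \<in> L" for c v
    using A.A_one(2)[OF LA[OF that]] one A.A_closed(5)[OF eA] by (simp_all add: star_smul_left)
  have simple: "simple_module A Mo"
    unfolding simple_module_def
  proof (intro conjI allI impI left_mod)
    show "carrier Mo \<noteq> {\<zero>\<^bsub>Mo\<^esub>}"
    proof
      assume eq: "carrier Mo = {\<zero>\<^bsub>Mo\<^esub>}"
      have "v = 0" if "v \<in> L" for v
      proof -
        have "{v} \<in> carrier Mo" using that by simp
        then have "{v} \<in> {{0}}" unfolding eq by simp
        then show ?thesis by simp
      qed
      then show False using L0 L_closed(1) by blast
    qed
    fix W assume "submodule W A Mo"
    then interpret W: submodule W A Mo .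
    have W_sub: "W \<subseteq> (\<lambda>v. {v}) ` L" using W.subset by simp
    define L' where "L' = {v. {v} \<in> W}"
    have W_eq: "W = (\<lambda>v. {v}) ` L'" using W_sub by (auto simp: L'_def)
    have L'L: "L' \<subseteq> L" using W_sub by (auto simp: L'_def)
    have zero: "0 \<in> L'" using W.one_closed by (simp add: L'_def)
    have add: "u + v \<in> L'" if "u \<in> L'" "v \<in> L'" for u v
      using W.m_closed[of "{u}" "{v}"] that by (simp add: L'_def)
    have mult: "a \<star> v \<in> L'" if "a \<in> carrier A" "v \<in> L'" for a v
      using W.smult_closed[of a "{v}"] that by (simp add: L'_def)
    have "fv.subspace L'"
      unfolding fv.subspace_def using zero add mult scalar L'L by (metis subsetD)
    then have "L' \<in> \<S> \<or> L' = {0}" using L'L LA mult unfolding \<S>_def by blast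
    then have "L' = L \<or> L' = {0}" using Lmin L'L by blast
    then show "W = {\<zero>\<^bsub>Mo\<^esub>} \<or> W = carrier Mo" using W_eq by auto
  qed
  define \<phi> :: "('g \<Rightarrow> 'k) set \<Rightarrow> ('g \<Rightarrow> 'k) set" where "\<phi> X = {x \<star> the_elem X}" for X
  have xA: "x \<in> carrier A" using x carr by (simp add: centre_def)
  have "module_endo A Mo \<phi>"
    unfolding module_endo_def
  proof (intro conjI ballI)
    show "\<phi> \<in> carrier Mo \<rightarrow> carrier Mo" using L_mult[OF xA] by (auto simp: \<phi>_def)
    show "\<phi> (X \<oplus>\<^bsub>Mo\<^esub> Y) = \<phi> X \<oplus>\<^bsub>Mo\<^esub> \<phi> Y" if "X \<in> carrier Mo" "Y \<in> carrier Mo" for X Y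
      using that by (auto simp: \<phi>_def star_add_right)
    show "\<phi> (a \<odot>\<^bsub>Mo\<^esub> X) = a \<odot>\<^bsub>Mo\<^esub> \<phi> X" if a: "a \<in> carrier A" and "X \<in> carrier Mo" for a X
    proof -
      have "a \<in> supp_in C" using a carr by simp
      then have "a \<star> x = x \<star> a"
        using fixed_commute[OF C_carrier, of x a] x supp_C by (auto simp: centre_def)
      then have "x \<star> (a \<star> v) = a \<star> (x \<star> v)" for v by (simp add: star_assoc[symmetric])
      then show ?thesis using that(2) by (auto simp: \<phi>_def)
    qed
  qed
  then obtain c where c: "\<And>X. X \<in> carrier Mo \<Longrightarrow> \<phi> X = (c \<odot>\<^bsub>A\<^esub> \<one>\<^bsub>A\<^esub>) \<odot>\<^bsub>Mo\<^esub> X"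
    using split simple unfolding split_algebra_def by blast
  \<comment> \<open>x acts on L as the scalar c, so x - c e annihilates a non-zero vector of L and
    cannot be a unit.\<close>
  obtain v where v: "v \<in> L" "v \<noteq> 0" using L0 L_closed(1) by blast
  have "x \<star> v = smul c e \<star> v" using c[of "{v}"] v(1) one by (simp add: \<phi>_def)
  then have "(x - smul c e) \<star> v = 0" by (simp add: star_diff)
  moreover have "x - smul c e \<in> centre C e"
    by (rule subspace_closed(3)[OF centre.S(1) x subspace_closed(5)[OF centre.S(1) centre.f]])
  moreover have "e \<star> v = v" using A.A_one(2)[OF LA[OF v(1)]] one by simp
  ultimately have "\<not> centre.unit (x - smul c e)" using centre.not_unit_annihilates v(2) by blast
  then show ?thesis by blast
qed

section \<open>Stability under N and the fixed points of the inertial quotient\<close>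

lemma stable_at_mult:
  assumes d: "\<And>a. a \<in> supp_in P \<Longrightarrow> d a \<in> supp_in P" and g: "g \<in> carrier G" "stable_at g d c" and h: "h \<in> carrier G" "stable_at h d c'"
  shows "stable_at (g \<otimes> h) d (c + cj g c')"
  unfolding stable_at_def
proof
  fix a :: "'g \<Rightarrow> 'k" assume a: "a \<in> supp_in P"
  have ha: "cj h a \<in> supp_in P" by (rule cj_P[OF h(1) a])
  have 1: "d (cj h a) = cj h (d a) + (c' \<star> cj h a - cj h a \<star> c')" using h(2) a by (simp add: stable_at_def)
  have "d (cj g (cj h a)) = cj g (d (cj h a)) + (c \<star> cj g (cj h a) - cj g (cj h a) \<star> c)"
    using g(2) ha by (simp add: stable_at_def)
  also have "cj g (d (cj h a)) = cj g (cj h (d a)) + (cj g c' \<star> cj g (cj h a) - cj g (cj h a) \<star> cj g c')"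
    unfolding 1 cj_lin_simps cj_mult[OF g(1)] ..
  finally have eq: "d (cj g (cj h a)) = cj g (cj h (d a)) + (cj g c' \<star> cj g (cj h a) - cj g (cj h a) \<star> cj g c') + (c \<star> cj g (cj h a) - cj g (cj h a) \<star> c)" .
  show "d (cj (g \<otimes> h) a) = cj (g \<otimes> h) (d a) + ((c + cj g c') \<star> cj (g \<otimes> h) a - cj (g \<otimes> h) a \<star> (c + cj g c'))"
    unfolding cj_cj[OF g(1) h(1), symmetric] eq by (simp add: star_distribs)
qed

lemma stable_at_C:
  assumes "c \<in> C" "\<And>a. a \<in> supp_in P \<Longrightarrow> d a \<in> supp_in P"
  shows "stable_at c d 0"
proof -
  have "cj c a = a" if "a \<in> supp_in P" for a :: "'g \<Rightarrow> 'k"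
    using commute_fixed[OF CG[OF assms(1)] supp_P[OF that] centralizer_commute_cj[OF P_carrier assms(1) that]] .
  then show ?thesis using assms(2) by (simp add: stable_at_def)
qed

lemma pair_stabilizer_eq: "pair_stabilizer G P e = N"
proof -
  have "g <# P #> inv g = P" if g: "g \<in> carrier G" for g
  proof -
    have "g <# P = P #> g" using normal.coset_eq[OF P_normal] g by simp
    then show ?thesis using g P_carrier by (simp add: coset_mult_assoc)
  qed
  then have "normalizer G P = carrier G" using P_carrier by (auto simp: normalizer_def stabilizer_def)
  then show ?thesis by (auto simp: pair_stabilizer_def N_def gconj_cj)
qed

lemma inertial_quotient_simps:
  "carrier (inertial_quotient G P e) = (\<lambda>g. M #> g) ` N" "\<one>\<^bsub>inertial_quotient G P e\<^esub> = M"
  unfolding inertial_quotient_def FactGroup_def pair_stabilizer_eq M_def[symmetric] RCOSETS_def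
  by (auto simp: r_coset_def)

lemma M_coset: "x \<in> M #> g \<longleftrightarrow> (\<exists>m\<in>M. x = m \<otimes> g)"
  by (auto simp: r_coset_def)

text \<open>An element of the coset that induces the lifted automorphism exactly; the other elements
  of X induce it only up to inner automorphisms of P.\<close>

definition acts_by :: "('g set \<Rightarrow> 'g \<Rightarrow> 'g) \<Rightarrow> 'g set \<Rightarrow> 'g \<Rightarrow> bool" where
  "acts_by \<sigma> X g \<longleftrightarrow> g \<in> X \<and> g \<in> N \<and> \<sigma> X = (\<lambda>u\<in>P. g \<otimes> u \<otimes> inv g)"

lemma inertial_lift_acts:
  assumes "inertial_lift G P e \<sigma>" "X \<in> carrier (inertial_quotient G P e)"
  shows "\<exists>g. acts_by \<sigma> X g"
proof -
  obtain g where g: "g \<in> X" "\<sigma> X = (\<lambda>u\<in>P. g \<otimes> u \<otimes> inv g)" using assms by (auto simp: inertial_lift_def)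
  have "g \<in> N"
    using assms(2) g(1) subgroup.m_closed[OF N_sub subsetD[OF M_N]] unfolding inertial_quotient_simps
    by (auto simp: M_coset)
  then show ?thesis using g by (auto simp: acts_by_def)
qed

lemma lin_ext_cj:
  assumes "acts_by \<sigma> X g" "a \<in> supp_in P"
  shows "lin_ext P (\<sigma> X) a = cj g a"
proof
  fix u
  have g: "g \<in> carrier G" and \<sigma>: "\<sigma> X = (\<lambda>u\<in>P. g \<otimes> u \<otimes> inv g)" using assms(1) NG by (auto simp: acts_by_def)
  show "lin_ext P (\<sigma> X) a u = cj g a u"
  proof (cases "u \<in> P")
    case True
    have inj: "inj_on (\<sigma> X) P"
      unfolding \<sigma> using g PG by (intro inj_on_inverseI[of _ "\<lambda>u. inv g \<otimes> u \<otimes> g"]) (simp add: inv_cancel)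
    have "inv_into P (\<sigma> X) u = inv g \<otimes> u \<otimes> g"
      using P_conj'[OF g True] PG[OF True] g by (intro inv_into_f_eq[OF inj]) (simp_all add: \<sigma> inv_cancel)
    then show ?thesis using True PG[OF True] g by (simp add: lin_ext_def cj_apply)
  next
    case False
    then show ?thesis using cj_P[OF g assms(2)] by (simp add: lin_ext_def supp_in_def)
  qed
qed

lemma kP_conv: "conv_algebra G (subgroup_algebra G P :: ('k, 'g \<Rightarrow> 'k) module)"
  by (rule subgroup_conv_algebra[OF P_sub])

definition ext_rel :: "('k, 'g \<Rightarrow> 'k) module \<Rightarrow> (('g \<Rightarrow> 'k) \<Rightarrow> 'g \<Rightarrow> 'k) \<Rightarrow> (('g \<Rightarrow> 'k) \<Rightarrow> 'g \<Rightarrow> 'k) \<Rightarrow> bool" where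
  "ext_rel B D D' \<longleftrightarrow> D \<in> Der (subgroup_algebra G P) \<and> D' \<in> Der B \<and> extends D D'"

lemma stable_at_cong:
  assumes "\<And>a. a \<in> supp_in P \<Longrightarrow> d a = D a" "g \<in> carrier G"
  shows "stable_at g d c \<longleftrightarrow> stable_at g D c"
  unfolding stable_at_def by (intro ball_cong refl) (simp only: assms(1) cj_P[OF assms(2)])

lemma der_conj_eq:
  fixes x :: "'g \<Rightarrow> 'k"
  assumes act: "acts_by \<sigma> X g" and x: "x \<in> supp_in P" and D: "D (cj (inv g) x) \<in> supp_in P"
  shows "der_conj (subgroup_algebra G P) (lin_ext P (\<sigma> X)) D x = cj g (D (cj (inv g) x))"
proof -
  have g: "g \<in> carrier G" using act NG by (auto simp: acts_by_def)
  have inj: "inj_on (lin_ext P (\<sigma> X)) (supp_in P :: ('g \<Rightarrow> 'k) set)"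
  proof (rule inj_on_inverseI[of _ "cj (inv g)"])
    fix a :: "'g \<Rightarrow> 'k" assume "a \<in> supp_in P"
    then show "cj (inv g) (lin_ext P (\<sigma> X) a) = a"
      unfolding lin_ext_cj[OF act \<open>a \<in> supp_in P\<close>] using g cj_one[OF supp_P[OF \<open>a \<in> supp_in P\<close>]] by (simp add: cj_cj)
  qed
  have "lin_ext P (\<sigma> X) (cj (inv g) x) = x"
    unfolding lin_ext_cj[OF act cj_P[OF inv_closed[OF g] x]] using g cj_one[OF supp_P[OF x]] by (simp add: cj_cj)
  then have "inv_into (supp_in P) (lin_ext P (\<sigma> X)) x = cj (inv g) x"
    by (rule inv_into_f_eq[OF inj cj_P[OF inv_closed[OF g] x]])
  then show ?thesis using x lin_ext_cj[OF act D] by (simp add: der_conj_def)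
qed

text \<open>Transport along the automorphism sends D + ad z to the transport of D plus ad
  (\<open>cj g z\<close>). So the class can only be fixed if the transport of D differs from D by an
  inner derivation. For the converse, equality of sets also asks for a preimage of each
  representative.\<close>

lemma class_fixed_iff:
  assumes act: "acts_by \<sigma> X g" and D: "D \<in> Der (subgroup_algebra G P)"
  defines "A \<equiv> subgroup_algebra G P :: ('k, 'g \<Rightarrow> 'k) module"
  shows "der_conj A (lin_ext P (\<sigma> X)) ` der_class A D = der_class A D \<longleftrightarrow> (\<exists>c\<in>supp_in P. stable_at g D c)"
proof -
  interpret A: conv_algebra G A unfolding A_def by (rule kP_conv)
  have carrA [simp]: "carrier A = supp_in P" by (simp add: A_def)
  have g: "g \<in> carrier G" "inv g \<in> carrier G" using act NG by (auto simp: acts_by_def)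
  have gg: "cj g (cj (inv g) x) = x" "cj (inv g) (cj g x) = x" if "x \<in> supp_in P" for x :: "'g \<Rightarrow> 'k"
    using g cj_one[OF supp_P[OF that]] by (simp_all add: cj_cj)
  have DP: "D x \<in> supp_in P" if "x \<in> supp_in P" for x
    using D that unfolding A_def[symmetric] A.Der_iff by auto
  let ?\<alpha> = "der_conj A (lin_ext P (\<sigma> X))"
  have \<alpha>: "?\<alpha> E x = cj g (D (cj (inv g) x)) + A.ad (cj g z) x"
    if "z \<in> supp_in P" "x \<in> supp_in P" "\<And>x. x \<in> supp_in P \<Longrightarrow> E x = D x + A.ad z x" for E z x
  proof -
    have ix: "cj (inv g) x \<in> supp_in P" by (rule cj_P[OF g(2) that(2)])
    have "E (cj (inv g) x) = D (cj (inv g) x) + A.ad z (cj (inv g) x)" by (rule that(3)[OF ix])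
    moreover have "D (cj (inv g) x) + A.ad z (cj (inv g) x) \<in> supp_in P"
      using DP[OF ix] A.ad_in[of z "cj (inv g) x"] ix that(1) A.A_closed(2) by simp
    ultimately have "?\<alpha> E x = cj g (D (cj (inv g) x) + A.ad z (cj (inv g) x))"
      using der_conj_eq[OF act that(2), of E] unfolding A_def[symmetric] by simp
    moreover have "cj g (A.ad z (cj (inv g) x)) = A.ad (cj g z) x"
      using gg(1)[OF that(2)] g by (simp add: A.ad_def cj_lin_simps cj_mult)
    ultimately show ?thesis by (simp only: cj_lin_simps)
  qed
  show ?thesis
  proof
    assume fixd: "?\<alpha> ` der_class A D = der_class A D"
    have "D \<in> der_class A D" using A.class_self D by (simp add: A_def)
    then have "?\<alpha> D \<in> der_class A D" using fixd by blast
    then obtain y where y: "y \<in> supp_in P" "\<And>x. x \<in> supp_in P \<Longrightarrow> ?\<alpha> D x = D x + A.ad y x"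
      unfolding A.mem_class by auto
    have z0: "(0 :: 'g \<Rightarrow> 'k) \<in> supp_in P" by (rule supp_in_closed(1))
    have "stable_at g D (- y)"
      unfolding stable_at_def
    proof
      fix a :: "'g \<Rightarrow> 'k" assume a: "a \<in> supp_in P"
      have ga: "cj g a \<in> supp_in P" by (rule cj_P[OF g(1) a])
      have "cj g (D a) = D (cj g a) + A.ad y (cj g a)"
        using \<alpha>[OF z0 ga, of D] y(2)[OF ga] gg(2)[OF a] by (simp add: A.ad_simps cj_lin_simps)
      then have "D (cj g a) = cj g (D a) - A.ad y (cj g a)" by (metis add_diff_cancel_right')
      also have "\<dots> = cj g (D a) + (- y \<star> cj g a - cj g a \<star> - y)" by (simp add: A.ad_def star_minus)
      finally show "D (cj g a) = cj g (D a) + (- y \<star> cj g a - cj g a \<star> - y)" .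
    qed
    then show "\<exists>c\<in>supp_in P. stable_at g D c" using supp_in_closed(4)[OF y(1)] by blast
  next
    assume "\<exists>c\<in>supp_in P. stable_at g D c"
    then obtain c where c: "c \<in> supp_in P" "stable_at g D c" by blast
    have D_eq: "cj g (D (cj (inv g) x)) = D x - A.ad c x" if x: "x \<in> supp_in P" for x
    proof -
      have "D (cj g (cj (inv g) x)) = cj g (D (cj (inv g) x)) + (c \<star> cj g (cj (inv g) x) - cj g (cj (inv g) x) \<star> c)"
        using c(2) cj_P[OF g(2) x] by (simp add: stable_at_def)
      then have "D x = cj g (D (cj (inv g) x)) + A.ad c x" unfolding gg(1)[OF x] A.ad_def .
      then show ?thesis by (metis add_diff_cancel_right')
    qed
    have \<alpha>': "?\<alpha> E x = D x + A.ad (cj g z - c) x"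
      if "z \<in> supp_in P" "x \<in> supp_in P" "\<And>x. x \<in> supp_in P \<Longrightarrow> E x = D x + A.ad z x" for E z x
    proof -
      have "?\<alpha> E x = cj g (D (cj (inv g) x)) + A.ad (cj g z) x" by (rule \<alpha>[OF that(1,2)]) (rule that(3))
      then show ?thesis unfolding D_eq[OF that(2)] A.ad_simps by (metis add_diff_eq diff_add_eq)
    qed
    have ext: "?\<alpha> E \<in> extensional (supp_in P)" for E by (simp add: der_conj_def)
    show "?\<alpha> ` der_class A D = der_class A D"
    proof
      show "?\<alpha> ` der_class A D \<subseteq> der_class A D"
      proof
        fix F assume "F \<in> ?\<alpha> ` der_class A D"
        then obtain E where E: "E \<in> der_class A D" "F = ?\<alpha> E" by blast
        then obtain z where z: "z \<in> supp_in P" "\<And>x. x \<in> supp_in P \<Longrightarrow> E x = D x + A.ad z x"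
          unfolding A.mem_class by auto
        have "cj g z - c \<in> supp_in P" by (intro supp_in_closed(3) cj_P g z(1) c(1))
        then show "F \<in> der_class A D" unfolding A.mem_class E(2) carrA using \<alpha>'[OF z(1) _ z(2)] ext by blast
      qed
      show "der_class A D \<subseteq> ?\<alpha> ` der_class A D"
      proof
        fix F assume F: "F \<in> der_class A D"
        then obtain y where y: "y \<in> supp_in P" "\<And>x. x \<in> supp_in P \<Longrightarrow> F x = D x + A.ad y x" and Fext: "F \<in> extensional (supp_in P)"
          unfolding A.mem_class by auto
        \<comment> \<open>Chosen to satisfy \<open>cj g z - c = y\<close>, so that E is sent to D +
          ad y.\<close>
        define z where "z = cj (inv g) (y + c)"
        have z: "z \<in> supp_in P" unfolding z_def by (intro cj_P g supp_in_closed(2) y(1) c(1))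
        define E where "E = (\<lambda>x\<in>supp_in P. D x + A.ad z x)"
        have E: "E x = D x + A.ad z x" if "x \<in> supp_in P" for x using that by (simp add: E_def)
        have "E \<in> der_class A D" unfolding A.mem_class carrA using z E by (auto simp: E_def)
        moreover have "F = ?\<alpha> E"
        proof (rule extensionalityI[OF Fext ext])
          fix x :: "'g \<Rightarrow> 'k" assume x: "x \<in> supp_in P"
          have "cj g z - c = y" using gg(1)[OF supp_in_closed(2)[OF y(1) c(1)]] by (simp add: z_def)
          moreover have "?\<alpha> E x = D x + A.ad (cj g z - c) x" by (rule \<alpha>'[OF z x]) (rule E)
          ultimately show "F x = ?\<alpha> E x" using y(2)[OF x] by simp
        qed
        ultimately show "F \<in> ?\<alpha> ` der_class A D" by blast
      qed
    qed
  qed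
qed

text \<open>Being a fixed point tests stability only at the elements that induce the lifts \<sigma>
  X. Every derivation of kP is stable at P and at C, and stability passes to products, so it spreads
  over M to all of N. For N, stability is equivalent to the existence of an extension.\<close>

lemma fixed_class_iff_extends:
  fixes B :: "('k, 'g \<Rightarrow> 'k) module"
  assumes lift: "inertial_lift G P e \<sigma>" and B: "conv_algebra G B" "carrier B = Bs"
    and D: "D \<in> Der (subgroup_algebra G P)"
  shows "der_class (subgroup_algebra G P) D \<in> carrier (HH1_kP_E G P e \<sigma>) \<longleftrightarrow> (\<exists>D'. ext_rel B D D')"
proof -
  let ?A = "subgroup_algebra G P :: ('k, 'g \<Rightarrow> 'k) module"
  interpret A: conv_algebra G ?A by (rule kP_conv)
  interpret B: conv_algebra G B by (rule B(1))
  obtain d where d: "derivation_on (supp_in P) d" "\<And>x. x \<in> supp_in P \<Longrightarrow> d x = D x"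
    using A.DerE[OF D] by auto
  have dP: "d a \<in> supp_in P" if "a \<in> supp_in P" for a using d(1) that by (auto simp: derivation_on_def)
  have "der_class ?A D \<in> carrier (HH1_kP_E G P e \<sigma>) \<longleftrightarrow>
      (\<forall>X\<in>carrier (inertial_quotient G P e). der_conj ?A (lin_ext P (\<sigma> X)) ` der_class ?A D = der_class ?A D)"
    using D by (auto simp: HH1_kP_E_def HH1_fixed_def A.HH1_carrier)
  also have "\<dots> \<longleftrightarrow> (\<forall>X\<in>carrier (inertial_quotient G P e). \<forall>g. acts_by \<sigma> X g \<longrightarrow> (\<exists>c\<in>supp_in P. stable_at g d c))"
  proof (intro ball_cong refl)
    fix X assume "X \<in> carrier (inertial_quotient G P e)"
    then obtain g where g: "acts_by \<sigma> X g" using inertial_lift_acts[OF lift] by blast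
    have *: "der_conj ?A (lin_ext P (\<sigma> X)) ` der_class ?A D = der_class ?A D \<longleftrightarrow> (\<exists>c\<in>supp_in P. stable_at g d c)"
      if "acts_by \<sigma> X g" for g
    proof -
      have "g \<in> carrier G" using that NG by (auto simp: acts_by_def)
      then show ?thesis using class_fixed_iff[OF that D] stable_at_cong[of d D g] d(2) by blast
    qed
    show "der_conj ?A (lin_ext P (\<sigma> X)) ` der_class ?A D = der_class ?A D \<longleftrightarrow> (\<forall>g. acts_by \<sigma> X g \<longrightarrow> (\<exists>c\<in>supp_in P. stable_at g d c))"
      using * g by blast
  qed
  also have "\<dots> \<longleftrightarrow> (\<forall>g\<in>N. \<exists>c\<in>supp_in P. stable_at g d c)"
  proof
    assume st: "\<forall>X\<in>carrier (inertial_quotient G P e). \<forall>g. acts_by \<sigma> X g \<longrightarrow> (\<exists>c\<in>supp_in P. stable_at g d c)"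
    show "\<forall>g\<in>N. \<exists>c\<in>supp_in P. stable_at g d c"
    proof
      fix n' assume n': "n' \<in> N"
      let ?X = "M #> n'"
      have X: "?X \<in> carrier (inertial_quotient G P e)" using n' by (simp add: inertial_quotient_simps)
      then obtain g where g: "acts_by \<sigma> ?X g" using inertial_lift_acts[OF lift] by blast
      then obtain c where c: "c \<in> supp_in P" "stable_at g d c" using st X by blast
      have gN: "g \<in> N" "g \<in> carrier G" using g NG by (auto simp: acts_by_def)
      obtain m where m: "m \<in> M" "g = m \<otimes> n'" using g by (auto simp: acts_by_def M_coset)
      have mG: "m \<in> carrier G" "n' \<in> carrier G" "inv m \<in> M" using m n' NG M_carrier M_sub by (auto simp: subgroup.m_inv_closed)
      obtain u h where uh: "u \<in> P" "h \<in> C" "inv m = u \<otimes> h" using M_iff mG(3) by blast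
      have "n' = inv m \<otimes> g" using m mG by (simp add: inv_cancel)
      then have n'_eq: "n' = u \<otimes> (h \<otimes> g)" using uh(3) PG[OF uh(1)] CG[OF uh(2)] gN(2) by (simp add: m_assoc)
      have 1: "stable_at (h \<otimes> g) d (0 + cj h c)"
        by (rule stable_at_mult[OF dP CG[OF uh(2)] stable_at_C[OF uh(2) dP] gN(2) c(2)])
      have hg: "h \<otimes> g \<in> carrier G" using CG[OF uh(2)] gN(2) by simp
      have 2: "stable_at (u \<otimes> (h \<otimes> g)) d (d (dl u) \<star> dl (inv u) + cj u (0 + cj h c))"
        by (rule stable_at_mult[OF dP PG[OF uh(1)] stable_at_P(1)[OF d(1) uh(1)] hg 1])
      moreover have "d (dl u) \<star> dl (inv u) + cj u (0 + cj h c) \<in> supp_in P"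
        by (intro supp_in_closed(1,2) stable_at_P(2)[OF d(1) uh(1)] cj_P PG[OF uh(1)] CG[OF uh(2)] c(1))
      ultimately show "\<exists>c\<in>supp_in P. stable_at n' d c" unfolding n'_eq by blast
    qed
  qed (auto simp: acts_by_def)
  also have "\<dots> \<longleftrightarrow> (\<exists>D'. ext_rel B D D')"
  proof
    assume "\<forall>g\<in>N. \<exists>c\<in>supp_in P. stable_at g d c"
    then obtain d' where d': "derivation_on Bs d'" "extends d d'" using stable_derivation_extends[OF d(1)] by metis
    have "restrict d' (carrier B) \<in> Der B" using B.DerI d'(1) B(2) by simp
    moreover have "extends D (restrict d' (carrier B))"
      using d'(2) d(2) Bs_star(2)[OF e_Bs supp_P] B(2) by (simp add: extends_def)
    ultimately show "\<exists>D'. ext_rel B D D'" using D by (auto simp: ext_rel_def)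
  next
    assume "\<exists>D'. ext_rel B D D'"
    then obtain D' where D': "D' \<in> Der B" "extends D D'" by (auto simp: ext_rel_def)
    obtain d' where d': "derivation_on Bs d'" "\<And>x. x \<in> Bs \<Longrightarrow> d' x = D' x" using B.DerE[OF D'(1)] B(2) by auto
    have "extends d d'" using D'(2) d(2) d'(2) Bs_star(2)[OF e_Bs supp_P] by (simp add: extends_def)
    then show "\<forall>g\<in>N. \<exists>c\<in>supp_in P. stable_at g d c" using stable_if_extends[OF d(1) d'(1)] by metis
  qed
  finally show ?thesis .
qed

text \<open>y acts on P as the lift s followed by conjugation with some v in P, so freeness has to
  be carried over from s. As s fixes only \<one>, sending x to x s(x)^-1 is injective and hence onto
  P. Writing v = w s(w)^-1 shows that y acts as s conjugated by w, so an element u fixed by y gives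
  w^-1 u w fixed by s.\<close>

lemma free_action:
  assumes lift: "inertial_lift G P e \<sigma>" and free: "acts_freely G P e \<sigma>"
  shows "\<forall>y\<in>N - M. \<forall>u\<in>P. u \<otimes> y = y \<otimes> u \<longrightarrow> u = \<one>"
proof (intro ballI impI)
  fix y u assume y: "y \<in> N - M" and u: "u \<in> P" and comm: "u \<otimes> y = y \<otimes> u"
  have yG: "y \<in> carrier G" using y NG by auto
  let ?X = "M #> y"
  have X: "?X \<in> carrier (inertial_quotient G P e)" using y by (simp add: inertial_quotient_simps)
  have "y \<in> ?X" using yG subgroup.one_closed[OF M_sub] by (auto simp: M_coset intro!: bexI[of _ \<one>])
  then have "?X \<noteq> \<one>\<^bsub>inertial_quotient G P e\<^esub>" using y by (auto simp: inertial_quotient_simps)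
  then have free': "\<And>v. v \<in> P \<Longrightarrow> \<sigma> ?X v = v \<Longrightarrow> v = \<one>" using free X by (auto simp: acts_freely_def)
  obtain g where g: "acts_by \<sigma> ?X g" using inertial_lift_acts[OF lift X] by blast
  have gG: "g \<in> carrier G" using g NG by (auto simp: acts_by_def)
  define s where "s x = g \<otimes> x \<otimes> inv g" for x
  have s_P: "s x \<in> P" if "x \<in> P" for x unfolding s_def by (rule P_conj[OF gG that])
  have s_mult: "s (x \<otimes> z) = s x \<otimes> s z" if "x \<in> P" "z \<in> P" for x z
    using PG that gG by (simp add: s_def m_assoc inv_cancel)
  have s_inv: "s (inv x) = inv (s x)" if "x \<in> P" for x
    using PG that gG by (simp add: s_def inv_mult_group m_assoc)
  have s_fix: "v = \<one>" if "v \<in> P" "s v = v" for v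
    using free'[OF that(1)] g that by (simp add: acts_by_def s_def)
  have P_ops: "inv x \<in> P" "x \<otimes> z \<in> P" if "x \<in> P" "z \<in> P" for x z
    using that P_sub by (auto simp: subgroup.m_closed subgroup.m_inv_closed)
  have inj: "inj_on (\<lambda>x. x \<otimes> inv (s x)) P"
  proof (rule inj_onI)
    fix x z assume x: "x \<in> P" and z: "z \<in> P" and eq: "x \<otimes> inv (s x) = z \<otimes> inv (s z)"
    have G: "x \<in> carrier G" "z \<in> carrier G" "s x \<in> carrier G" "s z \<in> carrier G" using PG x z s_P by auto
    have "inv z \<otimes> x = inv z \<otimes> (x \<otimes> inv (s x)) \<otimes> s x" using G by (simp add: m_assoc)
    also have "\<dots> = inv (s z) \<otimes> s x" unfolding eq using G by (simp add: inv_cancel)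
    also have "\<dots> = s (inv z \<otimes> x)" using s_mult[OF P_ops(1)[OF z z] x] s_inv[OF z] by simp
    finally have "inv z \<otimes> x = \<one>" using s_fix P_ops x z by metis
    then have "inv z = inv x" using G by (simp add: inv_equality)
    then show "x = z" using G by (metis inv_inv)
  qed
  have "(\<lambda>x. x \<otimes> inv (s x)) ` P = P"
    using inj by (intro endo_inj_surj fin_sub[OF P_carrier]) (auto intro!: P_ops s_P)
  obtain m where m: "m \<in> M" "g = m \<otimes> y" using g by (auto simp: acts_by_def M_coset)
  have mG: "m \<in> carrier G" "inv m \<in> M" using m M_carrier M_sub by (auto simp: subgroup.m_inv_closed)
  obtain v c where vc: "v \<in> P" "c \<in> C" "inv m = v \<otimes> c" using M_iff mG(2) by blast
  obtain w where w: "w \<in> P" "v = w \<otimes> inv (s w)" using \<open>(\<lambda>x. x \<otimes> inv (s x)) ` P = P\<close> vc(1) by blast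
  have G: "u \<in> carrier G" "v \<in> carrier G" "c \<in> carrier G" "w \<in> carrier G" "s w \<in> carrier G" "s u \<in> carrier G"
    using PG CG vc w u s_P by auto
  have y_eq: "y = v \<otimes> (c \<otimes> g)"
  proof -
    have "y = inv m \<otimes> g" using m mG yG by (simp add: inv_cancel)
    then show ?thesis using vc(3) G gG by (simp add: m_assoc)
  qed
  have "u \<otimes> y = v \<otimes> (c \<otimes> (g \<otimes> u))" unfolding comm using y_eq G gG by (simp add: m_assoc)
  also have "g \<otimes> u = s u \<otimes> g" using G gG by (simp add: s_def m_assoc)
  also have "c \<otimes> (s u \<otimes> g) = s u \<otimes> (c \<otimes> g)"
    using C_commute[OF vc(2) s_P[OF u]] G gG by (simp add: m_assoc[symmetric])
  finally have "u \<otimes> v \<otimes> (c \<otimes> g) = v \<otimes> s u \<otimes> (c \<otimes> g)" using y_eq G gG by (simp add: m_assoc)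
  then have "u \<otimes> v = v \<otimes> s u" using G gG by simp
  then have uv: "u \<otimes> (w \<otimes> inv (s w)) = w \<otimes> (inv (s w) \<otimes> s u)" using w G by (simp add: m_assoc)
  have "inv w \<otimes> u \<otimes> w = inv w \<otimes> (u \<otimes> (w \<otimes> inv (s w))) \<otimes> s w" using G by (simp add: m_assoc)
  also have "\<dots> = inv (s w) \<otimes> s u \<otimes> s w" unfolding uv using G by (simp add: m_assoc inv_cancel)
  also have "\<dots> = s (inv w \<otimes> u \<otimes> w)" using s_mult s_inv P_ops w(1) u by simp
  finally have "inv w \<otimes> u \<otimes> w = \<one>" using s_fix P_ops w(1) u by metis
  then have "w \<otimes> (inv w \<otimes> u \<otimes> w) \<otimes> inv w = \<one>" using G by simp
  then show "u = \<one>" using G by (simp only: inv_cancel)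
qed

text \<open>That classes correspond has two halves. If D - E is the inner derivation of z, then D' -
  E' minus the inner derivation of z b vanishes on kPe and is therefore inner. If D' - E' is inner,
  \<open>inner_restriction\<close> shows that D - E is inner.\<close>

lemma HH1_fixed_iso:
  fixes B :: "('k, 'g \<Rightarrow> 'k) module"
  assumes lift: "inertial_lift G P e \<sigma>" and B: "conv_algebra G B" "carrier B = Bs"
  defines "U \<equiv> {der_class B D' | D D'. ext_rel B D D'}"
  shows "\<exists>\<Phi>. lie_subalgebra U (HH1 B) \<and> lie_iso (HH1_kP_E G P e \<sigma>) ((HH1 B)\<lparr>carrier := U\<rparr>) \<Phi> \<and>
    canonical_HH1_map G B P e \<sigma> \<Phi>"
proof -
  let ?A = "subgroup_algebra G P :: ('k, 'g \<Rightarrow> 'k) module"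
  interpret A: conv_algebra G ?A by (rule kP_conv)
  interpret B: conv_algebra G B by (rule B(1))
  have ae: "a \<star> e \<in> carrier B" if "a \<in> supp_in P" for a using Bs_star(2)[OF e_Bs supp_P[OF that]] B(2) by simp
  have DP: "D a \<in> supp_in P" if "D \<in> Der ?A" "a \<in> supp_in P" for D a using that by (auto simp: A.Der_iff)
  have T: "{der_class ?A D | D D'. ext_rel B D D'} = carrier (HH1_kP_E G P e \<sigma>)"
  proof -
    have "carrier (HH1_kP_E G P e \<sigma>) \<subseteq> der_class ?A ` Der ?A"
      by (auto simp: HH1_kP_E_def HH1_fixed_def A.HH1_carrier)
    then show ?thesis using fixed_class_iff_extends[OF lift B] unfolding ext_rel_def by blast
  qed
  have HH: "(HH1 ?A)\<lparr>carrier := carrier (HH1_kP_E G P e \<sigma>)\<rparr> = HH1_kP_E G P e \<sigma>"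
    by (simp add: HH1_kP_E_def HH1_fixed_def)
  have rel: "D \<in> Der ?A" "D' \<in> Der B" "\<And>a. a \<in> supp_in P \<Longrightarrow> D' (a \<star> e) = D a \<star> e" if "ext_rel B D D'" for D D'
    using that by (auto simp: ext_rel_def extends_def)
  note relI = ext_rel_def[THEN iffD2, OF conjI, OF _ conjI, unfolded extends_def]
  have ex: "\<exists>D D'. ext_rel B D D'"
  proof -
    have "derivation_on S (\<lambda>_. 0)" if "0 \<in> S" for S :: "('g \<Rightarrow> 'k) set"
      unfolding derivation_on_def using that by (auto intro: linI)
    then have "restrict (\<lambda>_. 0) (carrier ?A) \<in> Der ?A" "restrict (\<lambda>_. 0) (carrier B) \<in> Der B"
      using A.DerI B.DerI A.A_closed(1) B.A_closed(1) by auto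
    then have "ext_rel B (restrict (\<lambda>_. 0) (carrier ?A)) (restrict (\<lambda>_. 0) (carrier B))"
      using ae by (auto simp: ext_rel_def extends_def)
    then show ?thesis by blast
  qed
  have add: "ext_rel B (der_add ?A D E) (der_add B D' E')" if DD: "ext_rel B D D'" and EE: "ext_rel B E E'" for D D' E E'
  proof (rule relI[OF A.der_ops(1) B.der_ops(1)])
    show "\<forall>a\<in>supp_in P. der_add B D' E' (a \<star> e) = der_add ?A D E a \<star> e"
      using B.der_ops(4)[OF rel(2)[OF DD] rel(2)[OF EE] ae] A.der_ops(4)[OF rel(1)[OF DD] rel(1)[OF EE]] rel(3)[OF DD] rel(3)[OF EE]
      by (auto simp: star_add_left)
  qed (use rel DD EE in blast)+
  have scale: "ext_rel B (der_scale ?A c D) (der_scale B c D')" if DD: "ext_rel B D D'" for D D' c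
  proof (rule relI[OF A.der_ops(2) B.der_ops(2)])
    show "\<forall>a\<in>supp_in P. der_scale B c D' (a \<star> e) = der_scale ?A c D a \<star> e"
      using B.der_ops(5)[OF rel(2)[OF DD] rel(2)[OF DD] ae] A.der_ops(5)[OF rel(1)[OF DD] rel(1)[OF DD]] rel(3)[OF DD]
      by (auto simp: star_smul_left)
  qed (use rel DD in blast)+
  have bracket: "ext_rel B (der_bracket ?A D E) (der_bracket B D' E')" if DD: "ext_rel B D D'" and EE: "ext_rel B E E'" for D D' E E'
  proof (rule relI[OF A.der_ops(3) B.der_ops(3)])
    show "\<forall>a\<in>supp_in P. der_bracket B D' E' (a \<star> e) = der_bracket ?A D E a \<star> e"
    proof
      fix a :: "'g \<Rightarrow> 'k" assume a: "a \<in> supp_in P"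
      have "der_bracket B D' E' (a \<star> e) = D' (E' (a \<star> e)) - E' (D' (a \<star> e))"
        by (rule B.der_ops(6)[OF rel(2)[OF DD] rel(2)[OF EE] ae[OF a]])
      also have "\<dots> = (D (E a) - E (D a)) \<star> e"
        using rel(3)[OF DD] rel(3)[OF EE] DP[OF rel(1)[OF DD]] DP[OF rel(1)[OF EE]] a by (simp add: star_diff)
      also have "D (E a) - E (D a) = der_bracket ?A D E a"
        using A.der_ops(6)[OF rel(1)[OF DD] rel(1)[OF EE]] a by simp
      finally show "der_bracket B D' E' (a \<star> e) = der_bracket ?A D E a \<star> e" .
    qed
  qed (use rel DD EE in blast)+
  have classes: "der_class ?A D = der_class ?A E \<longleftrightarrow> der_class B D' = der_class B E'"
    if DD: "ext_rel B D D'" and EE: "ext_rel B E E'" for D D' E E'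
  proof
    assume eq: "der_class ?A D = der_class ?A E"
    then obtain z where z: "z \<in> supp_in P" "\<And>x. x \<in> supp_in P \<Longrightarrow> D x = E x + A.ad z x"
      using A.class_eqD[OF rel(1)[OF DD] eq] by auto
    obtain d' where d': "derivation_on Bs d'" "\<And>x. x \<in> Bs \<Longrightarrow> d' x = D' x" using B.DerE[OF rel(2)[OF DD]] B(2) by auto
    obtain f' where f': "derivation_on Bs f'" "\<And>x. x \<in> Bs \<Longrightarrow> f' x = E' x" using B.DerE[OF rel(2)[OF EE]] B(2) by auto
    have zb: "z \<star> b \<in> Bs" by (rule Bs_star(2)[OF BsI[OF b_in b_idem] supp_P[OF z(1)]])
    let ?h = "\<lambda>x. d' x - f' x - (z \<star> b \<star> x - x \<star> (z \<star> b))"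
    have h: "derivation_on Bs ?h" by (intro derivation_diff d'(1) f'(1) derivation_inner zb)
    have "?h (a \<star> e) = 0" if a: "a \<in> supp_in P" for a
    proof -
      have aeB: "a \<star> e \<in> Bs" using ae[OF a] B(2) by simp
      have 1: "d' (a \<star> e) - f' (a \<star> e) = A.ad z a \<star> e"
        unfolding d'(2)[OF aeB] f'(2)[OF aeB] rel(3)[OF DD a] rel(3)[OF EE a] z(2)[OF a] by (simp add: star_add_left)
      have "z \<star> b \<star> (a \<star> e) = z \<star> a \<star> e" using Bs_b(1)[OF aeB] by (simp add: star_assoc)
      moreover have "a \<star> e \<star> (z \<star> b) = a \<star> z \<star> e"
      proof -
        have "a \<star> e \<star> (z \<star> b) = a \<star> (e \<star> z) \<star> b" by (simp add: star_assoc)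
        also have "\<dots> = a \<star> z \<star> (e \<star> b)" unfolding e_commute_P[OF z(1), symmetric] by (simp add: star_assoc)
        finally show ?thesis using be by simp
      qed
      ultimately have 2: "z \<star> b \<star> (a \<star> e) - a \<star> e \<star> (z \<star> b) = A.ad z a \<star> e" by (simp add: A.ad_def star_diff)
      show ?thesis unfolding 1 2 by simp
    qed
    then obtain y where y: "y \<in> Bs" "\<And>x. x \<in> Bs \<Longrightarrow> ?h x = y \<star> x - x \<star> y"
      using inner_if_zero_on_kPe[OF h] by blast
    show "der_class B D' = der_class B E'"
    proof (rule B.class_eqI[of "z \<star> b + y"])
      show "z \<star> b + y \<in> carrier B" using Bs_closed(2)[OF zb y(1)] B(2) by simp
      fix x assume "x \<in> carrier B"
      then have x: "x \<in> Bs" using B(2) by simp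
      have "D' x = E' x + (z \<star> b \<star> x - x \<star> (z \<star> b)) + ?h x" using d'(2)[OF x] f'(2)[OF x] by simp
      then show "D' x = E' x + B.ad (z \<star> b + y) x" unfolding y(2)[OF x] by (simp add: B.ad_def star_distribs)
    qed
  next
    assume eq: "der_class B D' = der_class B E'"
    then obtain y where y: "y \<in> Bs" "\<And>x. x \<in> Bs \<Longrightarrow> D' x = E' x + B.ad y x"
      using B.class_eqD[OF rel(2)[OF DD] eq] B(2) by auto
    have "\<exists>c\<in>supp_in P. \<forall>a\<in>supp_in P. D a - E a = c \<star> a - a \<star> c"
    proof (rule inner_restriction[of "\<lambda>a. D a - E a" y])
      fix a :: "'g \<Rightarrow> 'k" assume a: "a \<in> supp_in P"
      show "D a - E a \<in> supp_in P" by (rule supp_in_closed(3)[OF DP[OF rel(1)[OF DD] a] DP[OF rel(1)[OF EE] a]])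
      have aeB: "a \<star> e \<in> Bs" using ae[OF a] B(2) by simp
      show "y \<star> (a \<star> e) - a \<star> e \<star> y = (D a - E a) \<star> e"
        unfolding star_diff rel(3)[OF DD a, symmetric] rel(3)[OF EE a, symmetric] y(2)[OF aeB] by (simp add: B.ad_def)
    qed
    then obtain c where c: "c \<in> supp_in P" "\<And>a. a \<in> supp_in P \<Longrightarrow> D a - E a = c \<star> a - a \<star> c" by blast
    show "der_class ?A D = der_class ?A E"
    proof (rule A.class_eqI[of c])
      show "c \<in> carrier ?A" using c(1) by simp
      fix a assume "a \<in> carrier ?A"
      then have "D a - E a = A.ad c a" using c(2) by (simp add: A.ad_def)
      then show "D a = E a + A.ad c a" by (metis add.commute diff_add_cancel)
    qed
  qed
  have R_Der: "D \<in> Der ?A \<and> D' \<in> Der B" if "ext_rel B D D'" for D D' using rel that by blast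
  note iso = lie_iso_from_relation[of G ?A B "ext_rel B", OF kP_conv B(1) R_Der ex add bracket scale classes]
  have sub: "lie_subalgebra U (HH1 B)" unfolding U_def by (rule iso(1))
  obtain \<Phi> where \<Phi>: "lie_iso (HH1_kP_E G P e \<sigma>) ((HH1 B)\<lparr>carrier := U\<rparr>) \<Phi>"
    "\<And>D D'. ext_rel B D D' \<Longrightarrow> \<Phi> (der_class ?A D) = der_class B D'"
    using iso(2) unfolding T HH U_def by blast
  have "canonical_HH1_map G B P e \<sigma> \<Phi>"
    unfolding canonical_HH1_map_def Let_def
  proof (intro ballI impI)
    fix D assume "D \<in> Der ?A" "der_class ?A D \<in> carrier (HH1_kP_E G P e \<sigma>)"
    then obtain D' where D': "ext_rel B D D'" using fixed_class_iff_extends[OF lift B] by blast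
    show "\<exists>D'\<in>Der B. (\<forall>a\<in>carrier ?A. D' (a \<star> e) = D a \<star> e) \<and> \<Phi> (der_class ?A D) = der_class B D'"
      using rel[OF D'] \<Phi>(2)[OF D'] by (intro bexI[of _ D']) auto
  qed
  then show ?thesis using sub \<Phi>(1) by blast
qed

end

lemma (in split_block) all_classes_extend:
  fixes B :: "('k, 'g \<Rightarrow> 'k) module"
  assumes B: "conv_algebra G B" "carrier B = Bs"
    and free: "\<forall>y\<in>N - M. \<forall>u\<in>P. u \<otimes> y = y \<otimes> u \<longrightarrow> u = \<one>"
  shows "{der_class B D' | D D'. ext_rel B D D'} = carrier (HH1 B)"
proof -
  let ?A = "subgroup_algebra G P :: ('k, 'g \<Rightarrow> 'k) module"
  interpret A: conv_algebra G ?A by (rule kP_conv)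
  interpret B: conv_algebra G B by (rule B(1))
  have "\<exists>D1 D2. ext_rel B D1 D2 \<and> der_class B D = der_class B D2" if D: "D \<in> Der B" for D
  proof -
    obtain d where d: "derivation_on Bs d" "\<And>x. x \<in> Bs \<Longrightarrow> d x = D x" using B.DerE[OF D] B(2) by auto
    obtain d1 d2 z where dd: "derivation_on (supp_in P) d1" "derivation_on Bs d2" "extends d1 d2" "z \<in> Bs"
      "\<forall>x\<in>Bs. d x = d2 x + (z \<star> x - x \<star> z)" using derivation_from_kP[OF free d(1)] by blast
    let ?D1 = "restrict d1 (carrier ?A)" and ?D2 = "restrict d2 (carrier B)"
    have "?D1 \<in> Der ?A" "?D2 \<in> Der B" using A.DerI B.DerI dd(1,2) B(2) by auto
    moreover have "extends ?D1 ?D2" using dd(3) B(2) Bs_star(2)[OF e_Bs supp_P] by (simp add: extends_def)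
    moreover have "der_class B D = der_class B ?D2"
      using dd(4,5) d(2) B(2) by (intro B.class_eqI[of z]) (simp_all add: B.ad_def)
    ultimately show ?thesis by (auto simp: ext_rel_def)
  qed
  then show ?thesis by (fastforce simp: B.HH1_carrier ext_rel_def)
qed

theorem theorem6p2:
  fixes G :: "('g, 'm) monoid_scheme"
    and B :: "('k::field, 'g \<Rightarrow> 'k) module"
    and P :: "'g set"
    and e :: "'g \<Rightarrow> 'k"
    and \<sigma> :: "'g set \<Rightarrow> 'g \<Rightarrow> 'g"
    and p :: nat
  assumes "prime p" and "CHAR('k) = p"
    and "group G" and "finite (carrier G)"
    and "is_block (group_algebra G) B"
    and "defect_group p G B P" and "P \<lhd> G" and "P \<noteq> {\<one>\<^bsub>G\<^esub>}"
    and "maximal_brauer_pair p G B P e"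
    and "inertial_lift G P e \<sigma>"
    and "large_enough p G B"
  shows "(\<exists>L \<Phi>. lie_subalgebra L (HH1 B) \<and>
            lie_iso (HH1_kP_E G P e \<sigma>) ((HH1 B)\<lparr>carrier := L\<rparr>) \<Phi> \<and>
            canonical_HH1_map G B P e \<sigma> \<Phi>) \<and>
         (acts_freely G P e \<sigma> \<longrightarrow> lie_isomorphic (HH1_kP_E G P e \<sigma>) (HH1 B))"
proof -
  interpret modular_group G "TYPE('k)" p
    using assms(1-4) by (intro modular_group.intro finite_group.intro finite_group_axioms.intro modular_group_axioms.intro)
  define b where "b = \<one>\<^bsub>B\<^esub>"
  \<comment> \<open>With kG written as the algebra of the subgroup G, the same block lemma covers kG
    and kC_G(P).\<close>
  have "group_algebra G = (subgroup_algebra G (carrier G) :: ('k, 'g \<Rightarrow> 'k) module)"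
    by (simp add: group_algebra_def)
  with assms(5) have "is_block (subgroup_algebra G (carrier G)) B" by metis
  note B = is_block_props[OF subgroup_self this, folded b_def]
  have PC: "P \<subseteq> carrier G" by (rule subgroup.subset[OF normal_imp_subgroup[OF assms(7)]])
  have pair: "brauer_pair p G B P e" using assms(9) by (simp add: maximal_brauer_pair_def)
  then obtain A where A: "is_block (subgroup_algebra G (centralizer G P)) A" "\<one>\<^bsub>A\<^esub> = e"
    by (auto simp: brauer_pair_def is_block_idempotent_def)
  note A_props = is_block_props[OF centralizer_subgroup[OF PC] A(1), unfolded A(2)]
  \<comment> \<open>(P, e) is itself a B-Brauer pair, so the splitting convention applies to the
    block of kC_G(P) with identity e.\<close>
  have "split_algebra A" using assms(11) A pair by (auto simp: large_enough_def)
  have "brauer_map G P b = cut (centralizer G P) b" by (simp add: brauer_map_def cut_def)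
  then have brauer: "cut (centralizer G P) b \<star> e \<noteq> 0" using pair by (simp add: brauer_pair_def b_def)
  obtain n where n: "card P = p ^ n" using pair by (auto simp: brauer_pair_def p_subgroup_def)
  have "cut (centralizer G P) b \<noteq> 0" using brauer star_0(1) by metis
  then have trace: "\<exists>y\<in>supp_in (carrier G). (\<forall>u\<in>P. cj u y = y) \<and> b = rtr (carrier G) P y"
    using defect_relative_trace[OF B(3,2) assms(7,6)] by metis
  interpret normal_block G "TYPE('k)" p P b e n
    by (intro normal_block.intro normal_block_axioms.intro modular_group_axioms)
      (fact assms(7) n B(3) A_props(3) brauer trace)+
  interpret split_block G "TYPE('k)" p P b e n
    by unfold_locales (rule split_centre[OF A_props(1,2) A(2) \<open>split_algebra A\<close>])
  have carrier: "carrier B = Bs" using B(2) by (simp add: Bs_def)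
  obtain \<Phi> where \<Phi>: "lie_subalgebra {der_class B D' | D D'. ext_rel B D D'} (HH1 B)"
    "lie_iso (HH1_kP_E G P e \<sigma>) ((HH1 B)\<lparr>carrier := {der_class B D' | D D'. ext_rel B D D'}\<rparr>) \<Phi>"
    "canonical_HH1_map G B P e \<sigma> \<Phi>"
    using HH1_fixed_iso[OF assms(10) B(1) carrier] by blast
  moreover have "lie_isomorphic (HH1_kP_E G P e \<sigma>) (HH1 B)" if "acts_freely G P e \<sigma>"
    using \<Phi>(2) unfolding all_classes_extend[OF B(1) carrier free_action[OF assms(10) that]]
    by (auto simp: lie_isomorphic_def)
  ultimately show ?thesis by blast
qed

end
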